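(* Let $G$ be a 2-connected (not necessarily simple) graph and let $B(M(G))$ be the base polytope of its graphic matroid. Then: (1) $\operatorname{rank}B(M(G))=0$ if and only if $B(M(G))$ is unimodularly equivalent to $B(M(\mathcal{A}_{s+1}))$ for some $s\in\mathbb{Z}_{>0}$. (2) $\operatorname{rank}B(M(G))=1$ if and only if $B(M(G))$ is unimodularly equivalent to $B(M(\mathcal{B}_{s,p}))$ for some $s,p\in\mathbb{Z}_{>0}$. (3) $\operatorname{rank}B(M(G))=2$ if and only if $B(M(G))$ is unimodularly equivalent to $B(M(\mathcal{B}_{s_1,s_2,p}))$ for some $s_1,s_2\in\mathbb{Z}_{>0}$, $p\in\mathbb{Z}_{\ge0}$. (4) $\operatorname{rank}B(M(G))=3$ if and only if $B(M(G))$ is unimodularly equivalent to one of: (i) $B(M(\mathcal{B}_{s_1,s_2,s_3,p}))$ with $s_1,s_2,s_3\in\mathbb{Z}_{>0}$, $p\in\mathbb{Z}_{\ge0}$; (ii) $B(M(\mathcal{C}_{s,t,p,q}))$ with $s,q\in\mathbb{Z}_{>0}$, $t,p\in\mathbb{Z}_{\ge0}$; (iii) $B(M(\mathcal{D}_{s_1+1,s_2+1,s_3+1}))$ with $s_1,s_2,s_3\in\mathbb{Z}_{>0}$.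
   Context: A graph is 2-connected if deleting any single vertex leaves it connected ($K_2$ counts as 2-connected). $M(G)$ is the graphic matroid on $E(G)$ (bases = spanning forests); $B(M)=\mathrm{conv}\{\chi_B : B \text{ basis}\}\subset\mathbb{R}^{E}$. For a lattice polytope $P$ with $\dim P\ge1$, $\operatorname{rank}P:=F-(\dim P+1)$, $F$ the number of facets. Unimodular equivalence: $P'=f(P)+\mathbf{v}$ with $f$ unimodular and $\mathbf v$ a lattice vector (for polytopes in different ambient spaces, an affine isomorphism of affine hulls identifying lattice points). Graphs: $\mathcal{A}_s$: two vertices joined by $s$ parallel edges. $\mathcal{B}_{s_1,\dots,s_n,p}$ ($s_i\in\mathbb{Z}_{>0}$, $p\in\mathbb{Z}_{\ge0}$): vertices $v_1,\dots,v_{n+1},u_1,\dots,u_p$; for each $i\in[1,n]$, $s_i+1$ parallel edges between $v_i$ and $v_{i+1}$; plus the path $v_1,u_1,\dots,u_p,v_{n+1}$ of length $p+1$. $\mathcal{C}_{s,t,p,q}$ ($s,q\in\mathbb{Z}_{>0}$, $t,p\in\mathbb{Z}_{\ge0}$): vertices $v_1,v_2,v_3,u_1,\dots,u_p,w_1,\dots,w_q$; $s+1$ parallel edges between $v_1,v_2$; $t+1$ parallel edges between $v_2,v_3$; the path $v_1,u_1,\dots,u_p,v_3$ (length $p+1$) and the path $v_2,w_1,\dots,w_q,v_3$ (length $q+1$). $\mathcal{D}_{s_1,s_2,s_3}$: vertices $v_1,v_2,v_3$ with $s_1$ parallel edges $v_1v_2$, $s_2$ parallel edges $v_2v_3$,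 $s_3$ parallel edges $v_3v_1$. *)

theory Defs
  imports "HOL-Analysis.Analysis" "HOL-Analysis.Finite_Function_Topology"
begin

section \<open>Undirected multigraphs\<close>

text \<open>Parallel edges are distinct edges with the same end set; a loop has a singleton end set.\<close>

record ('v, 'e) multigraph =
  verts :: "'v set"
  edges :: "'e set"
  ends  :: "'e \<Rightarrow> 'v set"

definition finite_multigraph :: "('v, 'e) multigraph \<Rightarrow> bool" where
  "finite_multigraph G \<longleftrightarrow>
     finite (verts G) \<and> finite (edges G) \<and>
     (\<forall>e\<in>edges G. ends G e \<subseteq> verts G \<and> card (ends G e) \<in> {1, 2})"

definition graph_connected :: "('v, 'e) multigraph \<Rightarrow> bool" where
  "graph_connected G \<longleftrightarrow>
     verts G \<noteq> {} \<and>
     (\<forall>u\<in>verts G. \<forall>v\<in>verts G. (u, v) \<in> {(x, y). \<exists>e\<in>edges G. ends G e = {x, y}}\<^sup>*)"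

definition delete_vertex :: "('v, 'e) multigraph \<Rightarrow> 'v \<Rightarrow> ('v, 'e) multigraph" where
  "delete_vertex G v =
     \<lparr>verts = verts G - {v}, edges = {e \<in> edges G. v \<notin> ends G e}, ends = ends G\<rparr>"

text \<open>
  The graph without vertices is not connected, so a one-vertex graph is not 2-connected, whereas
  two vertices joined by one or more edges form a 2-connected graph.
\<close>

definition two_connected :: "('v, 'e) multigraph \<Rightarrow> bool" where
  "two_connected G \<longleftrightarrow>
     graph_connected G \<and> (\<forall>v\<in>verts G. graph_connected (delete_vertex G v))"

section \<open>The bases of the graphic matroid\<close>

text \<open>
  A cycle is given by its vertices and its edges in cyclic order. Length 1 is a loop and length 2
  is a pair of parallel edges.
\<close>

definition is_cycle :: "('v, 'e) multigraph \<Rightarrow> 'v list \<Rightarrow> 'e list \<Rightarrow> bool" where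
  "is_cycle G vs es \<longleftrightarrow>
     es \<noteq> [] \<and> length vs = length es \<and> distinct vs \<and> distinct es \<and>
     (\<forall>i<length es. ends G (es ! i) = {vs ! i, vs ! ((i + 1) mod length es)})"

definition is_forest :: "('v, 'e) multigraph \<Rightarrow> 'e set \<Rightarrow> bool" where
  "is_forest G F \<longleftrightarrow> F \<subseteq> edges G \<and> \<not> (\<exists>vs es. set es \<subseteq> F \<and> is_cycle G vs es)"

definition graphic_bases :: "('v, 'e) multigraph \<Rightarrow> 'e set set" where
  "graphic_bases G = {F. is_forest G F \<and> (\<forall>F'. is_forest G F' \<and> F \<subseteq> F' \<longrightarrow> F' = F)}"

section \<open>Base polytopes\<close>

text \<open>
  The space \<open>\<real>\<^sup>E\<close> is represented inside the real vector space of finitely supported functions on the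
  type of edges, a vector being extended by zero outside \<open>E\<close>. This allows the size of \<open>E\<close> to
  depend on numerical parameters.
\<close>

definition char_vec :: "'e set \<Rightarrow> 'e \<Rightarrow>\<^sub>0 real" where
  "char_vec B = (\<Sum>e\<in>B. Poly_Mapping.single e 1)"

definition base_polytope :: "('v, 'e) multigraph \<Rightarrow> ('e \<Rightarrow>\<^sub>0 real) set" where
  "base_polytope G = convex hull (char_vec ` graphic_bases G)"

section \<open>Dimension, facets, rank and unimodular equivalence\<close>

text \<open>
  The library's \<open>aff_dim\<close> and \<open>facet_of\<close> are restricted to Euclidean spaces. The definitions
  below are their analogues for nonempty finite-dimensional sets in any real vector space.
\<close>

definition polytope_dim :: "'a::real_vector set \<Rightarrow> nat" where
  "polytope_dim P = dim {x - y | x y. x \<in> P \<and> y \<in> P}"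

definition is_facet :: "'a::real_vector set \<Rightarrow> 'a set \<Rightarrow> bool" where
  "is_facet F P \<longleftrightarrow> F face_of P \<and> F \<noteq> {} \<and> polytope_dim P = polytope_dim F + 1"

text \<open>
  The rank is meant for polytopes of dimension at least 1. It takes integer values, so a point
  (which has no facet in the above sense) formally gets \<open>-1\<close>.
\<close>

definition polytope_rank :: "'a::real_vector set \<Rightarrow> int" where
  "polytope_rank P = int (card {F. is_facet F P}) - (int (polytope_dim P) + 1)"

definition lattice_points :: "('e \<Rightarrow>\<^sub>0 real) set" where
  "lattice_points = {x. \<forall>e. Poly_Mapping.lookup x e \<in> \<int>}"

definition unimodularly_equivalent ::
    "('a \<Rightarrow>\<^sub>0 real) set \<Rightarrow> ('b \<Rightarrow>\<^sub>0 real) set \<Rightarrow> bool" where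
  "unimodularly_equivalent P Q \<longleftrightarrow>
     (\<exists>f. (\<forall>x\<in>affine hull P. \<forall>y\<in>affine hull P. \<forall>u.
             f ((1 - u) *\<^sub>R x + u *\<^sub>R y) = (1 - u) *\<^sub>R f x + u *\<^sub>R f y) \<and>
          bij_betw f (affine hull P) (affine hull Q) \<and>
          f ` (affine hull P \<inter> lattice_points) = affine hull Q \<inter> lattice_points \<and>
          f ` P = Q)"

section \<open>The graph families\<close>

text \<open>\<open>Vv i\<close>, \<open>Vu i\<close> and \<open>Vw i\<close> are the vertices $v_i$, $u_i$ and $w_i$.\<close>

datatype family_vertex = Vv nat | Vu nat | Vw nat

text \<open>The edges of a graph given by a list of end sets are the positions in the list.\<close>

definition graph_of_ends :: "'v set \<Rightarrow> 'v set list \<Rightarrow> ('v, nat) multigraph" where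
  "graph_of_ends X es = \<lparr>verts = X, edges = {..<length es}, ends = (\<lambda>i. es ! i)\<rparr>"

definition path_ends :: "'v list \<Rightarrow> 'v set list" where
  "path_ends xs = map (\<lambda>(x, y). {x, y}) (zip xs (tl xs))"

definition graph_A :: "nat \<Rightarrow> (family_vertex, nat) multigraph" where
  "graph_A s = graph_of_ends {Vv 1, Vv 2} (replicate s {Vv 1, Vv 2})"

text \<open>The list \<open>ss\<close> is $[s_1, \dots, s_n]$, so $s_i$ is \<open>ss ! (i - 1)\<close>.\<close>

definition graph_B :: "nat list \<Rightarrow> nat \<Rightarrow> (family_vertex, nat) multigraph" where
  "graph_B ss p =
     graph_of_ends (Vv ` {1..length ss + 1} \<union> Vu ` {1..p})
       (concat (map (\<lambda>i. replicate (ss ! (i - 1) + 1) {Vv i, Vv (i + 1)}) [1..<length ss + 1])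
        @ path_ends ([Vv 1] @ map Vu [1..<p + 1] @ [Vv (length ss + 1)]))"

definition graph_C :: "nat \<Rightarrow> nat \<Rightarrow> nat \<Rightarrow> nat \<Rightarrow> (family_vertex, nat) multigraph" where
  "graph_C s t p q =
     graph_of_ends (Vv ` {1..3} \<union> Vu ` {1..p} \<union> Vw ` {1..q})
       (replicate (s + 1) {Vv 1, Vv 2} @ replicate (t + 1) {Vv 2, Vv 3}
        @ path_ends ([Vv 1] @ map Vu [1..<p + 1] @ [Vv 3])
        @ path_ends ([Vv 2] @ map Vw [1..<q + 1] @ [Vv 3]))"

definition graph_D :: "nat \<Rightarrow> nat \<Rightarrow> nat \<Rightarrow> (family_vertex, nat) multigraph" where
  "graph_D s1 s2 s3 =
     graph_of_ends (Vv ` {1..3})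
       (replicate s1 {Vv 1, Vv 2} @ replicate s2 {Vv 2, Vv 3} @ replicate s3 {Vv 3, Vv 1})"

end

(*
  Reflecting the coordinates in a set D of edges (x to 1 - x) is a unimodular equivalence which
  replaces every basis B by its symmetric difference with D. A series extension at e is therefore a
  parallel extension at e up to such reflections, and a parallel extension changes the polytope in
  a controlled way: it keeps the rank if x(e) = 0 already defines a facet and raises it by one
  otherwise.

  A loopless 2-connected graph with at least two edges either reduces to two parallel edges by
  series and parallel reductions, or it has a minor K_4. In the second case the polytope has a face
  B(M(K_4)) of rank at least 4, and the rank of a polytope is at least that of any of its faces.
  In the first case the set of bases is, up to reflections, an iterated series-parallel system
  whose rank counts the rank-raising steps. Up to rank 3 there are five families of them, described
  by the sizes of at most four classes of interchangeable elements, and the graphs A, B, C, D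
  realise exactly these.
*)
theory Submission
  imports Defs "HOL-Library.Transitive_Closure_Table"
begin

section \<open>Faces and dimension in real vector spaces\<close>

text \<open>A parallel step writes x(e) as a sum of two nonnegative coordinates x(e) and x(f). The
  dimension grows by one, every other facet lifts to one facet, and x(e) = 0, facet or not, gives
  way to the two facets x(e) = 0 and x(f) = 0: the rank changes by 0 or 1. To know which case occurs
  after many steps, the induction keeps systems in which every x(g) = 0 is a facet and no x(g) = 1
  is. A parallel step then costs nothing; a series step begins by exchanging x(e) = 0 and x(e) = 1
  and so raises the rank by one. A segment violates this invariant, its facets being of both kinds,
  so the recursion starts from three parallel elements and two parallel edges form a case of their
  own. Reflected systems need not be matroids, hence arbitrary set systems. The comparison with
  faces rests on ridges: through each facet R of a facet F passes another facet meeting F in R, so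
  facets minus dimension cannot increase on passing to a face. For K_4 the twelve faces x(e) = 0 and
  x(e) = 1 in dimension 5 already give 12 - 6 = 6.\<close>

definition dirs :: "'a::real_vector set \<Rightarrow> 'a set" where
  "dirs P = {x - y | x y. x \<in> P \<and> y \<in> P}"

lemma polytope_dim_dirs: "polytope_dim P = dim (dirs P)"
  by (simp add: polytope_dim_def dirs_def)

lemma dirs_mono: "F \<subseteq> P \<Longrightarrow> dirs F \<subseteq> dirs P"
  by (auto simp: dirs_def)

lemma dirs_I: "x \<in> P \<Longrightarrow> y \<in> P \<Longrightarrow> x - y \<in> dirs P"
  by (auto simp: dirs_def)

text \<open>\<open>dim\<close> is a natural number and is 0 on a span with an infinite basis, so
  monotonicity and strict growth of dimensions are only available inside a finitely generated
  span.\<close>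

definition fin_dim :: "'a::real_vector set \<Rightarrow> bool" where
  "fin_dim P \<longleftrightarrow> (\<exists>B. finite B \<and> P \<subseteq> span B)"

lemma fin_dim_subset: "fin_dim P \<Longrightarrow> F \<subseteq> P \<Longrightarrow> fin_dim F"
  by (auto simp: fin_dim_def)

lemma fin_dim_dirs: "fin_dim P \<Longrightarrow> fin_dim (dirs P)"
  unfolding fin_dim_def dirs_def by (blast intro: span_diff)

lemma fin_dim_hull: "finite S \<Longrightarrow> fin_dim (convex hull S)"
  unfolding fin_dim_def using convex_hull_subset_span by blast

lemma fin_dim_basis:
  assumes "fin_dim W"
  obtains B where "finite B" "independent B" "B \<subseteq> W" "W \<subseteq> span B" "card B = dim W"
proof -
  obtain C where C: "finite C" "W \<subseteq> span C" using assms by (auto simp: fin_dim_def)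
  obtain B where B: "B \<subseteq> W" "independent B" "W \<subseteq> span B" "card B = dim W"
    using basis_exists by blast
  have "finite B" using independent_span_bound[OF C(1) B(2)] B(1) C(2) by blast
  with B that show thesis by blast
qed

lemma dim_mono_fin:
  assumes "fin_dim W" "V \<subseteq> span W"
  shows "dim V \<le> dim W"
proof -
  obtain B where B: "finite B" "independent B" "B \<subseteq> W" "W \<subseteq> span B" "card B = dim W"
    using fin_dim_basis[OF assms(1)] by blast
  have "span W \<subseteq> span B" using B(4) span_minimal subspace_span by blast
  then show ?thesis using dim_le_card[of V B] B assms(2) by auto
qed

lemma dim_insert_fin:
  assumes "fin_dim W" "u \<notin> span W"
  shows "dim (insert u W) = dim W + 1"
proof -
  obtain B where B: "finite B" "independent B" "B \<subseteq> W" "W \<subseteq> span B" "card B = dim W"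
    using fin_dim_basis[OF assms(1)] by blast
  have "span W \<subseteq> span B" using B(4) span_minimal subspace_span by blast
  moreover have "span B \<subseteq> span W" using B(3) by (rule span_mono)
  ultimately have "span W = span B" by blast
  then have u: "u \<notin> span B" using assms(2) by simp
  have "independent (insert u B)" using u B(2) by (rule independent_insertI)
  moreover have "insert u W \<subseteq> span (insert u B)"
    using B(4) span_mono[of B "insert u B"] span_base[of u "insert u B"] by auto
  moreover have "insert u B \<subseteq> insert u W" using B(3) by auto
  ultimately have "card (insert u B) = dim (insert u W)" by (intro basis_card_eq_dim)
  moreover have "u \<notin> B" using u span_base by blast
  ultimately show ?thesis using B by simp
qed

lemma polytope_dim_mono: "fin_dim P \<Longrightarrow> F \<subseteq> P \<Longrightarrow> polytope_dim F \<le> polytope_dim P"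
  unfolding polytope_dim_dirs
  using dim_mono_fin[OF fin_dim_dirs subset_trans[OF dirs_mono span_superset]] .

text \<open>Multiples t (a - b) already form a subspace: a sum t (a - b) + s (c - e) is t + s times
  the difference of two weighted averages, which lie in F by convexity, and a negative factor swaps
  the two points.\<close>

lemma span_dirs_convex:
  assumes "convex F" "F \<noteq> {}" "d \<in> span (dirs F)"
  shows "\<exists>t\<ge>0. \<exists>a\<in>F. \<exists>b\<in>F. d = t *\<^sub>R (a - b)"
proof -
  let ?W = "{d. \<exists>t\<ge>0. \<exists>a\<in>F. \<exists>b\<in>F. d = t *\<^sub>R (a - b)}"
  have "subspace ?W"
  proof (rule subspaceI)
    show "0 \<in> ?W" using assms(2) by force
  next
    fix x y assume "x \<in> ?W" "y \<in> ?W"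
    then obtain t a b s c e where
      h: "t \<ge> 0" "a \<in> F" "b \<in> F" "x = t *\<^sub>R (a - b)" "s \<ge> 0" "c \<in> F" "e \<in> F" "y = s *\<^sub>R (c - e)"
      by blast
    show "x + y \<in> ?W"
    proof (cases "t + s = 0")
      case True
      then have "t = 0" "s = 0" using h by linarith+
      then have "x + y = 0 *\<^sub>R (a - b)" using h by simp
      then show ?thesis using h by blast
    next
      case False
      then have r: "t + s > 0" using h by linarith
      let ?p = "(t/(t+s)) *\<^sub>R a + (s/(t+s)) *\<^sub>R c" and ?q = "(t/(t+s)) *\<^sub>R b + (s/(t+s)) *\<^sub>R e"
      have one: "t/(t+s) + s/(t+s) = 1" using r by (simp add: add_divide_distrib[symmetric])
      have nn: "t/(t+s) \<ge> 0" "s/(t+s) \<ge> 0" using h r by auto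
      have "?p \<in> F" "?q \<in> F" using convexD[OF assms(1)] h nn one by blast+
      moreover have "x + y = (t+s) *\<^sub>R (?p - ?q)"
      proof -
        have "(t+s) *\<^sub>R ((t/(t+s)) *\<^sub>R v + (s/(t+s)) *\<^sub>R w) = t *\<^sub>R v + s *\<^sub>R w" for v w :: 'a
          using r by (simp add: scaleR_add_right)
        then show ?thesis unfolding scaleR_diff_right h(4,8) by (simp add: algebra_simps)
      qed
      ultimately show ?thesis using r by (intro CollectI exI[of _ "t+s"]) auto
    qed
  next
    fix c x assume "x \<in> ?W"
    then obtain t a b where h: "t \<ge> 0" "a \<in> F" "b \<in> F" "x = t *\<^sub>R (a - b)" by blast
    show "c *\<^sub>R x \<in> ?W"
    proof (cases "c \<ge> 0")
      case True
      then have "c *\<^sub>R x = (c * t) *\<^sub>R (a - b)" "c * t \<ge> 0" using h by auto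
      then show ?thesis using h by blast
    next
      case False
      then have "c *\<^sub>R x = (- c * t) *\<^sub>R (b - a)" "- c * t \<ge> 0"
        using h(1) False unfolding h(4) by (simp add: scaleR_diff_right, simp add: mult_nonpos_nonneg)
      then show ?thesis using h by blast
    qed
  qed
  moreover have "dirs F \<subseteq> ?W"
    unfolding dirs_def by (force intro: exI[of _ 1])
  ultimately have "span (dirs F) \<subseteq> ?W" using span_minimal by blast
  then show ?thesis using assms(3) by blast
qed

text \<open>If the dimensions agree, p - f0 is a direction of F, say t (a - b) with a, b in F. Then
  f0 + t a = p + t b, so after division by 1 + t a point of F lies between p and b, and the face
  property puts p into F.\<close>

lemma face_dim_eq:
  assumes "F face_of P" "F \<noteq> {}" "fin_dim P" "polytope_dim F = polytope_dim P"
  shows "F = P"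
proof
  show FP: "F \<subseteq> P" using assms(1) face_of_imp_subset by blast
  show "P \<subseteq> F"
  proof
    fix p assume p: "p \<in> P"
    obtain f0 where f0: "f0 \<in> F" using assms(2) by blast
    have fd: "fin_dim (dirs P)" "fin_dim (dirs F)"
      using fin_dim_dirs[OF assms(3)] fin_dim_dirs[OF fin_dim_subset[OF assms(3) FP]] .
    have "p - f0 \<in> span (dirs F)"
    proof (rule ccontr)
      assume n: "p - f0 \<notin> span (dirs F)"
      have "insert (p - f0) (dirs F) \<subseteq> dirs P"
        using dirs_mono[OF FP] dirs_I[OF p subsetD[OF FP f0]] by simp
      then have "dim (insert (p - f0) (dirs F)) \<le> dim (dirs P)"
        by (intro dim_mono_fin[OF fd(1)] subset_trans[OF _ span_superset])
      then show False using dim_insert_fin[OF fd(2) n] assms(4) by (simp add: polytope_dim_dirs)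
    qed
    then obtain t a b where t: "t \<ge> 0" "a \<in> F" "b \<in> F" "p - f0 = t *\<^sub>R (a - b)"
      using span_dirs_convex[OF face_of_imp_convex[OF assms(1)] assms(2)] by blast
    show "p \<in> F"
    proof (cases "t = 0 \<or> p = b")
      case True then show ?thesis using t f0 by auto
    next
      case False
      then have t0: "t > 0" and pb: "p \<noteq> b" using t by auto
      let ?x = "(1/(1+t)) *\<^sub>R f0 + (t/(1+t)) *\<^sub>R a"
      have one: "1/(1+t) + t/(1+t) = 1" using t0 by (simp add: add_divide_distrib[symmetric])
      have "?x \<in> F" using convexD[OF face_of_imp_convex[OF assms(1)] f0 t(2) _ _ one] t0 by simp
      moreover have "?x = (1 - t/(1+t)) *\<^sub>R p + (t/(1+t)) *\<^sub>R b"
      proof -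
        have 1: "1 - t/(1+t) = 1/(1+t)" using one by linarith
        have "p = f0 + t *\<^sub>R (a - b)" using t(4) by (simp add: algebra_simps)
        then show ?thesis unfolding 1
          by (simp only: scaleR_add_right scaleR_diff_right scaleR_scaleR) (simp add: algebra_simps)
      qed
      then have "?x \<in> open_segment p b" unfolding in_segment using t0 pb
        by (intro conjI exI[of _ "t/(1+t)"]) auto
      ultimately show ?thesis using face_ofD[OF assms(1) _ p] t(3) FP by blast
    qed
  qed
qed

lemma facet_subset_eq:
  assumes "is_facet F P" "is_facet F' P" "F \<subseteq> F'" "fin_dim P"
  shows "F = F'"
proof (rule face_dim_eq)
  show "F face_of F'"
    using assms(1-3) face_of_subset[of F P F'] face_of_imp_subset[of F' P] unfolding is_facet_def by simp
  show "F \<noteq> {}" "polytope_dim F = polytope_dim F'" using assms by (auto simp: is_facet_def)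
  show "fin_dim F'"
    using assms(2,4) fin_dim_subset[of P F'] face_of_imp_subset[of F' P] unfolding is_facet_def by simp
qed

text \<open>In a convex combination representing a point x of F, a generator s of positive weight
  lies in F: x lies between s and the normalised rest of the combination.\<close>

lemma face_of_hull_eq:
  assumes S: "finite S" and F: "F face_of convex hull S"
  shows "F = convex hull (F \<inter> S)"
proof
  show "convex hull (F \<inter> S) \<subseteq> F"
    by (rule hull_minimal) (use F face_of_imp_convex in auto)
  show "F \<subseteq> convex hull (F \<inter> S)"
  proof
    fix x assume x: "x \<in> F"
    then have "x \<in> convex hull S" using F face_of_imp_subset by blast
    then obtain u where u: "\<forall>s\<in>S. 0 \<le> u s" "sum u S = 1" "(\<Sum>s\<in>S. u s *\<^sub>R s) = x"
      unfolding convex_hull_finite[OF S] by blast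
    have key: "s \<in> F" if s: "s \<in> S" "u s > 0" for s
    proof (cases "u s = 1")
      case True
      then have "sum u (S - {s}) = 0" using u s S by (simp add: sum_diff1)
      then have "\<forall>r\<in>S - {s}. u r = 0" using u(1) S by (subst (asm) sum_nonneg_eq_0_iff) auto
      then have "x = s" using u(3) True S s
        by (subst (asm) sum.remove[OF S s(1)]) simp
      then show ?thesis using x by simp
    next
      case False
      have r: "sum u (S - {s}) = 1 - u s" using u s S by (simp add: sum_diff1)
      moreover have "sum u (S - {s}) \<ge> 0" using u(1) by (intro sum_nonneg) auto
      ultimately have lt: "u s < 1" using False by linarith
      let ?y = "\<Sum>r\<in>S - {s}. (u r / (1 - u s)) *\<^sub>R r"
      have y: "?y \<in> convex hull S"
      proof (rule convex_sum)
        show "finite (S - {s})" using S by simp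
        show "convex (convex hull S)" by simp
        show "(\<Sum>r\<in>S - {s}. u r / (1 - u s)) = 1"
          using r lt by (simp add: sum_divide_distrib[symmetric])
        show "0 \<le> u i / (1 - u s)" if "i \<in> S - {s}" for i using u(1) lt that by auto
        show "i \<in> convex hull S" if "i \<in> S - {s}" for i using that hull_inc by fast
      qed
      have "(1 - u s) *\<^sub>R ?y = (\<Sum>r\<in>S - {s}. u r *\<^sub>R r)"
        using lt by (simp add: scaleR_sum_right)
      then have xe: "x = (1 - u s) *\<^sub>R ?y + u s *\<^sub>R s"
        using u(3) by (subst (asm) sum.remove[OF S s(1)]) (simp add: add.commute)
      show ?thesis
      proof (cases "?y = s")
        case True
        then have "x = (1 - u s) *\<^sub>R s + u s *\<^sub>R s" using xe by metis
        then have "x = s" by (simp add: algebra_simps)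
        then show ?thesis using x by simp
      next
        case False
        then have "x \<in> open_segment ?y s" unfolding in_segment using xe lt s
          by (intro conjI exI[of _ "u s"]) auto
        then show ?thesis using face_ofD[OF F _ y hull_inc[OF s(1)] x] by blast
      qed
    qed
    have "x = (\<Sum>s\<in>F \<inter> S. u s *\<^sub>R s)"
      unfolding u(3)[symmetric] using S key u(1)
      by (intro sum.mono_neutral_right) (auto simp: less_le)
    moreover have "sum u (F \<inter> S) = 1"
      unfolding u(2)[symmetric] using S key u(1)
      by (intro sum.mono_neutral_left) (auto simp: less_le)
    ultimately show "x \<in> convex hull (F \<inter> S)"
      using u(1) S by (simp only:) (intro convex_sum, auto intro: hull_inc)
  qed
qed

lemma finite_faces_hull:
  assumes "finite S" shows "finite {F. F face_of convex hull S}"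
proof (rule finite_subset)
  show "{F. F face_of convex hull S} \<subseteq> (\<lambda>T. convex hull T) ` Pow S"
  proof
    fix F assume "F \<in> {F. F face_of convex hull S}"
    then have "F = convex hull (F \<inter> S)" using face_of_hull_eq[OF assms] by simp
    then show "F \<in> (\<lambda>T. convex hull T) ` Pow S" by blast
  qed
  show "finite ((\<lambda>T. convex hull T) ` Pow S)" using assms by simp
qed

lemma finite_facets_hull: "finite S \<Longrightarrow> finite {F. is_facet F (convex hull S)}"
  by (rule finite_subset[OF _ finite_faces_hull]) (auto simp: is_facet_def)

subsection \<open>Affine maps\<close>

definition aff_on :: "('a::real_vector \<Rightarrow> 'b::real_vector) \<Rightarrow> 'a set \<Rightarrow> bool" where
  "aff_on f S \<longleftrightarrow> (\<forall>x\<in>S. \<forall>y\<in>S. \<forall>u. f ((1 - u) *\<^sub>R x + u *\<^sub>R y) = (1 - u) *\<^sub>R f x + u *\<^sub>R f y)"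

text \<open>Affinity is only given on S, so the linear part is built by hand: moving a point of F to
  the origin gives a map on a subspace, and its values on a basis of the directions of F extend to a
  linear map on the whole space.\<close>

lemma aff_on_dim:
  fixes f :: "'c::real_vector \<Rightarrow> 'd::real_vector"
  assumes f: "aff_on f S" and S: "affine S" and inj: "inj_on f S" and FS: "F \<subseteq> S"
  shows "polytope_dim (f ` F) = polytope_dim F"
proof (cases "F = {}")
  case True
  have "dirs {} = ({} :: 'c::real_vector set)" by (simp add: dirs_def)
  moreover have "dim ({} :: 'c set) = card ({} :: 'c set)" by (rule dim_eq_card_independent) (rule independent_empty)
  ultimately have "polytope_dim ({} :: 'c set) = 0" by (simp add: polytope_dim_dirs)
  moreover have "dirs {} = ({} :: 'd::real_vector set)" by (simp add: dirs_def)
  moreover have "dim ({} :: 'd set) = card ({} :: 'd set)" by (rule dim_eq_card_independent) (rule independent_empty)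
  ultimately show ?thesis using True by (simp add: polytope_dim_dirs)
next
  case False
  then obtain a where a: "a \<in> F" by blast
  then have aS: "a \<in> S" using FS by blast
  define W where "W = {w. a + w \<in> S}"
  define g where "g = (\<lambda>w. f (a + w) - f a)"
  have sc: "c *\<^sub>R w \<in> W \<and> g (c *\<^sub>R w) = c *\<^sub>R g w" if "w \<in> W" for c w
  proof -
    have e: "a + c *\<^sub>R w = (1 - c) *\<^sub>R a + c *\<^sub>R (a + w)" by (simp add: algebra_simps)
    have "(1 - c) *\<^sub>R a + c *\<^sub>R (a + w) \<in> S"
      using S aS that unfolding affine_alt W_def by blast
    moreover have "f ((1 - c) *\<^sub>R a + c *\<^sub>R (a + w)) = (1 - c) *\<^sub>R f a + c *\<^sub>R f (a + w)"
      using f aS that unfolding aff_on_def W_def by blast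
    ultimately show ?thesis unfolding W_def g_def e by (simp add: algebra_simps)
  qed
  \<comment> \<open>Only affine combinations of two points are available; additivity comes from the
    midpoint, followed by scaling with 2.\<close>
  have half: "(1/2) *\<^sub>R (v + w) \<in> W \<and> g ((1/2) *\<^sub>R (v + w)) = (1/2) *\<^sub>R (g v + g w)"
    if "v \<in> W" "w \<in> W" for v w
  proof -
    have e: "a + (1/2) *\<^sub>R (v + w) = (1 - 1/2) *\<^sub>R (a + v) + (1/2) *\<^sub>R (a + w)"
    proof -
      have "a = (1/2) *\<^sub>R a + (1/2) *\<^sub>R a" by (simp flip: scaleR_add_left)
      then show ?thesis by (simp add: algebra_simps)
    qed
    have "(1 - 1/2) *\<^sub>R (a + v) + (1/2) *\<^sub>R (a + w) \<in> S"
      using S that unfolding affine_alt W_def by blast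
    moreover have "f ((1 - 1/2) *\<^sub>R (a + v) + (1/2) *\<^sub>R (a + w)) = (1 - 1/2) *\<^sub>R f (a + v) + (1/2) *\<^sub>R f (a + w)"
      using f that unfolding aff_on_def W_def by blast
    moreover have "(1 - 1/2) *\<^sub>R p + (1/2) *\<^sub>R q - f a = (1/2) *\<^sub>R ((p - f a) + (q - f a))" for p q
    proof -
      have "f a = (1/2) *\<^sub>R f a + (1/2) *\<^sub>R f a" by (simp flip: scaleR_add_left)
      then show ?thesis by (simp add: algebra_simps)
    qed
    ultimately show ?thesis unfolding W_def g_def mem_Collect_eq e by simp
  qed
  have ad: "v + w \<in> W \<and> g (v + w) = g v + g w" if "v \<in> W" "w \<in> W" for v w
    using sc[of "(1/2) *\<^sub>R (v + w)" 2] half[OF that] by simp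
  have subW: "subspace W"
    using sc ad aS by (intro subspaceI) (auto simp: W_def)
  have FW: "x - a \<in> W" if "x \<in> S" for x using that by (simp add: W_def)
  have dif: "x - y \<in> W \<and> g (x - y) = f x - f y" if "x \<in> S" "y \<in> S" for x y
  proof -
    have "x - y = (x - a) + (-1) *\<^sub>R (y - a)" by simp
    moreover have "(-1) *\<^sub>R (y - a) \<in> W" "g ((-1) *\<^sub>R (y - a)) = (-1) *\<^sub>R g (y - a)"
      using sc[OF FW[OF that(2)], of "-1"] by blast+
    ultimately have "x - y \<in> W \<and> g (x - y) = g (x - a) + (-1) *\<^sub>R g (y - a)"
      using ad[OF FW[OF that(1)]] by metis
    then show ?thesis by (simp add: g_def)
  qed
  have dW: "dirs F \<subseteq> W" using dif FS unfolding dirs_def by blast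
  obtain B where B: "B \<subseteq> dirs F" "independent B" "dirs F \<subseteq> span B" "card B = dim (dirs F)"
    using basis_exists by blast
  obtain h where h: "linear h" "\<forall>x\<in>B. h x = g x"
    using linear_independent_extend[OF B(2)] by blast
  have spW: "span B \<subseteq> W" using B(1) dW subW span_minimal by (metis subset_trans)
  have "subspace {x \<in> W. h x = g x}"
    using sc[of _ 0] sc ad subspace_0[OF subW] linear_0[OF h(1)] h(1)
    by (intro subspaceI) (auto simp: linear_add linear_scale)
  moreover have "B \<subseteq> {x \<in> W. h x = g x}" using h(2) B(1) dW by blast
  ultimately have "span B \<subseteq> {x \<in> W. h x = g x}" by (intro span_minimal)
  then have hg: "h x = g x" if "x \<in> span B" for x using that by blast
  have "inj_on h (span B)"
  proof (rule inj_onI)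
    fix x y assume xy: "x \<in> span B" "y \<in> span B" "h x = h y"
    then have "g x = g y" using hg by metis
    then have "f (a + x) = f (a + y)" by (simp add: g_def)
    then have "a + x = a + y" using inj xy spW unfolding W_def inj_on_def by blast
    then show "x = y" by simp
  qed
  then have ind: "independent (h ` B)" and injB: "inj_on h B"
    using linear_independent_injective_image[OF h(1) B(2)] inj_on_subset[OF _ span_superset] by auto
  have dfF: "dirs (f ` F) = h ` dirs F"
  proof -
    have *: "f x - f y = h (x - y)" if "x \<in> F" "y \<in> F" for x y
    proof -
      have "x - y \<in> span B" using B(3) dirs_I[OF that] by blast
      moreover have "x \<in> S" "y \<in> S" using that FS by blast+
      ultimately show ?thesis using hg dif[of x y] by metis
    qed
    have "dirs (f ` F) = {f x - f y | x y. x \<in> F \<and> y \<in> F}" by (auto simp: dirs_def)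
    also have "\<dots> = {h (x - y) | x y. x \<in> F \<and> y \<in> F}" using * by metis
    also have "\<dots> = h ` dirs F" by (auto simp: dirs_def)
    finally show ?thesis .
  qed
  have "h ` dirs F \<subseteq> span (h ` B)"
    unfolding linear_span_image[OF h(1)] using B(3) by blast
  then have "card (h ` B) = dim (h ` dirs F)"
    using B(1) ind by (intro basis_card_eq_dim) auto
  then show ?thesis unfolding polytope_dim_dirs dfF using B(4) card_image[OF injB] by simp
qed

lemma aff_on_face:
  assumes f: "aff_on f S" and S: "affine S" and inj: "inj_on f S" and PS: "P \<subseteq> S"
    and F: "F face_of P"
  shows "f ` F face_of f ` P"
  unfolding face_of_def
proof (intro conjI ballI impI)
  have FP: "F \<subseteq> P" using F face_of_imp_subset by blast
  show "f ` F \<subseteq> f ` P" using FP by blast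
  have fe: "f ((1 - u) *\<^sub>R x + u *\<^sub>R y) = (1 - u) *\<^sub>R f x + u *\<^sub>R f y" if "x \<in> P" "y \<in> P" for x y u
    using f PS that unfolding aff_on_def by blast
  have S': "(1 - u) *\<^sub>R x + u *\<^sub>R y \<in> S" if "x \<in> P" "y \<in> P" for x y u
    using S PS that unfolding affine_alt by blast
  show "convex (f ` F)"
    unfolding convex_alt
  proof (intro ballI allI impI)
    fix x y and u :: real assume "x \<in> f ` F" "y \<in> f ` F" "0 \<le> u \<and> u \<le> 1"
    then obtain x' y' where xy: "x' \<in> F" "y' \<in> F" "x = f x'" "y = f y'" by blast
    then have "(1 - u) *\<^sub>R x' + u *\<^sub>R y' \<in> F"
      using face_of_imp_convex[OF F] \<open>0 \<le> u \<and> u \<le> 1\<close> unfolding convex_alt by blast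
    moreover have "f ((1 - u) *\<^sub>R x' + u *\<^sub>R y') = (1 - u) *\<^sub>R x + u *\<^sub>R y"
      using fe xy FP by blast
    ultimately show "(1 - u) *\<^sub>R x + u *\<^sub>R y \<in> f ` F" by (metis imageI)
  qed
  fix a b x assume "a \<in> f ` P" "b \<in> f ` P" "x \<in> f ` F" and x: "x \<in> open_segment a b"
  then obtain a' b' x' where h: "a' \<in> P" "b' \<in> P" "x' \<in> F" "a = f a'" "b = f b'" "x = f x'" by blast
  obtain u where u: "0 < u" "u < 1" "x = (1 - u) *\<^sub>R a + u *\<^sub>R b" "a \<noteq> b"
    using x by (auto simp: in_segment)
  have "f x' = f ((1 - u) *\<^sub>R a' + u *\<^sub>R b')" using fe[OF h(1,2), of u] h u by simp
  moreover have "x' \<in> S" using h(3) FP PS by blast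
  ultimately have "x' = (1 - u) *\<^sub>R a' + u *\<^sub>R b'"
    using inj S'[OF h(1,2), of u] unfolding inj_on_def by blast
  then have "x' \<in> open_segment a' b'" using u h by (auto simp: in_segment)
  then have "a' \<in> F \<and> b' \<in> F" using face_ofD[OF F _ h(1,2,3)] by blast
  then show "a \<in> f ` F" "b \<in> f ` F" using h by auto
qed

lemma aff_on_inverse:
  assumes f: "aff_on f S" and S: "affine S" and inj: "inj_on f S"
  shows "aff_on (inv_into S f) (f ` S)" "affine (f ` S)"
proof -
  have fe: "f ((1 - u) *\<^sub>R x + u *\<^sub>R y) = (1 - u) *\<^sub>R f x + u *\<^sub>R f y" if "x \<in> S" "y \<in> S" for x y u
    using f that unfolding aff_on_def by blast
  have S': "(1 - u) *\<^sub>R x + u *\<^sub>R y \<in> S" if "x \<in> S" "y \<in> S" for x y u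
    using S that unfolding affine_alt by blast
  show "affine (f ` S)" unfolding affine_alt
  proof (clarify)
    fix x y and u :: real assume "x \<in> S" "y \<in> S"
    then show "(1 - u) *\<^sub>R f x + u *\<^sub>R f y \<in> f ` S" using fe S' by (metis imageI)
  qed
  show "aff_on (inv_into S f) (f ` S)" unfolding aff_on_def
  proof (clarify)
    fix x y and u :: real assume xy: "x \<in> S" "y \<in> S"
    have "inv_into S f ((1 - u) *\<^sub>R f x + u *\<^sub>R f y) = inv_into S f (f ((1 - u) *\<^sub>R x + u *\<^sub>R y))"
      using fe[OF xy] by simp
    also have "\<dots> = (1 - u) *\<^sub>R x + u *\<^sub>R y" using inv_into_f_f[OF inj] S'[OF xy] by blast
    also have "\<dots> = (1 - u) *\<^sub>R inv_into S f (f x) + u *\<^sub>R inv_into S f (f y)"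
      using inv_into_f_f[OF inj] xy by simp
    finally show "inv_into S f ((1 - u) *\<^sub>R f x + u *\<^sub>R f y) =
      (1 - u) *\<^sub>R inv_into S f (f x) + u *\<^sub>R inv_into S f (f y)" .
  qed
qed

lemma aff_on_facet:
  assumes "aff_on f S" "affine S" "inj_on f S" "P \<subseteq> S" "is_facet F P"
  shows "is_facet (f ` F) (f ` P)"
proof -
  have "F \<subseteq> S" using assms face_of_imp_subset unfolding is_facet_def by blast
  then show ?thesis
    using aff_on_face[OF assms(1-4)] aff_on_dim[OF assms(1-3)] assms(4,5) unfolding is_facet_def by auto
qed

lemma aff_on_rank:
  assumes f: "aff_on f S" and S: "affine S" and inj: "inj_on f S" and PS: "P \<subseteq> S"
  shows "polytope_rank (f ` P) = polytope_rank P"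
    and "bij_betw ((`) f) {F. is_facet F P} {F. is_facet F (f ` P)}"
proof -
  have sub: "F \<subseteq> P" if "is_facet F P" for F and P :: "'z::real_vector set"
    using that face_of_imp_subset unfolding is_facet_def by blast
  let ?g = "inv_into S f"
  have gf: "?g ` f ` X = X" if "X \<subseteq> S" for X using inv_into_image_cancel[OF inj that] .
  have fg: "f ` ?g ` Y = Y" if "Y \<subseteq> f ` S" for Y
    using that by (simp add: image_inv_into_cancel)
  have ginj: "inj_on ?g (f ` S)" by (rule inj_on_inv_into) simp
  show b: "bij_betw ((`) f) {F. is_facet F P} {F. is_facet F (f ` P)}"
  proof (rule bij_betwI')
    fix X Y assume "X \<in> {F. is_facet F P}" "Y \<in> {F. is_facet F P}"
    then have "X \<subseteq> S" "Y \<subseteq> S" using sub PS by blast+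
    then show "(f ` X = f ` Y) = (X = Y)" using inj by (rule_tac inj_on_image_eq_iff)
  next
    fix X assume "X \<in> {F. is_facet F P}"
    then show "f ` X \<in> {F. is_facet F (f ` P)}" using aff_on_facet[OF f S inj PS] by simp
  next
    fix Y assume "Y \<in> {F. is_facet F (f ` P)}"
    then have Y: "is_facet Y (f ` P)" by simp
    have "f ` P \<subseteq> f ` S" using PS by blast
    then have "is_facet (?g ` Y) (?g ` f ` P)"
      using aff_on_facet[OF aff_on_inverse[OF f S inj] ginj _ Y] by blast
    then have "is_facet (?g ` Y) P" using gf[OF PS] by simp
    moreover have "f ` ?g ` Y = Y" by (rule fg[OF subset_trans[OF sub[OF Y] image_mono[OF PS]]])
    ultimately show "\<exists>X\<in>{F. is_facet F P}. Y = f ` X" by (metis mem_Collect_eq)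
  qed
  show "polytope_rank (f ` P) = polytope_rank P"
    unfolding polytope_rank_def using bij_betw_same_card[OF b] aff_on_dim[OF f S inj PS] by simp
qed

lemma linear_aff_on: "linear f \<Longrightarrow> aff_on f S"
  unfolding aff_on_def by (simp add: linear_add linear_scale)

lemma unimodularly_equivalent_rank:
  assumes "unimodularly_equivalent P Q"
  shows "polytope_rank P = polytope_rank Q"
proof -
  obtain f where f: "aff_on f (affine hull P)" "bij_betw f (affine hull P) (affine hull Q)" "f ` P = Q"
    using assms unfolding unimodularly_equivalent_def aff_on_def by blast
  then show ?thesis
    using aff_on_rank(1)[OF f(1) affine_affine_hull _ hull_subset] unfolding bij_betw_def by auto
qed

subsection \<open>Exposed faces\<close>

text \<open>Faces come with a supporting functional because the arguments below rotate hyperplanes.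
  For lower bounds on the number of facets it is enough to count exposed ones.\<close>

definition exposed :: "'a::real_vector set \<Rightarrow> 'a set \<Rightarrow> bool" where
  "exposed F P \<longleftrightarrow> (\<exists>g::'a \<Rightarrow> real. \<exists>c. linear g \<and> (\<forall>x\<in>P. c \<le> g x) \<and> F = {x \<in> P. g x = c})"

lemma exposed_face:
  assumes "exposed F P" "convex P"
  shows "F face_of P"
proof -
  obtain g :: "'a \<Rightarrow> real" and c where g: "linear g" "\<forall>x\<in>P. c \<le> g x" "F = {x \<in> P. g x = c}"
    using assms(1) by (auto simp: exposed_def)
  show ?thesis
    unfolding face_of_def
  proof (intro conjI ballI impI)
    show "F \<subseteq> P" using g by auto
    show "convex F" unfolding convex_alt
    proof (intro ballI allI impI)
      fix x y and u :: real assume h: "x \<in> F" "y \<in> F" "0 \<le> u \<and> u \<le> 1"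
      then have "(1 - u) *\<^sub>R x + u *\<^sub>R y \<in> P" using assms(2) g(3) unfolding convex_alt by blast
      moreover have "g ((1 - u) *\<^sub>R x + u *\<^sub>R y) = c"
        using h g(3) by (simp add: linear_add[OF g(1)] linear_scale[OF g(1)]) (simp add: algebra_simps)
      ultimately show "(1 - u) *\<^sub>R x + u *\<^sub>R y \<in> F" using g by blast
    qed
    fix a b x assume h: "a \<in> P" "b \<in> P" "x \<in> F" "x \<in> open_segment a b"
    then obtain u where u: "0 < u" "u < 1" "x = (1 - u) *\<^sub>R a + u *\<^sub>R b" by (auto simp: in_segment)
    have "c = (1 - u) * g a + u * g b" using h u g by (simp add: linear_add linear_scale)
    then have e: "(1 - u) * (g a - c) + u * (g b - c) = 0" by (simp add: algebra_simps)
    moreover have "(1 - u) * (g a - c) \<ge> 0" "u * (g b - c) \<ge> 0" using u g h by auto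
    ultimately have "(1 - u) * (g a - c) = 0" "u * (g b - c) = 0" by linarith+
    then have "g a = c" "g b = c" using u by auto
    then show "a \<in> F" "b \<in> F" using g h by auto
  qed
qed

lemma linear_ge_hull:
  fixes g :: "'a::real_vector \<Rightarrow> real"
  assumes "linear g" "\<forall>s\<in>S. c \<le> g s" "x \<in> convex hull S"
  shows "c \<le> g x"
proof -
  have "convex {x. c \<le> g x}" unfolding convex_alt
  proof (clarify)
    fix x y and u :: real assume h: "c \<le> g x" "c \<le> g y" "0 \<le> u" "u \<le> 1"
    have "(1 - u) * (g x - c) \<ge> 0" "u * (g y - c) \<ge> 0" using h by auto
    then have "c \<le> (1 - u) * g x + u * g y" by (simp add: algebra_simps)
    then show "c \<le> g ((1 - u) *\<^sub>R x + u *\<^sub>R y)" using assms(1) by (simp add: linear_add linear_scale)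
  qed
  then have "convex hull S \<subseteq> {x. c \<le> g x}" using assms(2) by (intro hull_minimal) auto
  then show ?thesis using assms(3) by blast
qed

lemma exposed_hull_eq:
  assumes "finite S" "exposed F (convex hull S)"
  shows "F = convex hull (F \<inter> S)"
  using face_of_hull_eq[OF assms(1) exposed_face[OF assms(2) convex_convex_hull]] .

section \<open>Facets of a polytope compared with facets of its faces\<close>

definition xfacets :: "'a::real_vector set \<Rightarrow> 'a set set" where
  "xfacets P = {F. exposed F P \<and> F \<noteq> {} \<and> polytope_dim P = polytope_dim F + 1}"

lemma xfacets_subset: "convex P \<Longrightarrow> xfacets P \<subseteq> {F. is_facet F P}"
  unfolding xfacets_def is_facet_def using exposed_face by blast

lemma exposed_dim_less:
  assumes "exposed F P" "convex P" "fin_dim P" "F \<noteq> {}" "F \<noteq> P"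
  shows "polytope_dim F < polytope_dim P"
proof -
  have f: "F face_of P" using exposed_face[OF assms(1,2)] .
  show ?thesis
    using face_dim_eq[OF f assms(4,3)] polytope_dim_mono[OF assms(3) face_of_imp_subset[OF f]] assms(5)
    by linarith
qed

text \<open>Here l and m are the values of two functionals at a single generator: as long as t does
  not exceed the ratio, the generator stays on the right side of the tilted hyperplane.\<close>

lemma tilt_bound:
  fixes m l d c t :: real
  assumes "l > c" "t \<le> (m - d) / (l - c)"
  shows "d - t * c \<le> m - t * l"
proof -
  have "t * (l - c) \<le> m - d" using assms by (simp add: pos_le_divide_eq)
  then show ?thesis by (simp add: algebra_simps)
qed

text \<open>Rotating a supporting hyperplane of the facet \<open>F\<close> about the ridge \<open>R\<close> until it meets a new
  vertex gives the second facet through \<open>R\<close>.\<close>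

lemma xfacet_other:
  assumes S: "finite S" and P: "P = convex hull S" and F: "F \<in> xfacets P" and R: "R \<in> xfacets F"
  shows "\<exists>H. H \<in> xfacets P \<and> H \<inter> F = R"
proof -
  obtain l :: "'a \<Rightarrow> real" and c where l: "linear l" "\<forall>x\<in>P. c \<le> l x" "F = {x \<in> P. l x = c}"
    using F unfolding xfacets_def exposed_def by blast
  obtain m :: "'a \<Rightarrow> real" and d where m: "linear m" "\<forall>x\<in>F. d \<le> m x" "R = {x \<in> F. m x = d}"
    using R unfolding xfacets_def exposed_def by blast
  have cP: "convex P" and fP: "fin_dim P" using P S fin_dim_hull by auto
  have dims: "polytope_dim P = polytope_dim F + 1" "polytope_dim F = polytope_dim R + 1" "F \<noteq> {}" "R \<noteq> {}"
    using F R unfolding xfacets_def by auto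
  have SP: "S \<subseteq> P" unfolding P by (rule hull_subset)
  have "\<not> S \<subseteq> F"
  proof
    assume "S \<subseteq> F"
    moreover have "convex F"
      using F face_of_imp_convex[OF exposed_face[OF _ cP]] unfolding xfacets_def by simp
    ultimately have "P \<subseteq> F" unfolding P by (intro hull_minimal)
    moreover have "F \<subseteq> P" using l by auto
    ultimately show False using dims by auto
  qed
  then have ne: "S - F \<noteq> {}" by blast
  \<comment> \<open>t is the largest tilt at which no generator falls below the hyperplane; a
    generator s0 attaining the minimum lies on the new hyperplane but not in F.\<close>
  define r where "r = (\<lambda>s. (m s - d) / (l s - c))"
  define t where "t = Min (r ` (S - F))"
  have fin: "finite (r ` (S - F))" "r ` (S - F) \<noteq> {}" using S ne by auto
  obtain s0 where s0: "s0 \<in> S" "s0 \<notin> F" "t = r s0"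
    using Min_in[OF fin] unfolding t_def by blast
  have tle: "t \<le> r s" if "s \<in> S" "s \<notin> F" for s
    unfolding t_def using fin that by (intro Min_le) auto
  have lpos: "l s > c" if "s \<in> P" "s \<notin> F" for s
    using l that by (auto simp: less_le)
  define h where "h = (\<lambda>x. m x - t * l x)"
  have hl: "linear h" unfolding h_def
    using m(1) l(1) by (intro linear_compose_sub linear_compose_scale_right[of l t, simplified]) auto
  have hF: "h x = m x - t * c" if "x \<in> F" for x using that l by (simp add: h_def)
  have hS: "d - t * c \<le> h s" if "s \<in> S" for s
  proof (cases "s \<in> F")
    case True then show ?thesis using hF m by simp
  next
    case False
    then show ?thesis using tilt_bound[OF lpos tle[unfolded r_def]] that SP unfolding h_def by blast
  qed
  have hP: "\<forall>x\<in>P. d - t * c \<le> h x" using linear_ge_hull[OF hl] hS P by blast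
  define H where "H = {x \<in> P. h x = d - t * c}"
  have exH: "exposed H P" unfolding exposed_def H_def using hl hP by blast
  have HF: "H \<inter> F = R" unfolding H_def using hF m l by auto
  have "h s0 = d - t * c"
  proof -
    have "t * (l s0 - c) = m s0 - d" using lpos[of s0] s0 SP by (auto simp: r_def)
    then show ?thesis by (simp add: h_def algebra_simps)
  qed
  then have s0H: "s0 \<in> H" unfolding H_def using s0 SP by auto
  have cH: "convex H" and HP: "H \<subseteq> P"
    using face_of_imp_convex[OF exposed_face[OF exH cP]] face_of_imp_subset[OF exposed_face[OF exH cP]] .
  have "exposed R H"
    unfolding exposed_def
  proof (intro exI conjI)
    show "linear l" "\<forall>x\<in>H. c \<le> l x" using l HP by auto
    show "R = {x \<in> H. l x = c}" using HF HP l by auto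
  qed
  moreover have "R \<noteq> H" using s0H s0(2) HF by blast
  ultimately have "polytope_dim R < polytope_dim H"
    using exposed_dim_less[OF _ cH fin_dim_subset[OF fP HP] dims(4)] by simp
  moreover have "polytope_dim H < polytope_dim P"
  proof (rule exposed_dim_less[OF exH cP fP])
    show "H \<noteq> {}" using s0H by blast
    show "H \<noteq> P"
    proof
      assume "H = P"
      then have "R = F" using HF l by auto
      then have "polytope_dim R = polytope_dim F" by (rule arg_cong)
      then show False using dims(2) by linarith
    qed
  qed
  \<comment> \<open>The dimension of H is squeezed strictly between those of R and P, which differ
    by two.\<close>
  ultimately have "polytope_dim P = polytope_dim H + 1" using dims by linarith
  then have "H \<in> xfacets P" unfolding xfacets_def using exH s0H by auto
  then show ?thesis using HF by blast
qed

lemma finite_xfacets: "finite S \<Longrightarrow> finite (xfacets (convex hull S))"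
  by (rule finite_subset[OF xfacets_subset finite_facets_hull]) auto

text \<open>R is recovered from \<open>H R\<close> as its intersection with F, so the map is
  injective; it misses F, which meets itself in F and is no facet of itself. This accounts for the
  extra 1.\<close>

lemma card_xfacets_facet:
  assumes S: "finite S" and P: "P = convex hull S" and F: "F \<in> xfacets P"
  shows "card (xfacets F) + 1 \<le> card (xfacets P)"
proof -
  define H where "H = (\<lambda>R. SOME H. H \<in> xfacets P \<and> H \<inter> F = R)"
  have H: "H R \<in> xfacets P \<and> H R \<inter> F = R" if "R \<in> xfacets F" for R
    unfolding H_def by (rule someI_ex) (rule xfacet_other[OF S P F that])
  have "F \<notin> xfacets F" unfolding xfacets_def by simp
  then have nF: "H R \<noteq> F" if "R \<in> xfacets F" for R using H[OF that] that by auto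
  have "inj_on H (xfacets F)" using H by (intro inj_on_inverseI[where g = "\<lambda>X. X \<inter> F"]) simp
  then have "card (xfacets F) = card (H ` xfacets F)" by (simp add: card_image)
  also have "\<dots> \<le> card (xfacets P - {F})"
    using H nF finite_xfacets[OF S] P by (intro card_mono) auto
  also have "\<dots> < card (xfacets P)" using F finite_xfacets[OF S] P by (intro card_Diff1_less) auto
  finally show ?thesis by simp
qed

text \<open>In codimension at least two there is a functional m that takes one value on F and on a
  generator s1 outside F without being constant on P. Tilting the supporting functional of F by m
  until a generator s0 is reached gives a larger face, which stays proper because it avoids
  s1.\<close>

lemma exposed_extend:
  assumes S: "finite S" and P: "P = convex hull S" and F: "exposed F P" "F \<noteq> {}"
    and dim: "polytope_dim F + 1 < polytope_dim P"
  shows "\<exists>F'. exposed F' P \<and> F \<subseteq> F' \<and> F \<noteq> F' \<and> F' \<noteq> P \<and> exposed F F'"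
proof -
  obtain l :: "'a \<Rightarrow> real" and c where l: "linear l" "\<forall>x\<in>P. c \<le> l x" "F = {x \<in> P. l x = c}"
    using F unfolding exposed_def by blast
  have cP: "convex P" and fP: "fin_dim P" using P S fin_dim_hull by auto
  have SP: "S \<subseteq> P" unfolding P by (rule hull_subset)
  have FP: "F \<subseteq> P" using l by auto
  have cF: "convex F" using face_of_imp_convex[OF exposed_face[OF F(1) cP]] .
  obtain f0 where f0: "f0 \<in> F" using F by blast
  have "\<not> S \<subseteq> F"
  proof
    assume "S \<subseteq> F"
    then have "P \<subseteq> F" unfolding P using cF by (intro hull_minimal)
    then show False using dim FP by auto
  qed
  then obtain s1 where s1: "s1 \<in> S" "s1 \<notin> F" by blast
  let ?W = "insert (s1 - f0) (dirs F)"
  have fdF: "fin_dim (dirs F)" using fin_dim_dirs[OF fin_dim_subset[OF fP FP]] .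
  have "?W \<subseteq> dirs P"
    using dirs_mono[OF FP] dirs_I[OF subsetD[OF SP s1(1)] subsetD[OF FP f0]] by simp
  then have fdW: "fin_dim ?W" using fin_dim_subset[OF fin_dim_dirs[OF fP]] by simp
  have dW: "dim ?W \<le> polytope_dim F + 1"
  proof (cases "s1 - f0 \<in> span (dirs F)")
    case True
    then have "?W \<subseteq> span (dirs F)" using span_superset[of "dirs F"] by simp
    from dim_mono_fin[OF fdF this] show ?thesis by (simp add: polytope_dim_dirs)
  next
    case False
    from dim_insert_fin[OF fdF this] show ?thesis by (simp add: polytope_dim_dirs)
  qed
  have "\<exists>s2\<in>S. s2 - f0 \<notin> span ?W"
  proof (rule ccontr)
    assume "\<not> ?thesis"
    then have "\<forall>s\<in>S. s - f0 \<in> span ?W" by blast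
    then have sub: "S \<subseteq> {x. x - f0 \<in> span ?W}" by blast
    have "convex {x. x - f0 \<in> span ?W}" unfolding convex_alt
    proof (clarify)
      fix x y and u :: real assume h: "x - f0 \<in> span ?W" "y - f0 \<in> span ?W"
      have "(1 - u) *\<^sub>R x + u *\<^sub>R y - f0 = (1 - u) *\<^sub>R (x - f0) + u *\<^sub>R (y - f0)"
        by (simp add: algebra_simps)
      then show "(1 - u) *\<^sub>R x + u *\<^sub>R y - f0 \<in> span ?W"
        using span_add[OF span_scale[OF h(1)] span_scale[OF h(2)]] by simp
    qed
    then have "P \<subseteq> {x. x - f0 \<in> span ?W}" unfolding P using sub by (intro hull_minimal)
    then have "x - y \<in> span ?W" if "x \<in> P" "y \<in> P" for x y
      using span_diff[of "x - f0" ?W "y - f0"] that by auto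
    then have "dirs P \<subseteq> span ?W" unfolding dirs_def by blast
    then have "dim (dirs P) \<le> dim ?W" by (rule dim_mono_fin[OF fdW])
    then show False using dW dim unfolding polytope_dim_dirs by linarith
  qed
  then obtain s2 where s2: "s2 \<in> S" "s2 - f0 \<notin> span ?W" by blast
  obtain B where B: "B \<subseteq> ?W" "independent B" "?W \<subseteq> span B" by (rule basis_exists)
  have spB: "span B = span ?W" using span_mono[OF B(1)] span_minimal[OF B(3) subspace_span] by (rule subset_antisym)
  have "independent (insert (s2 - f0) B)"
    by (rule independent_insertI) (simp_all only: spB s2 B(2) not_False_eq_True)
  \<comment> \<open>m vanishes on the directions of F and on \<open>s1 - f0\<close> and is 1 on
    \<open>s2 - f0\<close>; it exists because the last vector is independent of the others.\<close>
  from linear_independent_extend[OF this, of "\<lambda>x. if x = s2 - f0 then 1 else (0::real)"]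
  obtain m :: "'a \<Rightarrow> real" where m: "linear m"
    "\<forall>x\<in>insert (s2 - f0) B. m x = (if x = s2 - f0 then 1 else 0)"
    by (elim exE conjE) (rule that)
  have "s2 - f0 \<notin> B" using s2(2) spB span_base[of _ B] by auto
  then have mB: "\<forall>x\<in>B. m x = 0" using m(2) by auto
  then have mW: "m x = 0" if "x \<in> span ?W" for x
    using linear_eq_0_on_span[OF m(1), of B x] mB that spB by auto
  define d where "d = m f0"
  have mF: "m x = d" if "x \<in> F" for x
  proof -
    have "m (x - f0) = 0" using mW[OF span_base] dirs_I[OF that f0] by simp
    then show ?thesis using m(1) by (simp add: d_def linear_diff)
  qed
  have ms1: "m s1 = d" using mW[of "s1 - f0"] span_base[of "s1 - f0" ?W] m(1) by (simp add: d_def linear_diff)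
  have ms2: "m s2 > d" using m by (simp add: d_def linear_diff)
  let ?S = "{s \<in> S. m s > d}"
  define r where "r = (\<lambda>s. (l s - c) / (m s - d))"
  \<comment> \<open>Only generators with \<open>m s > d\<close> restrict the tilt; for the others
    the bound holds with every positive t.\<close>
  define t where "t = Min (r ` ?S)"
  have fin: "finite (r ` ?S)" "r ` ?S \<noteq> {}" using S s2 ms2 by auto
  obtain s0 where s0: "s0 \<in> S" "m s0 > d" "t = r s0"
    using Min_in[OF fin] unfolding t_def by blast
  have tle: "t \<le> r s" if "s \<in> S" "m s > d" for s
    unfolding t_def using fin that by (intro Min_le) auto
  have s0F: "s0 \<notin> F" using mF s0 by force
  then have "l s0 > c" using l s0 SP by (auto simp: less_le)
  then have tpos: "t > 0" using s0 by (simp add: r_def)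
  define h where "h = (\<lambda>x. l x - t * m x)"
  have hl: "linear h" unfolding h_def
    using m(1) l(1) by (intro linear_compose_sub linear_compose_scale_right[of m t, simplified]) auto
  have hS: "c - t * d \<le> h s" if "s \<in> S" for s
  proof (cases "m s > d")
    case True
    then show ?thesis using tilt_bound[OF True tle[OF that True, unfolded r_def]] unfolding h_def by blast
  next
    case False
    then have "t * m s \<le> t * d" using tpos by simp
    moreover have "c \<le> l s" using l that SP by blast
    ultimately show ?thesis unfolding h_def by linarith
  qed
  have hP: "\<forall>x\<in>P. c - t * d \<le> h x" using linear_ge_hull[OF hl] hS P by blast
  define F' where "F' = {x \<in> P. h x = c - t * d}"
  have ex: "exposed F' P" unfolding exposed_def F'_def using hl hP by blast
  have FF': "F \<subseteq> F'" unfolding F'_def h_def using mF l by auto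
  have "h s0 = c - t * d"
  proof -
    have "t * (m s0 - d) = l s0 - c" using s0 by (auto simp: r_def)
    then show ?thesis by (simp add: h_def algebra_simps)
  qed
  then have "s0 \<in> F'" using s0 SP unfolding F'_def by auto
  then have ne: "F \<noteq> F'" using s0F by blast
  have "h s1 > c - t * d" using ms1 l s1 SP unfolding h_def by (auto simp: less_le)
  then have "s1 \<notin> F'" unfolding F'_def by simp
  then have nP: "F' \<noteq> P" using s1 SP by blast
  have "exposed F F'" unfolding exposed_def
  proof (intro exI conjI)
    show "linear l" "\<forall>x\<in>F'. c \<le> l x" using l unfolding F'_def by auto
    show "F = {x \<in> F'. l x = c}" using FF' l unfolding F'_def by auto
  qed
  then show ?thesis using ex FF' ne nP by blast
qed

text \<open>The number of exposed facets minus the dimension is monotone; the inequality avoids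
  subtraction of naturals. Codimension one is \<open>card_xfacets_facet\<close>; otherwise
  \<open>exposed_extend\<close> supplies an intermediate face, exposed in P and containing F as an
  exposed face, and the induction hypothesis applies to both pairs.\<close>

theorem card_xfacets_mono:
  fixes S :: "'a::real_vector set"
  assumes "finite S" "P = convex hull S" "exposed F P" "F \<noteq> {}"
  shows "card (xfacets F) + polytope_dim P \<le> card (xfacets P) + polytope_dim F"
  using assms
proof (induction "polytope_dim P - polytope_dim F" arbitrary: S P F rule: less_induct)
  case less
  have cP: "convex P" and fP: "fin_dim P" using less.prems fin_dim_hull by auto
  have FP: "F \<subseteq> P" using less.prems unfolding exposed_def by auto
  then have dle: "polytope_dim F \<le> polytope_dim P" using polytope_dim_mono[OF fP] by simp
  have "F \<noteq> P \<Longrightarrow> polytope_dim F < polytope_dim P"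
    by (rule exposed_dim_less[OF less.prems(3) cP fP less.prems(4)])
  then consider "F = P" | "F \<noteq> P" "polytope_dim P = polytope_dim F + 1" | "polytope_dim F + 1 < polytope_dim P"
    by linarith
  then show ?case
  proof cases
    case 1
    then show ?thesis by (simp only: le_refl)
  next
    case 2
    then have "F \<in> xfacets P" using less.prems unfolding xfacets_def by blast
    from card_xfacets_facet[OF less.prems(1,2) this] 2(2) show ?thesis by linarith
  next
    case 3
    then obtain F' where F': "exposed F' P" "F \<subseteq> F'" "F \<noteq> F'" "F' \<noteq> P" "exposed F F'"
      using exposed_extend[OF less.prems(1-4)] by blast
    have F'h: "F' = convex hull (F' \<inter> S)" 
      using exposed_hull_eq[OF less.prems(1) F'(1)[unfolded less.prems(2)]] .
    have F'P: "F' \<subseteq> P" using F'(1) unfolding exposed_def by auto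
    have cF': "convex F'" by (subst F'h) (rule convex_convex_hull)
    have d1: "polytope_dim F' < polytope_dim P"
      using F'(2,4) less.prems(4) by (intro exposed_dim_less[OF F'(1) cP fP]) auto
    have d2: "polytope_dim F < polytope_dim F'"
      by (rule exposed_dim_less[OF F'(5) cF' fin_dim_subset[OF fP F'P] less.prems(4) F'(3)])
    have "card (xfacets F) + polytope_dim F' \<le> card (xfacets F') + polytope_dim F"
      using less.prems(1,4) d1 d2 by (intro less.hyps[OF _ _ F'h F'(5)]) auto
    moreover have "card (xfacets F') + polytope_dim P \<le> card (xfacets P) + polytope_dim F'"
      using less.prems(1,2,4) d1 d2 F' by (intro less.hyps[of P F' S]) auto
    ultimately show ?thesis by linarith
  qed
qed

text \<open>Some exhibited exposed facets of a face already bound the rank of the whole polytope;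
  this is the form applied to K_4.\<close>

corollary rank_face_lower_bound:
  fixes S :: "'a::real_vector set"
  assumes "finite S" "P = convex hull S" "exposed F P" "F \<noteq> {}"
    and "X \<subseteq> xfacets F"
  shows "int (card X) - (int (polytope_dim F) + 1) \<le> polytope_rank P"
proof -
  have F: "F = convex hull (F \<inter> S)" using exposed_hull_eq[OF assms(1) assms(3)[unfolded assms(2)]] .
  have "finite (xfacets F)" by (subst F) (rule finite_xfacets[OF finite_Int], simp add: assms(1))
  then have "card X \<le> card (xfacets F)" using assms(5) card_mono by blast
  moreover have "card (xfacets P) \<le> card {F. is_facet F P}"
    using finite_facets_hull[OF assms(1)] xfacets_subset[of P] assms(2) by (intro card_mono) auto
  moreover have "card (xfacets F) + polytope_dim P \<le> card (xfacets P) + polytope_dim F"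
    by (rule card_xfacets_mono[OF assms(1-4)])
  ultimately show ?thesis unfolding polytope_rank_def by linarith
qed

section \<open>Polytopes of set systems\<close>

abbreviation lk :: "('e \<Rightarrow>\<^sub>0 real) \<Rightarrow> 'e \<Rightarrow> real" where
  "lk \<equiv> Poly_Mapping.lookup"

abbreviation unit_vec :: "'e \<Rightarrow> ('e \<Rightarrow>\<^sub>0 real)" where
  "unit_vec e \<equiv> Poly_Mapping.single e 1"

definition poly_of :: "'e set set \<Rightarrow> ('e \<Rightarrow>\<^sub>0 real) set" where
  "poly_of N = convex hull (char_vec ` N)"

definition zero_face :: "'e \<Rightarrow> ('e \<Rightarrow>\<^sub>0 real) set \<Rightarrow> ('e \<Rightarrow>\<^sub>0 real) set" where
  "zero_face e P = {x \<in> P. lk x e = 0}"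

definition one_face :: "'e \<Rightarrow> ('e \<Rightarrow>\<^sub>0 real) set \<Rightarrow> ('e \<Rightarrow>\<^sub>0 real) set" where
  "one_face e P = {x \<in> P. lk x e = 1}"

lemma lookup_scaleR [simp]: "lk (r *\<^sub>R x) i = r * lk x i"
proof -
  have "finite {i. lk x i \<noteq> 0}" using finite_lookup .
  then have "finite {i. r *\<^sub>R lk x i \<noteq> 0}" by (rule rev_finite_subset) auto
  then show ?thesis unfolding scaleR_poly_mapping_def by (simp add: lookup_Abs_poly_mapping)
qed

lemmas lk_simps = lookup_add lookup_minus lookup_single when_def

lemma linear_lk: "linear (\<lambda>x. lk x e)"
  by (rule linearI) (simp_all add: lookup_add)

lemma lookup_char_vec: "finite X \<Longrightarrow> lk (char_vec X) e = (if e \<in> X then 1 else 0)"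
  unfolding char_vec_def lookup_sum by (simp add: lookup_single when_def)

lemma convex_linear_ge: "linear (g :: 'a::real_vector \<Rightarrow> real) \<Longrightarrow> convex {x. c \<le> g x}"
  unfolding convex_alt
proof (clarify)
  fix x y and u :: real assume g: "linear g" and h: "c \<le> g x" "c \<le> g y" "0 \<le> u" "u \<le> 1"
  have "(1 - u) * (g x - c) \<ge> 0" "u * (g y - c) \<ge> 0" using h by auto
  then have "c \<le> (1 - u) * g x + u * g y" by (simp add: algebra_simps)
  then show "c \<le> g ((1 - u) *\<^sub>R x + u *\<^sub>R y)" using g by (simp add: linear_add linear_scale)
qed

lemma convex_lk_ge: "convex {x. c \<le> lk x e}"
  using convex_linear_ge[OF linear_lk] .

lemma convex_lk_le: "convex {x. lk x e \<le> c}"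
proof -
  have "convex {x. - c \<le> - lk x e}"
    by (rule convex_linear_ge) (simp add: linear_compose_neg[OF linear_lk])
  then show ?thesis by simp
qed

lemma poly_of_bounds:
  assumes "finite E" "N \<subseteq> Pow E" "x \<in> poly_of N"
  shows "0 \<le> lk x e" "lk x e \<le> 1" "e \<notin> E \<Longrightarrow> lk x e = 0"
proof -
  have f: "finite X" "X \<subseteq> E" if "X \<in> N" for X using that assms(1,2) finite_subset by blast+
  have "char_vec ` N \<subseteq> {x. 0 \<le> lk x e}" using f by (auto simp: lookup_char_vec)
  then have "poly_of N \<subseteq> {x. 0 \<le> lk x e}" unfolding poly_of_def by (rule hull_minimal) (rule convex_lk_ge)
  then show "0 \<le> lk x e" using assms(3) by blast
  have "char_vec ` N \<subseteq> {x. lk x e \<le> 1}" using f by (auto simp: lookup_char_vec)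
  then have "poly_of N \<subseteq> {x. lk x e \<le> 1}" unfolding poly_of_def by (rule hull_minimal) (rule convex_lk_le)
  then show "lk x e \<le> 1" using assms(3) by blast
  assume e: "e \<notin> E"
  have "lk (char_vec X) e \<le> 0" if "X \<in> N" for X
    using f[OF that] e by (auto simp: lookup_char_vec)
  then have "char_vec ` N \<subseteq> {x. lk x e \<le> 0}" by auto
  then have "poly_of N \<subseteq> {x. lk x e \<le> 0}" unfolding poly_of_def by (rule hull_minimal) (rule convex_lk_le)
  then show "lk x e = 0" using assms(3) \<open>0 \<le> lk x e\<close> by force
qed

lemma poly_of_inc: "X \<in> N \<Longrightarrow> char_vec X \<in> poly_of N"
  unfolding poly_of_def by (simp add: hull_inc)

lemma finite_system: "finite E \<Longrightarrow> N \<subseteq> Pow E \<Longrightarrow> finite N"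
  by (meson finite_Pow_iff finite_subset)

lemma convex_poly_of [simp]: "convex (poly_of N)"
  unfolding poly_of_def by simp

lemma fin_dim_poly_of: "finite N \<Longrightarrow> fin_dim (poly_of N)"
  unfolding poly_of_def by (rule fin_dim_hull) simp

lemma finite_facets_poly_of: "finite N \<Longrightarrow> finite {F. is_facet F (poly_of N)}"
  unfolding poly_of_def by (rule finite_facets_hull) simp

lemma exposed_zero_face:
  "(\<And>x. x \<in> P \<Longrightarrow> 0 \<le> lk x e) \<Longrightarrow> exposed (zero_face e P) P"
  unfolding exposed_def zero_face_def using linear_lk[of e] by blast

lemma exposed_one_face:
  assumes "\<And>x. x \<in> P \<Longrightarrow> lk x e \<le> 1" shows "exposed (one_face e P) P"
  unfolding exposed_def one_face_def
proof (intro exI conjI)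
  show "linear (\<lambda>x. - lk x e)" by (rule linear_compose_neg[OF linear_lk])
  show "\<forall>x\<in>P. -1 \<le> - lk x e" "{x \<in> P. lk x e = 1} = {x \<in> P. - lk x e = - 1}" using assms by auto
qed

subsection \<open>Splitting a coordinate\<close>

definition shift_vec :: "'e \<Rightarrow> 'e \<Rightarrow> ('e \<Rightarrow>\<^sub>0 real)" where
  "shift_vec e f = unit_vec e - unit_vec f"

definition merge_coord :: "'e \<Rightarrow> 'e \<Rightarrow> ('e \<Rightarrow>\<^sub>0 real) \<Rightarrow> ('e \<Rightarrow>\<^sub>0 real)" where
  "merge_coord e f q = q + lk q f *\<^sub>R shift_vec e f"

text \<open>The fibre over a point p of P consists of the ways to divide \<open>lk p e\<close> into
  two nonnegative shares for e and f. By \<open>poly_of_par_ext\<close> this is the polytope of the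
  system in which e has been doubled.\<close>

definition split_coord :: "'e \<Rightarrow> 'e \<Rightarrow> ('e \<Rightarrow>\<^sub>0 real) set \<Rightarrow> ('e \<Rightarrow>\<^sub>0 real) set" where
  "split_coord e f P = {q. 0 \<le> lk q e \<and> 0 \<le> lk q f \<and> merge_coord e f q \<in> P}"

definition move_coord :: "'e \<Rightarrow> 'e \<Rightarrow> ('e \<Rightarrow>\<^sub>0 real) \<Rightarrow> ('e \<Rightarrow>\<^sub>0 real)" where
  "move_coord e f p = p - lk p e *\<^sub>R shift_vec e f"

lemma lk_shift_vec: "lk (shift_vec e f) g = (if g = e then 1 else 0) - (if g = f then 1 else 0)"
  by (auto simp: shift_vec_def lk_simps)

lemma linear_merge_coord: "linear (merge_coord e f)"
  unfolding merge_coord_def by (rule linearI) (auto simp: lk_simps algebra_simps)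

lemma linear_move_coord: "linear (move_coord e f)"
  unfolding move_coord_def by (rule linearI) (auto simp: lk_simps algebra_simps)

text \<open>Coordinate f is vacant on P and receives a share of coordinate e; a point with positive
  e-coordinate is what makes the split raise the dimension.\<close>

locale split_setup =
  fixes P :: "('e \<Rightarrow>\<^sub>0 real) set" and e f :: 'e
  assumes convex_P: "convex P" and fin_P: "fin_dim P" and ef: "e \<noteq> f"
    and nice: "\<And>x. x \<in> P \<Longrightarrow> lk x f = 0" "\<And>x. x \<in> P \<Longrightarrow> 0 \<le> lk x e"
    and pos: "\<exists>x\<in>P. 0 < lk x e"
begin

abbreviation "u \<equiv> shift_vec e f"
abbreviation "mg \<equiv> merge_coord e f"
abbreviation "mv \<equiv> move_coord e f"
abbreviation "sp \<equiv> split_coord e f"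
abbreviation "Q \<equiv> sp P"

lemma lk_u: "lk u e = 1" "lk u f = -1" "g \<noteq> e \<Longrightarrow> g \<noteq> f \<Longrightarrow> lk u g = 0"
  using ef by (auto simp: lk_shift_vec)

lemma lk_mg: "lk (mg q) e = lk q e + lk q f" "lk (mg q) f = 0" "g \<noteq> e \<Longrightarrow> g \<noteq> f \<Longrightarrow> lk (mg q) g = lk q g"
  by (simp_all add: merge_coord_def lookup_add lk_u)

lemma lk_mv: "lk (mv q) e = 0" "lk (mv q) f = lk q f + lk q e" "g \<noteq> e \<Longrightarrow> g \<noteq> f \<Longrightarrow> lk (mv q) g = lk q g"
  by (simp_all add: move_coord_def lookup_minus lk_u)

lemma mg_id: "lk x f = 0 \<Longrightarrow> mg x = x"
  by (simp add: merge_coord_def)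

lemma mg_add: "mg (q + t *\<^sub>R u) = mg q"
  by (simp add: merge_coord_def lookup_add lk_u algebra_simps)

lemma mg_mv: "lk p f = 0 \<Longrightarrow> mg (mv p) = p"
  using mg_add[of p "- lk p e"] mg_id[of p] by (simp add: move_coord_def)

lemma in_split: "H \<subseteq> P \<Longrightarrow> h \<in> H \<Longrightarrow> h \<in> sp H" "H \<subseteq> P \<Longrightarrow> h \<in> H \<Longrightarrow> mv h \<in> sp H"
  using nice[of h] by (auto simp: split_coord_def mg_id mg_mv lk_mv)

lemma convex_split: "convex H \<Longrightarrow> convex (sp H)"
proof -
  assume "convex H"
  then have "convex (mg -` H)" by (rule convex_linear_vimage[OF linear_merge_coord])
  moreover have "sp H = {q. 0 \<le> lk q e} \<inter> {q. 0 \<le> lk q f} \<inter> mg -` H"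
    by (auto simp: split_coord_def)
  ultimately show "convex (sp H)" by (simp add: convex_Int convex_lk_ge)
qed

lemma fin_dim_split: "H \<subseteq> P \<Longrightarrow> fin_dim (sp H)"
proof -
  assume "H \<subseteq> P"
  from fin_dim_subset[OF fin_P this] obtain B where B: "finite B" "H \<subseteq> span B"
    unfolding fin_dim_def by blast
  have "sp H \<subseteq> span (insert u B)"
  proof
    fix q assume "q \<in> sp H"
    then have m: "mg q \<in> span B" using B by (auto simp: split_coord_def)
    have "mg q \<in> span (insert u B)" using m span_mono[of B "insert u B"] by auto
    moreover have "lk q f *\<^sub>R u \<in> span (insert u B)" by (simp add: span_base span_scale)
    ultimately have "mg q - lk q f *\<^sub>R u \<in> span (insert u B)" by (rule span_diff)
    then show "q \<in> span (insert u B)" by (simp add: merge_coord_def)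
  qed
  then show ?thesis unfolding fin_dim_def using B(1) by (intro exI[of _ "insert u B"]) simp
qed

text \<open>The fibre direction u is new, since its f-coordinate is not zero whereas all directions
  of H vanish at f. It is realised by the two ends h and \<open>mv h\<close> of the fibre over h,
  which differ because \<open>lk h e\<close> is positive.\<close>

lemma dim_split:
  assumes HP: "H \<subseteq> P" and h: "h \<in> H" "0 < lk h e"
  shows "polytope_dim (sp H) = polytope_dim H + 1"
proof -
  have fd: "fin_dim (dirs H)" using fin_dim_dirs[OF fin_dim_subset[OF fin_P HP]] .
  have "lk x f = 0" if "x \<in> H" for x using nice(1) HP that by blast
  then have "dirs H \<subseteq> {x. lk x f = 0}" by (auto simp: dirs_def lookup_minus)
  moreover have "subspace {x. lk x f = 0}"
    by (rule subspaceI) (auto simp: lookup_add)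
  ultimately have "span (dirs H) \<subseteq> {x. lk x f = 0}" by (rule span_minimal)
  then have u: "u \<notin> span (dirs H)" using lk_u by auto
  have 1: "dirs (sp H) \<subseteq> span (insert u (dirs H))"
  proof
    fix d assume "d \<in> dirs (sp H)"
    then obtain q r where d: "d = q - r" "q \<in> sp H" "r \<in> sp H" by (auto simp: dirs_def)
    have "mg q - mg r \<in> dirs H" using d by (intro dirs_I) (auto simp: split_coord_def)
    then have a: "mg q - mg r \<in> span (insert u (dirs H))" by (intro span_base) simp
    have b: "(lk q f - lk r f) *\<^sub>R u \<in> span (insert u (dirs H))" by (intro span_scale span_base) simp
    have "d = (mg q - mg r) - (lk q f - lk r f) *\<^sub>R u"
      by (simp add: d merge_coord_def algebra_simps)
    then show "d \<in> span (insert u (dirs H))" using span_diff[OF a b] by simp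
  qed
  have "H \<subseteq> sp H" using in_split[OF HP] by auto
  then have 2: "dirs H \<subseteq> dirs (sp H)" by (rule dirs_mono)
  have "h - mv h \<in> dirs (sp H)" using in_split[OF HP h(1)] by (intro dirs_I)
  then have "(1 / lk h e) *\<^sub>R (h - mv h) \<in> span (dirs (sp H))" by (intro span_scale span_base)
  moreover have "(1 / lk h e) *\<^sub>R (h - mv h) = u" using h by (simp add: move_coord_def)
  ultimately have "insert u (dirs H) \<subseteq> span (dirs (sp H))"
    using subset_trans[OF 2 span_superset] by simp
  then have "span (insert u (dirs H)) \<subseteq> span (dirs (sp H))" by (rule span_minimal) simp
  moreover have "span (dirs (sp H)) \<subseteq> span (insert u (dirs H))" using 1 by (rule span_minimal) simp
  ultimately have "span (dirs (sp H)) = span (insert u (dirs H))" by (rule subset_antisym[rotated])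
  then have "dim (dirs (sp H)) = dim (insert u (dirs H))" by (rule span_eq_dim)
  then show ?thesis using dim_insert_fin[OF fd u] by (simp add: polytope_dim_dirs)
qed

lemma dim_Q: "polytope_dim Q = polytope_dim P + 1"
proof -
  from pos obtain x where "x \<in> P" "0 < lk x e" by blast
  then show ?thesis by (rule dim_split[OF subset_refl])
qed

lemma zero_f_split: "H \<subseteq> P \<Longrightarrow> zero_face f (sp H) = H"
  using nice by (auto simp: zero_face_def split_coord_def mg_id)

lemma zero_e_split: "H \<subseteq> P \<Longrightarrow> zero_face e (sp H) = mv ` H"
proof
  assume HP: "H \<subseteq> P"
  show "mv ` H \<subseteq> zero_face e (sp H)" using in_split(2)[OF HP] by (auto simp: zero_face_def lk_mv)
  show "zero_face e (sp H) \<subseteq> mv ` H"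
  proof
    fix q assume q: "q \<in> zero_face e (sp H)"
    then have "mv (mg q) = q"
      by (simp add: zero_face_def move_coord_def lk_mg) (simp add: merge_coord_def)
    moreover have "mg q \<in> H" using q by (simp add: zero_face_def split_coord_def)
    ultimately show "q \<in> mv ` H" by (metis image_eqI)
  qed
qed

lemma Q_nonneg: "q \<in> Q \<Longrightarrow> 0 \<le> lk q e" "q \<in> Q \<Longrightarrow> 0 \<le> lk q f"
  by (auto simp: split_coord_def)

lemma zero_e_facet: "is_facet (zero_face e Q) Q"
proof -
  have "affine {x. lk x f = 0}" unfolding affine_alt by (auto simp: lookup_add)
  moreover have "inj_on mv {x. lk x f = 0}"
    by (rule inj_on_inverseI[where g = mg]) (simp add: mg_mv)
  moreover have "P \<subseteq> {x. lk x f = 0}" using nice by auto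
  ultimately have "polytope_dim (mv ` P) = polytope_dim P"
    by (rule aff_on_dim[OF linear_aff_on[OF linear_move_coord]])
  moreover have "mv ` P \<noteq> {}" using pos by blast
  ultimately show ?thesis
    using exposed_face[OF exposed_zero_face[OF Q_nonneg(1)] convex_split[OF convex_P]]
    unfolding is_facet_def zero_e_split[OF subset_refl] dim_Q by simp
qed

lemma zero_f_facet: "is_facet (zero_face f Q) Q"
  using exposed_face[OF exposed_zero_face[OF Q_nonneg(2)] convex_split[OF convex_P]] pos
  unfolding is_facet_def zero_f_split[OF subset_refl] dim_Q by auto

lemma zero_ne: "zero_face e Q \<noteq> zero_face f Q"
proof -
  obtain x where x: "x \<in> P" "0 < lk x e" using pos by blast
  have "mv x \<in> zero_face e Q" using zero_e_split[OF subset_refl] x by blast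
  moreover have "mv x \<notin> zero_face f Q" using x nice[of x] by (simp add: zero_face_def lk_mv)
  ultimately show ?thesis by blast
qed

text \<open>A facet contained in the proper face x(e) = 0 has the same dimension as that face and
  therefore equals it.\<close>

lemma facet_pos:
  assumes H: "is_facet H P" "H \<noteq> zero_face e P"
  shows "\<exists>h\<in>H. 0 < lk h e"
proof (rule ccontr)
  assume n: "\<not> ?thesis"
  have Hf: "H face_of P" "H \<noteq> {}" "polytope_dim P = polytope_dim H + 1" using H by (auto simp: is_facet_def)
  have HP: "H \<subseteq> P" using Hf face_of_imp_subset by blast
  have Z: "exposed (zero_face e P) P" by (rule exposed_zero_face) (rule nice(2))
  have sub: "H \<subseteq> zero_face e P" using n HP nice by (force simp: zero_face_def)
  have ZP: "zero_face e P \<subseteq> P" by (auto simp: zero_face_def)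
  from pos obtain x where "x \<in> P" "0 < lk x e" by blast
  then have "x \<in> P" "x \<notin> zero_face e P" by (auto simp: zero_face_def)
  then have "zero_face e P \<noteq> P" by blast
  moreover have "zero_face e P \<noteq> {}" using sub Hf by blast
  ultimately have d: "polytope_dim (zero_face e P) < polytope_dim P"
    using exposed_dim_less[OF Z convex_P fin_P] by simp
  have "polytope_dim H \<le> polytope_dim (zero_face e P)"
    by (rule polytope_dim_mono[OF fin_dim_subset[OF fin_P ZP] sub])
  then have "polytope_dim H = polytope_dim (zero_face e P)" using d Hf by linarith
  then have "H = zero_face e P"
    by (rule face_dim_eq[OF face_of_subset[OF Hf(1) sub ZP] Hf(2) fin_dim_subset[OF fin_P ZP]])
  then show False using H by blast
qed

text \<open>Merging is linear, so it maps a segment to a segment or to a point, and membership in H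
  can be tested after merging.\<close>

lemma split_face:
  assumes H: "H face_of P"
  shows "sp H face_of Q"
  unfolding face_of_def
proof (intro conjI ballI impI)
  have HP: "H \<subseteq> P" using H face_of_imp_subset by blast
  show "sp H \<subseteq> Q" using HP by (auto simp: split_coord_def)
  show "convex (sp H)" using face_of_imp_convex[OF H] by (rule convex_split)
  fix a b x assume h: "a \<in> Q" "b \<in> Q" "x \<in> sp H" "x \<in> open_segment a b"
  then obtain t where t: "0 < t" "t < 1" "x = (1 - t) *\<^sub>R a + t *\<^sub>R b" by (auto simp: in_segment)
  then have m: "mg x = (1 - t) *\<^sub>R mg a + t *\<^sub>R mg b"
    using linear_merge_coord[of e f] by (simp add: linear_add linear_scale)
  have ab: "mg a \<in> P" "mg b \<in> P" "mg x \<in> H" using h by (auto simp: split_coord_def)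
  have "mg a \<in> H \<and> mg b \<in> H"
  proof (cases "mg a = mg b")
    case True
    then have "mg x = mg a" using m by (simp flip: scaleR_add_left)
    then show ?thesis using True ab by simp
  next
    case False
    then have "mg x \<in> open_segment (mg a) (mg b)" using m t by (auto simp: in_segment)
    then show ?thesis using face_ofD[OF H _ ab] by blast
  qed
  then show "a \<in> sp H" "b \<in> sp H" using h by (auto simp: split_coord_def)
qed

lemma split_facet:
  assumes H: "is_facet H P" "H \<noteq> zero_face e P"
  shows "is_facet (sp H) Q"
proof -
  have Hf: "H face_of P" "polytope_dim P = polytope_dim H + 1" using H by (auto simp: is_facet_def)
  have HP: "H \<subseteq> P" using Hf face_of_imp_subset by blast
  obtain h where h: "h \<in> H" "0 < lk h e" using facet_pos[OF H] by blast
  have "sp H \<noteq> {}" using in_split(1)[OF HP h(1)] by blast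
  moreover have "polytope_dim Q = polytope_dim (sp H) + 1"
    using dim_split[OF HP h] Hf(2) dim_Q by linarith
  ultimately show ?thesis using split_face[OF Hf(1)] unfolding is_facet_def by blast
qed

text \<open>A facet of the split polytope that lies in neither of the two new coordinate hyperplanes
  contains every fibre of the merging map that it meets.\<close>

lemma facet_split_cases:
  assumes F: "is_facet F Q"
  shows "F = zero_face e Q \<or> F = zero_face f Q \<or> (\<exists>H. is_facet H P \<and> H \<noteq> zero_face e P \<and> F = sp H)"
proof -
  have Ff: "F face_of Q" "F \<noteq> {}" "polytope_dim Q = polytope_dim F + 1" using F by (auto simp: is_facet_def)
  have FQ: "F \<subseteq> Q" using Ff face_of_imp_subset by blast
  have fQ: "fin_dim Q" by (rule fin_dim_split[OF subset_refl])
  have cF: "convex F" using face_of_imp_convex[OF Ff(1)] .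
  have cQ: "convex Q" using convex_split[OF convex_P] .
  show ?thesis
  proof (cases "F \<subseteq> zero_face e Q \<or> F \<subseteq> zero_face f Q")
    case True
    then show ?thesis 
      using facet_subset_eq[OF F zero_e_facet _ fQ] facet_subset_eq[OF F zero_f_facet _ fQ] by auto
  next
    case False
    then obtain q1 q2 where "q1 \<in> F" "lk q1 e \<noteq> 0" "q2 \<in> F" "lk q2 f \<noteq> 0"
      using FQ by (auto simp: zero_face_def)
    then have q12: "q1 \<in> F" "0 < lk q1 e" "q2 \<in> F" "0 < lk q2 f" "0 \<le> lk q1 f" "0 \<le> lk q2 e"
      using FQ Q_nonneg by (force simp: less_le)+
    \<comment> \<open>The average of q1 and q2 has both new coordinates positive, so it is interior
      to its fibre.\<close>
    define m where "m = (1/2) *\<^sub>R q1 + (1/2) *\<^sub>R q2"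
    have m: "m \<in> F" "0 < lk m e" "0 < lk m f"
      using convexD[OF cF q12(1,3), of "1/2" "1/2"] q12 by (auto simp: m_def lookup_add)
    have inQ: "q + t *\<^sub>R u \<in> Q" if "q \<in> Q" "0 \<le> lk q e + t" "0 \<le> lk q f - t" for q t
      using that mg_add[of q t] by (simp add: split_coord_def lookup_add lk_u)
    have fib: "c + t *\<^sub>R u \<in> F" if c: "c \<in> F" "0 < lk c e" "0 < lk c f" "c + t *\<^sub>R u \<in> Q" for c t
    proof (cases "t = 0")
      case False
      \<comment> \<open>s is so small that the opposite step by \<open>- (s * t)\<close> keeps both
        coordinates nonnegative; c then lies between the two ends.\<close>
      define s where "s = min (lk c e) (lk c f) / (2 * \<bar>t\<bar>)"
      have s: "s > 0" using c False by (simp add: s_def)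
      have st: "\<bar>s * t\<bar> = min (lk c e) (lk c f) / 2" using False c by (simp add: s_def abs_mult)
      then have "lk c e - s * t \<ge> 0" "lk c f + s * t \<ge> 0" using c by linarith+
      then have b: "c + (- (s * t)) *\<^sub>R u \<in> Q" using inQ[of c "- (s * t)"] c FQ by auto
      have "u \<noteq> 0" using lk_u(1) by auto
      have "(1 - 1/(1+s)) = s/(1+s)" using s by (simp add: field_simps)
      then have "c = (1 - 1/(1+s)) *\<^sub>R (c + t *\<^sub>R u) + (1/(1+s)) *\<^sub>R (c + (- (s * t)) *\<^sub>R u)"
        using s by (simp only: scaleR_add_right scaleR_scaleR)
          (simp add: scaleR_add_left[symmetric] add_divide_distrib[symmetric] algebra_simps)
      moreover have "c + t *\<^sub>R u \<noteq> c + (- (s * t)) *\<^sub>R u"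
      proof
        assume "c + t *\<^sub>R u = c + (- (s * t)) *\<^sub>R u"
        then have "lk (c + t *\<^sub>R u) e = lk (c + (- (s * t)) *\<^sub>R u) e" by simp
        then have "t = - (s * t)" by (simp only: lookup_add lookup_scaleR lk_u)
        then have "t * (1 + s) = 0" by (simp add: algebra_simps)
        then show False using False s by simp
      qed
      ultimately have "c \<in> open_segment (c + t *\<^sub>R u) (c + (- (s * t)) *\<^sub>R u)"
        unfolding in_segment using s by (intro conjI exI[of _ "1/(1+s)"]) auto
      then show ?thesis using face_ofD[OF Ff(1) _ c(4) b c(1)] by blast
    qed (use c in simp)
    \<comment> \<open>A general q is averaged with m to make both coordinates positive. The shifted
      average then lies in F and in a segment ending at the shifted q, so the face property returns
      the shifted q itself.\<close>
    have fib2: "q + t *\<^sub>R u \<in> F" if q: "q \<in> F" "q + t *\<^sub>R u \<in> Q" for q t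
    proof -
      let ?q = "q + t *\<^sub>R u" and ?c = "(1/2) *\<^sub>R q + (1/2) *\<^sub>R m"
      have "0 \<le> lk q e" "0 \<le> lk q f" using q FQ Q_nonneg by auto
      then have c: "?c \<in> F" "0 < lk ?c e" "0 < lk ?c f"
        using convexD[OF cF q(1) m(1), of "1/2" "1/2"] m by (auto simp: lookup_add)
      have e: "?c + (t/2) *\<^sub>R u = (1/2) *\<^sub>R ?q + (1/2) *\<^sub>R m" by (simp add: algebra_simps)
      have mQ: "m \<in> Q" using m FQ by blast
      have "(1/2) *\<^sub>R ?q + (1/2) *\<^sub>R m \<in> Q" using convexD[OF cQ q(2) mQ, of "1/2" "1/2"] by simp
      then have z: "(1/2) *\<^sub>R ?q + (1/2) *\<^sub>R m \<in> F" using fib[OF c, of "t/2"] unfolding e by simp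
      show ?thesis
      proof (cases "?q = m")
        case False
        then have "(1/2) *\<^sub>R ?q + (1/2) *\<^sub>R m \<in> open_segment ?q m"
          unfolding in_segment by (intro conjI exI[of _ "1/2"]) auto
        then show ?thesis using face_ofD[OF Ff(1) _ q(2) mQ z] by blast
      qed (use m in simp)
    qed
    define H where "H = mg ` F"
    have HP: "H \<subseteq> P" using FQ by (auto simp: H_def split_coord_def)
    have FH: "F = sp H"
    proof
      show "F \<subseteq> sp H" using FQ by (auto simp: H_def split_coord_def)
      show "sp H \<subseteq> F"
      proof
        fix q assume q: "q \<in> sp H"
        then obtain r where r: "r \<in> F" "mg q = mg r" by (auto simp: H_def split_coord_def)
        have "q = r + (lk r f - lk q f) *\<^sub>R u"
        proof -
          have "q + lk q f *\<^sub>R u = r + lk r f *\<^sub>R u" using r(2) by (simp add: merge_coord_def)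
          then show ?thesis by (simp add: algebra_simps)
        qed
        moreover have "q \<in> Q" using q HP by (auto simp: split_coord_def)
        ultimately show "q \<in> F" using fib2[OF r(1), of "lk r f - lk q f"] by simp
      qed
    qed
    \<comment> \<open>P sits in Q as the face x(f) = 0, so H is a slice of the face F and thus a
      face of P.\<close>
    have Hz: "H = F \<inter> P"
    proof
      show "F \<inter> P \<subseteq> H"
      proof
        fix x assume x: "x \<in> F \<inter> P"
        then have "mg x = x" using nice by (intro mg_id) auto
        then show "x \<in> H" unfolding H_def using x by (metis IntD1 image_eqI)
      qed
      show "H \<subseteq> F \<inter> P" using HP in_split(1)[OF HP] FH by blast
    qed
    have "P \<subseteq> Q" using in_split(1)[OF subset_refl] by blast
    then have Hface: "H face_of P" unfolding Hz using face_of_slice[OF Ff(1) convex_P]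
      by (simp add: Int_absorb1 inf.absorb2)
    have mH: "mg m \<in> H" "0 < lk (mg m) e" using m by (auto simp: H_def lk_mg)
    have "polytope_dim F = polytope_dim H + 1" using dim_split[OF HP mH] FH by simp
    then have "is_facet H P" unfolding is_facet_def using Hface Ff(3) dim_Q mH(1) by auto
    moreover have "H \<noteq> zero_face e P" using mH by (auto simp: zero_face_def)
    ultimately show ?thesis using FH by blast
  qed
qed

lemma facets_split:
  "{F. is_facet F Q} =
    {zero_face e Q, zero_face f Q} \<union> sp ` ({F. is_facet F P} - {zero_face e P})"
  using facet_split_cases split_facet zero_e_facet zero_f_facet by blast

text \<open>Two coordinate facets come in, one goes out if x(e) = 0 was a facet, and the dimension
  grows by one.\<close>

lemma rank_split:
  assumes "finite {F. is_facet F P}"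
  shows "polytope_rank Q = polytope_rank P + 1 - (if is_facet (zero_face e P) P then 1 else 0)"
proof -
  let ?S = "{F. is_facet F P} - {zero_face e P}"
  have sub: "H \<subseteq> P" if "H \<in> ?S" for H
    using that face_of_imp_subset by (auto simp: is_facet_def)
  have inj: "inj_on sp ?S"
    by (rule inj_on_inverseI[where g = "zero_face f"]) (simp add: zero_f_split sub)
  have "zero_face e Q \<notin> sp ` ?S"
  proof
    assume "zero_face e Q \<in> sp ` ?S"
    then obtain H where H: "H \<in> ?S" "zero_face e Q = sp H" by blast
    then obtain h where "h \<in> H" "0 < lk h e" using facet_pos by blast
    then have "h \<in> zero_face e Q" "0 < lk h e" using in_split(1)[OF sub[OF H(1)]] H(2) by auto
    then show False by (simp add: zero_face_def)
  qed
  moreover have "zero_face f Q \<notin> sp ` ?S"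
  proof
    assume "zero_face f Q \<in> sp ` ?S"
    then obtain H where H: "H \<in> ?S" "zero_face f Q = sp H" by blast
    then obtain h where h: "h \<in> H" "0 < lk h e" using facet_pos by blast
    then have "mv h \<in> zero_face f Q" using in_split(2)[OF sub[OF H(1)]] H(2) by auto
    then have "lk h f + lk h e = 0" by (simp add: zero_face_def lk_mv)
    moreover have "lk h f = 0" using nice(1) sub[OF H(1)] h(1) by blast
    ultimately show False using h(2) by simp
  qed
  ultimately have "card {F. is_facet F Q} = card ?S + 2"
    unfolding facets_split using zero_ne assms card_image[OF inj] by (simp add: card_Un_disjoint)
  moreover have "int (card ?S) = int (card {F. is_facet F P}) - (if is_facet (zero_face e P) P then 1 else 0)"
    using card_Suc_Diff1[OF assms, of "zero_face e P"] by auto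
  ultimately show ?thesis unfolding polytope_rank_def dim_Q by simp
qed

end

subsection \<open>Parallel extension and toggling of a set system\<close>

text \<open>For the bases of a matroid this adjoins f parallel to e: f may take the place of e in
  any member.\<close>

definition par_ext :: "'e \<Rightarrow> 'e \<Rightarrow> 'e set set \<Rightarrow> 'e set set" where
  "par_ext e f N = N \<union> {insert f (X - {e}) | X. X \<in> N \<and> e \<in> X}"

definition toggle :: "'e set \<Rightarrow> 'e set \<Rightarrow> 'e set" where
  "toggle D X = (D - X) \<union> (X - D)"

lemma mem_toggle: "x \<in> toggle D X \<longleftrightarrow> (x \<in> D) \<noteq> (x \<in> X)"
  by (auto simp: toggle_def)

lemma toggle_toggle [simp]: "toggle D (toggle D X) = X"
  by (auto simp: toggle_def)

lemma toggle_image_toggle [simp]: "toggle D ` toggle D ` N = N"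
  by (simp add: image_image)

lemma toggle_subset: "D \<subseteq> E \<Longrightarrow> X \<subseteq> E \<Longrightarrow> toggle D X \<subseteq> E"
  by (auto simp: toggle_def)

lemma toggle_system: "D \<subseteq> E \<Longrightarrow> N \<subseteq> Pow E \<Longrightarrow> toggle D ` N \<subseteq> Pow E"
  by (rule image_subsetI, rule PowI, rule toggle_subset) auto

lemma par_ext_system: "N \<subseteq> Pow E \<Longrightarrow> par_ext e f N \<subseteq> Pow (insert f E)"
  by (auto simp: par_ext_def)

lemma char_vec_insert:
  "finite X \<Longrightarrow> f \<notin> X \<Longrightarrow> char_vec (insert f X) = unit_vec f + char_vec X"
  by (simp add: char_vec_def)

lemma char_vec_move:
  assumes "finite X" "e \<in> X" "f \<notin> X"
  shows "char_vec (insert f (X - {e})) = char_vec X - shift_vec e f"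
proof -
  have "char_vec X = unit_vec e + char_vec (X - {e})"
    using char_vec_insert[of "X - {e}" e] assms by (simp add: insert_absorb)
  moreover have "char_vec (insert f (X - {e})) = unit_vec f + char_vec (X - {e})"
    using assms by (intro char_vec_insert) auto
  ultimately show ?thesis by (simp add: shift_vec_def algebra_simps)
qed

lemma linear_image_hull_subset:
  assumes "linear g" "\<And>s. s \<in> S \<Longrightarrow> g s \<in> convex hull T" "x \<in> convex hull S"
  shows "g x \<in> convex hull T"
proof -
  have "convex (g -` (convex hull T))" by (rule convex_linear_vimage[OF assms(1)]) simp
  then have "convex hull S \<subseteq> g -` (convex hull T)" using assms(2) by (intro hull_minimal) auto
  then show ?thesis using assms(3) by blast
qed

text \<open>For the inclusion from right to left, q is a convex combination of its merged point p
  and of p with the e-coordinate moved to f, the weights being the shares q(e)/p(e) and q(f)/p(e).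
  If p(e) = 0, then q = p.\<close>

lemma poly_of_par_ext:
  assumes E: "finite E" "N \<subseteq> Pow E" and e: "e \<in> E" and f: "f \<notin> E"
  shows "poly_of (par_ext e f N) = split_coord e f (poly_of N)"
proof
  have ef: "e \<noteq> f" using e f by auto
  have fX: "finite X" "f \<notin> X" if "X \<in> N" for X using that E f finite_subset by blast+
  have lkX: "lk (char_vec X) f = 0" "0 \<le> lk (char_vec X) e" if "X \<in> N" for X
    using fX[OF that] by (simp_all add: lookup_char_vec)
  show "poly_of (par_ext e f N) \<subseteq> split_coord e f (poly_of N)"
    unfolding poly_of_def[of "par_ext e f N"]
  proof (rule hull_minimal)
    have "convex (merge_coord e f -` poly_of N)" by (rule convex_linear_vimage[OF linear_merge_coord]) simp
    moreover have "split_coord e f (poly_of N) = {q. 0 \<le> lk q e} \<inter> {q. 0 \<le> lk q f} \<inter> merge_coord e f -` poly_of N"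
      by (auto simp: split_coord_def)
    ultimately show "convex (split_coord e f (poly_of N))" by (simp add: convex_Int convex_lk_ge)
    show "char_vec ` par_ext e f N \<subseteq> split_coord e f (poly_of N)"
    proof
      fix v assume "v \<in> char_vec ` par_ext e f N"
      then obtain Y where Y: "v = char_vec Y" "Y \<in> par_ext e f N" by blast
      then consider "Y \<in> N" | X where "X \<in> N" "e \<in> X" "Y = insert f (X - {e})"
        by (auto simp: par_ext_def)
      then show "v \<in> split_coord e f (poly_of N)"
      proof cases
        case 1
        then show ?thesis using Y lkX[OF 1] poly_of_inc[OF 1] by (simp add: split_coord_def merge_coord_def)
      next
        case 2
        note X = fX[OF 2(1)]
        have v: "v = char_vec X - shift_vec e f" using char_vec_move[OF X(1) 2(2) X(2)] Y 2 by simp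
        then have "lk v f = 1" "lk v e = 0"
          using X 2(2) ef by (auto simp: lookup_minus lk_shift_vec lookup_char_vec)
        then show ?thesis using v poly_of_inc[OF 2(1)] by (simp add: split_coord_def merge_coord_def)
      qed
    qed
  qed
  show "split_coord e f (poly_of N) \<subseteq> poly_of (par_ext e f N)"
  proof
    fix q assume q: "q \<in> split_coord e f (poly_of N)"
    define p where "p = merge_coord e f q"
    have p: "p \<in> poly_of N" using q by (simp add: p_def split_coord_def)
    have q0: "0 \<le> lk q e" "0 \<le> lk q f" using q by (auto simp: split_coord_def)
    have pe: "lk p e = lk q e + lk q f" using ef by (simp add: p_def merge_coord_def lookup_add lk_shift_vec)
    have sub: "poly_of N \<subseteq> poly_of (par_ext e f N)"
      unfolding poly_of_def by (intro hull_mono image_mono) (auto simp: par_ext_def)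
    have mv: "move_coord e f p \<in> poly_of (par_ext e f N)"
      unfolding poly_of_def
    proof (rule linear_image_hull_subset[OF linear_move_coord _ p[unfolded poly_of_def]])
      fix s assume "s \<in> char_vec ` N"
      then obtain X where X: "X \<in> N" "s = char_vec X" by blast
      show "move_coord e f s \<in> convex hull (char_vec ` par_ext e f N)"
      proof (cases "e \<in> X")
        case True
        then have "move_coord e f s = char_vec (insert f (X - {e}))"
          using char_vec_move[OF fX(1)[OF X(1)] True fX(2)[OF X(1)]] X fX[OF X(1)]
          by (simp add: move_coord_def lookup_char_vec)
        moreover have "insert f (X - {e}) \<in> par_ext e f N" using True X by (auto simp: par_ext_def)
        ultimately show ?thesis by (simp add: hull_inc)
      next
        case False
        then have "move_coord e f s = char_vec X" using X fX[OF X(1)] by (simp add: move_coord_def lookup_char_vec)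
        moreover have "X \<in> par_ext e f N" using X by (auto simp: par_ext_def)
        ultimately show ?thesis by (simp add: hull_inc)
      qed
    qed
    show "q \<in> poly_of (par_ext e f N)"
    proof (cases "lk p e = 0")
      case True
      then have "lk q f = 0" using q0 pe by linarith
      then have "q = p" by (simp add: p_def merge_coord_def)
      then show ?thesis using p sub by blast
    next
      case False
      then have pos: "lk p e > 0" using q0 pe by linarith
      have one: "lk q e / lk p e + lk q f / lk p e = 1" using pos pe by (simp add: add_divide_distrib[symmetric])
      have c: "(lk q e / lk p e) *\<^sub>R p + (lk q f / lk p e) *\<^sub>R move_coord e f p \<in> poly_of (par_ext e f N)"
        using convexD[OF convex_poly_of _ mv _ _ one] p sub q0 pos by auto
      have "(lk q e / lk p e) *\<^sub>R p + (lk q f / lk p e) *\<^sub>R move_coord e f p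
          = (lk q e / lk p e + lk q f / lk p e) *\<^sub>R p - (lk q f / lk p e * lk p e) *\<^sub>R shift_vec e f"
        by (simp add: move_coord_def scaleR_diff_right scaleR_add_left)
      also have "\<dots> = p - lk q f *\<^sub>R shift_vec e f" unfolding one using pos by simp
      also have "\<dots> = q" by (simp add: p_def merge_coord_def)
      finally show ?thesis using c by simp
    qed
  qed
qed

lemma split_setup_poly_of:
  assumes "finite E" "N \<subseteq> Pow E" "e \<in> E" "f \<notin> E" "X \<in> N" "e \<in> X"
  shows "split_setup (poly_of N) e f"
proof
  show "convex (poly_of N)" by simp
  show "fin_dim (poly_of N)" by (rule fin_dim_poly_of[OF finite_system[OF assms(1,2)]])
  show "e \<noteq> f" using assms by auto
  show "lk x f = 0" "0 \<le> lk x e" if "x \<in> poly_of N" for x using poly_of_bounds[OF assms(1,2) that] assms(4) by auto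
  have "finite X" using assms finite_subset by blast
  then show "\<exists>x\<in>poly_of N. 0 < lk x e"
    using poly_of_inc[OF assms(5)] assms(6) by (intro bexI[of _ "char_vec X"]) (simp add: lookup_char_vec)
qed

lemma rank_par_ext:
  assumes "finite E" "N \<subseteq> Pow E" "e \<in> E" "f \<notin> E" "X \<in> N" "e \<in> X"
  shows "polytope_rank (poly_of (par_ext e f N)) =
    polytope_rank (poly_of N) + 1 - (if is_facet (zero_face e (poly_of N)) (poly_of N) then 1 else 0)"
proof -
  interpret split_setup "poly_of N" e f by (rule split_setup_poly_of[OF assms])
  show ?thesis
    unfolding poly_of_par_ext[OF assms(1-4)]
    by (rule rank_split[OF finite_facets_poly_of[OF finite_system[OF assms(1,2)]]])
qed

lemma rank_par_ext_ge:
  assumes "finite E" "N \<subseteq> Pow E" "e \<in> E" "f \<notin> E"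
  shows "polytope_rank (poly_of N) \<le> polytope_rank (poly_of (par_ext e f N))"
proof (cases "\<exists>X\<in>N. e \<in> X")
  case True
  then obtain X where "X \<in> N" "e \<in> X" by blast
  from rank_par_ext[OF assms this] show ?thesis by simp
next
  case False
  then have "par_ext e f N = N" by (auto simp: par_ext_def)
  then show ?thesis by simp
qed

text \<open>One map for the reflection in D and the renaming along \<pi>: with \<pi> the identity it
  gives the rank of toggled systems, in general the unimodular equivalences.\<close>

definition transport :: "'a set \<Rightarrow> ('a \<Rightarrow> 'b) \<Rightarrow> 'a set \<Rightarrow> ('a \<Rightarrow>\<^sub>0 real) \<Rightarrow> ('b \<Rightarrow>\<^sub>0 real)" where
  "transport E \<pi> D x = (\<Sum>e\<in>E. (if e \<in> D then 1 - lk x e else lk x e) *\<^sub>R unit_vec (\<pi> e))"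

text \<open>The affine space on which \<open>transport\<close> is injective; the map forgets all
  coordinates outside E.\<close>

definition supp_in :: "'a set \<Rightarrow> ('a \<Rightarrow>\<^sub>0 real) set" where
  "supp_in E = {x. \<forall>e. e \<notin> E \<longrightarrow> lk x e = 0}"

lemma affine_supp_in: "affine (supp_in E)"
  unfolding affine_alt supp_in_def by (auto simp: lookup_add)

lemma poly_of_supp: "finite E \<Longrightarrow> N \<subseteq> Pow E \<Longrightarrow> poly_of N \<subseteq> supp_in E"
  unfolding supp_in_def by (intro subsetI CollectI allI impI) (rule poly_of_bounds(3))

lemma aff_on_transport: "aff_on (transport E \<pi> D) S"
proof -
  have *: "transport E \<pi> D ((1 - u) *\<^sub>R x + u *\<^sub>R y)
    = (1 - u) *\<^sub>R transport E \<pi> D x + u *\<^sub>R transport E \<pi> D y" for x y u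
    unfolding transport_def scaleR_sum_right sum.distrib[symmetric] scaleR_scaleR scaleR_add_left[symmetric]
  proof (intro sum.cong refl arg_cong2[where f = scaleR])
    fix e
    show "(if e \<in> D then 1 - lk ((1 - u) *\<^sub>R x + u *\<^sub>R y) e else lk ((1 - u) *\<^sub>R x + u *\<^sub>R y) e)
      = (1 - u) * (if e \<in> D then 1 - lk x e else lk x e) + u * (if e \<in> D then 1 - lk y e else lk y e)"
      by (simp add: lookup_add) (simp add: algebra_simps)
  qed
  show ?thesis unfolding aff_on_def using * by blast
qed

lemma lk_transport:
  assumes "finite E" "inj_on \<pi> E"
  shows "g \<in> E \<Longrightarrow> lk (transport E \<pi> D x) (\<pi> g) = (if g \<in> D then 1 - lk x g else lk x g)"
    and "h \<notin> \<pi> ` E \<Longrightarrow> lk (transport E \<pi> D x) h = 0"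
proof -
  show "lk (transport E \<pi> D x) h = 0" if "h \<notin> \<pi> ` E"
    unfolding transport_def lookup_sum lookup_scaleR using that
    by (intro sum.neutral) (auto simp: lookup_single when_def)
  assume g: "g \<in> E"
  have "lk (transport E \<pi> D x) (\<pi> g) = (\<Sum>e\<in>E. if e = g then (if g \<in> D then 1 - lk x g else lk x g) else 0)"
    unfolding transport_def lookup_sum lookup_scaleR using assms(2) g
    by (intro sum.cong refl) (auto simp: lookup_single when_def inj_on_def)
  then show "lk (transport E \<pi> D x) (\<pi> g) = (if g \<in> D then 1 - lk x g else lk x g)"
    using assms(1) g by simp
qed

lemma inj_on_transport:
  assumes "finite E" "inj_on \<pi> E"
  shows "inj_on (transport E \<pi> D) (supp_in E)"
proof (rule inj_onI)
  fix x y assume h: "x \<in> supp_in E" "y \<in> supp_in E" "transport E \<pi> D x = transport E \<pi> D y"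
  have "lk x g = lk y g" for g
  proof (cases "g \<in> E")
    case True
    then show ?thesis using lk_transport(1)[OF assms True, of D x] lk_transport(1)[OF assms True, of D y] h(3)
      by (auto split: if_splits)
  qed (use h in \<open>auto simp: supp_in_def\<close>)
  then show "x = y" by (intro poly_mapping_eqI)
qed

lemma transport_char_vec:
  assumes "finite E" "inj_on \<pi> E" "X \<subseteq> E" "D \<subseteq> E"
  shows "transport E \<pi> D (char_vec X) = char_vec (\<pi> ` toggle D X)"
proof (rule poly_mapping_eqI)
  fix h
  have fin: "finite X" "finite (\<pi> ` toggle D X)"
    using finite_subset[OF assms(3,1)] finite_subset[OF toggle_subset[OF assms(4,3)] assms(1)] by simp_all
  show "lk (transport E \<pi> D (char_vec X)) h = lk (char_vec (\<pi> ` toggle D X)) h"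
  proof (cases "h \<in> \<pi> ` E")
    case True
    then obtain g where g: "g \<in> E" "h = \<pi> g" by blast
    have "h \<in> \<pi> ` toggle D X \<longleftrightarrow> g \<in> toggle D X"
      using g toggle_subset[OF assms(4,3)] inj_on_image_mem_iff[OF assms(2)] by blast
    then show ?thesis using lk_transport(1)[OF assms(1,2) g(1)] fin g
      by (simp add: lookup_char_vec mem_toggle)
  next
    case False
    then have "h \<notin> \<pi> ` toggle D X" using toggle_subset[OF assms(4,3)] by blast
    then show ?thesis using lk_transport(2)[OF assms(1,2) False] fin by (simp add: lookup_char_vec)
  qed
qed

text \<open>Separating the constant lets the convex hull pass through a linear map and a translation
  in turn.\<close>

lemma transport_linear:
  obtains g where "linear g" "transport E \<pi> D = (\<lambda>x. transport E \<pi> D 0 + g x)"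
proof
  define g where "g = (\<lambda>x. transport E \<pi> D x - transport E \<pi> D 0)"
  have g: "g x = (\<Sum>e\<in>E. (if e \<in> D then - lk x e else lk x e) *\<^sub>R unit_vec (\<pi> e))" for x
    unfolding g_def transport_def sum_subtractf[symmetric] scaleR_diff_left[symmetric]
    by (intro sum.cong refl) auto
  show "linear g"
    unfolding g by (rule linearI)
      (auto simp: lookup_add scaleR_sum_right sum.distrib[symmetric] scaleR_add_left[symmetric] intro!: sum.cong)
  show "transport E \<pi> D = (\<lambda>x. transport E \<pi> D 0 + g x)" by (auto simp: g_def)
qed

lemma transport_poly_of:
  assumes "finite E" "inj_on \<pi> E" "N \<subseteq> Pow E" "D \<subseteq> E"
  shows "transport E \<pi> D ` poly_of N = poly_of ((\<lambda>X. \<pi> ` toggle D X) ` N)"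
proof -
  let ?c = "transport E \<pi> D 0"
  obtain g where lin: "linear g" and t: "transport E \<pi> D = (\<lambda>x. ?c + g x)"
    by (rule transport_linear)
  have "transport E \<pi> D ` poly_of N = (+) ?c ` g ` poly_of N"
    by (subst t) (simp add: image_image)
  also have "\<dots> = convex hull ((+) ?c ` g ` char_vec ` N)"
    unfolding poly_of_def convex_hull_linear_image[OF lin] convex_hull_translation ..
  also have "(+) ?c ` g ` char_vec ` N = (\<lambda>X. transport E \<pi> D (char_vec X)) ` N"
    by (subst (2) t) (simp add: image_image)
  also have "\<dots> = char_vec ` (\<lambda>X. \<pi> ` toggle D X) ` N"
    unfolding image_image using transport_char_vec[OF assms(1,2) _ assms(4)] assms(3)
    by (intro image_cong) auto
  finally show ?thesis unfolding poly_of_def .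
qed

lemma rank_transport:
  assumes "finite E" "inj_on \<pi> E" "N \<subseteq> Pow E" "D \<subseteq> E"
  shows "polytope_rank (poly_of ((\<lambda>X. \<pi> ` toggle D X) ` N)) = polytope_rank (poly_of N)"
    and "bij_betw ((`) (transport E \<pi> D)) {F. is_facet F (poly_of N)}
      {F. is_facet F (poly_of ((\<lambda>X. \<pi> ` toggle D X) ` N))}"
  using aff_on_rank[OF aff_on_transport affine_supp_in inj_on_transport[OF assms(1,2)]
      poly_of_supp[OF assms(1,3)], of D]
  unfolding transport_poly_of[OF assms] by auto

lemma rank_toggle:
  assumes "finite E" "N \<subseteq> Pow E" "D \<subseteq> E"
  shows "polytope_rank (poly_of (toggle D ` N)) = polytope_rank (poly_of N)"
  using rank_transport(1)[of E id N D] assms by simp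

text \<open>Reflection exchanges x(g) = 0 and x(g) = 1 exactly for g in D. Toggling twice is the
  identity, so carrying facets in one direction, applied to both systems, gives the
  equivalence.\<close>

lemma facet_toggle:
  assumes E: "finite E" "N \<subseteq> Pow E" "D \<subseteq> E" and g: "g \<in> E"
  shows "is_facet (zero_face g (poly_of (toggle D ` N))) (poly_of (toggle D ` N)) \<longleftrightarrow>
      is_facet ((if g \<in> D then one_face else zero_face) g (poly_of N)) (poly_of N)"
    and "is_facet (one_face g (poly_of (toggle D ` N))) (poly_of (toggle D ` N)) \<longleftrightarrow>
      is_facet ((if g \<in> D then zero_face else one_face) g (poly_of N)) (poly_of N)"
proof -
  have *: "is_facet (transport E id D ` F) (poly_of (toggle D ` N))"
    if "N \<subseteq> Pow E" "is_facet F (poly_of N)" for F N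
  proof -
    have "transport E id D ` poly_of N = poly_of (toggle D ` N)"
      using transport_poly_of[OF E(1) inj_on_id that(1) E(3)] by simp
    then show ?thesis
      using aff_on_facet[OF aff_on_transport[of E id D] affine_supp_in
          inj_on_transport[OF E(1) inj_on_id] poly_of_supp[OF E(1) that(1)] that(2)] by simp
  qed
  have lk: "lk (transport E id D x) g = (if g \<in> D then 1 - lk x g else lk x g)" for x
    using lk_transport(1)[OF E(1) _ g, of id] by simp
  have z: "transport E id D ` zero_face g (poly_of N) = (if g \<in> D then one_face else zero_face) g (poly_of (toggle D ` N))"
    "transport E id D ` one_face g (poly_of N) = (if g \<in> D then zero_face else one_face) g (poly_of (toggle D ` N))"
    if "N \<subseteq> Pow E" for N
  proof -
    have e: "poly_of (toggle D ` N) = transport E id D ` poly_of N"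
      using transport_poly_of[OF E(1) _ that E(3), of id] by simp
    show "transport E id D ` zero_face g (poly_of N) = (if g \<in> D then one_face else zero_face) g (poly_of (toggle D ` N))"
      "transport E id D ` one_face g (poly_of N) = (if g \<in> D then zero_face else one_face) g (poly_of (toggle D ` N))"
      unfolding e by (auto simp: zero_face_def one_face_def lk)
  qed
  note tN = toggle_system[OF E(3,2)]
  show "is_facet (zero_face g (poly_of (toggle D ` N))) (poly_of (toggle D ` N)) \<longleftrightarrow>
      is_facet ((if g \<in> D then one_face else zero_face) g (poly_of N)) (poly_of N)"
    
    using *[OF E(2), of "zero_face g (poly_of N)"] *[OF E(2), of "one_face g (poly_of N)"]
      *[OF tN, of "zero_face g (poly_of (toggle D ` N))"] *[OF tN, of "one_face g (poly_of (toggle D ` N))"]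
    unfolding z[OF E(2)] z[OF tN] toggle_image_toggle by (auto split: if_splits)
  show "is_facet (one_face g (poly_of (toggle D ` N))) (poly_of (toggle D ` N)) \<longleftrightarrow>
      is_facet ((if g \<in> D then zero_face else one_face) g (poly_of N)) (poly_of N)"
    
    using *[OF E(2), of "zero_face g (poly_of N)"] *[OF E(2), of "one_face g (poly_of N)"]
      *[OF tN, of "zero_face g (poly_of (toggle D ` N))"] *[OF tN, of "one_face g (poly_of (toggle D ` N))"]
    unfolding z[OF E(2)] z[OF tN] toggle_image_toggle by (auto split: if_splits)
qed

text \<open>Each coordinate is copied or replaced by its difference from 1, which preserves and
  reflects integrality.\<close>

lemma unimodularly_equivalent_transport:
  assumes E: "finite E" "inj_on \<pi> E" "N \<subseteq> Pow E" "D \<subseteq> E"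
  shows "unimodularly_equivalent (poly_of N) (poly_of ((\<lambda>X. \<pi> ` toggle D X) ` N))"
proof -
  let ?f = "transport E \<pi> D" and ?P = "poly_of N"
  let ?Q = "poly_of ((\<lambda>X. \<pi> ` toggle D X) ` N)"
  note fP = transport_poly_of[OF E]
  have hP: "affine hull ?P \<subseteq> supp_in E"
    by (rule hull_minimal[where S = affine, OF poly_of_supp[OF E(1,3)] affine_supp_in])
  have inj: "inj_on ?f (affine hull ?P)" by (rule inj_on_subset[OF inj_on_transport[OF E(1,2)] hP])
  have im: "?f ` (affine hull ?P) = affine hull ?Q"
  proof
    have "affine (?f ` (affine hull ?P))"
      by (rule aff_on_inverse(2)[OF aff_on_transport affine_affine_hull inj])
    then show "affine hull ?Q \<subseteq> ?f ` (affine hull ?P)"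
      unfolding fP[symmetric] by (rule hull_minimal[rotated]) (rule image_mono[OF hull_subset])
    let ?W = "{x \<in> affine hull ?P. ?f x \<in> affine hull ?Q}"
    have "affine ?W"
    proof (rule affine_alt[THEN iffD2], intro ballI allI)
      fix x y and u :: real assume xy: "x \<in> ?W" "y \<in> ?W"
      then have 1: "(1 - u) *\<^sub>R x + u *\<^sub>R y \<in> affine hull ?P"
        using affine_affine_hull[of ?P] unfolding affine_alt by simp
      have "?f ((1 - u) *\<^sub>R x + u *\<^sub>R y) = (1 - u) *\<^sub>R ?f x + u *\<^sub>R ?f y"
        using aff_on_transport[of E \<pi> D UNIV] unfolding aff_on_def by simp
      then have "?f ((1 - u) *\<^sub>R x + u *\<^sub>R y) \<in> affine hull ?Q"
        using xy affine_affine_hull[of ?Q] unfolding affine_alt by simp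
      then show "(1 - u) *\<^sub>R x + u *\<^sub>R y \<in> ?W" using 1 by simp
    qed
    moreover have "?P \<subseteq> ?W" using hull_subset[of ?P affine] hull_subset[of ?Q affine] fP by blast
    ultimately have "affine hull ?P \<subseteq> ?W" by (rule hull_minimal[rotated])
    then show "?f ` (affine hull ?P) \<subseteq> affine hull ?Q" by blast
  qed
  have lat: "?f x \<in> lattice_points \<longleftrightarrow> x \<in> lattice_points" if x: "x \<in> supp_in E" for x
  proof -
    have "(\<forall>h. lk (?f x) h \<in> \<int>) \<longleftrightarrow> (\<forall>g\<in>E. lk (?f x) (\<pi> g) \<in> \<int>)"
      using lk_transport(2)[OF E(1,2)] by (metis Ints_0 imageE)
    also have "\<dots> \<longleftrightarrow> (\<forall>g\<in>E. lk x g \<in> \<int>)"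
    proof (intro ball_cong refl)
      fix g assume "g \<in> E"
      moreover have "1 - y \<in> \<int> \<longleftrightarrow> y \<in> \<int>" for y :: real
        using Ints_diff[of 1 "1 - y"] Ints_diff[of 1 y] by auto
      ultimately show "lk (?f x) (\<pi> g) \<in> \<int> \<longleftrightarrow> lk x g \<in> \<int>" using lk_transport(1)[OF E(1,2)] by auto
    qed
    also have "\<dots> \<longleftrightarrow> (\<forall>g. lk x g \<in> \<int>)" using x unfolding supp_in_def by (metis (mono_tags, lifting) Ints_0 mem_Collect_eq)
    finally show ?thesis by (simp add: lattice_points_def)
  qed
  have "?f ` (affine hull ?P \<inter> lattice_points) = affine hull ?Q \<inter> lattice_points"
    unfolding im[symmetric] using lat hP by blast
  moreover have "\<forall>x\<in>affine hull ?P. \<forall>y\<in>affine hull ?P. \<forall>u.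
      ?f ((1 - u) *\<^sub>R x + u *\<^sub>R y) = (1 - u) *\<^sub>R ?f x + u *\<^sub>R ?f y"
    using aff_on_transport unfolding aff_on_def by blast
  ultimately show ?thesis unfolding unimodularly_equivalent_def using inj im fP
    by (intro exI[of _ ?f]) (simp add: bij_betw_def)
qed

subsection \<open>Series-parallel systems\<close>

text \<open>Keeps the facets x(g) = 0 of different elements apart; if one of them coincided with
  x(e) = 0, it would not lift through a split at e.\<close>

definition separated :: "'e set \<Rightarrow> 'e set set \<Rightarrow> bool" where
  "separated E N \<longleftrightarrow> (\<forall>g\<in>E. \<forall>h\<in>E. g \<noteq> h \<longrightarrow> (\<exists>X\<in>N. (g \<in> X) \<noteq> (h \<in> X)))"

text \<open>The invariant that predicts every further step: x(e) = 0 is a facet, so a parallel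
  extension keeps the rank; x(e) = 1 is none, so a parallel extension after reflecting e raises it
  by one.\<close>

definition normal :: "int \<Rightarrow> 'e set \<Rightarrow> 'e set set \<Rightarrow> bool" where
  "normal k E N \<longleftrightarrow> finite E \<and> N \<subseteq> Pow E \<and> N \<noteq> {} \<and> polytope_rank (poly_of N) = k \<and>
    (\<forall>g\<in>E. is_facet (zero_face g (poly_of N)) (poly_of N) \<and> \<not> is_facet (one_face g (poly_of N)) (poly_of N)) \<and>
    separated E N"

lemma char_vec_in_zero_face:
  "X \<in> N \<Longrightarrow> finite X \<Longrightarrow> char_vec X \<in> zero_face g (poly_of N) \<longleftrightarrow> g \<notin> X"
  "X \<in> N \<Longrightarrow> finite X \<Longrightarrow> char_vec X \<in> one_face g (poly_of N) \<longleftrightarrow> g \<in> X"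
  by (simp_all add: zero_face_def one_face_def poly_of_inc lookup_char_vec)

text \<open>Covers the base case and both kinds of steps. Hypothesis \<open>one\<close> tolerates a
  facet x(g) = 1 that coincides with x(e) = 0, because that facet is the one which the split does
  not lift. The segment is the case in point: there x(b) = 1 is the same face as x(a) = 0.\<close>

lemma normal_par_ext:
  assumes E: "finite E" "N \<subseteq> Pow E" "e \<in> E" "f \<notin> E"
    and X1: "X1 \<in> N" "e \<in> X1" and X0: "X0 \<in> N" "e \<notin> X0"
    and zero: "\<And>g. g \<in> E \<Longrightarrow> g \<noteq> e \<Longrightarrow> is_facet (zero_face g (poly_of N)) (poly_of N)"
    and one: "\<And>g. g \<in> E \<Longrightarrow> g \<noteq> e \<Longrightarrow> is_facet (one_face g (poly_of N)) (poly_of N) \<Longrightarrow>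
      one_face g (poly_of N) = zero_face e (poly_of N)"
    and sep: "separated E N"
    and k: "k = polytope_rank (poly_of N) + 1 - (if is_facet (zero_face e (poly_of N)) (poly_of N) then 1 else 0)"
  shows "normal k (insert f E) (par_ext e f N)"
proof -
  interpret split_setup "poly_of N" e f by (rule split_setup_poly_of[OF E X1])
  note Q = poly_of_par_ext[OF E]
  have fin: "finite X" "f \<notin> X" if "X \<in> N" for X using that E finite_subset by blast+
  have fQ: "fin_dim Q" by (rule fin_dim_split[OF subset_refl])
  have sub: "zero_face g (poly_of N) \<subseteq> poly_of N" "one_face g (poly_of N) \<subseteq> poly_of N" for g
    by (auto simp: zero_face_def one_face_def)
  have zQ: "zero_face g Q = sp (zero_face g (poly_of N))" "one_face g Q = sp (one_face g (poly_of N))"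
    if "g \<noteq> e" "g \<noteq> f" for g
    using that by (auto simp: zero_face_def one_face_def split_coord_def lk_mg)
  have zfQ: "zero_face f Q = poly_of N" by (rule zero_f_split[OF subset_refl])
  have zeQ: "zero_face e Q = mv ` poly_of N" by (rule zero_e_split[OF subset_refl])
  have le: "lk q e + lk q f \<le> 1" if "q \<in> Q" for q
    using that poly_of_bounds(2)[OF E(1,2), of "mg q" e] by (simp add: split_coord_def lk_mg)
  obtain p where p: "p \<in> poly_of N" "0 < lk p e" using pos by blast
  have pf: "lk p f = 0" using nice(1)[OF p(1)] .
  have zero_facets: "is_facet (zero_face g Q) Q" if g: "g \<in> insert f E" for g
  proof -
    consider "g = e" | "g = f" | "g \<in> E" "g \<noteq> e" "g \<noteq> f" using g by blast
    then show ?thesis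
    proof cases
      case 3
      \<comment> \<open>Separation ensures that x(g) = 0 is not the facet x(e) = 0.\<close>
      obtain X where "X \<in> N" "(g \<in> X) \<noteq> (e \<in> X)"
        using sep[unfolded separated_def, rule_format, OF 3(1) E(3) 3(2)] by blast
      then have "zero_face g (poly_of N) \<noteq> zero_face e (poly_of N)"
        using char_vec_in_zero_face(1)[OF \<open>X \<in> N\<close> fin(1)] by blast
      then show ?thesis unfolding zQ[OF 3(2,3)] by (intro split_facet zero 3(1,2))
    qed (use zero_e_facet zero_f_facet in auto)
  qed
  have one_facets: "\<not> is_facet (one_face g Q) Q" if g: "g \<in> insert f E" for g
  proof
    assume fac: "is_facet (one_face g Q) Q"
    consider "g = e" | "g = f" | "g \<in> E" "g \<noteq> e" "g \<noteq> f" using g by blast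
    then show False
    proof cases
      case 1
      \<comment> \<open>Since x(e) + x(f) is at most 1, x(e) = 1 forces x(f) = 0. If the two faces
        were equal, e would lie in every member of N, contrary to X0.\<close>
      have "one_face e Q \<subseteq> zero_face f Q"
        using le Q_nonneg by (fastforce simp: zero_face_def one_face_def)
      then have "one_face e Q = poly_of N"
        using facet_subset_eq[OF _ zero_f_facet _ fQ] fac 1 zfQ by auto
      then have "char_vec X0 \<in> one_face e Q" using poly_of_inc[OF X0(1)] by simp
      then show False using fin[OF X0(1)] X0(2) by (simp add: one_face_def lookup_char_vec)
    next
      case 2
      have "one_face f Q \<subseteq> zero_face e Q"
        using le Q_nonneg by (fastforce simp: zero_face_def one_face_def)
      then have "one_face f Q = zero_face e Q"
        using facet_subset_eq[OF _ zero_e_facet _ fQ] fac 2 by auto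
      moreover have "char_vec X0 \<in> zero_face e Q"
        using in_split(1)[OF subset_refl poly_of_inc[OF X0(1)]] fin[OF X0(1)] X0(2)
        by (simp add: zero_face_def lookup_char_vec)
      ultimately have "char_vec X0 \<in> one_face f Q" by simp
      then show False using fin[OF X0(1)] by (simp add: one_face_def lookup_char_vec)
    next
      case 3
      \<comment> \<open>p and \<open>mv p\<close> have the same g-coordinate but differ at e and f,
        so x(g) = 1 is neither of the two new coordinate facets.\<close>
      have inP: "p \<in> Q" "mv p \<in> Q" using in_split[OF subset_refl p(1)] by auto
      from facet_split_cases[OF fac] show False
      proof (elim disjE exE conjE)
        assume h: "one_face g Q = zero_face e Q"
        then have "mv p \<in> one_face g Q" using p(1) zeQ by blast
        then have "p \<in> one_face g Q" using 3 inP by (simp add: one_face_def lk_mv)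
        then show False using h p by (simp add: zero_face_def)
      next
        assume h: "one_face g Q = zero_face f Q"
        then have "p \<in> one_face g Q" using p(1) zfQ by blast
        then have "mv p \<in> one_face g Q" using 3 inP by (simp add: one_face_def lk_mv)
        then show False using h p pf by (simp add: zero_face_def lk_mv)
      next
        fix H assume H: "is_facet H (poly_of N)" "H \<noteq> zero_face e (poly_of N)" "one_face g Q = sp H"
        have "H \<subseteq> poly_of N" using H(1) face_of_imp_subset by (auto simp: is_facet_def)
        then have "H = zero_face f (sp H)" by (simp add: zero_f_split)
        also have "\<dots> = one_face g (poly_of N)" 
          by (simp only: H(3)[symmetric] zQ(2)[OF 3(2,3)] zero_f_split[OF sub(2)])
        finally show False using one[OF 3(1,2)] H(1,2) by simp
      qed
    qed
  qed
  have "separated (insert f E) (par_ext e f N)"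
    unfolding separated_def
  proof (intro ballI impI)
    have old: "\<exists>X\<in>par_ext e f N. (g \<in> X) \<noteq> (h \<in> X)" if gh: "g \<in> E" "h \<in> E" "g \<noteq> h" for g h
    proof -
      obtain X where X: "X \<in> N" "(g \<in> X) \<noteq> (h \<in> X)"
        using sep[unfolded separated_def, rule_format, OF gh] by blast
      then have "X \<in> par_ext e f N" by (simp add: par_ext_def)
      then show ?thesis using X(2) by (rule bexI[rotated])
    qed
    have new: "\<exists>X\<in>par_ext e f N. (g \<in> X) \<noteq> (f \<in> X)" if g: "g \<in> E" for g
    proof (cases "g = e")
      case True
      then show ?thesis using X1 fin(2)[OF X1(1)] by (intro bexI[of _ X1]) (auto simp: par_ext_def)
    next
      case False
      then obtain X where X: "X \<in> N" "(g \<in> X) \<noteq> (e \<in> X)"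
        using sep[unfolded separated_def, rule_format, OF g E(3)] False by blast
      show ?thesis
      proof (cases "e \<in> X")
        case True
        then have "insert f (X - {e}) \<in> par_ext e f N" using X by (auto simp: par_ext_def)
        then show ?thesis using X True g E(4) by (intro bexI[of _ "insert f (X - {e})"]) auto
      next
        case False
        then show ?thesis using X fin(2)[OF X(1)] by (intro bexI[of _ X]) (auto simp: par_ext_def)
      qed
    qed
    fix g h assume "g \<in> insert f E" "h \<in> insert f E" "g \<noteq> h"
    then consider "g \<in> E" "h \<in> E" "g \<noteq> h" | "g = f" "h \<in> E" | "g \<in> E" "h = f" by blast
    then show "\<exists>X\<in>par_ext e f N. (g \<in> X) \<noteq> (h \<in> X)"
    proof cases
      case 2
      then show ?thesis using new[of h] by (metis (no_types, lifting))
    qed (use old new in auto)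
  qed
  moreover have "polytope_rank (poly_of (par_ext e f N)) = k" using rank_par_ext[OF E X1] k by simp
  moreover have "par_ext e f N \<noteq> {}" using X1 by (auto simp: par_ext_def)
  ultimately show ?thesis
    unfolding normal_def Q using zero_facets one_facets E(1) par_ext_system[OF E(2)] by auto
qed

lemma polytope_dim_singleton: "polytope_dim {x} = 0"
proof -
  have "dirs {x} \<subseteq> span {}" by (auto simp: dirs_def)
  then have "dim (dirs {x}) \<le> card ({} :: 'a set)" by (intro dim_le_card) auto
  then show ?thesis by (simp add: polytope_dim_dirs)
qed

lemma poly_of_segment:
  assumes "a \<noteq> b"
  shows "polytope_rank (poly_of {{a}, {b}}) = 0"
    and "is_facet (zero_face b (poly_of {{a}, {b}})) (poly_of {{a}, {b}})"
    and "is_facet (zero_face a (poly_of {{a}, {b}})) (poly_of {{a}, {b}})"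
    and "one_face b (poly_of {{a}, {b}}) = zero_face a (poly_of {{a}, {b}})"
proof -
  let ?N = "{{a}, {b}}" and ?P = "poly_of {{a}, {b}}"
  let ?x = "unit_vec a" and ?y = "unit_vec b"
  have cv: "char_vec ` ?N = {?x, ?y}" by (simp add: char_vec_def)
  have P: "?P = convex hull {?x, ?y}" unfolding poly_of_def cv ..
  have lk: "lk ?x a = 1" "lk ?x b = 0" "lk ?y a = 0" "lk ?y b = 1" using assms by (auto simp: lookup_single when_def)
  have xy: "?x \<noteq> ?y" using lk by auto
  have P2: "?P = {(1 - u) *\<^sub>R ?x + u *\<^sub>R ?y | u. 0 \<le> u \<and> u \<le> 1}"
    unfolding P segment_convex_hull[symmetric] by (simp add: closed_segment_def)
  have za: "zero_face a ?P = {?y}" unfolding zero_face_def P2 using lk by (auto simp: lookup_add intro: exI[of _ 1])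
  have zb: "zero_face b ?P = {?x}" unfolding zero_face_def P2 using lk by (auto simp: lookup_add intro: exI[of _ 0])
  have ob: "one_face b ?P = {?y}" unfolding one_face_def P2 using lk by (auto simp: lookup_add intro: exI[of _ 1])
  have dim: "polytope_dim ?P = 1"
  proof -
    have "dirs ?P \<subseteq> span {?x - ?y}"
    proof
      fix d assume "d \<in> dirs ?P"
      then obtain u v where "d = ((1 - u) *\<^sub>R ?x + u *\<^sub>R ?y) - ((1 - v) *\<^sub>R ?x + v *\<^sub>R ?y)"
        unfolding dirs_def P2 by blast
      then have "d = (v - u) *\<^sub>R (?x - ?y)" by (simp add: algebra_simps)
      then show "d \<in> span {?x - ?y}" by (simp add: span_base span_scale)
    qed
    moreover have "?x \<in> ?P" "?y \<in> ?P" unfolding P by (auto simp: hull_inc)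
    then have "{?x - ?y} \<subseteq> dirs ?P" using dirs_I by blast
    moreover have "independent {?x - ?y}" using xy by simp
    ultimately have "card {?x - ?y} = dim (dirs ?P)" by (intro basis_card_eq_dim)
    then show ?thesis by (simp add: polytope_dim_dirs)
  qed
  have b: "0 \<le> lk x g" if "x \<in> ?P" for x g
    using poly_of_bounds(1)[of "{a,b}" ?N, OF _ _ that] by auto
  have face: "zero_face g ?P face_of ?P" for g
    by (rule exposed_face[OF exposed_zero_face[OF b] convex_poly_of])
  show fb: "is_facet (zero_face b ?P) ?P" using face[of b] unfolding is_facet_def zb dim by (simp add: polytope_dim_singleton)
  show fa: "is_facet (zero_face a ?P) ?P" using face[of a] unfolding is_facet_def za dim by (simp add: polytope_dim_singleton)
  show "one_face b ?P = zero_face a ?P" using za ob by simp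
  have "{F. is_facet F ?P} = {{?x}, {?y}}"
  proof
    show "{{?x}, {?y}} \<subseteq> {F. is_facet F ?P}" using fa fb za zb by auto
    show "{F. is_facet F ?P} \<subseteq> {{?x}, {?y}}"
    proof
      fix F assume "F \<in> {F. is_facet F ?P}"
      then have F: "is_facet F ?P" by simp
      have Fh: "F = convex hull (F \<inter> {?x, ?y})"
        using F unfolding is_facet_def P by (intro face_of_hull_eq) auto
      have ne: "F \<noteq> {}" "F \<noteq> ?P" using F by (auto simp: is_facet_def)
      consider "F \<inter> {?x, ?y} = {}" | "F \<inter> {?x, ?y} = {?x}" | "F \<inter> {?x, ?y} = {?y}" | "F \<inter> {?x, ?y} = {?x, ?y}"
        by blast
      then show "F \<in> {{?x}, {?y}}"
      proof cases
        case 1 then show ?thesis using Fh ne(1) by simp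
      next
        case 2 have "F = convex hull {?x}" by (rule Fh[unfolded 2])
        then show ?thesis by simp
      next
        case 3 have "F = convex hull {?y}" by (rule Fh[unfolded 3])
        then show ?thesis by simp
      next
        case 4 have "F = convex hull {?x, ?y}" by (rule Fh[unfolded 4])
        then show ?thesis using ne(2) P by simp
      qed
    qed
  qed
  then show "polytope_rank ?P = 0" unfolding polytope_rank_def dim using xy by simp
qed

text \<open>k counts the series steps. A series step does not reflect back afterwards, so the
  members are bases only up to toggling. The start has three elements because the polytope of {{a},
  {b}} is a segment, in which x(a) = 0 is also x(b) = 1.\<close>

inductive sp_system :: "nat \<Rightarrow> 'e set \<Rightarrow> 'e set set \<Rightarrow> bool" where
  triangle: "a \<noteq> b \<Longrightarrow> a \<noteq> c \<Longrightarrow> b \<noteq> c \<Longrightarrow> sp_system 0 {a, b, c} {{a}, {b}, {c}}"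
| parallel: "sp_system k E N \<Longrightarrow> e \<in> E \<Longrightarrow> f \<notin> E \<Longrightarrow> sp_system k (insert f E) (par_ext e f N)"
| series: "sp_system k E N \<Longrightarrow> e \<in> E \<Longrightarrow> f \<notin> E \<Longrightarrow>
    sp_system (Suc k) (insert f E) (par_ext e f (toggle {e} ` N))"

lemma facet_nontrivial:
  assumes E: "finite E" "N \<subseteq> Pow E" "N \<noteq> {}" and fac: "is_facet (zero_face e (poly_of N)) (poly_of N)"
  shows "\<exists>X\<in>N. e \<in> X" "\<exists>X\<in>N. e \<notin> X"
proof -
  have fin: "finite X" if "X \<in> N" for X using finite_subset[of X E] that E by blast
  have cz: "convex (zero_face e (poly_of N))"
    using fac face_of_imp_convex[of "zero_face e (poly_of N)" "poly_of N"] by (simp add: is_facet_def)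
  show "\<exists>X\<in>N. e \<in> X"
  proof (rule ccontr)
    assume "\<not> ?thesis"
    then have "char_vec ` N \<subseteq> zero_face e (poly_of N)" using char_vec_in_zero_face(1)[OF _ fin] by auto
    then have "poly_of N \<subseteq> zero_face e (poly_of N)" unfolding poly_of_def[of N] using cz
      by (intro hull_minimal) (simp_all add: poly_of_def)
    then have "zero_face e (poly_of N) = poly_of N" by (auto simp: zero_face_def)
    then show False using fac by (simp add: is_facet_def)
  qed
  show "\<exists>X\<in>N. e \<notin> X"
  proof (rule ccontr)
    assume "\<not> ?thesis"
    then have "char_vec ` N \<subseteq> {x. 1 \<le> lk x e}" using fin by (auto simp: lookup_char_vec)
    then have "poly_of N \<subseteq> {x. 1 \<le> lk x e}" unfolding poly_of_def by (intro hull_minimal convex_lk_ge)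
    then have "zero_face e (poly_of N) = {}" by (force simp: zero_face_def)
    then show False using fac by (simp add: is_facet_def)
  qed
qed

text \<open>The point of the invariant: the number of series steps is the rank of the
  polytope.\<close>

lemma sp_system_normal: "sp_system k E N \<Longrightarrow> normal (int k) E N"
proof (induction rule: sp_system.induct)
  case (triangle a b c)
  note s = poly_of_segment[OF triangle(1)]
  \<comment> \<open>The triangle is the split of a segment; the facet x(b) = 1 of the segment falls
    under the exception in hypothesis \<open>one\<close>.\<close>
  have "normal 0 (insert c {a, b}) (par_ext a c {{a}, {b}})"
    using triangle s by (intro normal_par_ext[where ?X1.0 = "{a}" and ?X0.0 = "{b}"]) (auto simp: separated_def)
  moreover have "par_ext a c {{a}, {b}} = {{a}, {b}, {c}}" using triangle by (auto simp: par_ext_def)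
  moreover have "insert c {a, b} = {a, b, c}" by auto
  ultimately show ?case by simp
next
  case (parallel k E N e f)
  note N = parallel.IH[unfolded normal_def]
  obtain X1 X0 where "X1 \<in> N" "e \<in> X1" "X0 \<in> N" "e \<notin> X0"
    using facet_nontrivial[of E N e] N parallel.hyps by blast
  then show ?case using N parallel.hyps by (intro normal_par_ext[where ?X1.0 = X1 and ?X0.0 = X0]) auto
next
  case (series k E N e f)
  note N = series.IH[unfolded normal_def]
  have E: "finite E" "N \<subseteq> Pow E" "{e} \<subseteq> E" using N series.hyps by auto
  have sys: "toggle {e} ` N \<subseteq> Pow E" by (rule toggle_system[OF E(3,2)])
  note ft = facet_toggle[OF E]
  obtain X1 X0 where X: "X1 \<in> N" "e \<in> X1" "X0 \<in> N" "e \<notin> X0"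
    using facet_nontrivial[of E N e] N series.hyps by blast
  \<comment> \<open>Reflecting e turns x(e) = 1, which is no facet by normality, into x(e) = 0; this
    is where the rank goes up.\<close>
  have nz: "\<not> is_facet (zero_face e (poly_of (toggle {e} ` N))) (poly_of (toggle {e} ` N))"
    using ft(1)[OF series.hyps(2)] N series.hyps by simp
  have fin: "finite X" if "X \<in> N" for X using finite_subset[of X E] that E by blast
  \<comment> \<open>Needed for separation after reflecting e: if membership of g and of e were
    always opposite, x(g) + x(e) = 1 would hold on the polytope, and the facet x(g) = 0 would be
    x(e) = 1, which normality excludes.\<close>
  have both: "\<exists>X\<in>N. (g \<in> X) = (e \<in> X)" if g: "g \<in> E" for g
  proof (rule ccontr)
    assume n: "\<not> ?thesis"
    have lkN: "lk x g + lk x e = 1" if x: "x \<in> poly_of N" for x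
    proof -
      have lin: "linear (\<lambda>x. lk x g + lk x e)" by (rule linear_compose_add[OF linear_lk linear_lk])
      have 1: "lk s g + lk s e = 1" if s: "s \<in> char_vec ` N" for s
      proof -
        obtain X where "X \<in> N" "s = char_vec X" using s by blast
        then show ?thesis using n fin[of X] by (auto simp: lookup_char_vec)
      qed
      have "1 \<le> lk x g + lk x e"
        using linear_ge_hull[OF lin, of "char_vec ` N" 1 x] 1 x unfolding poly_of_def by simp
      moreover have "-1 \<le> - (lk x g + lk x e)"
        using linear_ge_hull[OF linear_compose_neg[OF lin], of "char_vec ` N" "-1" x] 1 x unfolding poly_of_def by simp
      ultimately show ?thesis by simp
    qed
    have "zero_face g (poly_of N) = one_face e (poly_of N)"
      unfolding zero_face_def one_face_def by (intro Collect_cong conj_cong refl) (use lkN in fastforce)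
    then show False using N g series.hyps by metis
  qed
  show ?case
  proof (rule normal_par_ext[OF E(1) sys series.hyps(2,3), where ?X1.0 = "toggle {e} X0" and ?X0.0 = "toggle {e} X1"])
    show "toggle {e} X0 \<in> toggle {e} ` N" "e \<in> toggle {e} X0" "toggle {e} X1 \<in> toggle {e} ` N" "e \<notin> toggle {e} X1"
      using X by (auto simp: mem_toggle)
    show "is_facet (zero_face g (poly_of (toggle {e} ` N))) (poly_of (toggle {e} ` N))" if "g \<in> E" "g \<noteq> e" for g
      using ft(1)[OF that(1)] that N by simp
    show "one_face g (poly_of (toggle {e} ` N)) = zero_face e (poly_of (toggle {e} ` N))"
      if "g \<in> E" "g \<noteq> e" "is_facet (one_face g (poly_of (toggle {e} ` N))) (poly_of (toggle {e} ` N))" for g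
      using ft(2)[OF that(1)] that N by simp
    show "separated E (toggle {e} ` N)"
      unfolding separated_def
    proof (intro ballI impI)
      fix g h assume gh: "g \<in> E" "h \<in> E" "g \<noteq> h"
      have "\<exists>X\<in>N. (g \<in> toggle {e} X) \<noteq> (h \<in> toggle {e} X)"
      proof -
        consider "h = e" | "g = e" | "g \<noteq> e" "h \<noteq> e" by blast
        then show ?thesis
        proof cases
          case 1
          then obtain X where "X \<in> N" "(g \<in> X) = (e \<in> X)" using both[OF gh(1)] by blast
          then show ?thesis using 1 gh(3) by (intro bexI[of _ X]) (auto simp: mem_toggle)
        next
          case 2
          then obtain X where "X \<in> N" "(h \<in> X) = (e \<in> X)" using both[OF gh(2)] by blast
          then show ?thesis using 2 gh(3) by (intro bexI[of _ X]) (auto simp: mem_toggle)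
        next
          case 3
          from N have "separated E N" by simp
          from this[unfolded separated_def, rule_format, OF gh]
          obtain X where "X \<in> N" "(g \<in> X) \<noteq> (h \<in> X)" by blast
          then show ?thesis using 3 by (intro bexI[of _ X]) (auto simp: mem_toggle)
        qed
      qed
      then show "\<exists>X\<in>toggle {e} ` N. (g \<in> X) \<noteq> (h \<in> X)" by blast
    qed
    show "int (Suc k) = polytope_rank (poly_of (toggle {e} ` N)) + 1 -
      (if is_facet (zero_face e (poly_of (toggle {e} ` N))) (poly_of (toggle {e} ` N)) then 1 else 0)"
      using nz rank_toggle[OF E] N by simp
  qed
qed

subsection \<open>Systems given by a partition into classes\<close>

text \<open>A member is a partial transversal of the classes whose set of labels is allowed by T.
  Elements with the same label are interchangeable, so up to renaming the system depends only on T
  and the class sizes.\<close>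

definition class_system :: "'e set \<Rightarrow> ('e \<Rightarrow> nat) \<Rightarrow> nat set set \<Rightarrow> 'e set set" where
  "class_system E c T = {X. X \<subseteq> E \<and> inj_on c X \<and> c ` X \<in> T}"

abbreviation cls :: "'e set \<Rightarrow> ('e \<Rightarrow> nat) \<Rightarrow> nat \<Rightarrow> 'e set" where
  "cls E c i \<equiv> {x \<in> E. c x = i}"

lemma class_system_cong:
  assumes "\<And>x. x \<in> E \<Longrightarrow> c x = c' x"
  shows "class_system E c T = class_system E c' T"
proof -
  have "inj_on c X = inj_on c' X \<and> c ` X = c' ` X" if "X \<subseteq> E" for X
    using that assms by (intro conjI inj_on_cong image_cong) auto
  then show ?thesis unfolding class_system_def by (intro Collect_cong) auto
qed

lemma class_system_relabel:
  assumes \<tau>: "inj_on \<tau> L" and c: "c ` E \<subseteq> L" and T: "\<Union>T \<subseteq> L"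
  shows "class_system E (\<tau> \<circ> c) ((`) \<tau> ` T) = class_system E c T"
proof -
  have "inj_on (\<tau> \<circ> c) X = inj_on c X \<and> ((\<tau> \<circ> c) ` X \<in> (`) \<tau> ` T) = (c ` X \<in> T)" if "X \<subseteq> E" for X
  proof
    have cX: "c ` X \<subseteq> L" using that c by blast
    show "inj_on (\<tau> \<circ> c) X = inj_on c X"
      using comp_inj_on[OF _ inj_on_subset[OF \<tau> cX]] inj_on_imageI2[of \<tau> c X] by auto
    have eq: "\<tau> ` c ` X = \<tau> ` t \<longleftrightarrow> c ` X = t" if t: "t \<in> T" for t
    proof -
      have "t \<subseteq> L" using t T by blast
      then show ?thesis by (rule inj_on_image_eq_iff[OF \<tau> cX])
    qed
    have "(\<tau> \<circ> c) ` X \<in> (`) \<tau> ` T \<longleftrightarrow> (\<exists>t\<in>T. \<tau> ` c ` X = \<tau> ` t)" by (auto simp: image_comp)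
    also have "\<dots> \<longleftrightarrow> (\<exists>t\<in>T. c ` X = t)" by (intro bex_cong refl eq)
    finally show "((\<tau> \<circ> c) ` X \<in> (`) \<tau> ` T) = (c ` X \<in> T)" by simp
  qed
  then show ?thesis unfolding class_system_def by (intro Collect_cong) auto
qed

text \<open>A member containing f contains no other element of its class, so exchanging f for e
  leads to a member of the smaller system, and conversely.\<close>

lemma par_ext_class_system:
  assumes e: "e \<in> E" and f: "f \<notin> E" and c: "c f = c e"
  shows "par_ext e f (class_system E c T) = class_system (insert f E) c T"
proof (rule set_eqI)
  fix Y
  show "Y \<in> par_ext e f (class_system E c T) \<longleftrightarrow> Y \<in> class_system (insert f E) c T"
  proof
    assume "Y \<in> par_ext e f (class_system E c T)"
    then consider "Y \<in> class_system E c T" | X where "X \<in> class_system E c T" "e \<in> X" "Y = insert f (X - {e})"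
      by (auto simp: par_ext_def)
    then show "Y \<in> class_system (insert f E) c T"
    proof cases
      case 2
      then have X: "X \<subseteq> E" "inj_on c X" "c ` X \<in> T" by (auto simp: class_system_def)
      have XI: "insert e (X - {e}) = X" using 2(2) by blast
      have "c e \<notin> c ` (X - {e})" using X(2) 2(2) by (auto simp: inj_on_def)
      moreover have "inj_on c (X - {e})" using X(2) by (rule inj_on_subset) auto
      ultimately have "inj_on c Y" using c 2(3) by (auto simp: inj_on_insert)
      moreover have "c ` Y = c ` insert e (X - {e})" unfolding 2(3) by (simp only: image_insert c)
      then have "c ` Y = c ` X" unfolding XI .
      ultimately show ?thesis using X 2(3) unfolding class_system_def by auto
    qed (auto simp: class_system_def)
  next
    assume Y: "Y \<in> class_system (insert f E) c T"
    show "Y \<in> par_ext e f (class_system E c T)"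
    proof (cases "f \<in> Y")
      case True
      define X where "X = insert e (Y - {f})"
      have inj: "inj_on c Y" using Y by (simp add: class_system_def)
      have eY: "e \<notin> Y" using inj True c e f by (auto simp: inj_on_def)
      have YI: "insert f (Y - {f}) = Y" using True by blast
      have "c ` X = c ` insert f (Y - {f})" unfolding X_def by (simp only: image_insert c)
      then have "c ` X = c ` Y" unfolding YI .
      moreover have "c f \<notin> c ` (Y - {f})" using inj True by (auto simp: inj_on_def)
      then have "inj_on c X" using inj c unfolding X_def inj_on_insert by (auto intro: inj_on_subset)
      ultimately have "X \<in> class_system E c T" using Y e unfolding class_system_def X_def by auto
      moreover have "Y = insert f (X - {e})" using eY True by (auto simp: X_def)
      moreover have "e \<in> X" by (simp add: X_def)
      ultimately show ?thesis unfolding par_ext_def by blast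
    next
      case False
      then show ?thesis using Y unfolding par_ext_def class_system_def by auto
    qed
  qed
qed

lemma mem_series_ext:
  "Y \<in> par_ext e f (toggle {e} ` N) \<longleftrightarrow>
    (\<exists>X\<in>N. if e \<in> X then Y = X - {e} else Y = insert e X \<or> Y = insert f X)"
proof -
  have t: "toggle {e} X = (if e \<in> X then X - {e} else insert e X)" for X by (auto simp: toggle_def)
  have "Y \<in> par_ext e f (toggle {e} ` N) \<longleftrightarrow>
    (\<exists>X\<in>N. Y = toggle {e} X \<or> e \<in> toggle {e} X \<and> Y = insert f (toggle {e} X - {e}))"
    unfolding par_ext_def by blast
  also have "\<dots> \<longleftrightarrow> (\<exists>X\<in>N. if e \<in> X then Y = X - {e} else Y = insert e X \<or> Y = insert f X)"
    by (intro bex_cong refl) (simp add: t)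
  finally show ?thesis .
qed

text \<open>Reflecting and doubling e puts e and f into a new class j. A member without e gains e or
  f, hence the label j; a member with e loses it, hence the label i.\<close>

definition series_types :: "nat \<Rightarrow> nat \<Rightarrow> nat set set \<Rightarrow> nat set set" where
  "series_types i j T = insert j ` T \<union> (\<lambda>t. t - {i}) ` (T \<inter> {t. i \<in> t})"

text \<open>Since e and f share the fresh label j, a member of the new system contains at most one
  of them. With neither, it arises from an old member by removing e; otherwise removing the one it
  contains gives an old member.\<close>

lemma series_class_system:
  assumes e: "e \<in> E" and f: "f \<notin> E" and j: "j \<notin> c ` E" "j \<notin> \<Union>T"
  shows "par_ext e f (toggle {e} ` class_system E c T)
    = class_system (insert f E) (c(e := j, f := j)) (series_types (c e) j T)"
proof -
  define c' where "c' = c(e := j, f := j)"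
  have c'e: "c' e = j" "c' f = j" and c'x: "\<And>x. x \<noteq> e \<Longrightarrow> x \<noteq> f \<Longrightarrow> c' x = c x"
    by (auto simp: c'_def)
  have im: "c' ` X = c ` X" "inj_on c' X = inj_on c X" if X: "e \<notin> X" "f \<notin> X" for X
  proof -
    have eq: "c' x = c x" if "x \<in> X" for x using that X by (intro c'x) auto
    show "c' ` X = c ` X" by (rule image_cong[OF refl eq])
    show "inj_on c' X = inj_on c X" by (rule inj_on_cong[OF eq])
  qed
  have ins: "c' ` insert x X = insert j (c ` X)" "inj_on c' (insert x X) = inj_on c X"
    if "e \<notin> X" "f \<notin> X" "x = e \<or> x = f" "X \<subseteq> E" for x X
  proof -
    have x: "c' x = j" using that(3) c'e by auto
    then show "c' ` insert x X = insert j (c ` X)" using im(1)[OF that(1,2)] by (simp add: image_insert)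
    have "j \<notin> c ` X" using j(1) that(4) by blast
    moreover have "x \<notin> X" using that(1-3) by blast
    moreover have "X - {x} = X" using that(1-3) by blast
    ultimately show "inj_on c' (insert x X) = inj_on c X"
      unfolding inj_on_insert x using im[OF that(1,2)] by simp
  qed
  have "Y \<in> par_ext e f (toggle {e} ` class_system E c T) \<longleftrightarrow>
    Y \<in> class_system (insert f E) c' (series_types (c e) j T)" for Y
  proof
    assume "Y \<in> par_ext e f (toggle {e} ` class_system E c T)"
    then obtain X where X: "X \<subseteq> E" "inj_on c X" "c ` X \<in> T"
      "if e \<in> X then Y = X - {e} else Y = insert e X \<or> Y = insert f X"
      unfolding mem_series_ext class_system_def by blast
    have fX: "f \<notin> X" using X(1) f by blast
    show "Y \<in> class_system (insert f E) c' (series_types (c e) j T)"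
    proof (cases "e \<in> X")
      case True
      then have Y: "Y = X - {e}" using X by simp
      have n: "e \<notin> Y" "f \<notin> Y" using Y fX by auto
      have "c ` Y = c ` X - {c e}" using X(2) True unfolding Y by (auto simp: inj_on_def)
      then have "c ` Y \<in> series_types (c e) j T" using X(3) True unfolding series_types_def by blast
      moreover have "inj_on c Y" using X(2) unfolding Y by (rule inj_on_subset) auto
      ultimately show ?thesis unfolding class_system_def using im[OF n] Y X(1) by auto
    next
      case False
      then obtain x where x: "x = e \<or> x = f" "Y = insert x X" using X(4) by auto
      have "insert j (c ` X) \<in> series_types (c e) j T" using X(3) unfolding series_types_def by blast
      then show ?thesis unfolding class_system_def x(2) using ins[OF False fX x(1) X(1)] X(1,2) x(1) e
        by auto
    qed
  next
    assume "Y \<in> class_system (insert f E) c' (series_types (c e) j T)"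
    then have Y: "Y \<subseteq> insert f E" "inj_on c' Y" "c' ` Y \<in> series_types (c e) j T"
      by (auto simp: class_system_def)
    show "Y \<in> par_ext e f (toggle {e} ` class_system E c T)"
    proof (cases "e \<notin> Y \<and> f \<notin> Y")
      case True
      then have n: "e \<notin> Y" "f \<notin> Y" by auto
      have "j \<notin> c ` Y" using j Y(1) n by auto
      moreover have "c ` Y \<in> series_types (c e) j T" using Y(3) im(1)[OF n] by simp
      ultimately obtain t where t: "t \<in> T" "c e \<in> t" "c ` Y = t - {c e}"
        unfolding series_types_def by auto
      have "c ` insert e Y = t" "inj_on c (insert e Y)"
        using t Y(2) im(2)[OF n] n by auto
      then have "insert e Y \<in> class_system E c T" using t e Y(1) n unfolding class_system_def by auto
      then show ?thesis unfolding mem_series_ext using n by (intro bexI[of _ "insert e Y"]) auto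
    next
      case False
      then obtain x where x: "x = e \<or> x = f" "x \<in> Y" by blast
      define X where "X = Y - {x}"
      have YX: "Y = insert x X" using x by (auto simp: X_def)
      have n: "e \<notin> X" "f \<notin> X"
        using inj_onD[OF Y(2), of x e] inj_onD[OF Y(2), of x f] x c'e unfolding X_def by auto
      have XE: "X \<subseteq> E" using n Y(1) unfolding X_def by blast
      note i = ins[OF n x(1) XE]
      have "insert j (c ` X) \<in> series_types (c e) j T" using Y(3) i unfolding YX by simp
      then consider t where "t \<in> T" "insert j (c ` X) = insert j t" | t where "t \<in> T" "insert j (c ` X) = t - {c e}"
        unfolding series_types_def by blast
      then have "c ` X \<in> T"
      proof cases
        case 1
        have "j \<notin> c ` X" "j \<notin> t" using j XE 1(1) by auto
        then have "c ` X = t" using 1(2) by (simp add: insert_ident)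
        then show ?thesis using 1(1) by simp
      next
        case 2
        then show ?thesis using j(2) by blast
      qed
      moreover have "inj_on c X" using Y(2) i unfolding YX by simp
      ultimately have "X \<in> class_system E c T" using XE by (simp add: class_system_def)
      then show ?thesis unfolding mem_series_ext using n x(1) YX by (intro bexI[of _ X]) auto
    qed
  qed
  then show ?thesis unfolding c'_def by (rule set_eqI)
qed

text \<open>The series-parallel systems of rank at most 3 fall into five families, distinguished by the
  label sets \<open>T\<close> with labels below 4; \<open>n i\<close> is the number of elements with label \<open>i\<close>. Up to toggling
  they come from $\mathcal{A}$, $\mathcal{B}_{s,p}$, $\mathcal{B}_{s_1,s_2,p}$,
  $\mathcal{B}_{s_1,s_2,s_3,p}$ (or $\mathcal{D}$ if \<open>n 3 = 0\<close>) and $\mathcal{C}$, respectively.\<close>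

definition shaped :: "nat \<Rightarrow> nat set set \<Rightarrow> (nat \<Rightarrow> nat) \<Rightarrow> bool" where
  "shaped k T n \<longleftrightarrow>
    (k = 0 \<and> T = {{0}} \<and> n 0 \<ge> 3 \<and> n 1 = 0 \<and> n 2 = 0 \<and> n 3 = 0) \<or>
    (k = 1 \<and> T = {{}, {0, 1}} \<and> n 0 \<ge> 2 \<and> n 1 \<ge> 2 \<and> n 2 = 0 \<and> n 3 = 0) \<or>
    (k = 2 \<and> T = {{0}, {1}, {0, 1, 2}} \<and> n 0 \<ge> 2 \<and> n 1 \<ge> 2 \<and> n 2 \<ge> 1 \<and> n 3 = 0) \<or>
    (k = 3 \<and> T = {{0, 1}, {0, 2}, {1, 2}, {0, 1, 2, 3}} \<and> n 0 \<ge> 2 \<and> n 1 \<ge> 2 \<and> n 2 \<ge> 2) \<or>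
    (k = 3 \<and> T = {{}, {0, 1}, {2, 3}, {0, 1, 2, 3}, {0, 3}} \<and> n 0 \<ge> 2 \<and> n 1 \<ge> 1 \<and> n 2 \<ge> 1 \<and> n 3 \<ge> 2)"

lemma shaped_Suc:
  "k = 0 \<Longrightarrow> n 0 \<ge> 2 \<Longrightarrow> n 1 \<ge> 2 \<Longrightarrow> n 2 = 0 \<Longrightarrow> n 3 = 0 \<Longrightarrow> shaped (Suc k) {{}, {0, 1}} n"
  "k = 1 \<Longrightarrow> n 0 \<ge> 2 \<Longrightarrow> n 1 \<ge> 2 \<Longrightarrow> n 2 \<ge> 1 \<Longrightarrow> n 3 = 0 \<Longrightarrow> shaped (Suc k) {{0}, {1}, {0, 1, 2}} n"
  "k = 2 \<Longrightarrow> n 0 \<ge> 2 \<Longrightarrow> n 1 \<ge> 2 \<Longrightarrow> n 2 \<ge> 2 \<Longrightarrow>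
    shaped (Suc k) {{0, 1}, {0, 2}, {1, 2}, {0, 1, 2, 3}} n"
  "k = 2 \<Longrightarrow> n 0 \<ge> 2 \<Longrightarrow> n 1 \<ge> 1 \<Longrightarrow> n 2 \<ge> 1 \<Longrightarrow> n 3 \<ge> 2 \<Longrightarrow>
    shaped (Suc k) {{}, {0, 1}, {2, 3}, {0, 1, 2, 3}, {0, 3}} n"
  by (simp_all add: shaped_def)

lemma shaped_labels: "shaped k T n \<Longrightarrow> \<Union>T \<subseteq> {..<4}"
  unfolding shaped_def by (elim disjE conjE) auto

text \<open>The new class gets the spare label 4, and n lists the resulting sizes: two in the new
  class, one fewer in the class of e. The permutation \<tau> with inverse \<sigma> renames the five
  labels; \<open>n (\<sigma> 4) = 0\<close> says that the label renamed to 4 is empty, so labels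
  below 4 suffice again.\<close>

lemma series_relabel:
  fixes \<tau> \<sigma> :: "nat \<Rightarrow> nat"
  assumes E: "finite E" "e \<in> E" "f \<notin> E" and c: "c ` E \<subseteq> {..<4}" and T: "\<Union>T \<subseteq> {..<4}"
    and perm: "\<forall>k<5. \<tau> k < 5 \<and> \<sigma> k < 5 \<and> \<tau> (\<sigma> k) = k \<and> \<sigma> (\<tau> k) = k"
    and n: "n = (\<lambda>k. if k = 4 then 2 else card (cls E c k) - (if k = c e then 1 else 0))" "n (\<sigma> 4) = 0"
  shows "\<exists>c'. c' ` insert f E \<subseteq> {..<4} \<and> (\<forall>k<4. card (cls (insert f E) c' k) = n (\<sigma> k)) \<and>
    par_ext e f (toggle {e} ` class_system E c T)
      = class_system (insert f E) c' ((`) \<tau> ` series_types (c e) 4 T)"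
proof -
  let ?E = "insert f E" and ?c = "c(e := 4, f := 4)"
  have c5: "?c x < 5" if "x \<in> ?E" for x using that c by force
  have cE: "c x < 4" if "x \<in> E" for x using that c by auto
  have ne: "e \<noteq> f" using E by auto
  have card: "card (cls ?E ?c m) = n m" for m
  proof (cases "m = 4")
    case True
    then have "cls ?E ?c m = {e, f}" using cE E by force
    then show ?thesis using True n ne by simp
  next
    case False
    then have "cls ?E ?c m = cls E c m - {e}" using E by auto
    then show ?thesis using False n E by (simp add: card_Diff_singleton_if)
  qed
  have sw: "cls ?E (\<tau> \<circ> ?c) k = cls ?E ?c (\<sigma> k)" if "k < 5" for k
    using perm c5 that by (auto simp del: fun_upd_apply)
  have card': "card (cls ?E (\<tau> \<circ> ?c) k) = n (\<sigma> k)" if "k < 5" for k using sw[OF that] card by simp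
  have "card (cls ?E (\<tau> \<circ> ?c) 4) = 0" using card'[of 4] n(2) by simp
  then have "cls ?E (\<tau> \<circ> ?c) 4 = {}" using E(1) by (simp del: comp_apply fun_upd_apply)
  then have "(\<tau> \<circ> ?c) x \<noteq> 4" if "x \<in> ?E" for x using that by blast
  moreover have "(\<tau> \<circ> ?c) x < 5" if "x \<in> ?E" for x using c5[OF that] perm by simp
  ultimately have sub: "(\<tau> \<circ> ?c) ` ?E \<subseteq> {..<4}" by (force simp del: comp_apply fun_upd_apply)
  have inj: "inj_on \<tau> {..<5}" by (rule inj_on_inverseI[where g = \<sigma>]) (use perm in auto)
  have U: "\<Union>(series_types (c e) 4 T) \<subseteq> {..<5}" using T by (fastforce simp: series_types_def)
  have "4 \<notin> c ` E" "4 \<notin> \<Union>T" using c T by auto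
  note ser = series_class_system[OF E(2,3) this]
  have "par_ext e f (toggle {e} ` class_system E c T)
      = class_system ?E (\<tau> \<circ> ?c) ((`) \<tau> ` series_types (c e) 4 T)"
    unfolding ser using class_system_relabel[OF inj _ U] c5 by (metis image_subsetI lessThan_iff)
  then show ?thesis using sub card' by (intro exI[of _ "\<tau> \<circ> ?c"]) (simp del: comp_apply fun_upd_apply)
qed

lemma less_5: "(\<forall>k<5. P k) \<longleftrightarrow> P 0 \<and> P 1 \<and> P 2 \<and> P 3 \<and> P (4::nat)"
  by (auto simp: numeral_eq_Suc All_less_Suc)

text \<open>A parallel step enlarges a nonempty class and keeps the shape. For a series step, k and
  the label of e leave finitely many cases; the explicit lists are the permutation that brings the
  new label sets to the listed form and its inverse.\<close>

lemma sp_system_shape: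
  assumes "sp_system k E N" "k \<le> 3"
  shows "\<exists>c T. c ` E \<subseteq> {..<4} \<and> shaped k T (\<lambda>i. card (cls E c i)) \<and> N = class_system E c T"
  using assms
proof (induction rule: sp_system.induct)
  case (triangle x y z)
  have "{{x}, {y}, {z}} = class_system {x, y, z} (\<lambda>_. 0) {{0}}"
  proof
    show "{{x}, {y}, {z}} \<subseteq> class_system {x, y, z} (\<lambda>_. 0) {{0}}" by (auto simp: class_system_def)
    show "class_system {x, y, z} (\<lambda>_. 0) {{0}} \<subseteq> {{x}, {y}, {z}}"
    proof
      fix X assume "X \<in> class_system {x, y, z} (\<lambda>_. 0) {{0}}"
      then have X: "X \<subseteq> {x, y, z}" "inj_on (\<lambda>_. 0::nat) X" "(\<lambda>_. 0::nat) ` X = {0}"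
        by (auto simp: class_system_def)
      then obtain w where "w \<in> X" by blast
      with X(2) have "X = {w}" by (auto simp: inj_on_def)
      then show "X \<in> {{x}, {y}, {z}}" using X(1) by auto
    qed
  qed
  moreover have "cls {x, y, z} (\<lambda>_. 0) 0 = {x, y, z}" by auto
  ultimately show ?case using triangle(1-3)
    by (intro exI[of _ "\<lambda>_. 0"] exI[of _ "{{0}}"]) (simp add: shaped_def)
next
  case (parallel k E N e f)
  then obtain c T where c: "c ` E \<subseteq> {..<4}" "shaped k T (\<lambda>i. card (cls E c i))" "N = class_system E c T" by blast
  have fin: "finite E" using sp_system_normal[OF parallel.hyps(1)] by (simp add: normal_def)
  let ?c = "c(f := c e)"
  have ce: "?c x = c x" if "x \<in> E" for x using that parallel.hyps by auto
  have "N = class_system E ?c T" unfolding c(3) by (intro class_system_cong) (simp only: ce)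
  then have N: "par_ext e f N = class_system (insert f E) ?c T"
    using par_ext_class_system[OF parallel.hyps(2,3), of ?c T] parallel.hyps(2,3) by auto
  have cl: "cls (insert f E) ?c i = (if i = c e then insert f (cls E c i) else cls E c i)" for i
    using parallel.hyps by auto
  have card: "card (cls (insert f E) ?c i) = card (cls E c i) + (if i = c e then 1 else 0)" for i
    unfolding cl using fin parallel.hyps by simp
  have "e \<in> cls E c (c e)" using parallel.hyps by simp
  then have pos: "card (cls E c (c e)) \<noteq> 0" using fin by auto
  have "shaped k T (\<lambda>i. card (cls (insert f E) ?c i))"
    using c(2) pos unfolding card shaped_def by (elim disjE conjE) (auto split: if_splits)
  moreover have "?c ` insert f E \<subseteq> {..<4}" using c(1) parallel.hyps by auto
  ultimately show ?case using N by blast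
next
  case (series k E N e f)
  then obtain c T where c: "c ` E \<subseteq> {..<4}" "shaped k T (\<lambda>i. card (cls E c i))" "N = class_system E c T" by auto
  have fin: "finite E" using sp_system_normal[OF series.hyps(1)] by (simp add: normal_def)
  have ce4: "c e < 4" using c(1) series.hyps(2) by auto
  define n where "n = (\<lambda>k. if k = 4 then 2 else card (cls E c k) - (if k = c e then 1 else 0))"
  have "e \<in> cls E c (c e)" using series.hyps by simp
  then have pos: "card (cls E c (c e)) \<noteq> 0" using fin by auto
  have key: ?case
    if perm: "\<forall>k<5. \<tau> k < 5 \<and> \<sigma> k < 5 \<and> \<tau> (\<sigma> k) = k \<and> \<sigma> (\<tau> k) = k" and n0: "n (\<sigma> 4) = 0"
      and T': "(`) \<tau> ` series_types (c e) 4 T = T'" and sh: "shaped (Suc k) T' (\<lambda>i. n (\<sigma> i))" for \<tau> \<sigma> T'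
  proof -
    obtain c' where c': "c' ` insert f E \<subseteq> {..<4}" "\<forall>k<4. card (cls (insert f E) c' k) = n (\<sigma> k)"
      "par_ext e f (toggle {e} ` N) = class_system (insert f E) c' ((`) \<tau> ` series_types (c e) 4 T)"
      using series_relabel[OF fin series.hyps(2,3) c(1) shaped_labels[OF c(2)] perm n_def n0] c(3) by blast
    have "shaped (Suc k) T' (\<lambda>i. card (cls (insert f E) c' i))"
      using sh c'(2) unfolding shaped_def by simp
    then show ?thesis using c'(1,3) T' by blast
  qed
  have cases4: "c e = 0 \<or> c e = 1 \<or> c e = 2 \<or> c e = 3" using ce4 by linarith
  consider "k = 0" | "k = 1" | "k = 2" using series.prems by linarith
  then show ?case
  proof cases
    case 1
    then have ce: "c e = 0" and T: "T = {{0}}" using c(2) pos cases4 by (auto simp: shaped_def)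
    have sz: "3 \<le> card (cls E c 0)" "card (cls E c 1) = 0" "card (cls E c 2) = 0" "card (cls E c 3) = 0"
      using c(2) 1 by (simp_all add: shaped_def)
    show ?thesis
    proof (rule key)
      show "(`) ((!) [0,4,2,3,1]) ` series_types (c e) 4 T = {{}, {0, 1}}"
        unfolding T ce by (simp add: series_types_def Int_insert_left insert_Diff_if, simp add: insert_commute)
      show "\<forall>k<5. [0,4,2,3,1] ! k < (5::nat) \<and> [0,4,2,3,1] ! k < (5::nat) \<and>
        [0,4,2,3,1] ! ([0,4,2,3,1] ! k) = k \<and> [0,4,2,3,1] ! ([0,4,2,3,1] ! k) = k"
        unfolding less_5 by simp
    qed (use sz 1 ce in \<open>simp add: n_def\<close>, rule shaped_Suc, use sz 1 ce in \<open>auto simp: n_def\<close>)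
  next
    case 2
    then have T: "T = {{}, {0, 1}}" and ce: "c e = 0 \<or> c e = 1" using c(2) pos cases4 by (auto simp: shaped_def)
    have sz: "2 \<le> card (cls E c 0)" "2 \<le> card (cls E c 1)" "card (cls E c 2) = 0" "card (cls E c 3) = 0"
      using c(2) 2 by (simp_all add: shaped_def)
    from ce show ?thesis
    proof
      assume ce: "c e = 0"
      show ?thesis
      proof (rule key)
        show "(`) ((!) [2,1,4,3,0]) ` series_types (c e) 4 T = {{0}, {1}, {0, 1, 2}}"
          unfolding T ce by (simp add: series_types_def Int_insert_left insert_Diff_if, simp add: insert_commute)
        show "\<forall>k<5. [2,1,4,3,0] ! k < (5::nat) \<and> [4,1,0,3,2] ! k < (5::nat) \<and>
          [2,1,4,3,0] ! ([4,1,0,3,2] ! k) = k \<and> [4,1,0,3,2] ! ([2,1,4,3,0] ! k) = k"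
          unfolding less_5 by simp
      qed (use sz 2 ce in \<open>simp add: n_def\<close>, rule shaped_Suc, use sz 2 ce in \<open>auto simp: n_def\<close>)
    next
      assume ce: "c e = 1"
      show ?thesis
      proof (rule key)
        show "(`) ((!) [0,2,4,3,1]) ` series_types (c e) 4 T = {{0}, {1}, {0, 1, 2}}"
          unfolding T ce by (simp add: series_types_def Int_insert_left insert_Diff_if, simp add: insert_commute)
        show "\<forall>k<5. [0,2,4,3,1] ! k < (5::nat) \<and> [0,4,1,3,2] ! k < (5::nat) \<and>
          [0,2,4,3,1] ! ([0,4,1,3,2] ! k) = k \<and> [0,4,1,3,2] ! ([0,2,4,3,1] ! k) = k"
          unfolding less_5 by simp
      qed (use sz 2 ce in \<open>simp add: n_def\<close>, rule shaped_Suc, use sz 2 ce in \<open>auto simp: n_def\<close>)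
    qed
  next
    case 3
    then have T: "T = {{0}, {1}, {0, 1, 2}}" and ce: "c e = 0 \<or> c e = 1 \<or> c e = 2"
      using c(2) pos cases4 by (auto simp: shaped_def)
    have sz: "2 \<le> card (cls E c 0)" "2 \<le> card (cls E c 1)" "1 \<le> card (cls E c 2)" "card (cls E c 3) = 0"
      using c(2) 3 by (simp_all add: shaped_def)
    \<comment> \<open>A series step at label 0 or 1 leads to the fifth family, at label 2 to the
      fourth.\<close>
    from ce show ?thesis
    proof (elim disjE)
      assume ce: "c e = 0"
      show ?thesis
      proof (rule key)
        show "(`) ((!) [1,3,2,4,0]) ` series_types (c e) 4 T = {{}, {0, 1}, {2, 3}, {0, 1, 2, 3}, {0, 3}}"
          unfolding T ce by (simp add: series_types_def Int_insert_left insert_Diff_if, simp add: insert_commute)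
        show "\<forall>k<5. [1,3,2,4,0] ! k < (5::nat) \<and> [4,0,2,1,3] ! k < (5::nat) \<and>
          [1,3,2,4,0] ! ([4,0,2,1,3] ! k) = k \<and> [4,0,2,1,3] ! ([1,3,2,4,0] ! k) = k"
          unfolding less_5 by simp
      qed (use sz 3 ce in \<open>simp add: n_def\<close>, rule shaped_Suc, use sz 3 ce in \<open>auto simp: n_def\<close>)
    next
      assume ce: "c e = 1"
      show ?thesis
      proof (rule key)
        show "(`) ((!) [3,1,2,4,0]) ` series_types (c e) 4 T = {{}, {0, 1}, {2, 3}, {0, 1, 2, 3}, {0, 3}}"
          unfolding T ce by (simp add: series_types_def Int_insert_left insert_Diff_if, simp add: insert_commute)
        show "\<forall>k<5. [3,1,2,4,0] ! k < (5::nat) \<and> [4,1,2,0,3] ! k < (5::nat) \<and>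
          [3,1,2,4,0] ! ([4,1,2,0,3] ! k) = k \<and> [4,1,2,0,3] ! ([3,1,2,4,0] ! k) = k"
          unfolding less_5 by simp
      qed (use sz 3 ce in \<open>simp add: n_def\<close>, rule shaped_Suc, use sz 3 ce in \<open>auto simp: n_def\<close>)
    next
      \<comment> \<open>The old class 2 becomes class 3 with one element fewer and may now be empty;
        this is where the graphs D come from.\<close>
      assume ce: "c e = 2"
      show ?thesis
      proof (rule key)
        show "(`) ((!) [0,1,3,4,2]) ` series_types (c e) 4 T = {{0, 1}, {0, 2}, {1, 2}, {0, 1, 2, 3}}"
          unfolding T ce by (simp add: series_types_def Int_insert_left insert_Diff_if, simp add: insert_commute)
        show "\<forall>k<5. [0,1,3,4,2] ! k < (5::nat) \<and> [0,1,4,2,3] ! k < (5::nat) \<and>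
          [0,1,3,4,2] ! ([0,1,4,2,3] ! k) = k \<and> [0,1,4,2,3] ! ([0,1,3,4,2] ! k) = k"
          unfolding less_5 by simp
      qed (use sz 3 ce in \<open>simp add: n_def\<close>, rule shaped_Suc, use sz 3 ce in \<open>auto simp: n_def\<close>)
    qed
  qed
qed

text \<open>For the converse, that every shape occurs: elements of a class beyond the number m are
  added by parallel steps, so only classes of size m need a construction.\<close>

lemma sp_grow:
  assumes "finite A" "m \<ge> 1" "card A \<ge> m" "A \<inter> E0 = {}" "\<And>x. x \<in> A \<Longrightarrow> c x = i"
    and "\<And>A'. A' \<subseteq> A \<Longrightarrow> card A' = m \<Longrightarrow> sp_system k (E0 \<union> A') (class_system (E0 \<union> A') c T)"
  shows "sp_system k (E0 \<union> A) (class_system (E0 \<union> A) c T)"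
  using assms
proof (induction A rule: finite_psubset_induct)
  case (psubset A)
  show ?case
  proof (cases "card A = m")
    case False
    then have "card A \<ge> 2" using psubset.prems by linarith
    then obtain e f where ef: "e \<in> A" "f \<in> A" "e \<noteq> f"
      by (metis card_le_Suc0_iff_eq not_less_eq_eq numeral_2_eq_2 psubset.hyps(1))
    have "sp_system k (E0 \<union> (A - {f})) (class_system (E0 \<union> (A - {f})) c T)"
    proof (rule psubset.IH)
      show "A - {f} \<subset> A" using ef by blast
      show "m \<le> card (A - {f})" using False psubset.prems(2) ef psubset.hyps by simp
      show "sp_system k (E0 \<union> A') (class_system (E0 \<union> A') c T)" if "A' \<subseteq> A - {f}" "card A' = m" for A'
        using that by (intro psubset.prems(5)) auto
    qed (use psubset.prems(1,3,4) in auto)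
    then have "sp_system k (insert f (E0 \<union> (A - {f}))) (par_ext e f (class_system (E0 \<union> (A - {f})) c T))"
      by (rule sp_system.parallel) (use ef psubset.prems(3) in auto)
    moreover have "par_ext e f (class_system (E0 \<union> (A - {f})) c T)
        = class_system (insert f (E0 \<union> (A - {f}))) c T"
      by (rule par_ext_class_system) (use ef psubset.prems in auto)
    moreover have "insert f (E0 \<union> (A - {f})) = E0 \<union> A" using ef by blast
    ultimately show ?thesis by simp
  qed (use psubset.prems in simp)
qed

text \<open>Undoes a series step: the pair {e, f} forming class j is dissolved by returning e to
  class i and deleting f.\<close>

lemma sp_series_class:
  assumes A: "cls E c j = {e, f}" "e \<noteq> f" and i: "i \<noteq> j" "j \<notin> \<Union>T"
    and sp: "sp_system k (E - {f}) (class_system (E - {f}) (c(e := i)) T)"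
  shows "sp_system (Suc k) E (class_system E c (series_types i j T))"
proof -
  let ?c = "c(e := i)"
  have ef: "e \<in> E" "f \<in> E" "c e = j" "c f = j" using A(1) by auto
  have "j \<notin> ?c ` (E - {f})" using A i ef by auto
  then have "par_ext e f (toggle {e} ` class_system (E - {f}) ?c T)
      = class_system (insert f (E - {f})) (?c(e := j, f := j)) (series_types (?c e) j T)"
    using ef A(2) i(2) by (intro series_class_system) auto
  moreover have "?c(e := j, f := j) = c" using ef by (auto simp: fun_eq_iff)
  moreover have "insert f (E - {f}) = E" using ef by blast
  moreover have "sp_system (Suc k) (insert f (E - {f})) (par_ext e f (toggle {e} ` class_system (E - {f}) ?c T))"
    using sp by (rule sp_system.series) (use ef A(2) in auto)
  ultimately show ?thesis by simp
qed

lemma cls_split: "E = (E - cls E c i) \<union> cls E c i"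
  by auto

lemma sp_grow_class:
  assumes "finite E" "card (cls E c i) \<ge> 2"
    and step: "\<And>E'. finite E' \<Longrightarrow> card (cls E' c i) = 2 \<Longrightarrow>
      (\<And>j. j \<noteq> i \<Longrightarrow> cls E' c j = cls E c j) \<Longrightarrow> E' \<subseteq> E \<Longrightarrow> sp_system k E' (class_system E' c T)"
  shows "sp_system k E (class_system E c T)"
proof (subst (1 2) cls_split[of E c i], rule sp_grow[where m = 2 and i = i])
  fix A' assume A': "A' \<subseteq> cls E c i" "card A' = 2"
  let ?E = "(E - cls E c i) \<union> A'"
  have "cls ?E c i = A'" using A' by auto
  moreover have "cls ?E c j = cls E c j" if "j \<noteq> i" for j using A' that by auto
  ultimately show "sp_system k ?E (class_system ?E c T)" using A' assms(1)
    by (intro step) (auto intro: finite_subset)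
qed (use assms in auto)

lemma card_2_elems:
  assumes "card A = 2" obtains e f where "A = {e, f}" "e \<noteq> f"
  using assms by (auto simp: card_2_iff)

lemma sp_types_0:
  assumes "finite E" "card E \<ge> 3" "c ` E \<subseteq> {a}"
  shows "sp_system 0 E (class_system E c {{a}})"
proof -
  have "sp_system 0 ({} \<union> E) (class_system ({} \<union> E) c {{a}})"
  proof (rule sp_grow[where m = 3 and i = a])
    fix A assume A: "A \<subseteq> E" "card A = 3"
    then obtain x y z where xyz: "A = {x, y, z}" "x \<noteq> y" "x \<noteq> z" "y \<noteq> z"
      by (auto simp: card_3_iff)
    have ca: "c v = a" if "v \<in> A" for v using that A assms(3) by auto
    have "class_system A c {{a}} = {{x}, {y}, {z}}"
    proof
      show "{{x}, {y}, {z}} \<subseteq> class_system A c {{a}}" using xyz ca by (auto simp: class_system_def)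
      show "class_system A c {{a}} \<subseteq> {{x}, {y}, {z}}"
      proof
        fix X assume "X \<in> class_system A c {{a}}"
        then have X: "X \<subseteq> A" "inj_on c X" "c ` X = {a}" by (auto simp: class_system_def)
        then obtain w where w: "w \<in> X" by blast
        have "v = w" if "v \<in> X" for v using inj_onD[OF X(2) _ that w] ca X(1) w that by auto
        then have "X = {w}" using w by blast
        then show "X \<in> {{x}, {y}, {z}}" using X(1) xyz by auto
      qed
    qed
    then show "sp_system 0 ({} \<union> A) (class_system ({} \<union> A) c {{a}})"
      using sp_system.triangle[OF xyz(2-4)] xyz(1) by simp
  qed (use assms in auto)
  then show ?thesis by simp
qed

lemma cls_move:
  assumes "cls E c j = {e, f}" "e \<noteq> f" "i \<noteq> j"
  shows "cls (E - {f}) (c(e := i)) m = (if m = j then {} else if m = i then insert e (cls E c i) else cls E c m)"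
  using assms by auto

lemma card_cls_move:
  assumes "finite E" "cls E c j = {e, f}" "e \<noteq> f" "i \<noteq> j"
  shows "card (cls (E - {f}) (c(e := i)) m) =
    (if m = j then 0 else if m = i then Suc (card (cls E c i)) else card (cls E c m))"
proof -
  have "e \<notin> cls E c i" using assms by auto
  then show ?thesis unfolding cls_move[OF assms(2-4)] using assms(1) by simp
qed

lemma move_image_subset:
  assumes "c ` E \<subseteq> insert j L" "cls E' c j = {e, f}" "E' \<subseteq> E" "i \<in> L"
  shows "(c(e := i)) ` (E' - {f}) \<subseteq> L"
proof
  fix v assume "v \<in> (c(e := i)) ` (E' - {f})"
  then obtain x where x: "x \<in> E'" "x \<noteq> f" "v = (c(e := i)) x" by blast
  show "v \<in> L"
  proof (cases "x = e")
    case False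
    then have "c x \<noteq> j" using x assms(2) by auto
    moreover have "c x \<in> insert j L" using assms(1,3) x by auto
    ultimately show ?thesis using x False by simp
  qed (use x assms in simp)
qed

text \<open>Class b, cut down to two elements, is undone as a series step into class a, which leaves
  a single class. The labels are variables because the next shape reduces to this one under other
  labels.\<close>

lemma sp_types_1:
  assumes "finite E" "a \<noteq> b" "c ` E \<subseteq> {a, b}" "card (cls E c a) \<ge> 2" "card (cls E c b) \<ge> 2"
  shows "sp_system 1 E (class_system E c {{}, {a, b}})"
  using assms(1,5)
proof (rule sp_grow_class)
  fix E' assume E': "finite E'" "card (cls E' c b) = 2" "\<And>j. j \<noteq> b \<Longrightarrow> cls E' c j = cls E c j" "E' \<subseteq> E"
  obtain e f where ef: "cls E' c b = {e, f}" "e \<noteq> f" using card_2_elems[OF E'(2)] .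
  note mv = card_cls_move[OF E'(1) ef assms(2)]
  have sub: "(c(e := a)) ` (E' - {f}) \<subseteq> {a}" 
    by (rule move_image_subset[OF _ ef(1) E'(4)]) (use assms(3) in auto)
  then have "cls (E' - {f}) (c(e := a)) a = E' - {f}" by auto
  then have "card (E' - {f}) \<ge> 3" using mv[of a] E'(3)[OF assms(2)] assms(2,4) by simp
  then have "sp_system 0 (E' - {f}) (class_system (E' - {f}) (c(e := a)) {{a}})"
    using sub E'(1) by (intro sp_types_0) auto
  from sp_series_class[OF ef assms(2) _ this]
  have "sp_system (Suc 0) E' (class_system E' c (series_types a b {{a}}))" using assms(2) by simp
  moreover have "series_types a b {{a}} = {{}, {a, b}}" by (auto simp: series_types_def)
  ultimately show "sp_system 1 E' (class_system E' c {{}, {a, b}})" by simp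
qed

text \<open>Undoing class a into class m leaves the rank one shape on m and b, and the returned
  element brings m to the required two.\<close>

lemma sp_types_2:
  assumes "finite E" "distinct [a, b, m]" "c ` E \<subseteq> {a, b, m}"
    and "card (cls E c a) \<ge> 2" "card (cls E c b) \<ge> 2" "card (cls E c m) \<ge> 1"
  shows "sp_system 2 E (class_system E c {{a}, {b}, {a, b, m}})"
  using assms(1,4)
proof (rule sp_grow_class)
  fix E' assume E': "finite E'" "card (cls E' c a) = 2" "\<And>j. j \<noteq> a \<Longrightarrow> cls E' c j = cls E c j" "E' \<subseteq> E"
  obtain e f where ef: "cls E' c a = {e, f}" "e \<noteq> f" using card_2_elems[OF E'(2)] .
  have d: "m \<noteq> a" "m \<noteq> b" "a \<noteq> b" "b \<noteq> a" "a \<noteq> m" "b \<noteq> m" using assms(2) by auto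
  note mv = card_cls_move[OF E'(1) ef d(1)]
  have sub: "(c(e := m)) ` (E' - {f}) \<subseteq> {m, b}"
    by (rule move_image_subset[OF _ ef(1) E'(4)]) (use assms(3) in auto)
  have "sp_system 1 (E' - {f}) (class_system (E' - {f}) (c(e := m)) {{}, {m, b}})"
    using E'(1) sub d assms(5,6) by (intro sp_types_1) (simp_all only: mv, auto simp: E'(3) d)
  from sp_series_class[OF ef d(1) _ this]
  have "sp_system (Suc 1) E' (class_system E' c (series_types m a {{}, {m, b}}))" using d by auto
  moreover have "series_types m a {{}, {m, b}} = {{a}, {b}, {a, b, m}}"
    using d by (simp add: series_types_def Int_insert_left insert_Diff_if) (simp add: insert_commute)
  ultimately show "sp_system 2 E' (class_system E' c {{a}, {b}, {a, b, m}})" by (simp add: numeral_2_eq_2)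
qed

text \<open>Undoing class d into class m leaves the rank two shape with m as third class. The
  returned element makes m nonempty, so m may be empty at the outset.\<close>

lemma sp_types_3a:
  assumes "finite E" "distinct [a, b, d, m]" "c ` E \<subseteq> {a, b, d, m}"
    and "card (cls E c a) \<ge> 2" "card (cls E c b) \<ge> 2" "card (cls E c d) \<ge> 2"
  shows "sp_system 3 E (class_system E c {{a, b}, {a, d}, {b, d}, {a, b, d, m}})"
  using assms(1,6)
proof (rule sp_grow_class)
  fix E' assume E': "finite E'" "card (cls E' c d) = 2" "\<And>j. j \<noteq> d \<Longrightarrow> cls E' c j = cls E c j" "E' \<subseteq> E"
  obtain e f where ef: "cls E' c d = {e, f}" "e \<noteq> f" using card_2_elems[OF E'(2)] .
  have d: "m \<noteq> d" "a \<noteq> d" "b \<noteq> d" "a \<noteq> b" "m \<noteq> a" "m \<noteq> b" "a \<noteq> m" "b \<noteq> m" "d \<noteq> m" "d \<noteq> a" "d \<noteq> b" "b \<noteq> a"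
    using assms(2) by auto
  note mv = card_cls_move[OF E'(1) ef d(1)]
  have sub: "(c(e := m)) ` (E' - {f}) \<subseteq> {a, b, m}"
    by (rule move_image_subset[OF _ ef(1) E'(4)]) (use assms(3) in auto)
  have "sp_system 2 (E' - {f}) (class_system (E' - {f}) (c(e := m)) {{a}, {b}, {a, b, m}})"
    using E'(1) sub d assms(4,5) by (intro sp_types_2) (simp_all only: mv, auto simp: E'(3) d)
  from sp_series_class[OF ef d(1) _ this]
  have "sp_system (Suc 2) E' (class_system E' c (series_types m d {{a}, {b}, {a, b, m}}))" using d by auto
  moreover have "series_types m d {{a}, {b}, {a, b, m}} = {{a, b}, {a, d}, {b, d}, {a, b, d, m}}"
  proof -
    have i: "insert d {a} = {a, d}" "insert d {b} = {b, d}" "insert d {a, b, m} = {a, b, d, m}" by auto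
    have 1: "insert d ` {{a}, {b}, {a, b, m}} = {{a, d}, {b, d}, {a, b, d, m}}"
      by (simp only: image_insert image_empty i)
    have 2: "{{a}, {b}, {a, b, m}} \<inter> {t. m \<in> t} = {{a, b, m}}" "{a, b, m} - {m} = {a, b}"
      using d by auto
    have "{X, Y, Z} \<union> {W} = {W, X, Y, Z}" for W X Y Z :: "nat set" by auto
    note this[of "{a, d}" "{b, d}" "{a, b, d, m}" "{a, b}"]
    then show ?thesis unfolding series_types_def 1 2(1) by (simp only: image_insert image_empty 2(2))
  qed
  ultimately show "sp_system 3 E' (class_system E' c {{a, b}, {a, d}, {b, d}, {a, b, d, m}})"
    by (simp add: numeral_3_eq_3 numeral_2_eq_2)
qed

text \<open>Undoing class a into class b leaves the rank two shape with b and m as the classes of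
  size at least two and d as third class; this explains the sizes required here.\<close>

lemma sp_types_3b:
  assumes "finite E" "distinct [a, b, d, m]" "c ` E \<subseteq> {a, b, d, m}"
    and "card (cls E c a) \<ge> 2" "card (cls E c b) \<ge> 1" "card (cls E c d) \<ge> 1" "card (cls E c m) \<ge> 2"
  shows "sp_system 3 E (class_system E c {{}, {a, b}, {d, m}, {a, b, d, m}, {a, m}})"
  using assms(1,4)
proof (rule sp_grow_class)
  fix E' assume E': "finite E'" "card (cls E' c a) = 2" "\<And>j. j \<noteq> a \<Longrightarrow> cls E' c j = cls E c j" "E' \<subseteq> E"
  obtain e f where ef: "cls E' c a = {e, f}" "e \<noteq> f" using card_2_elems[OF E'(2)] .
  have d: "b \<noteq> a" "m \<noteq> d" "a \<noteq> d" "b \<noteq> d" "d \<noteq> b" "d \<noteq> a" "m \<noteq> a" "m \<noteq> b" "a \<noteq> b" "a \<noteq> m" "d \<noteq> m" "b \<noteq> m"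
    using assms(2) by auto
  note mv = card_cls_move[OF E'(1) ef d(1)]
  have sub: "(c(e := b)) ` (E' - {f}) \<subseteq> {b, m, d}"
    by (rule move_image_subset[OF _ ef(1) E'(4)]) (use assms(3) in auto)
  have "sp_system 2 (E' - {f}) (class_system (E' - {f}) (c(e := b)) {{b}, {m}, {b, m, d}})"
    using E'(1) sub d assms(5-7) by (intro sp_types_2) (simp_all only: mv, auto simp: E'(3) d)
  from sp_series_class[OF ef d(1) _ this]
  have "sp_system (Suc 2) E' (class_system E' c (series_types b a {{b}, {m}, {b, m, d}}))" using d by auto
  moreover have "series_types b a {{b}, {m}, {b, m, d}} = {{}, {a, b}, {d, m}, {a, b, d, m}, {a, m}}"
  proof -
    have i: "{a, b, m, d} = {a, b, d, m}" by auto
    have 1: "insert a ` {{b}, {m}, {b, m, d}} = {{a, b}, {a, m}, {a, b, d, m}}"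
      by (simp only: image_insert image_empty i)
    have 2: "{{b}, {m}, {b, m, d}} \<inter> {t. b \<in> t} = {{b}, {b, m, d}}" "{b, m, d} - {b} = {d, m}" "{b} - {b} = {}"
      using d by auto
    have "{X, Y, Z} \<union> {V, U} = {U, X, V, Z, Y}" for X Y Z U V :: "nat set" by auto
    note this[of "{a, b}" "{a, m}" "{a, b, d, m}" "{d, m}" "{}"]
    moreover have "(\<lambda>t. t - {b}) ` {{b}, {b, m, d}} = {{d, m}, {}}"
      unfolding image_insert image_empty 2(2,3) by (rule insert_commute)
    ultimately show ?thesis unfolding series_types_def 1 2(1) by (simp only:)
  qed
  ultimately show "sp_system 3 E' (class_system E' c {{}, {a, b}, {d, m}, {a, b, d, m}, {a, m}})"
    by (simp add: numeral_3_eq_3 numeral_2_eq_2)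
qed

lemma shaped_sp_system:
  assumes E: "finite E" "c ` E \<subseteq> {..<4}" and sh: "shaped k T (\<lambda>i. card (cls E c i))"
  shows "sp_system k E (class_system E c T)"
proof -
  have c4: "c x = 0 \<or> c x = 1 \<or> c x = 2 \<or> c x = 3" if "x \<in> E" for x
    using E(2) that by (auto simp: less_Suc_eq numeral_eq_Suc)
  have empty: "c x \<noteq> i" if "card (cls E c i) = 0" "x \<in> E" for x i using that E(1) by auto
  show ?thesis
    using sh unfolding shaped_def
  proof (elim disjE conjE)
    assume h: "k = 0" "T = {{0}}" "3 \<le> card (cls E c 0)" "card (cls E c 1) = 0" "card (cls E c 2) = 0" "card (cls E c 3) = 0"
    have sub: "c ` E \<subseteq> {0}"
    proof (rule image_subsetI)
      fix x assume x: "x \<in> E"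
      show "c x \<in> {0}" using c4[OF x] empty[OF h(4) x] empty[OF h(5) x] empty[OF h(6) x] by auto
    qed
    then have "cls E c 0 = E" by auto
    then have "card E \<ge> 3" using h(3) by simp
    then show ?thesis unfolding h(1,2) using E sub by (intro sp_types_0)
  next
    assume h: "k = 1" "T = {{}, {0, 1}}" "2 \<le> card (cls E c 0)" "2 \<le> card (cls E c 1)" "card (cls E c 2) = 0" "card (cls E c 3) = 0"
    have sub: "c ` E \<subseteq> {0, 1}"
    proof (rule image_subsetI)
      fix x assume x: "x \<in> E"
      show "c x \<in> {0, 1}" using c4[OF x] empty[OF h(5) x] empty[OF h(6) x] by auto
    qed
    show ?thesis unfolding h(1,2) by (rule sp_types_1[OF E(1) _ sub h(3,4)]) simp
  next
    assume h: "k = 2" "T = {{0}, {1}, {0, 1, 2}}" "2 \<le> card (cls E c 0)" "2 \<le> card (cls E c 1)" "1 \<le> card (cls E c 2)" "card (cls E c 3) = 0"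
    have sub: "c ` E \<subseteq> {0, 1, 2}"
    proof (rule image_subsetI)
      fix x assume x: "x \<in> E"
      show "c x \<in> {0, 1, 2}" using c4[OF x] empty[OF h(6) x] by auto
    qed
    show ?thesis unfolding h(1,2) by (rule sp_types_2[OF E(1) _ sub h(3-5)]) simp
  next
    assume h: "k = 3" "T = {{0, 1}, {0, 2}, {1, 2}, {0, 1, 2, 3}}" "2 \<le> card (cls E c 0)" "2 \<le> card (cls E c 1)" "2 \<le> card (cls E c 2)"
    have sub: "c ` E \<subseteq> {0, 1, 2, 3}"
    proof (rule image_subsetI)
      fix x assume x: "x \<in> E"
      show "c x \<in> {0, 1, 2, 3}" using c4[OF x] by auto
    qed
    show ?thesis unfolding h(1,2) by (rule sp_types_3a[OF E(1) _ sub h(3-5)]) simp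
  next
    assume h: "k = 3" "T = {{}, {0, 1}, {2, 3}, {0, 1, 2, 3}, {0, 3}}" "2 \<le> card (cls E c 0)" "1 \<le> card (cls E c 1)" "1 \<le> card (cls E c 2)" "2 \<le> card (cls E c 3)"
    have sub: "c ` E \<subseteq> {0, 1, 2, 3}"
    proof (rule image_subsetI)
      fix x assume x: "x \<in> E"
      show "c x \<in> {0, 1, 2, 3}" using c4[OF x] by auto
    qed
    show ?thesis unfolding h(1,2) by (rule sp_types_3b[OF E(1) _ sub h(3-6)]) simp
  qed
qed

lemma shaped_rank:
  assumes E: "finite E" "c ` E \<subseteq> {..<4}" and sh: "shaped k T (\<lambda>i. card (cls E c i))" and D: "D \<subseteq> E"
  shows "polytope_rank (poly_of (toggle D ` class_system E c T)) = int k"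
proof -
  have n: "normal (int k) E (class_system E c T)" by (rule sp_system_normal[OF shaped_sp_system[OF E sh]])
  then show ?thesis using rank_toggle[OF E(1) _ D, of "class_system E c T"] by (simp add: normal_def)
qed

section \<open>Equivalence of class systems with equal class sizes\<close>

lemma class_bijection:
  assumes "finite E1" "finite E2" "\<And>i. card (cls E1 c1 i) = card (cls E2 c2 i)"
  obtains \<pi> where "bij_betw \<pi> E1 E2" "\<And>x. x \<in> E1 \<Longrightarrow> c2 (\<pi> x) = c1 x"
proof -
  have "\<exists>h. bij_betw h (cls E1 c1 i) (cls E2 c2 i)" for i
    using assms by (intro finite_same_card_bij) auto
  then obtain h where h: "\<And>i. bij_betw (h i) (cls E1 c1 i) (cls E2 c2 i)" by metis
  define \<pi> where "\<pi> = (\<lambda>x. h (c1 x) x)"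
  have m: "\<pi> x \<in> E2" "c2 (\<pi> x) = c1 x" if "x \<in> E1" for x
    using bij_betw_apply[OF h, of x "c1 x"] that by (auto simp: \<pi>_def)
  have "bij_betw \<pi> E1 E2"
    unfolding bij_betw_def
  proof
    show "inj_on \<pi> E1"
    proof (rule inj_onI)
      fix x y assume xy: "x \<in> E1" "y \<in> E1" "\<pi> x = \<pi> y"
      then have c: "c1 x = c1 y" using m by metis
      then have "h (c1 x) x = h (c1 x) y" using xy(3) by (simp add: \<pi>_def)
      then show "x = y" using inj_onD[OF bij_betw_imp_inj_on[OF h[of "c1 x"]]] xy c by auto
    qed
    show "\<pi> ` E1 = E2"
    proof
      show "E2 \<subseteq> \<pi> ` E1"
      proof
        fix y assume "y \<in> E2"
        then have "y \<in> h (c2 y) ` cls E1 c1 (c2 y)" using bij_betw_imp_surj_on[OF h] by auto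
        then obtain x where "x \<in> E1" "c1 x = c2 y" "y = h (c2 y) x" by blast
        then have "y = \<pi> x" by (simp add: \<pi>_def)
        then show "y \<in> \<pi> ` E1" using \<open>x \<in> E1\<close> by blast
      qed
    qed (use m in auto)
  qed
  then show thesis using m(2) by (rule that)
qed

text \<open>A bijection matching the classes carries one class system to the other; the reflection
  set D collects the elements at which the two given toggles disagree.\<close>

lemma class_systems_equivalent:
  assumes E: "finite E1" "finite E2" and card: "\<And>i. card (cls E1 c1 i) = card (cls E2 c2 i)"
    and D: "D1 \<subseteq> E1" "D2 \<subseteq> E2"
  shows "unimodularly_equivalent (poly_of (toggle D1 ` class_system E1 c1 T))
    (poly_of (toggle D2 ` class_system E2 c2 T))"
proof -
  obtain \<pi> where \<pi>: "bij_betw \<pi> E1 E2" "\<And>x. x \<in> E1 \<Longrightarrow> c2 (\<pi> x) = c1 x"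
    by (rule class_bijection[OF E card]) blast
  have inj: "inj_on \<pi> E1" and im: "\<pi> ` E1 = E2" using \<pi>(1) by (auto simp: bij_betw_def)
  define D where "D = {x \<in> E1. (x \<in> D1) \<noteq> (\<pi> x \<in> D2)}"
  have sys: "toggle D1 ` class_system E1 c1 T \<subseteq> Pow E1"
    by (rule toggle_system[OF D(1)]) (auto simp: class_system_def)
  have DE: "D \<subseteq> E1" by (auto simp: D_def)
  have t: "\<pi> ` toggle D (toggle D1 Y) = toggle D2 (\<pi> ` Y)" if Y: "Y \<subseteq> E1" for Y
  proof (rule set_eqI)
    fix z
    have s: "toggle D (toggle D1 Y) \<subseteq> E1" using toggle_subset[OF DE toggle_subset[OF D(1) Y]] .
    show "z \<in> \<pi> ` toggle D (toggle D1 Y) \<longleftrightarrow> z \<in> toggle D2 (\<pi> ` Y)"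
    proof (cases "z \<in> E2")
      case True
      then obtain x where x: "x \<in> E1" "z = \<pi> x" using im by blast
      have "z \<in> \<pi> ` toggle D (toggle D1 Y) \<longleftrightarrow> x \<in> toggle D (toggle D1 Y)"
        "z \<in> \<pi> ` Y \<longleftrightarrow> x \<in> Y"
        using inj_on_image_mem_iff[OF inj x(1) s] inj_on_image_mem_iff[OF inj x(1) Y] x(2) by auto
      then show ?thesis using x by (auto simp: mem_toggle D_def)
    next
      case False
      then have "z \<notin> \<pi> ` toggle D (toggle D1 Y)" "z \<notin> \<pi> ` Y" "z \<notin> D2" using s Y im D(2) by blast+
      then show ?thesis by (simp add: mem_toggle)
    qed
  qed
  have "(\<lambda>X. \<pi> ` X) ` class_system E1 c1 T = class_system E2 c2 T"
  proof -
    have c: "inj_on c2 (\<pi> ` Y) = inj_on c1 Y" "c2 ` \<pi> ` Y = c1 ` Y" if "Y \<subseteq> E1" for Y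
    proof -
      have e: "(c2 \<circ> \<pi>) x = c1 x" if "x \<in> Y" for x using \<pi>(2) that \<open>Y \<subseteq> E1\<close> by auto
      have iY: "inj_on \<pi> Y" using inj_on_subset[OF inj \<open>Y \<subseteq> E1\<close>] .
      show "inj_on c2 (\<pi> ` Y) = inj_on c1 Y"
      proof -
        have "inj_on (c2 \<circ> \<pi>) Y = inj_on c1 Y" by (rule inj_on_cong) (rule e)
        then show ?thesis using comp_inj_on_iff[OF iY, of c2] by simp
      qed
      show "c2 ` \<pi> ` Y = c1 ` Y" unfolding image_comp by (rule image_cong[OF refl e])
    qed
    show ?thesis
    proof
      show "(\<lambda>X. \<pi> ` X) ` class_system E1 c1 T \<subseteq> class_system E2 c2 T"
        using c im by (auto simp: class_system_def)
      show "class_system E2 c2 T \<subseteq> (\<lambda>X. \<pi> ` X) ` class_system E1 c1 T"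
      proof
        fix Z assume Z: "Z \<in> class_system E2 c2 T"
        then obtain Y where Y: "Y \<subseteq> E1" "Z = \<pi> ` Y"
          using im by (auto simp: class_system_def subset_image_iff)
        then have "Y \<in> class_system E1 c1 T" using Z c[OF Y(1)] by (simp add: class_system_def)
        then show "Z \<in> (\<lambda>X. \<pi> ` X) ` class_system E1 c1 T" using Y by blast
      qed
    qed
  qed
  then have "toggle D2 ` class_system E2 c2 T = toggle D2 ` (`) \<pi> ` class_system E1 c1 T" by simp
  also have "\<dots> = (\<lambda>X. \<pi> ` toggle D X) ` toggle D1 ` class_system E1 c1 T"
    unfolding image_image using t by (intro image_cong refl) (auto simp: class_system_def)
  finally show ?thesis using unimodularly_equivalent_transport[OF E(1) inj sys DE] by simp
qed

section \<open>Connectivity and spanning trees\<close>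

definition crosses :: "('e \<Rightarrow> 'v set) \<Rightarrow> 'v set \<Rightarrow> 'e \<Rightarrow> bool" where
  "crosses en Z e \<longleftrightarrow> en e \<inter> Z \<noteq> {} \<and> en e - Z \<noteq> {}"

text \<open>With connectivity phrased by cuts, deleting, exchanging and contracting edges is a
  matter of comparing which cuts are crossed, with no walks to be rerouted.\<close>

definition cut_conn :: "'v set \<Rightarrow> ('e \<Rightarrow> 'v set) \<Rightarrow> 'e set \<Rightarrow> bool" where
  "cut_conn V en F \<longleftrightarrow> V \<noteq> {} \<and> (\<forall>Z\<subseteq>V. Z \<noteq> {} \<longrightarrow> Z \<noteq> V \<longrightarrow> (\<exists>e\<in>F. crosses en Z e))"

definition wf_graph :: "'v set \<Rightarrow> ('e \<Rightarrow> 'v set) \<Rightarrow> 'e set \<Rightarrow> bool" where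
  "wf_graph V en E \<longleftrightarrow> finite V \<and> finite E \<and> (\<forall>e\<in>E. en e \<subseteq> V \<and> card (en e) \<in> {1, 2})"

lemma cut_connD: "cut_conn V en F \<Longrightarrow> Z \<subseteq> V \<Longrightarrow> Z \<noteq> {} \<Longrightarrow> Z \<noteq> V \<Longrightarrow> \<exists>e\<in>F. crosses en Z e"
  by (simp add: cut_conn_def)

lemma cut_connI: "V \<noteq> {} \<Longrightarrow> (\<And>Z. Z \<subseteq> V \<Longrightarrow> Z \<noteq> {} \<Longrightarrow> Z \<noteq> V \<Longrightarrow> \<exists>e\<in>F. crosses en Z e) \<Longrightarrow> cut_conn V en F"
  by (simp add: cut_conn_def)

lemma cut_conn_replace:
  assumes "cut_conn V en F" "\<And>e Z. e \<in> F \<Longrightarrow> crosses en Z e \<Longrightarrow> \<exists>e'\<in>F'. crosses en' Z e'"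
  shows "cut_conn V en' F'"
proof (rule cut_connI)
  show "V \<noteq> {}" using assms(1) by (simp add: cut_conn_def)
  fix Z assume "Z \<subseteq> V" "Z \<noteq> {}" "Z \<noteq> V"
  then obtain e where "e \<in> F" "crosses en Z e" using cut_connD[OF assms(1)] by blast
  then show "\<exists>e'\<in>F'. crosses en' Z e'" by (rule assms(2))
qed

lemma cut_conn_mono: "cut_conn V en F \<Longrightarrow> F \<subseteq> F' \<Longrightarrow> cut_conn V en F'"
  by (rule cut_conn_replace) auto

lemma card_12E:
  assumes "card A \<in> {1, 2}" obtains x y where "A = {x, y}"
  using assms by (auto simp: card_1_singleton_iff card_2_iff)

text \<open>A walk leaving Z uses an edge across it; conversely the set of vertices reachable from u
  is crossed by no edge and hence is everything.\<close>

lemma graph_connected_cut: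
  assumes "wf_graph V en E"
  shows "graph_connected \<lparr>verts = V, edges = E, ends = en\<rparr> \<longleftrightarrow> cut_conn V en E"
proof -
  let ?R = "{(x, y). \<exists>e\<in>E. en e = {x, y}}"
  have wf: "en e \<subseteq> V" "card (en e) \<in> {1, 2}" if "e \<in> E" for e using assms that by (auto simp: wf_graph_def)
  have exit: "\<exists>e\<in>E. crosses en Z e" if uv: "(u, v) \<in> ?R\<^sup>*" and Z: "u \<in> Z" "v \<notin> Z" for u v Z
    using uv Z
  proof (induction rule: rtrancl_induct)
    case (step y z)
    show ?case
    proof (cases "y \<in> Z")
      case True
      obtain e where "e \<in> E" "en e = {y, z}" using step.hyps(2) by blast
      then show ?thesis using True step.prems(2) by (intro bexI[of _ e]) (auto simp: crosses_def)
    qed (use step in simp)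
  qed simp
  show ?thesis
  proof
    assume G: "graph_connected \<lparr>verts = V, edges = E, ends = en\<rparr>"
    show "cut_conn V en E"
    proof (rule cut_connI)
      show "V \<noteq> {}" using G by (simp add: graph_connected_def)
      fix Z assume Z: "Z \<subseteq> V" "Z \<noteq> {}" "Z \<noteq> V"
      then obtain u v where uv: "u \<in> Z" "v \<in> V" "v \<notin> Z" by blast
      then have "(u, v) \<in> ?R\<^sup>*" using G Z(1) by (auto simp: graph_connected_def)
      then show "\<exists>e\<in>E. crosses en Z e" using exit uv by blast
    qed
  next
    assume C: "cut_conn V en E"
    have "(u, v) \<in> ?R\<^sup>*" if u: "u \<in> V" and v: "v \<in> V" for u v
    proof (rule ccontr)
      assume n: "(u, v) \<notin> ?R\<^sup>*"
      let ?Z = "{z \<in> V. (u, z) \<in> ?R\<^sup>*}"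
      have "?Z \<subseteq> V" "?Z \<noteq> {}" "?Z \<noteq> V" using u v n by auto
      then obtain e where e: "e \<in> E" "crosses en ?Z e" using cut_connD[OF C] by blast
      then obtain x y where xy: "x \<in> en e" "x \<in> ?Z" "y \<in> en e" "y \<notin> ?Z" by (auto simp: crosses_def)
      then have "x \<noteq> y" by auto
      obtain a b where "en e = {a, b}" using card_12E[OF wf(2)[OF e(1)]] .
      then have "en e = {x, y}" using xy \<open>x \<noteq> y\<close> by auto
      then have "(x, y) \<in> ?R" using e(1) by auto
      then have "(u, y) \<in> ?R\<^sup>*" using xy(2) by (auto intro: rtrancl.rtrancl_into_rtrancl)
      then show False using xy wf(1)[OF e(1)] by auto
    qed
    then show "graph_connected \<lparr>verts = V, edges = E, ends = en\<rparr>"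
      using C by (simp add: graph_connected_def cut_conn_def)
  qed
qed

text \<open>A tree on m vertices is enlarged by an edge crossing its vertex set, which brings
  exactly one new vertex.\<close>

lemma spanning_tree_grow:
  assumes wf: "wf_graph V en F" and C: "cut_conn V en F"
  shows "1 \<le> m \<Longrightarrow> m \<le> card V \<Longrightarrow> \<exists>W T. W \<subseteq> V \<and> T \<subseteq> F \<and> card W = m \<and> card T + 1 = m \<and>
    cut_conn W en T \<and> (\<forall>e\<in>T. en e \<subseteq> W)"
proof (induction m rule: dec_induct)
  case base
  obtain r where "r \<in> V" using C by (auto simp: cut_conn_def)
  then show ?case
    by (intro exI[of _ "{r}"] exI[of _ "{}"]) (auto simp: cut_conn_def subset_singleton_iff)
next
  case (step m)
  then obtain W T where h: "W \<subseteq> V" "T \<subseteq> F" "card W = m" "card T + 1 = m" "cut_conn W en T" "\<forall>e\<in>T. en e \<subseteq> W"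
    by auto
  have "W \<noteq> V" "W \<noteq> {}" using h(3) step.prems step.hyps by auto
  then obtain e where e: "e \<in> F" "crosses en W e" using cut_connD[OF C h(1)] by blast
  then obtain x y where xy: "x \<in> en e" "x \<in> W" "y \<in> en e" "y \<notin> W" by (auto simp: crosses_def)
  have "en e \<subseteq> V" "card (en e) \<in> {1, 2}" using wf e(1) by (auto simp: wf_graph_def)
  then obtain a b where "en e = {a, b}" using card_12E by metis
  then have exy: "en e = {x, y}" using xy by auto
  have fin: "finite W" "finite T" using h wf finite_subset by (auto simp: wf_graph_def)
  have "e \<notin> T" using h(6) xy by blast
  show ?case
  proof (intro exI conjI)
    show "insert y W \<subseteq> V" "insert e T \<subseteq> F" using h e xy \<open>en e \<subseteq> V\<close> by auto
    show "card (insert y W) = Suc m" "card (insert e T) + 1 = Suc m" using h fin xy \<open>e \<notin> T\<close> by auto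
    show "\<forall>g\<in>insert e T. en g \<subseteq> insert y W" using h(6) exy xy(2) by auto
    show "cut_conn (insert y W) en (insert e T)"
    proof (rule cut_connI)
      fix Z assume Z: "Z \<subseteq> insert y W" "Z \<noteq> {}" "Z \<noteq> insert y W"
      consider "Z \<inter> W = {}" | "W \<subseteq> Z" | "Z \<inter> W \<noteq> {}" "Z \<inter> W \<noteq> W" by blast
      then show "\<exists>g\<in>insert e T. crosses en Z g"
      proof cases
        case 1
        then have "Z = {y}" using Z by auto
        then show ?thesis using exy xy by (auto simp: crosses_def)
      next
        case 2
        then have "Z = W" using Z by auto
        then show ?thesis using exy xy by (auto simp: crosses_def)
      next
        case 3
        then obtain g where g: "g \<in> T" "crosses en (Z \<inter> W) g" using cut_connD[OF h(5), of "Z \<inter> W"] by auto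
        then have "crosses en Z g" using h(6) by (auto simp: crosses_def)
        then show ?thesis using g(1) by blast
      qed
    qed simp
  qed
qed

lemma spanning_tree:
  assumes "wf_graph V en F" "cut_conn V en F"
  obtains T where "T \<subseteq> F" "card T + 1 = card V" "cut_conn V en T"
proof -
  have "1 \<le> card V" using assms by (simp add: cut_conn_def wf_graph_def Suc_le_eq card_gt_0_iff)
  from spanning_tree_grow[OF assms this le_refl]
  obtain W T where h: "W \<subseteq> V" "T \<subseteq> F" "card W = card V" "card T + 1 = card V" "cut_conn W en T"
    by (elim exE conjE)
  then have "W = V" using assms(1) by (intro card_subset_eq) (auto simp: wf_graph_def)
  with h that show thesis by blast
qed

section \<open>Spanning trees as the bases of the graphic matroid\<close>

lemma wf_graph_subset: "wf_graph V en E \<Longrightarrow> F \<subseteq> E \<Longrightarrow> wf_graph V en F"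
  unfolding wf_graph_def using finite_subset by blast

lemma cut_conn_card:
  assumes "wf_graph V en F" "cut_conn V en F" shows "card V \<le> card F + 1"
proof -
  obtain T where T: "T \<subseteq> F" "card T + 1 = card V" using spanning_tree[OF assms] .
  have "finite F" using assms(1) by (simp add: wf_graph_def)
  then show ?thesis using card_mono[OF _ T(1)] T(2) by simp
qed

text \<open>The count of edges stands in for acyclicity; \<open>graphic_bases_trees\<close>
  identifies these sets with the maximal forests of a connected graph.\<close>

definition trees :: "'v set \<Rightarrow> ('e \<Rightarrow> 'v set) \<Rightarrow> 'e set \<Rightarrow> 'e set set" where
  "trees V en E = {T. T \<subseteq> E \<and> cut_conn V en T \<and> card T + 1 = card V}"

lemma trees_subset: "trees V en E \<subseteq> Pow E"
  by (auto simp: trees_def)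

text \<open>If edge i were the only one to cross, walking round the rest of the cycle from one of
  its ends to the other would stay on one side of Z.\<close>

lemma cycle_crosses_twice:
  assumes cyc: "is_cycle G vs es" and i: "i < length es" "crosses (ends G) Z (es ! i)"
  shows "\<exists>j<length es. j \<noteq> i \<and> crosses (ends G) Z (es ! j)"
proof (rule ccontr)
  assume n: "\<not> ?thesis"
  let ?n = "length es"
  have c: "ends G (es ! k) = {vs ! k, vs ! ((k + 1) mod ?n)}" if "k < ?n" for k
    using cyc that by (auto simp: is_cycle_def)
  \<comment> \<open>f runs through the vertices of the cycle from the head of edge i; at index
    \<open>?n - 1\<close> it reaches the tail of that edge.\<close>
  define f where "f = (\<lambda>j. vs ! ((i + 1 + j) mod ?n))"
  have "(f j \<in> Z) = (f 0 \<in> Z)" if "j < ?n" for j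
    using that
  proof (induction j)
    case (Suc j)
    let ?k = "(i + 1 + j) mod ?n"
    have k: "?k < ?n" using i(1) by (intro mod_less_divisor) linarith
    have "?k \<noteq> i"
    proof (cases "i + 1 + j < ?n")
      case False
      then have "?k = i + 1 + j - ?n" using Suc.prems i(1) by (simp add: le_mod_geq)
      then show ?thesis using False Suc.prems by linarith
    qed simp
    then have "\<not> crosses (ends G) Z (es ! ?k)" using n k by blast
    moreover have "ends G (es ! ?k) = {f j, f (Suc j)}"
      unfolding c[OF k] f_def by (simp add: mod_Suc_eq)
    ultimately have "(f j \<in> Z) = (f (Suc j) \<in> Z)" by (auto simp: crosses_def)
    then show ?case using Suc by simp
  qed simp
  from this[of "?n - 1"] have "(f (?n - 1) \<in> Z) = (f 0 \<in> Z)" using i(1) by simp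
  moreover have "f (?n - 1) = vs ! i"
  proof -
    have e: "i + 1 + (?n - 1) = i + ?n" using i(1) by linarith
    show ?thesis unfolding f_def e using i(1) by simp
  qed
  ultimately have "\<not> crosses (ends G) Z (es ! i)" unfolding c[OF i(1)] crosses_def by (auto simp: f_def)
  then show False using i(2) by simp
qed

lemma cycle_edge_removable:
  assumes wf: "cut_conn V (ends G) F" and cyc: "is_cycle G vs es" "set es \<subseteq> F" and i: "i < length es"
  shows "cut_conn V (ends G) (F - {es ! i})"
proof (rule cut_conn_replace[OF wf])
  fix e Z assume e: "e \<in> F" "crosses (ends G) Z e"
  show "\<exists>e'\<in>F - {es ! i}. crosses (ends G) Z e'"
  proof (cases "e = es ! i")
    case True
    then obtain j where j: "j < length es" "j \<noteq> i" "crosses (ends G) Z (es ! j)"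
      using cycle_crosses_twice[OF cyc(1) i] e by blast
    have "distinct es" using cyc(1) by (simp add: is_cycle_def)
    then have "es ! j \<noteq> es ! i" "es ! j \<in> F" using i j cyc(2) nth_mem by (auto simp: nth_eq_iff_index_eq)
    then show ?thesis using j by blast
  qed (use e in blast)
qed

text \<open>A loop is a cycle by itself; otherwise the tree contains a path with distinct vertices
  between the ends of e, and e closes it.\<close>

lemma tree_plus_edge_cycle:
  assumes wf: "wf_graph V (ends G) T" and C: "cut_conn V (ends G) T" and e: "e \<notin> T"
    "ends G e \<subseteq> V" "card (ends G e) \<in> {1, 2}"
  shows "\<exists>vs es. set es \<subseteq> insert e T \<and> is_cycle G vs es"
proof -
  obtain x y where xy: "ends G e = {x, y}" using card_12E[OF e(3)] .
  show ?thesis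
  proof (cases "x = y")
    case True
    then show ?thesis using xy by (intro exI[of _ "[x]"] exI[of _ "[e]"]) (simp add: is_cycle_def)
  next
    case False
    let ?r = "\<lambda>x y. \<exists>g\<in>T. ends G g = {x, y}"
    have "graph_connected \<lparr>verts = V, edges = T, ends = ends G\<rparr>" using graph_connected_cut[OF wf] C by simp
    then have "(x, y) \<in> {(x, y). ?r x y}\<^sup>*" using e(2) xy by (simp add: graph_connected_def)
    then have "?r\<^sup>*\<^sup>* x y" by (simp add: Enum.rtranclp_rtrancl_eq)
    then obtain xs where "rtrancl_path ?r x xs y" unfolding rtranclp_eq_rtrancl_path by blast
    then obtain ps where ps: "rtrancl_path ?r x ps y" "distinct (x # ps)"
      by (rule rtrancl_path_distinct)
    have "ps \<noteq> []" using ps(1) False by (auto elim: rtrancl_path.cases)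
    then have last: "last ps = y" using rtrancl_path_last[OF ps(1)] by simp
    let ?p = "x # ps"
    let ?n = "length ps"
    have "\<exists>g\<in>T. ends G g = {?p ! i, ?p ! Suc i}" if "i < ?n" for i
      using rtrancl_path_nth[OF ps(1) that] by simp
    then obtain g where g: "\<And>i. i < ?n \<Longrightarrow> g i \<in> T \<and> ends G (g i) = {?p ! i, ?p ! Suc i}" by metis
    \<comment> \<open>An edge of the path occurs once: equal ends force equal positions, as the
      vertices are distinct.\<close>
    have inj: "i = j" if ij: "i < ?n" "j < ?n" "g i = g j" for i j
    proof -
      have "{?p ! i, ?p ! Suc i} = {?p ! j, ?p ! Suc j}" using g ij by metis
      then consider "?p ! i = ?p ! j" | "?p ! i = ?p ! Suc j" "?p ! Suc i = ?p ! j" by (auto simp: doubleton_eq_iff)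
      then show ?thesis
      proof cases
        case 1
        then show ?thesis using nth_eq_iff_index_eq[OF ps(2), of i j] ij by simp
      next
        case 2
        then have "i = Suc j" "Suc i = j"
          using nth_eq_iff_index_eq[OF ps(2), of i "Suc j"] nth_eq_iff_index_eq[OF ps(2), of "Suc i" j] ij by simp_all
        then show ?thesis by simp
      qed
    qed
    define es where "es = map g [0..<?n] @ [e]"
    have "distinct es" unfolding es_def using inj g e(1) by (auto simp: distinct_map inj_on_def)
    moreover have "set es \<subseteq> insert e T" unfolding es_def using g by auto
    moreover have "ends G (es ! i) = {?p ! i, ?p ! ((i + 1) mod length es)}" if "i < length es" for i
    proof (cases "i < ?n")
      case True
      then show ?thesis using g[OF True] by (simp add: es_def nth_append)
    next
      case False
      then have "i = ?n" using that by (simp add: es_def)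
      moreover have "?p ! ?n = y" using last \<open>ps \<noteq> []\<close> by (simp add: last_conv_nth nth_Cons')
      ultimately show ?thesis using xy by (auto simp: es_def nth_append)
    qed
    ultimately have "is_cycle G ?p es" using ps(2) by (auto simp: is_cycle_def es_def)
    then show ?thesis using \<open>set es \<subseteq> insert e T\<close> by blast
  qed
qed

text \<open>A tree has no cycle, since a cycle edge could be dropped, leaving too few edges for
  connectivity. A maximal forest is connected, since an edge across an uncrossed cut could be added:
  a cycle through it would cross that cut a second time.\<close>

lemma graphic_bases_trees:
  assumes wf: "wf_graph (verts G) (ends G) (edges G)" and C: "cut_conn (verts G) (ends G) (edges G)"
  shows "graphic_bases G = trees (verts G) (ends G) (edges G)"
proof (rule set_eqI)
  fix F
  let ?V = "verts G" and ?en = "ends G" and ?E = "edges G"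
  have wfe: "?en e \<subseteq> ?V" "card (?en e) \<in> {1, 2}" if "e \<in> ?E" for e using wf that by (auto simp: wf_graph_def)
  have acyclic: "is_forest G F" if F: "F \<subseteq> ?E" "cut_conn ?V ?en F" "card F + 1 = card ?V" for F
    unfolding is_forest_def
  proof (intro conjI F(1) notI)
    assume "\<exists>vs es. set es \<subseteq> F \<and> is_cycle G vs es"
    then obtain vs es where c: "set es \<subseteq> F" "is_cycle G vs es" by blast
    have C': "cut_conn ?V ?en (F - {es ! 0})" 
      by (rule cycle_edge_removable[OF F(2) c(2,1)]) (use c(2) in \<open>auto simp: is_cycle_def\<close>)
    have "es ! 0 \<in> F" using c by (auto simp: is_cycle_def intro!: nth_mem subsetD[OF c(1)])
    moreover have "finite F" using F(1) wf finite_subset by (auto simp: wf_graph_def)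
    moreover have "card ?V \<le> card (F - {es ! 0}) + 1"
      using F(1) by (intro cut_conn_card[OF wf_graph_subset[OF wf] C']) auto
    ultimately show False using F(3) card_Suc_Diff1[of F "es ! 0"] by linarith
  qed
  show "F \<in> graphic_bases G \<longleftrightarrow> F \<in> trees ?V ?en ?E"
  proof
    assume "F \<in> graphic_bases G"
    then have F: "is_forest G F" "\<And>F'. is_forest G F' \<Longrightarrow> F \<subseteq> F' \<Longrightarrow> F' = F" by (auto simp: graphic_bases_def)
    have FE: "F \<subseteq> ?E" using F(1) by (simp add: is_forest_def)
    have CF: "cut_conn ?V ?en F"
    proof (rule cut_connI)
      show "?V \<noteq> {}" using C by (simp add: cut_conn_def)
      fix Z assume Z: "Z \<subseteq> ?V" "Z \<noteq> {}" "Z \<noteq> ?V"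
      show "\<exists>e\<in>F. crosses ?en Z e"
      proof (rule ccontr)
        assume n: "\<not> ?thesis"
        obtain e where e: "e \<in> ?E" "crosses ?en Z e" using cut_connD[OF C Z] by blast
        have "is_forest G (insert e F)"
          unfolding is_forest_def
        proof (intro conjI notI)
          show "insert e F \<subseteq> ?E" using e FE by simp
          assume "\<exists>vs es. set es \<subseteq> insert e F \<and> is_cycle G vs es"
          then obtain vs es where c: "set es \<subseteq> insert e F" "is_cycle G vs es" by blast
          have "\<not> set es \<subseteq> F" using F(1) c(2) by (auto simp: is_forest_def)
          then obtain i where i: "i < length es" "es ! i = e" using c(1) by (metis in_set_conv_nth insertE subsetD subsetI)
          then obtain j where j: "j < length es" "j \<noteq> i" "crosses ?en Z (es ! j)"
            using cycle_crosses_twice[OF c(2), of i Z] e(2) by auto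
          have "es ! j \<noteq> e" using c(2) i j by (auto simp: is_cycle_def nth_eq_iff_index_eq)
          then have "es ! j \<in> F" using c(1) j(1) nth_mem by fastforce
          then show False using n j(3) by blast
        qed
        then have "insert e F = F" using F(2) by blast
        then show False using n e(2) by blast
      qed
    qed
    obtain T where T: "T \<subseteq> F" "card T + 1 = card ?V" "cut_conn ?V ?en T"
      using spanning_tree[OF wf_graph_subset[OF wf FE] CF] .
    have "T = F"
    proof (rule ccontr)
      assume "T \<noteq> F"
      then obtain e where e: "e \<in> F" "e \<notin> T" using T(1) by blast
      then have "\<exists>vs es. set es \<subseteq> insert e T \<and> is_cycle G vs es"
        using FE T by (intro tree_plus_edge_cycle[OF wf_graph_subset[OF wf] T(3)] wfe) auto
      then show False using F(1) T(1) e(1) unfolding is_forest_def by blast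
    qed
    then show "F \<in> trees ?V ?en ?E" using T FE by (simp add: trees_def)
  next
    assume "F \<in> trees ?V ?en ?E"
    then have F: "F \<subseteq> ?E" "cut_conn ?V ?en F" "card F + 1 = card ?V" by (auto simp: trees_def)
    have "F' = F" if F': "is_forest G F'" "F \<subseteq> F'" for F'
    proof (rule ccontr)
      assume "F' \<noteq> F"
      then obtain e where e: "e \<in> F'" "e \<notin> F" using F'(2) by blast
      moreover have "F' \<subseteq> ?E" using F'(1) by (simp add: is_forest_def)
      ultimately have "\<exists>vs es. set es \<subseteq> insert e F \<and> is_cycle G vs es"
        using F by (intro tree_plus_edge_cycle[OF wf_graph_subset[OF wf] F(2)] wfe) auto
      then show False using F'(1,2) e(1) unfolding is_forest_def by blast
    qed
    then show "F \<in> graphic_bases G" using acyclic[OF F] by (auto simp: graphic_bases_def)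
  qed
qed

subsection \<open>Reductions\<close>

lemma cut_conn_swap:
  assumes "cut_conn V en F" "en e = en f" "e \<in> F'" "F - {f} \<subseteq> F'"
  shows "cut_conn V en F'"
proof (rule cut_conn_replace[OF assms(1)])
  fix g Z assume g: "g \<in> F" "crosses en Z g"
  show "\<exists>g\<in>F'. crosses en Z g"
  proof (cases "g = f")
    case True
    then have "crosses en Z e" using g(2) assms(2) by (simp add: crosses_def)
    then show ?thesis using assms(3) by blast
  next
    case False
    then show ?thesis using g assms(4) by blast
  qed
qed

text \<open>No tree contains both e and f, as dropping f would leave a connected set with too few
  edges.\<close>

lemma trees_parallel:
  assumes wf: "wf_graph V en E" and ef: "e \<in> E" "f \<in> E" "e \<noteq> f" "en e = en f"
  shows "trees V en E = par_ext e f (trees V en (E - {f}))"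
proof (rule set_eqI)
  fix Y
  have fin: "finite X" if "X \<subseteq> E" for X using that wf finite_subset by (auto simp: wf_graph_def)
  show "Y \<in> trees V en E \<longleftrightarrow> Y \<in> par_ext e f (trees V en (E - {f}))"
  proof
    assume "Y \<in> trees V en E"
    then have Y: "Y \<subseteq> E" "cut_conn V en Y" "card Y + 1 = card V" by (auto simp: trees_def)
    show "Y \<in> par_ext e f (trees V en (E - {f}))"
    proof (cases "f \<in> Y")
      case False
      then show ?thesis using Y by (auto simp: par_ext_def trees_def)
    next
      case True
      have card: "card (Y - {f}) + 1 = card Y" using True fin[OF Y(1)] by (metis Suc_eq_plus1 card_Suc_Diff1)
      have eY: "e \<notin> Y"
      proof
        assume "e \<in> Y"
        then have "cut_conn V en (Y - {f})" using ef(3) by (intro cut_conn_swap[OF Y(2) ef(4)]) auto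
        then have "card V \<le> card (Y - {f}) + 1"
          using Y(1) by (intro cut_conn_card[OF wf_graph_subset[OF wf]]) auto
        then show False using Y(3) card by simp
      qed
      let ?X = "insert e (Y - {f})"
      have "cut_conn V en ?X" by (rule cut_conn_swap[OF Y(2) ef(4)]) auto
      moreover have "card ?X = card Y" using eY card fin[OF Y(1)] by simp
      ultimately have "?X \<in> trees V en (E - {f})" using Y ef by (auto simp: trees_def)
      moreover have "Y = insert f (?X - {e})" using True eY by auto
      moreover have "e \<in> ?X" by simp
      ultimately show ?thesis unfolding par_ext_def by (intro UnI2 CollectI exI[of _ ?X] conjI)
    qed
  next
    assume "Y \<in> par_ext e f (trees V en (E - {f}))"
    then consider "Y \<in> trees V en (E - {f})" | X where "X \<in> trees V en (E - {f})" "e \<in> X" "Y = insert f (X - {e})"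
      by (auto simp: par_ext_def)
    then show "Y \<in> trees V en E"
    proof cases
      case 2
      then have X: "X \<subseteq> E - {f}" "cut_conn V en X" "card X + 1 = card V" by (auto simp: trees_def)
      have CY: "cut_conn V en Y" unfolding 2(3) by (rule cut_conn_swap[OF X(2) ef(4)[symmetric]]) auto
      have "finite X" using X(1) fin by blast
      moreover have "f \<notin> X" using X(1) by blast
      ultimately have "card Y = card X" unfolding 2(3) using card_Suc_Diff1[of X e] 2(2) by simp
      then show ?thesis using CY X 2 ef by (auto simp: trees_def)
    qed (auto simp: trees_def)
  qed
qed

text \<open>Cuts separating w from c are crossed by f itself; the others correspond to the cuts of
  the contracted vertex set.\<close>

lemma contract_cut_conn:
  assumes f: "en f = {w, c}" "w \<noteq> c" "w \<in> V" "c \<in> V"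
    and X: "\<And>g. g \<in> X \<Longrightarrow> en g \<subseteq> V \<and> en' g = (\<lambda>x. if x = w then c else x) ` en g"
  shows "cut_conn V en (insert f X) \<longleftrightarrow> cut_conn (V - {w}) en' X"
proof -
  let ?\<phi> = "\<lambda>x. if x = w then c else x"
  have cr: "crosses en' Z g = crosses en {x \<in> V. ?\<phi> x \<in> Z} g" if "g \<in> X" for g Z
    using X[OF that] by (auto simp: crosses_def)
  show ?thesis
  proof
    assume C: "cut_conn V en (insert f X)"
    show "cut_conn (V - {w}) en' X"
    proof (rule cut_connI)
      show "V - {w} \<noteq> {}" using f by auto
      fix Z assume Z: "Z \<subseteq> V - {w}" "Z \<noteq> {}" "Z \<noteq> V - {w}"
      let ?Z = "{x \<in> V. ?\<phi> x \<in> Z}"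
      obtain z where z: "z \<in> V" "z \<noteq> w" "z \<notin> Z" using Z by blast
      have "?Z \<noteq> V" using z by auto
      moreover have "?Z \<noteq> {}" using Z(1,2) by auto
      ultimately obtain g where g: "g \<in> insert f X" "crosses en ?Z g" using cut_connD[OF C, of ?Z] by auto
      have "\<not> crosses en ?Z f" using f by (auto simp: crosses_def)
      then have "g \<in> X" using g by auto
      then show "\<exists>g\<in>X. crosses en' Z g" using g cr by blast
    qed
  next
    assume C: "cut_conn (V - {w}) en' X"
    show "cut_conn V en (insert f X)"
    proof (rule cut_connI)
      show "V \<noteq> {}" using f by auto
      fix Z assume Z: "Z \<subseteq> V" "Z \<noteq> {}" "Z \<noteq> V"
      show "\<exists>e\<in>insert f X. crosses en Z e"
      proof (cases "(w \<in> Z) = (c \<in> Z)")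
        case False
        then show ?thesis using f by (auto simp: crosses_def)
      next
        case True
        have "Z - {w} \<noteq> {}" "Z - {w} \<noteq> V - {w}" using True Z f by auto
        then obtain g where g: "g \<in> X" "crosses en' (Z - {w}) g" using cut_connD[OF C, of "Z - {w}"] Z by auto
        moreover have "{x \<in> V. ?\<phi> x \<in> Z - {w}} = Z" using True Z f by auto
        ultimately show ?thesis using cr by auto
      qed
    qed
  qed
qed

definition two_conn :: "'v set \<Rightarrow> ('e \<Rightarrow> 'v set) \<Rightarrow> 'e set \<Rightarrow> bool" where
  "two_conn V en E \<longleftrightarrow> cut_conn V en E \<and> (\<forall>v\<in>V. cut_conn (V - {v}) en {e \<in> E. v \<notin> en e})"

lemma two_conn_parallel:
  assumes "two_conn V en E" "e \<in> E" "e \<noteq> f" "en e = en f"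
  shows "two_conn V en (E - {f})"
proof -
  have "cut_conn V en (E - {f})"
  proof (rule cut_conn_swap[where en = en and e = e and f = f])
    show "cut_conn V en E" using assms(1) by (simp add: two_conn_def)
  qed (use assms(2-4) in auto)
  moreover have "cut_conn (V - {v}) en {g \<in> E - {f}. v \<notin> en g}" if v: "v \<in> V" for v
  proof -
    have C: "cut_conn (V - {v}) en {g \<in> E. v \<notin> en g}" using assms(1) v by (simp add: two_conn_def)
    show ?thesis
    proof (rule cut_conn_replace[OF C])
      fix g Z assume g: "g \<in> {g \<in> E. v \<notin> en g}" "crosses en Z g"
      show "\<exists>g\<in>{g \<in> E - {f}. v \<notin> en g}. crosses en Z g"
      proof (cases "g = f")
        case True
        then have "crosses en Z e" "v \<notin> en e" using g assms(4) by (simp_all add: crosses_def)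
        then show ?thesis using assms(2,3) by blast
      next
        case False
        then show ?thesis using g by blast
      qed
    qed
  qed
  ultimately show ?thesis by (simp add: two_conn_def)
qed

text \<open>w is a vertex of degree two. It is suppressed by contracting f, after which e runs from
  b to c; the other edges keep their names and ends, so that the two systems of trees can be
  compared.\<close>

locale series_pair =
  fixes V :: "'v set" and en :: "'e \<Rightarrow> 'v set" and E e f w b c
  assumes wf: "wf_graph V en E" and ef: "e \<in> E" "f \<in> E" "e \<noteq> f" "en e = {w, b}" "en f = {w, c}"
    and bc: "b \<noteq> w" "c \<noteq> w" "b \<noteq> c" and only: "\<And>g. g \<in> E \<Longrightarrow> w \<in> en g \<Longrightarrow> g = e \<or> g = f"
begin

definition "en' = en(e := {b, c})"

lemma verts: "w \<in> V" "b \<in> V" "c \<in> V"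
  using wf ef by (auto simp: wf_graph_def)

lemma ends_in: "g \<in> E \<Longrightarrow> en g \<subseteq> V"
  using wf by (auto simp: wf_graph_def)

lemma en'_c: "g \<in> E - {f} \<Longrightarrow> en' g = (\<lambda>x. if x = w then c else x) ` en g"
  using only[of g] ef bc by (cases "g = e") (auto simp: en'_def image_iff)

lemma en'_b: "g \<in> E - {e, f} \<Longrightarrow> en' g = (\<lambda>x. if x = w then b else x) ` en g"
  using only[of g] by (auto simp: en'_def image_iff)

lemma wf': "wf_graph (V - {w}) en' (E - {f})"
  unfolding wf_graph_def
proof (intro conjI ballI)
  fix g assume g: "g \<in> E - {f}"
  show "en' g \<subseteq> V - {w}" using g only[of g] ends_in[of g] bc verts by (auto simp: en'_def)
  show "card (en' g) \<in> {1, 2}" using g wf bc by (auto simp: en'_def wf_graph_def)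
qed (use wf in \<open>auto simp: wf_graph_def\<close>)

lemma contract_f:
  assumes "X \<subseteq> E - {f}"
  shows "cut_conn V en (insert f X) \<longleftrightarrow> cut_conn (V - {w}) en' X"
proof (rule contract_cut_conn[where en = en and f = f, OF ef(5) bc(2)[symmetric] verts(1,3)])
  fix g assume "g \<in> X"
  then show "en g \<subseteq> V \<and> en' g = (\<lambda>x. if x = w then c else x) ` en g"
    using en'_c[of g] ends_in[of g] assms by blast
qed

lemma contract_e:
  assumes "X \<subseteq> E - {e, f}"
  shows "cut_conn V en (insert e X) \<longleftrightarrow> cut_conn (V - {w}) en' X"
proof (rule contract_cut_conn[where en = en and f = e, OF ef(4) bc(1)[symmetric] verts(1,2)])
  fix g assume "g \<in> X"
  then show "en g \<subseteq> V \<and> en' g = (\<lambda>x. if x = w then b else x) ` en g"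
    using en'_b[of g] ends_in[of g] assms by blast
qed

text \<open>A tree must leave w, so it contains f or, failing that, e. Contracting that edge gives a
  tree X of the reduced graph, which comes back as X + f always and as X + e only if e is not in X.
  Reflected at e and f, this is the parallel extension of the reduced system reflected at e.\<close>

lemma trees_series:
  "trees V en E = toggle {e, f} ` par_ext e f (toggle {e} ` trees (V - {w}) en' (E - {f}))"
proof -
  let ?B = "trees (V - {w}) en' (E - {f})"
  have fin: "finite X" if "X \<subseteq> E" for X using that wf finite_subset by (auto simp: wf_graph_def)
  have cV: "card V = card (V - {w}) + 1"
    using verts wf by (simp add: wf_graph_def) (metis Suc_pred card_gt_0_iff empty_iff)
  have mem: "T \<in> trees V en E \<longleftrightarrow> (\<exists>X\<in>?B. T = insert f X \<or> e \<notin> X \<and> T = insert e X)" for T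
  proof
    assume "T \<in> trees V en E"
    then have T: "T \<subseteq> E" "cut_conn V en T" "card T + 1 = card V" by (auto simp: trees_def)
    show "\<exists>X\<in>?B. T = insert f X \<or> e \<notin> X \<and> T = insert e X"
    proof (cases "f \<in> T")
      case True
      then have "T = insert f (T - {f})" by blast
      moreover have "T - {f} \<in> ?B"
      proof -
        have "cut_conn (V - {w}) en' (T - {f})" using contract_f[of "T - {f}"] T True by (auto simp: insert_absorb)
        moreover have "card T = card (T - {f}) + 1" using True fin[OF T(1)] by (metis Suc_eq_plus1 card_Suc_Diff1)
        ultimately show ?thesis using T cV by (auto simp: trees_def)
      qed
      ultimately show ?thesis by blast
    next
      case False
      have "{w} \<noteq> V" using verts bc by auto
      then obtain g where "g \<in> T" "crosses en {w} g" using cut_connD[OF T(2), of "{w}"] verts by auto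
      then have "g = e" using only[of g] T(1) False by (auto simp: crosses_def)
      then have eT: "e \<in> T" using \<open>g \<in> T\<close> by simp
      then have "T = insert e (T - {e})" by blast
      moreover have "T - {e} \<in> ?B"
      proof -
        have "cut_conn (V - {w}) en' (T - {e})" using contract_e[of "T - {e}"] T False eT by (auto simp: insert_absorb)
        moreover have "card T = card (T - {e}) + 1" using eT fin[OF T(1)] by (metis Suc_eq_plus1 card_Suc_Diff1)
        ultimately show ?thesis using T cV False by (auto simp: trees_def)
      qed
      ultimately show ?thesis by (intro bexI[of _ "T - {e}"]) simp_all
    qed
  next
    assume "\<exists>X\<in>?B. T = insert f X \<or> e \<notin> X \<and> T = insert e X"
    then obtain X where X: "X \<in> ?B" "T = insert f X \<or> e \<notin> X \<and> T = insert e X" by blast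
    then have h: "X \<subseteq> E - {f}" "cut_conn (V - {w}) en' X" "card X + 1 = card (V - {w})" by (auto simp: trees_def)
    have "X \<subseteq> E" using h(1) by blast
    then have fX: "finite X" "f \<notin> X" using fin h(1) by auto
    from X(2) show "T \<in> trees V en E"
    proof
      assume T: "T = insert f X"
      then show ?thesis using h cV fX ef(2) contract_f[OF h(1)] by (auto simp: trees_def)
    next
      assume T: "e \<notin> X \<and> T = insert e X"
      then have "X \<subseteq> E - {e, f}" using h(1) by blast
      then show ?thesis using T h cV fX ef(1) contract_e by (auto simp: trees_def)
    qed
  qed
  have fB: "f \<notin> X" if "X \<in> ?B" for X using that by (auto simp: trees_def)
  have tg: "(\<exists>Y. (if e \<in> X then Y = X - {e} else Y = insert e X \<or> Y = insert f X) \<and> T = toggle {e, f} Y)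
      \<longleftrightarrow> T = insert f X \<or> e \<notin> X \<and> T = insert e X" if X: "X \<in> ?B" for X T
  proof (cases "e \<in> X")
    case True
    then have "toggle {e, f} (X - {e}) = insert f X" using fB[OF X] by (auto simp: toggle_def)
    then show ?thesis using True by auto
  next
    case False
    have tt: "toggle {e, f} (insert e X) = insert f X" "toggle {e, f} (insert f X) = insert e X"
      using False fB[OF X] ef(3) by (auto simp: toggle_def)
    have "(\<exists>Y. (Y = insert e X \<or> Y = insert f X) \<and> T = toggle {e, f} Y) \<longleftrightarrow>
        T = toggle {e, f} (insert e X) \<or> T = toggle {e, f} (insert f X)" by blast
    also have "\<dots> \<longleftrightarrow> T = insert f X \<or> T = insert e X" unfolding tt ..
    finally show ?thesis using False by simp
  qed
  show ?thesis
  proof (rule set_eqI)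
    fix T
    have "T \<in> toggle {e, f} ` par_ext e f (toggle {e} ` ?B)
      \<longleftrightarrow> (\<exists>X\<in>?B. \<exists>Y. (if e \<in> X then Y = X - {e} else Y = insert e X \<or> Y = insert f X) \<and> T = toggle {e, f} Y)"
      unfolding image_iff Bex_def mem_series_ext by blast
    also have "\<dots> \<longleftrightarrow> T \<in> trees V en E" unfolding mem by (intro bex_cong refl tg)
    finally show "T \<in> trees V en E \<longleftrightarrow> T \<in> toggle {e, f} ` par_ext e f (toggle {e} ` ?B)" by blast
  qed
qed

text \<open>Deleting a vertex v other than c commutes with the contraction of f.\<close>

lemma two_conn_series:
  assumes "two_conn V en E" shows "two_conn (V - {w}) en' (E - {f})"
proof -
  have E: "insert f (E - {f}) = E" using ef by blast
  have "cut_conn (V - {w}) en' (E - {f})" using contract_f[OF subset_refl] assms E by (simp add: two_conn_def)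
  moreover have "cut_conn (V - {w} - {v}) en' {g \<in> E - {f}. v \<notin> en' g}" if v: "v \<in> V - {w}" for v
  proof (cases "v = c")
    case False
    have C: "cut_conn (V - {v}) en {g \<in> E. v \<notin> en g}" using assms v by (simp add: two_conn_def)
    have "{g \<in> E. v \<notin> en g} = insert f {g \<in> E - {f}. v \<notin> en' g}"
      using False v ef by (auto simp: en'_def)
    then have "cut_conn (V - {v}) en (insert f {g \<in> E - {f}. v \<notin> en' g})" using C by simp
    moreover have "cut_conn (V - {v}) en (insert f {g \<in> E - {f}. v \<notin> en' g})
        \<longleftrightarrow> cut_conn (V - {v} - {w}) en' {g \<in> E - {f}. v \<notin> en' g}"
    proof (rule contract_cut_conn[where en = en and f = f, OF ef(5) bc(2)[symmetric]])
      fix g assume g: "g \<in> {g \<in> E - {f}. v \<notin> en' g}"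
      then have "en' g = (\<lambda>x. if x = w then c else x) ` en g" by (intro en'_c) simp
      moreover have "v \<notin> en g" using g v ef by (auto simp: en'_def split: if_splits)
      ultimately show "en g \<subseteq> V - {v} \<and> en' g = (\<lambda>x. if x = w then c else x) ` en g" using ends_in[of g] g by auto
    qed (use verts v False in auto)
    moreover have "V - {v} - {w} = V - {w} - {v}" by blast
    ultimately show ?thesis by simp
  next
    case True
    \<comment> \<open>Deleting c destroys f, so here w is contracted into b along e instead.\<close>
    have C: "cut_conn (V - {c}) en {g \<in> E. c \<notin> en g}" using assms verts by (simp add: two_conn_def)
    have "{g \<in> E. c \<notin> en g} = insert e {g \<in> E - {f}. c \<notin> en' g}"
      using ef bc by (auto simp: en'_def)
    then have "cut_conn (V - {c}) en (insert e {g \<in> E - {f}. c \<notin> en' g})" using C by simp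
    moreover have "cut_conn (V - {c}) en (insert e {g \<in> E - {f}. c \<notin> en' g})
        \<longleftrightarrow> cut_conn (V - {c} - {w}) en' {g \<in> E - {f}. c \<notin> en' g}"
    proof (rule contract_cut_conn[where en = en and f = e, OF ef(4) bc(1)[symmetric]])
      fix g assume g: "g \<in> {g \<in> E - {f}. c \<notin> en' g}"
      then have ne: "g \<noteq> e" by (auto simp: en'_def)
      then have "en' g = (\<lambda>x. if x = w then b else x) ` en g" using g by (intro en'_b) simp
      moreover have "c \<notin> en g" using g ne by (simp add: en'_def)
      ultimately show "en g \<subseteq> V - {c} \<and> en' g = (\<lambda>x. if x = w then b else x) ` en g" using ends_in[of g] g by auto
    qed (use verts bc in auto)
    moreover have "V - {c} - {w} = V - {w} - {v}" using True by blast
    ultimately show ?thesis using True by simp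
  qed
  ultimately show ?thesis by (simp add: two_conn_def)
qed

end

section \<open>Complete graphs on four vertices as minors\<close>

text \<open>In a 2-connected simple graph of minimum degree 3 we look for a partition of the vertices
  into four connected, pairwise adjacent parts. A state \<open>(y, K)\<close> consists of a vertex \<open>y\<close> and
  a connected set \<open>K\<close> such that the remaining vertices also induce a connected graph and \<open>y\<close> has
  neighbours on both sides. Choose \<open>K\<close> minimal such that \<open>K\<close> together with \<open>y\<close> contains a cycle
  (in the sense of \<open>rooted_core\<close>). If \<open>y'\<close> is a neighbour of \<open>y\<close> in \<open>K\<close>, the components of
  \<open>K - {y'}\<close> are trees attached to \<open>y'\<close>, so by the degree condition each of them has an edge
  to the rest; the component of another neighbour of \<open>y\<close> and its complement in \<open>K\<close> are two
  further parts.\<close>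

locale min_degree_3 =
  fixes V :: "'v set" and nb :: "'v \<Rightarrow> 'v \<Rightarrow> bool"
  assumes finite_V: "finite V" and V_ne: "V \<noteq> {}"
    and nb_sym: "nb x y \<Longrightarrow> nb y x" and nb_irrefl: "\<not> nb x x" and nb_in: "nb x y \<Longrightarrow> x \<in> V \<and> y \<in> V"
    and nb_conn: "v \<in> V \<Longrightarrow> Z \<subseteq> V - {v} \<Longrightarrow> Z \<noteq> {} \<Longrightarrow> Z \<noteq> V - {v} \<Longrightarrow> \<exists>x\<in>Z. \<exists>y\<in>V - {v} - Z. nb x y"
    and degree: "v \<in> V \<Longrightarrow> 3 \<le> card {u. nb v u}"
begin

definition cset :: "'v set \<Rightarrow> bool" where
  "cset S \<longleftrightarrow> S \<noteq> {} \<and> (\<forall>Z\<subseteq>S. Z \<noteq> {} \<longrightarrow> Z \<noteq> S \<longrightarrow> (\<exists>x\<in>Z. \<exists>y\<in>S - Z. nb x y))"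

abbreviation "adjacent X Y \<equiv> \<exists>x\<in>X. \<exists>y\<in>Y. nb x y"
abbreviation "N v \<equiv> {u. nb v u}"

text \<open>Forces a cycle in Z together with y, as no vertex of Z is isolated or a leaf there. Its
  negation yields in every nonempty part of K a vertex with at most one neighbour in that part and
  y, which is the form in which it is used.\<close>

definition rooted_core :: "'v \<Rightarrow> 'v set \<Rightarrow> bool" where
  "rooted_core y K \<longleftrightarrow> (\<exists>Z\<subseteq>K. Z \<noteq> {} \<and> (\<forall>v\<in>Z. 2 \<le> card (N v \<inter> insert y Z)))"

definition state :: "'v \<Rightarrow> 'v set \<Rightarrow> bool" where
  "state y K \<longleftrightarrow> y \<in> V \<and> K \<subseteq> V - {y} \<and> cset K \<and> cset (V - K - {y}) \<and>
    adjacent {y} K \<and> adjacent {y} (V - K - {y})"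

section \<open>Connected sets of vertices and their components\<close>

lemma csetD: "cset S \<Longrightarrow> Z \<subseteq> S \<Longrightarrow> Z \<noteq> {} \<Longrightarrow> Z \<noteq> S \<Longrightarrow> \<exists>x\<in>Z. \<exists>y\<in>S - Z. nb x y"
  by (simp add: cset_def)

lemma csetI: "S \<noteq> {} \<Longrightarrow> (\<And>Z. Z \<subseteq> S \<Longrightarrow> Z \<noteq> {} \<Longrightarrow> Z \<noteq> S \<Longrightarrow> \<exists>x\<in>Z. \<exists>y\<in>S - Z. nb x y) \<Longrightarrow> cset S"
  by (simp add: cset_def)

lemma finite_N: "finite (N v)"
  by (rule finite_subset[OF _ finite_V]) (use nb_in in blast)

lemma card_N_le: "card (N v) \<le> Suc (card (N v - {y}))"
proof (cases "y \<in> N v")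
  case True
  then show ?thesis using card_Suc_Diff1[OF finite_N] by (metis le_refl)
next
  case False
  then have "N v - {y} = N v" by blast
  then show ?thesis by simp
qed

lemma cset_singleton: "cset {r}"
  by (auto simp: cset_def subset_singleton_iff)

text \<open>A set and its complement have the same crossing edges, and one of the two avoids
  u.\<close>

lemma cset_avoid:
  assumes "u \<in> S" and "\<And>Z. Z \<subseteq> S \<Longrightarrow> Z \<noteq> {} \<Longrightarrow> u \<notin> Z \<Longrightarrow> \<exists>x\<in>Z. \<exists>y\<in>S - Z. nb x y"
  shows "cset S"
proof (rule csetI)
  show "S \<noteq> {}" using assms(1) by blast
  fix Z assume Z: "Z \<subseteq> S" "Z \<noteq> {}" "Z \<noteq> S"
  show "\<exists>x\<in>Z. \<exists>y\<in>S - Z. nb x y"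
  proof (cases "u \<in> Z")
    case True
    have "S - Z \<noteq> {}" using Z by blast
    then obtain x y where "x \<in> S - Z" "y \<in> S - (S - Z)" "nb x y" using assms(2)[of "S - Z"] True by auto
    then show ?thesis using nb_sym Z(1) by blast
  qed (use assms(2) Z in blast)
qed

lemma cset_insert:
  assumes "cset L" "l \<in> L" "nb l s" shows "cset (insert s L)"
proof (cases "s \<in> L")
  case False
  show ?thesis
  proof (rule cset_avoid[of s])
    fix Z assume Z: "Z \<subseteq> insert s L" "Z \<noteq> {}" "s \<notin> Z"
    show "\<exists>x\<in>Z. \<exists>y\<in>insert s L - Z. nb x y"
    proof (cases "Z = L")
      case True
      then show ?thesis using assms False by blast
    next
      case F: False
      then obtain x y where "x \<in> Z" "y \<in> L - Z" "nb x y" using csetD[OF assms(1), of Z] Z by auto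
      then show ?thesis by blast
    qed
  qed simp
qed (use assms in \<open>simp add: insert_absorb\<close>)

text \<open>L has maximal size among the connected subsets of S containing x; an edge to the rest of
  S would allow a further vertex.\<close>

lemma component:
  assumes "x \<in> S" "S \<subseteq> V"
  obtains L where "L \<subseteq> S" "x \<in> L" "cset L" "\<And>l s. l \<in> L \<Longrightarrow> s \<in> S - L \<Longrightarrow> \<not> nb l s"
proof -
  let ?C = "{L. L \<subseteq> S \<and> x \<in> L \<and> cset L}"
  have fin: "finite S" using assms(2) finite_V finite_subset by blast
  have "{x} \<in> ?C" using assms cset_singleton by simp
  moreover have "finite ?C" using fin by simp
  ultimately obtain L where L: "L \<in> ?C" "\<And>L'. L' \<in> ?C \<Longrightarrow> card L' \<le> card L"
    using Max_in[of "card ` ?C"] Max_ge[of "card ` ?C"] by (smt (verit) empty_iff finite_imageI image_iff image_is_empty)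
  have "\<not> nb l s" if ls: "l \<in> L" "s \<in> S - L" for l s
  proof
    assume "nb l s"
    then have "insert s L \<in> ?C" using L(1) ls cset_insert by auto
    then have "card (insert s L) \<le> card L" by (rule L(2))
    moreover have "finite L" using L(1) fin finite_subset by blast
    ultimately show False using ls by simp
  qed
  moreover have "L \<subseteq> S" "x \<in> L" "cset L" using L(1) by auto
  ultimately show thesis by (intro that[of L])
qed

text \<open>Without y the graph is still connected, so a set disjoint from B in the complement of L
  has an outgoing edge, and this edge cannot enter L, whose outside neighbours other than y lie in
  B. Sets containing B are treated through their complements, sets splitting B by the connectivity
  of B.\<close>

lemma complement_cset:
  assumes y: "y \<in> V" "y \<notin> B" "y \<notin> L" and B: "cset B" "B \<subseteq> V" "B \<inter> L = {}"
    and no: "\<And>l s. l \<in> L \<Longrightarrow> s \<in> V - {y} - L - B \<Longrightarrow> \<not> nb l s"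
  shows "cset (V - L - {y})"
proof (rule csetI)
  let ?A = "V - L - {y}"
  have BA: "B \<subseteq> ?A" "B \<noteq> {}" using y B by (auto simp: cset_def)
  then show "?A \<noteq> {}" by blast
  have free: "\<exists>x\<in>Z. \<exists>z\<in>?A - Z. nb x z" if Z: "Z \<subseteq> ?A" "Z \<noteq> {}" "Z \<inter> B = {}" for Z
  proof -
    have "Z \<subseteq> V - {y}" "Z \<noteq> V - {y}" using Z(1,3) BA by auto
    then obtain x z where xz: "x \<in> Z" "z \<in> V - {y} - Z" "nb x z" using nb_conn[OF y(1) _ Z(2)] by blast
    have "z \<notin> L" using no[of z x] nb_sym[OF xz(3)] xz(1) Z by blast
    then show ?thesis using xz by blast
  qed
  fix Z assume Z: "Z \<subseteq> ?A" "Z \<noteq> {}" "Z \<noteq> ?A"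
  consider "Z \<inter> B = {}" | "B \<subseteq> Z" | "Z \<inter> B \<noteq> {}" "Z \<inter> B \<noteq> B" by blast
  then show "\<exists>x\<in>Z. \<exists>z\<in>?A - Z. nb x z"
  proof cases
    case 2
    then have "?A - Z \<noteq> {}" "(?A - Z) \<inter> B = {}" using Z by auto
    then obtain x z where "x \<in> ?A - Z" "z \<in> ?A - (?A - Z)" "nb x z" using free[of "?A - Z"] by blast
    then show ?thesis using nb_sym by blast
  next
    case 3
    then obtain x z where "x \<in> Z \<inter> B" "z \<in> B - Z \<inter> B" "nb x z" using csetD[OF B(1), of "Z \<inter> B"] by auto
    then show ?thesis using BA by blast
  qed (use free Z in blast)
qed

text \<open>Peels off a vertex v with at most one neighbour in L and y. Unless v is all of L, that
  neighbour lies in L, so removing v keeps L connected and does not change the neighbours of y in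
  L.\<close>

lemma pendant_tree:
  assumes "finite L" "cset L" "y \<notin> L"
    and "\<And>Z. Z \<subseteq> L \<Longrightarrow> Z \<noteq> {} \<Longrightarrow> \<exists>v\<in>Z. card (N v \<inter> insert y Z) \<le> 1"
  shows "card (N y \<inter> L) \<le> 1"
  using assms
proof (induction L rule: finite_psubset_induct)
  case (psubset L)
  have "L \<noteq> {}" using psubset.prems(1) by (simp add: cset_def)
  then obtain v where v: "v \<in> L" "card (N v \<inter> insert y L) \<le> 1" using psubset.prems(3)[of L] by blast
  have uniq: "a = b" if "nb v a" "nb v b" "a \<in> insert y L" "b \<in> insert y L" for a b
    using v(2) that card_le_Suc0_iff_eq[of "N v \<inter> insert y L"] finite_N by auto
  show ?case
  proof (cases "L = {v}")
    case True
    then have "N y \<inter> L \<subseteq> {v}" by blast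
    then show ?thesis using card_mono[of "{v}"] by auto
  next
    case False
    then obtain u where u: "u \<in> L" "u \<noteq> v" "nb v u" using csetD[OF psubset.prems(1), of "{v}"] v(1) by blast
    have vy: "\<not> nb v y" using uniq[OF u(3), of y] u(1) psubset.prems(2) by auto
    have c: "cset (L - {v})"
    proof (rule cset_avoid[of u])
      show "u \<in> L - {v}" using u by simp
      fix Z assume Z: "Z \<subseteq> L - {v}" "Z \<noteq> {}" "u \<notin> Z"
      then obtain x z where xz: "x \<in> Z" "z \<in> L - Z" "nb x z" using csetD[OF psubset.prems(1), of Z] u by blast
      have "z \<noteq> v"
      proof
        assume "z = v"
        then have "x = u" using uniq[of x u] nb_sym[OF xz(3)] u xz Z by auto
        then show False using xz Z by simp
      qed
      then show "\<exists>x\<in>Z. \<exists>z\<in>L - {v} - Z. nb x z" using xz by blast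
    qed
    have "card (N y \<inter> (L - {v})) \<le> 1"
      using v(1) psubset.prems(2,3) by (intro psubset.IH[OF _ c]) auto
    moreover have "N y \<inter> (L - {v}) = N y \<inter> L" using vy nb_sym by blast
    ultimately show ?thesis by simp
  qed
qed

text \<open>For adjacent r and y take a component L of the graph without r and y. A vertex of L has
  at most r as a neighbour outside L and y, so degree three leaves two neighbours inside.\<close>

lemma initial_state: "\<exists>y K. state y K \<and> rooted_core y K"
proof -
  obtain r where r: "r \<in> V" using V_ne by blast
  have c3: "3 \<le> card (N r)" using degree[OF r] .
  then have "N r \<noteq> {}" by (metis card.empty not_numeral_le_zero)
  then obtain y where y: "nb r y" by blast
  have yV: "y \<in> V" "y \<noteq> r" using y nb_in nb_irrefl by blast+
  have "\<not> N r \<subseteq> {y}" using c3 card_mono[of "{y}" "N r"] by auto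
  then obtain z where "z \<in> V - {r, y}" using nb_in nb_irrefl by blast
  then obtain L where L: "L \<subseteq> V - {r, y}" "z \<in> L" "cset L" "\<And>l s. l \<in> L \<Longrightarrow> s \<in> V - {r, y} - L \<Longrightarrow> \<not> nb l s"
    using component[of z "V - {r, y}"] by blast
  have A: "cset (V - L - {y})"
    by (rule complement_cset[of y "{r}"]) (use yV r L cset_singleton in auto)
  have "L \<noteq> V - {r}" "L \<noteq> {}" "L \<subseteq> V - {r}" using L yV by auto
  then obtain l s where ls: "l \<in> L" "s \<in> V - {r} - L" "nb l s" using nb_conn[OF r, of L] by blast
  then have "s = y" using L(4)[of l s] by blast
  then have yL: "adjacent {y} L" using ls nb_sym by blast
  have "adjacent {y} (V - L - {y})" using nb_sym[OF y] r L yV by blast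
  then have "state y L" using yV L A yL by (auto simp: state_def)
  moreover have "rooted_core y L"
    unfolding rooted_core_def
  proof (intro exI conjI ballI)
    show "L \<subseteq> L" "L \<noteq> {}" using L by auto
    fix v assume v: "v \<in> L"
    have "N v - {r} \<subseteq> N v \<inter> insert y L" using L(4)[OF v] nb_in[of v] by blast
    then have "card (N v - {r}) \<le> card (N v \<inter> insert y L)" by (intro card_mono) (auto simp: finite_N)
    moreover have "3 \<le> card (N v)" using degree v L by blast
    moreover have "card (N v) \<le> Suc (card (N v - {r}))" by (rule card_N_le)
    ultimately show "2 \<le> card (N v \<inter> insert y L)" by linarith
  qed
  ultimately show ?thesis by blast
qed

lemma k4_partition:
  obtains A y S1 S2 where "cset A" "cset S1" "cset S2" "y \<in> V"
    "V = A \<union> {y} \<union> S1 \<union> S2" "A \<inter> S1 = {}" "A \<inter> S2 = {}" "S1 \<inter> S2 = {}" "y \<notin> A" "y \<notin> S1" "y \<notin> S2"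
    "adjacent {y} A" "adjacent {y} S1" "adjacent {y} S2" "adjacent S1 A" "adjacent S2 A" "adjacent S1 S2"
proof -
  let ?P = "\<lambda>p. state (fst p) (snd p) \<and> rooted_core (fst p) (snd p)"
  obtain p where "?P p" "\<And>q. ?P q \<Longrightarrow> card (snd p) \<le> card (snd q)"
    using ex_has_least_nat[of ?P _ "\<lambda>p. card (snd p)"] initial_state by (metis fst_conv snd_conv)
  then obtain y K where st: "state y K" and core: "rooted_core y K"
    and least: "\<And>y' K'. state y' K' \<Longrightarrow> rooted_core y' K' \<Longrightarrow> card K \<le> card K'"
    by (metis fst_conv snd_conv)
  define A where "A = V - K - {y}"
  have s: "y \<in> V" "K \<subseteq> V - {y}" "cset K" "cset A" "adjacent {y} K" "adjacent {y} A"
    using st by (auto simp: state_def A_def)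
  have finK: "finite K" using s(2) finite_V finite_subset by blast
  obtain y' where y': "y' \<in> K" "nb y y'" using s(5) by blast
  have NV: "u \<in> A \<or> u = y \<or> u \<in> K" if "nb v u" for v u using nb_in[OF that] by (auto simp: A_def)
  \<comment> \<open>Each component L of K without y' yields a smaller state, so minimality denies it
    a core. Some vertex of L then has at most one neighbour in L and y'; of its three neighbours
    only y can be another, so one lies in A.\<close>
  have comp: "\<not> rooted_core y' L \<and> adjacent L A \<and> adjacent {y'} L"
    if L: "L \<subseteq> K - {y'}" "cset L" "\<And>l s. l \<in> L \<Longrightarrow> s \<in> K - {y'} - L \<Longrightarrow> \<not> nb l s" for L
  proof -
    have Lne: "L \<noteq> {}" using L(2) by (simp add: cset_def)
    then obtain l s where ls: "l \<in> L" "s \<in> K - L" "nb l s" using csetD[OF s(3), of L] L(1) y' by blast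
    then have "s = y'" using L(3)[of l s] by blast
    then have a1: "adjacent {y'} L" using ls nb_sym by blast
    obtain a where a: "a \<in> A" "nb y a" using s(6) by blast
    have cB: "cset (insert y A)" using cset_insert[OF s(4) a(1) nb_sym[OF a(2)]] .
    have "cset (V - L - {y'})"
      by (rule complement_cset[of y' "insert y A"]) (use y' s L cB in \<open>auto simp: A_def\<close>)
    moreover have "adjacent {y'} (V - L - {y'})" using nb_sym[OF y'(2)] s(1,2) L(1) y'(1) by blast
    ultimately have "state y' L" using L(1,2) y'(1) s(2) a1 by (auto simp: state_def)
    moreover have "card L < card K" using L(1) y'(1) finK by (intro psubset_card_mono) auto
    ultimately have nc: "\<not> rooted_core y' L" using least[of y' L] by linarith
    then obtain v where v: "v \<in> L" "\<not> 2 \<le> card (N v \<inter> insert y' L)" using Lne unfolding rooted_core_def by blast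
    have "adjacent L A"
    proof (rule ccontr)
      assume n: "\<not> adjacent L A"
      have "N v - {y} \<subseteq> N v \<inter> insert y' L" using NV[of v] L(3)[OF v(1)] n v(1) by blast
      then have "card (N v - {y}) \<le> card (N v \<inter> insert y' L)" by (intro card_mono) (auto simp: finite_N)
      moreover have "3 \<le> card (N v)" using degree v(1) L(1) s(2) by blast
      moreover have "card (N v) \<le> Suc (card (N v - {y}))" by (rule card_N_le)
      ultimately show False using v(2) by linarith
    qed
    then show ?thesis using nc a1 by blast
  qed
  have sub: "K - {y'} \<subseteq> V" using s(2) by blast
  \<comment> \<open>If y' were the only neighbour of y in K, the core Z would survive in a component
    of K without y', against minimality, or consist of y' alone, which then has too few
    neighbours.\<close>
  have "\<exists>x\<in>K. nb y x \<and> x \<noteq> y'"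
  proof (rule ccontr)
    assume n: "\<not> ?thesis"
    obtain Z where Z: "Z \<subseteq> K" "Z \<noteq> {}" "\<And>v. v \<in> Z \<Longrightarrow> 2 \<le> card (N v \<inter> insert y Z)"
      using core by (auto simp: rooted_core_def)
    have vy: "\<not> nb v y" if "v \<in> K" "v \<noteq> y'" for v using n that nb_sym by blast
    have "Z \<subseteq> {y'}"
    proof (rule ccontr)
      assume "\<not> Z \<subseteq> {y'}"
      then obtain z where z: "z \<in> Z" "z \<in> K - {y'}" using Z(1) by blast
      then obtain L where L: "L \<subseteq> K - {y'}" "z \<in> L" "cset L" "\<And>l s. l \<in> L \<Longrightarrow> s \<in> K - {y'} - L \<Longrightarrow> \<not> nb l s"
        using component[OF z(2) sub] by blast
      have "rooted_core y' L"
        unfolding rooted_core_def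
      proof (intro exI conjI ballI)
        show "Z \<inter> L \<subseteq> L" "Z \<inter> L \<noteq> {}" using z L by auto
        fix v assume v: "v \<in> Z \<inter> L"
        have "N v \<inter> insert y Z \<subseteq> N v \<inter> insert y' (Z \<inter> L)"
          using vy[of v] v L(1) L(4)[of v] Z(1) by blast
        then have "card (N v \<inter> insert y Z) \<le> card (N v \<inter> insert y' (Z \<inter> L))"
          by (intro card_mono) (auto simp: finite_N)
        then show "2 \<le> card (N v \<inter> insert y' (Z \<inter> L))" using Z(3)[OF IntD1[OF v]] by linarith
      qed
      then show False using comp[OF L(1,3,4)] by blast
    qed
    then have "Z = {y'}" using Z(2) by blast
    then have "N y' \<inter> insert y Z \<subseteq> {y}" using nb_irrefl by blast
    then have "card (N y' \<inter> insert y Z) \<le> 1" using card_mono[of "{y}" "N y' \<inter> insert y Z"] by simp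
    then show False using Z(3)[of y'] \<open>Z = {y'}\<close> by simp
  qed
  then obtain x where x: "x \<in> K - {y'}" "nb y x" by blast
  obtain L where L: "L \<subseteq> K - {y'}" "x \<in> L" "cset L" "\<And>l s. l \<in> L \<Longrightarrow> s \<in> K - {y'} - L \<Longrightarrow> \<not> nb l s"
    using component[OF x(1) sub] by blast
  have cL: "\<not> rooted_core y' L" "adjacent L A" "adjacent {y'} L" using comp[OF L(1,3,4)] by auto
  let ?S = "K - L"
  have y'S: "y' \<in> ?S" using y'(1) L(1) by blast
  have cS: "cset ?S"
  proof (rule cset_avoid[OF y'S])
    fix Z assume Z: "Z \<subseteq> ?S" "Z \<noteq> {}" "y' \<notin> Z"
    then obtain a b where ab: "a \<in> Z" "b \<in> K - Z" "nb a b" using csetD[OF s(3), of Z] y'(1) by blast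
    have "b \<notin> L" using L(4)[of b a] nb_sym[OF ab(3)] ab(1) Z by blast
    then show "\<exists>a\<in>Z. \<exists>b\<in>?S - Z. nb a b" using ab by blast
  qed
  \<comment> \<open>A second component supplies the edge to A. If there is none, the part is y'
    alone: y' has at most one neighbour in L, by \<open>pendant_tree\<close>, and besides it only y,
    so its third neighbour lies in A.\<close>
  have SA: "adjacent ?S A"
  proof (cases "K - {y'} = L")
    case False
    then obtain z where z: "z \<in> K - {y'}" "z \<notin> L" using L(1) by blast
    obtain M where M: "M \<subseteq> K - {y'}" "z \<in> M" "cset M" "\<And>l s. l \<in> M \<Longrightarrow> s \<in> K - {y'} - M \<Longrightarrow> \<not> nb l s"
      using component[OF z(1) sub] by blast
    have "M \<inter> L = {}"
    proof (rule ccontr)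
      assume ne: "M \<inter> L \<noteq> {}"
      have "M \<inter> L \<noteq> M" using M(2) z(2) by blast
      then obtain a b where "a \<in> M \<inter> L" "b \<in> M - M \<inter> L" "nb a b" using csetD[OF M(3), of "M \<inter> L"] ne by blast
      then show False using L(4)[of a b] M(1) by blast
    qed
    then show ?thesis using comp[OF M(1,3,4)] M(1) by blast
  next
    case True
    show ?thesis
    proof (rule ccontr)
      assume n: "\<not> ?thesis"
      have "card (N y' \<inter> L) \<le> 1"
      proof (rule pendant_tree)
        show "finite L" using L(1) finK by (auto intro: finite_subset)
        show "cset L" "y' \<notin> L" using L by auto
        fix Z assume "Z \<subseteq> L" "Z \<noteq> {}"
        then obtain v where "v \<in> Z" "\<not> 2 \<le> card (N v \<inter> insert y' Z)" using cL(1) unfolding rooted_core_def by blast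
        then show "\<exists>v\<in>Z. card (N v \<inter> insert y' Z) \<le> 1" by (intro bexI[of _ v]) linarith
      qed
      moreover have "N y' - {y} \<subseteq> N y' \<inter> L" using NV[of y'] n y'S True nb_irrefl by blast
      then have "card (N y' - {y}) \<le> card (N y' \<inter> L)" by (intro card_mono) (auto simp: finite_N)
      moreover have "3 \<le> card (N y')" using degree y'(1) s(2) by blast
      moreover have "card (N y') \<le> Suc (card (N y' - {y}))" by (rule card_N_le)
      ultimately show False by linarith
    qed
  qed
  show thesis
  proof (rule that[of A ?S L y])
    show "V = A \<union> {y} \<union> ?S \<union> L" using s(1,2) L(1) by (auto simp: A_def)
    show "A \<inter> ?S = {}" "A \<inter> L = {}" "y \<notin> A" "y \<notin> ?S" "y \<notin> L" "?S \<inter> L = {}" using s(2) L(1) by (auto simp: A_def)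
    show "adjacent {y} ?S" using y' y'S by blast
    show "adjacent {y} L" using x L(2) by blast
    show "adjacent ?S L" using cL(3) y'S by blast
  qed (use s cS L(3) SA cL in auto)
qed

end

subsection \<open>The face of a complete graph on four vertices\<close>

text \<open>Coordinate b is nonzero only in the difference belonging to b, which gives independence
  one element at a time.\<close>

lemma independent_edge_differences:
  assumes "fin_dim F" "finite B" "a \<notin> B" "\<And>b. b \<in> B \<Longrightarrow> unit_vec a - unit_vec b \<in> dirs F"
  shows "card B \<le> polytope_dim F"
proof -
  let ?W = "(\<lambda>b. unit_vec a - unit_vec b :: 'a \<Rightarrow>\<^sub>0 real) ` B"
  have "dim ?W = card B"
    using assms(2,3)
  proof (induction B rule: finite_induct)
    case empty
    have "dim ({} :: ('a \<Rightarrow>\<^sub>0 real) set) = card ({} :: ('a \<Rightarrow>\<^sub>0 real) set)"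
      by (rule dim_eq_card_independent) (rule independent_empty)
    then show ?case by simp
  next
    case (insert b B)
    let ?W = "(\<lambda>b. unit_vec a - unit_vec b :: 'a \<Rightarrow>\<^sub>0 real) ` B"
    have "?W \<subseteq> {x. lk x b = 0}" using insert.hyps insert.prems by (auto simp: lookup_minus lookup_single when_def)
    moreover have "subspace {x. lk x b = 0}" by (rule subspaceI) (auto simp: lookup_add)
    ultimately have "span ?W \<subseteq> {x. lk x b = 0}" by (rule span_minimal)
    moreover have "lk (unit_vec a - unit_vec b :: 'a \<Rightarrow>\<^sub>0 real) b \<noteq> 0"
      using insert.prems by (auto simp: lookup_minus lookup_single when_def)
    ultimately have "unit_vec a - unit_vec b \<notin> span ?W" by blast
    moreover have "fin_dim ?W" unfolding fin_dim_def
      by (intro exI[of _ ?W] conjI finite_imageI insert.hyps(1) span_superset)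
    ultimately show ?case using insert by (simp add: dim_insert_fin)
  qed
  moreover have "?W \<subseteq> dirs F" using assms(4) by blast
  then have "dim ?W \<le> dim (dirs F)" by (intro dim_mono_fin[OF fin_dim_dirs[OF assms(1)]] subset_trans[OF _ span_superset])
  ultimately show ?thesis by (simp add: polytope_dim_dirs)
qed

lemma poly_of_dim_le:
  assumes "finite U" and diff: "\<And>X Y. X \<in> N \<Longrightarrow> Y \<in> N \<Longrightarrow> char_vec X - char_vec Y \<in> span U"
  shows "polytope_dim (poly_of N) \<le> card U"
proof (cases "N = {}")
  case True
  then have "dirs (poly_of N) \<subseteq> span U" by (simp add: poly_of_def dirs_def)
  then show ?thesis unfolding polytope_dim_dirs by (rule dim_le_card[OF _ assms(1)])
next
  case False
  then obtain Y where Y: "Y \<in> N" by blast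
  have c: "convex {x. x - char_vec Y \<in> span U}" unfolding convex_alt
  proof (clarify)
    fix x y and u :: real assume h: "x - char_vec Y \<in> span U" "y - char_vec Y \<in> span U"
    have "(1 - u) *\<^sub>R x + u *\<^sub>R y - char_vec Y = (1 - u) *\<^sub>R (x - char_vec Y) + u *\<^sub>R (y - char_vec Y)"
      by (simp add: algebra_simps)
    then show "(1 - u) *\<^sub>R x + u *\<^sub>R y - char_vec Y \<in> span U"
      using span_add[OF span_scale[OF h(1)] span_scale[OF h(2)]] by simp
  qed
  have "char_vec ` N \<subseteq> {x. x - char_vec Y \<in> span U}" using diff[OF _ Y] by blast
  then have "poly_of N \<subseteq> {x. x - char_vec Y \<in> span U}" unfolding poly_of_def using c by (rule hull_minimal)
  then have s: "x - char_vec Y \<in> span U" if "x \<in> poly_of N" for x using that by blast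
  have "dirs (poly_of N) \<subseteq> span U"
  proof
    fix d assume "d \<in> dirs (poly_of N)"
    then obtain x y where "d = x - y" "x \<in> poly_of N" "y \<in> poly_of N" by (auto simp: dirs_def)
    then show "d \<in> span U" using span_diff[OF s[of x] s[of y]] by simp
  qed
  then show ?thesis unfolding polytope_dim_dirs by (rule dim_le_card[OF _ assms(1)])
qed

definition doubletons :: "nat set set" where
  "doubletons = {d. d \<subseteq> {..<4} \<and> card d = 2}"

text \<open>The spanning trees of K_4 on the vertices 0 to 3, each edge being its own set of
  ends.\<close>

definition k4_trees :: "nat set set set" where
  "k4_trees = {R. R \<subseteq> doubletons \<and> card R = 3 \<and> cut_conn {..<4} id R}"

text \<open>A naming of the four vertices. Up to naming, K_4 has two spanning trees, the star and
  the path.\<close>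

locale four =
  fixes i j k l :: nat
  assumes four: "distinct [i, j, k, l]" "{i, j, k, l} = {..<4}"
begin

lemma ne: "i \<noteq> j" "i \<noteq> k" "i \<noteq> l" "j \<noteq> i" "j \<noteq> k" "j \<noteq> l" "k \<noteq> i" "k \<noteq> j" "k \<noteq> l" "l \<noteq> i" "l \<noteq> j" "l \<noteq> k"
  using four(1) by auto

lemma lt: "i < 4" "j < 4" "k < 4" "l < 4"
  using four(2) by auto

lemma star: "{{i, j}, {i, k}, {i, l}} \<in> k4_trees"
proof -
  have "cut_conn {..<4} id {{i, j}, {i, k}, {i, l}}"
  proof (rule cut_connI)
    fix Z assume Z: "Z \<subseteq> {..<4::nat}" "Z \<noteq> {}" "Z \<noteq> {..<4}"
    show "\<exists>e\<in>{{i, j}, {i, k}, {i, l}}. crosses id Z e"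
    proof (rule ccontr)
      assume "\<not> ?thesis"
      then have "(i \<in> Z) = (j \<in> Z)" "(i \<in> Z) = (k \<in> Z)" "(i \<in> Z) = (l \<in> Z)" by (auto simp: crosses_def)
      then show False using Z unfolding four(2)[symmetric] by blast
    qed
  qed (simp add: lessThan_empty_iff)
  then show ?thesis using ne lt by (auto simp: k4_trees_def doubletons_def doubleton_eq_iff)
qed

lemma path: "{{i, j}, {j, k}, {k, l}} \<in> k4_trees"
proof -
  have "cut_conn {..<4} id {{i, j}, {j, k}, {k, l}}"
  proof (rule cut_connI)
    fix Z assume Z: "Z \<subseteq> {..<4::nat}" "Z \<noteq> {}" "Z \<noteq> {..<4}"
    show "\<exists>e\<in>{{i, j}, {j, k}, {k, l}}. crosses id Z e"
    proof (rule ccontr)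
      assume "\<not> ?thesis"
      then have "(i \<in> Z) = (j \<in> Z)" "(j \<in> Z) = (k \<in> Z)" "(k \<in> Z) = (l \<in> Z)" by (auto simp: crosses_def)
      then show False using Z unfolding four(2)[symmetric] by blast
    qed
  qed (simp add: lessThan_empty_iff)
  then show ?thesis using ne lt by (auto simp: k4_trees_def doubletons_def doubleton_eq_iff)
qed

end

lemma four_perm:
  assumes "four i j k l"
  shows "four j i k l" "four i k j l" "four i j l k"
  using assms by (auto simp: four_def)

lemma four_of_doubleton:
  assumes "d \<in> doubletons" obtains i j k l where "d = {i, j}" "four i j k l"
proof -
  have d: "d \<subseteq> {..<4}" "card d = 2" using assms by (auto simp: doubletons_def)
  obtain i j where ij: "d = {i, j}" "i \<noteq> j" using d(2) by (auto simp: card_2_iff)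
  have "card ({..<4} - d) = 2" using d finite_subset[OF d(1)] by (simp add: card_Diff_subset)
  then obtain k l where kl: "{..<4} - d = {k, l}" "k \<noteq> l" by (auto simp: card_2_iff)
  then have "k \<noteq> i" "k \<noteq> j" "l \<noteq> i" "l \<noteq> j" using ij by auto
  moreover have "{i, j, k, l} = {..<4}" using kl(1) ij(1) d(1) by auto
  ultimately show thesis using ij kl(2) by (intro that[of i j k l]) (auto simp: four_def)
qed

lemma four_of_two_doubletons:
  assumes d: "d \<in> doubletons" "d' \<in> doubletons" "d \<noteq> d'"
  obtains i j k l where "four i j k l" "d = {i, j}" "d' = {k, l} \<or> d' = {i, k}"
proof -
  obtain i j k l where h: "d = {i, j}" "four i j k l" by (rule four_of_doubleton[OF d(1)])
  interpret four i j k l by fact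
  obtain a b where ab: "d' = {a, b}" "a \<noteq> b" using d(2) by (auto simp: doubletons_def card_2_iff)
  have "a \<in> {i, j, k, l}" "b \<in> {i, j, k, l}" using d(2) ab four(2) by (auto simp: doubletons_def)
  then consider "d' = {k, l}" | "d' = {i, k}" | "d' = {i, l}" | "d' = {j, k}" | "d' = {j, l}"
    using ab d(3) h(1) by auto
  then show thesis
  proof cases
    case 3
    then show thesis using h four_perm(3)[OF h(2)] by (intro that[of i j l k]) auto
  next
    case 4
    then show thesis using h four_perm(1)[OF h(2)] by (intro that[of j i k l]) auto
  next
    case 5
    then show thesis using h four_perm(1)[OF four_perm(3)[OF h(2)]] by (intro that[of j i l k]) auto
  qed (use h that in auto)
qed

text \<open>The members of \<open>N\<close> that contain \<open>C\<close> and otherwise use only six elements indexed by the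
  edges of $K_4$ span an exposed face. It is a copy of the base polytope of $M(K_4)$, and the rank
  of a face bounds the rank of the whole polytope from below.\<close>

locale k4_face =
  fixes E :: "'e set" and N :: "'e set set" and C :: "'e set" and ed :: "nat set \<Rightarrow> 'e"
  assumes fin: "finite E" and NE: "N \<subseteq> Pow E" and C: "C \<subseteq> E" and edE: "d \<in> doubletons \<Longrightarrow> ed d \<in> E - C"
    and inj: "inj_on ed doubletons"
    and trees: "R \<in> k4_trees \<Longrightarrow> C \<union> ed ` R \<in> N"
    and card_N: "X \<in> N \<Longrightarrow> card X = card C + 3"
begin

definition "NF = {X \<in> N. C \<subseteq> X \<and> X \<subseteq> C \<union> ed ` doubletons}"
abbreviation "F \<equiv> poly_of NF"

lemma finite_doubletons: "finite doubletons"
  by (rule finite_subset[of _ "Pow {..<4}"]) (auto simp: doubletons_def)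

lemma card_doubletons: "card doubletons = 6"
  using n_subsets[of "{..<4::nat}" 2] by (simp add: doubletons_def numeral_eq_Suc)

lemma finite_mem: "X \<in> N \<Longrightarrow> finite X"
  using NE fin finite_subset by blast

lemma NF_sys: "NF \<subseteq> Pow E" "finite NF"
proof -
  show "NF \<subseteq> Pow E" using NE by (auto simp: NF_def)
  then show "finite NF" using finite_system[OF fin] by blast
qed

lemma tree_in: "R \<in> k4_trees \<Longrightarrow> C \<union> ed ` R \<in> NF"
  using trees by (auto simp: NF_def k4_trees_def)

lemma ed_mem: "R \<in> k4_trees \<Longrightarrow> d \<in> doubletons \<Longrightarrow> ed d \<in> C \<union> ed ` R \<longleftrightarrow> d \<in> R"
  using edE[of d] inj_on_image_mem_iff[OF inj, of d R] by (auto simp: k4_trees_def)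

text \<open>The functional weighs C by -1, the six elements by 0 and all others by 1. On members of
  N it is at least minus the size of C, with equality exactly on \<open>NF\<close>.\<close>

lemma exposed_F: "exposed F (poly_of N)"
proof -
  define g :: "('e \<Rightarrow>\<^sub>0 real) \<Rightarrow> real" where
    "g = (\<lambda>x. \<Sum>e\<in>E. (if e \<in> C then - 1 else if e \<in> ed ` doubletons then 0 else 1) * lk x e)"
  have lin: "linear g" unfolding g_def
    by (rule linearI) (auto simp: lookup_add algebra_simps sum.distrib[symmetric] sum_distrib_left intro!: sum.cong)
  have gX: "g (char_vec X) = - real (card (X \<inter> C)) + real (card (X - C - ed ` doubletons))" if X: "X \<in> N" for X
  proof -
    have XE: "X \<subseteq> E" using NE X by blast
    have "g (char_vec X) = (\<Sum>e\<in>E. (if e \<in> X \<inter> C then - 1 else 0) + (if e \<in> X - C - ed ` doubletons then 1 else 0))"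
      unfolding g_def using finite_mem[OF X] by (intro sum.cong refl) (auto simp: lookup_char_vec)
    also have "\<dots> = (\<Sum>e\<in>E. if e \<in> X \<inter> C then - 1 else 0) + (\<Sum>e\<in>E. if e \<in> X - C - ed ` doubletons then 1 else 0)"
      by (rule sum.distrib)
    also have "(\<Sum>e\<in>E. if e \<in> X \<inter> C then - 1 else (0::real)) = (\<Sum>e\<in>X \<inter> C. - 1)"
      using XE fin by (intro sum.mono_neutral_cong_right) auto
    also have "(\<Sum>e\<in>E. if e \<in> X - C - ed ` doubletons then 1 else (0::real)) = (\<Sum>e\<in>X - C - ed ` doubletons. 1)"
      using XE fin by (intro sum.mono_neutral_cong_right) auto
    finally show ?thesis by simp
  qed
  have finC: "finite C" using C fin finite_subset by blast
  have ge: "- real (card C) \<le> g (char_vec X)" and eq: "g (char_vec X) = - real (card C) \<longleftrightarrow> X \<in> NF"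
    if X: "X \<in> N" for X
  proof -
    have le: "card (X \<inter> C) \<le> card C" using finC by (intro card_mono) auto
    then show "- real (card C) \<le> g (char_vec X)" unfolding gX[OF X] by linarith
    have "g (char_vec X) = - real (card C) \<longleftrightarrow> card (X \<inter> C) = card C \<and> card (X - C - ed ` doubletons) = 0"
      unfolding gX[OF X] using le by auto
    also have "card (X \<inter> C) = card C \<longleftrightarrow> C \<subseteq> X"
      using card_subset_eq[OF finC, of "X \<inter> C"] by (auto simp: Int_absorb1)
    also have "card (X - C - ed ` doubletons) = 0 \<longleftrightarrow> X \<subseteq> C \<union> ed ` doubletons"
      using finite_mem[OF X] by auto
    finally show "g (char_vec X) = - real (card C) \<longleftrightarrow> X \<in> NF" using X by (auto simp: NF_def)
  qed
  define F' where "F' = {x \<in> poly_of N. g x = - real (card C)}"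
  have bound: "\<forall>x\<in>poly_of N. - real (card C) \<le> g x"
    unfolding poly_of_def using linear_ge_hull[OF lin, of "char_vec ` N"] ge by blast
  have ex: "exposed F' (poly_of N)" unfolding exposed_def F'_def using lin bound by blast
  have "finite (char_vec ` N)" using finite_system[OF fin NE] by simp
  from exposed_hull_eq[OF this ex[unfolded poly_of_def]]
  have "F' = convex hull (F' \<inter> char_vec ` N)" .
  also have "F' \<inter> char_vec ` N = char_vec ` NF"
    unfolding F'_def using eq poly_of_inc by (auto simp: NF_def)
  finally have "F' = F" by (simp add: poly_of_def)
  then show ?thesis using ex by simp
qed

lemma dirs_exchange:
  assumes R: "insert a R \<in> k4_trees" "insert b R \<in> k4_trees" "a \<notin> R" "b \<notin> R"
    and P: "char_vec (C \<union> ed ` insert a R) \<in> P" "char_vec (C \<union> ed ` insert b R) \<in> P"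
  shows "unit_vec (ed a) - unit_vec (ed b) \<in> dirs P"
proof -
  have sub: "insert a R \<subseteq> doubletons" "insert b R \<subseteq> doubletons" using R by (auto simp: k4_trees_def)
  have finR: "finite (C \<union> ed ` R)" 
    using finite_subset[OF C fin] finite_subset[OF sub(1) finite_doubletons] by simp
  have "char_vec (C \<union> ed ` insert d R) = unit_vec (ed d) + char_vec (C \<union> ed ` R)"
    if d: "d \<in> doubletons" "d \<notin> R" for d
  proof -
    have "R \<subseteq> doubletons" using sub(1) by simp
    then have "ed d \<notin> ed ` R" using inj_on_image_mem_iff[OF inj d(1)] d(2) by simp
    then have "ed d \<notin> C \<union> ed ` R" using edE[OF d(1)] by blast
    from char_vec_insert[OF finR this] show ?thesis by simp
  qed
  then have "char_vec (C \<union> ed ` insert a R) - char_vec (C \<union> ed ` insert b R) = unit_vec (ed a) - unit_vec (ed b)"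
    using sub R(3,4) by simp
  then show ?thesis using dirs_I[OF P] by simp
qed

lemma bounds: "x \<in> F \<Longrightarrow> 0 \<le> lk x e" "x \<in> F \<Longrightarrow> lk x e \<le> 1"
  using poly_of_bounds[OF fin NF_sys(1)] by auto

lemma in_zero: "R \<in> k4_trees \<Longrightarrow> d \<in> doubletons \<Longrightarrow> char_vec (C \<union> ed ` R) \<in> zero_face (ed d) F \<longleftrightarrow> d \<notin> R"
  and in_one: "R \<in> k4_trees \<Longrightarrow> d \<in> doubletons \<Longrightarrow> char_vec (C \<union> ed ` R) \<in> one_face (ed d) F \<longleftrightarrow> d \<in> R"
  using char_vec_in_zero_face[OF tree_in, of R "ed d"] ed_mem[of R d] finite_mem[OF trees, of R] by auto

text \<open>Every member of \<open>NF\<close> consists of C and exactly three of the six elements,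
  so differences of members are combinations of the five vectors comparing \<open>ed d\<close> with
  a fixed \<open>ed d0\<close>.\<close>

lemma dim_F_le: "polytope_dim F \<le> 5"
proof -
  have "{0, 1} \<in> doubletons" by (auto simp: doubletons_def)
  then obtain d0 where d0: "d0 \<in> doubletons" by blast
  let ?U = "(\<lambda>d. unit_vec (ed d) - unit_vec (ed d0) :: 'e \<Rightarrow>\<^sub>0 real) ` (doubletons - {d0})"
  have finU: "finite ?U" using finite_doubletons by simp
  have U: "unit_vec e - unit_vec (ed d0) \<in> span ?U" if e: "e \<in> ed ` doubletons" for e
  proof -
    obtain d where d: "d \<in> doubletons" "e = ed d" using e by blast
    show ?thesis
    proof (cases "d = d0")
      case True
      then show ?thesis using d by (simp add: span_zero)
    next
      case False
      then show ?thesis using d by (intro span_base) blast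
    qed
  qed
  have rep: "char_vec X - char_vec C - 3 *\<^sub>R unit_vec (ed d0) \<in> span ?U" if X: "X \<in> NF" for X
  proof -
    have h: "C \<subseteq> X" "X - C \<subseteq> ed ` doubletons" "finite X" "card X = card C + 3"
      using X card_N finite_mem by (auto simp: NF_def)
    have finC: "finite C" using h(1,3) finite_subset by blast
    have c3: "card (X - C) = 3" using h finC by (simp add: card_Diff_subset)
    have "char_vec X = char_vec C + char_vec (X - C)"
      unfolding char_vec_def using sum.subset_diff[OF h(1,3), of unit_vec] by (simp add: add.commute)
    moreover have "char_vec (X - C) = (\<Sum>e\<in>X - C. unit_vec e - unit_vec (ed d0)) + 3 *\<^sub>R unit_vec (ed d0)"
    proof -
      have "(\<Sum>e\<in>X - C. unit_vec (ed d0) :: 'e \<Rightarrow>\<^sub>0 real) = 3 *\<^sub>R unit_vec (ed d0)"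
        using c3 sum_constant_scaleR[of "unit_vec (ed d0) :: 'e \<Rightarrow>\<^sub>0 real" "X - C"] by simp
      then show ?thesis by (simp add: char_vec_def sum_subtractf)
    qed
    ultimately have "char_vec X - char_vec C - 3 *\<^sub>R unit_vec (ed d0) = (\<Sum>e\<in>X - C. unit_vec e - unit_vec (ed d0))"
      by (simp add: algebra_simps)
    then show ?thesis using h(2) U by (auto intro!: span_sum)
  qed
  have "char_vec X - char_vec Y \<in> span ?U" if "X \<in> NF" "Y \<in> NF" for X Y
    using span_diff[OF rep[OF that(1)] rep[OF that(2)]] by simp
  then have "polytope_dim F \<le> card ?U" by (rule poly_of_dim_le[OF finU])
  also have "\<dots> \<le> card (doubletons - {d0})" by (rule card_image_le) (use finite_doubletons in simp)
  also have "\<dots> = 5" using d0 card_doubletons by simp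
  finally show ?thesis .
qed

lemma card_four_image:
  assumes "distinct ds" "set ds \<subseteq> doubletons" "length ds = 4"
  shows "card (ed ` set ds) = 4" "finite (ed ` set ds)"
  using card_image[OF inj_on_subset[OF inj assms(2)]] assms by (simp_all add: distinct_card)

text \<open>As F has dimension at most 5, a proper exposed face of dimension at least 4 is a facet,
  and the dimension of F comes out as exactly 5.\<close>

lemma facet_if_dim:
  assumes "exposed H F" "H \<noteq> F" "H \<noteq> {}" "4 \<le> polytope_dim H"
  shows "H \<in> xfacets F" "polytope_dim F = 5"
proof -
  have "polytope_dim H < polytope_dim F"
    by (rule exposed_dim_less[OF assms(1) convex_poly_of fin_dim_poly_of[OF NF_sys(2)] assms(3,2)])
  then have "polytope_dim F = 5" "polytope_dim H = 4" using dim_F_le assms(4) by linarith+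
  then show "H \<in> xfacets F" "polytope_dim F = 5" using assms by (auto simp: xfacets_def)
qed

lemma fin_dim_sub: "H \<subseteq> F \<Longrightarrow> fin_dim H"
  using fin_dim_subset[OF fin_dim_poly_of[OF NF_sys(2)]] .

lemma four_perms:
  assumes "four i j k l"
  shows "four j i k l" "four i k j l" "four k i j l" "four k l i j" "four k i l j" "four l k i j" "four j i l k"
    "four l i k j" "four l i j k" "four i k l j" "four i l k j" "four j k i l" "four j l i k" "four l j k i" "four k j i l"
    "four i l j k" "four j k l i" "four j l k i" "four l j i k" "four l k j i" "four k j l i" "four k l j i" "four i j l k"
  using assms by (auto simp: four_def)

lemma zero_facet:
  assumes "d \<in> doubletons"
  shows "zero_face (ed d) F \<in> xfacets F" "polytope_dim F = 5"
proof -
  obtain i j k l where d: "d = {i, j}" and f: "four i j k l" by (rule four_of_doubleton[OF assms])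
  interpret four i j k l by fact
  note p = four_perms[OF f]
  have dd: "{k, l} \<in> doubletons" "{i, l} \<in> doubletons" "{j, l} \<in> doubletons" "{i, k} \<in> doubletons" "{j, k} \<in> doubletons"
    by (simp_all add: doubletons_def lt ne)
  let ?Z = "zero_face (ed d) F"
  have nd: "{i, j} \<noteq> {k, l}" "{i, j} \<noteq> {i, l}" "{i, j} \<noteq> {j, l}" "{i, j} \<noteq> {i, k}" "{i, j} \<noteq> {j, k}"
    by (simp_all add: doubleton_eq_iff ne)
  have mem: "char_vec (C \<union> ed ` R) \<in> ?Z" if "R \<in> k4_trees" "{i, j} \<notin> R" for R
    using in_zero[OF that(1) assms] that(2) d by simp
  \<comment> \<open>t1 and t4 are the stars at k and l; the other trees arise from them by
    exchanging {k, l} for another edge. None contains {i, j}, and the exchanges give four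
    independent directions.\<close>
  have t1: "{{k, l}, {i, k}, {j, k}} \<in> k4_trees" using four.star[OF p(4)] by (simp add: insert_commute)
  have t2: "{{i, l}, {i, k}, {j, k}} \<in> k4_trees" using four.path[OF p(12)] by (simp add: insert_commute)
  have t3: "{{j, l}, {i, k}, {j, k}} \<in> k4_trees" using four.path[OF p(2)] by (simp add: insert_commute)
  have t4: "{{k, l}, {i, l}, {j, l}} \<in> k4_trees" using four.star[OF p(8)] by (simp add: insert_commute)
  have t5: "{{i, k}, {i, l}, {j, l}} \<in> k4_trees" using four.path[OF p(13)] by (simp add: insert_commute)
  have t6: "{{j, k}, {i, l}, {j, l}} \<in> k4_trees" using four.path[OF p(16)] by (simp add: insert_commute)
  have e: "unit_vec (ed {k, l}) - unit_vec (ed x) \<in> dirs ?Z" if "x \<in> {{i, l}, {j, l}, {i, k}, {j, k}}" for x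
  proof -
    have "unit_vec (ed {k, l}) - unit_vec (ed {i, l}) \<in> dirs ?Z"
      by (rule dirs_exchange[OF t1 t2 _ _ mem[OF t1] mem[OF t2]]) (simp_all add: doubleton_eq_iff ne)
    moreover have "unit_vec (ed {k, l}) - unit_vec (ed {j, l}) \<in> dirs ?Z"
      by (rule dirs_exchange[OF t1 t3 _ _ mem[OF t1] mem[OF t3]]) (simp_all add: doubleton_eq_iff ne)
    moreover have "unit_vec (ed {k, l}) - unit_vec (ed {i, k}) \<in> dirs ?Z"
      by (rule dirs_exchange[OF t4 t5 _ _ mem[OF t4] mem[OF t5]]) (simp_all add: doubleton_eq_iff ne)
    moreover have "unit_vec (ed {k, l}) - unit_vec (ed {j, k}) \<in> dirs ?Z"
      by (rule dirs_exchange[OF t4 t6 _ _ mem[OF t4] mem[OF t6]]) (simp_all add: doubleton_eq_iff ne)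
    ultimately show ?thesis using that by (elim insertE emptyE) (simp_all only:)
  qed
  have four': "card (ed ` {{i, l}, {j, l}, {i, k}, {j, k}}) = 4"
    using card_four_image(1)[of "[{i, l}, {j, l}, {i, k}, {j, k}]"] dd by (simp add: doubleton_eq_iff ne)
  have "ed {k, l} \<notin> ed ` {{i, l}, {j, l}, {i, k}, {j, k}}"
    using inj_on_image_mem_iff[OF inj dd(1), of "{{i, l}, {j, l}, {i, k}, {j, k}}"] dd by (simp add: doubleton_eq_iff ne)
  then have "card (ed ` {{i, l}, {j, l}, {i, k}, {j, k}}) \<le> polytope_dim ?Z"
    using e by (intro independent_edge_differences fin_dim_sub) (auto simp: zero_face_def)
  then have dim: "4 \<le> polytope_dim ?Z" using four' by simp
  have "char_vec (C \<union> ed ` {{i, j}, {i, k}, {i, l}}) \<in> F" using poly_of_inc[OF tree_in[OF star]] .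
  moreover have "char_vec (C \<union> ed ` {{i, j}, {i, k}, {i, l}}) \<notin> ?Z" using in_zero[OF star assms] d by simp
  ultimately have "?Z \<noteq> F" by metis
  moreover have "?Z \<noteq> {}" using mem[OF t1] nd by (metis empty_iff insertI1 insert_iff singletonD)
  ultimately show "?Z \<in> xfacets F" "polytope_dim F = 5"
    using facet_if_dim[OF exposed_zero_face[OF bounds(1)] _ _ dim] by auto
qed

lemma one_facet:
  assumes "d \<in> doubletons"
  shows "one_face (ed d) F \<in> xfacets F"
proof -
  obtain i j k l where d: "d = {i, j}" and f: "four i j k l" by (rule four_of_doubleton[OF assms])
  interpret four i j k l by fact
  note p = four_perms[OF f]
  have dd: "{k, l} \<in> doubletons" "{i, l} \<in> doubletons" "{j, l} \<in> doubletons" "{i, k} \<in> doubletons" "{j, k} \<in> doubletons"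
    by (simp_all add: doubletons_def lt ne)
  let ?Z = "one_face (ed d) F"
  have nd: "{i, j} \<noteq> {k, l}" "{i, j} \<noteq> {i, l}" "{i, j} \<noteq> {j, l}" "{i, j} \<noteq> {i, k}" "{i, j} \<noteq> {j, k}"
    by (simp_all add: doubleton_eq_iff ne)
  have mem: "char_vec (C \<union> ed ` R) \<in> ?Z" if "R \<in> k4_trees" "{i, j} \<in> R" for R
    using in_one[OF that(1) assms] that(2) d by simp
  \<comment> \<open>All these trees contain {i, j}; t2, t3 and t4 exchange the edge {i, l} of t1 for
    another one, and t6 that of t5.\<close>
  have t1: "{{i, l}, {i, j}, {k, l}} \<in> k4_trees" using four.path[OF p(7)] by (simp add: insert_commute)
  have t2: "{{i, k}, {i, j}, {k, l}} \<in> k4_trees" using four.path[OF p(1)] by (simp add: insert_commute)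
  have t3: "{{j, k}, {i, j}, {k, l}} \<in> k4_trees" using path by (simp add: insert_commute)
  have t4: "{{j, l}, {i, j}, {k, l}} \<in> k4_trees" using four.path[OF p(23)] by (simp add: insert_commute)
  have t5: "{{i, l}, {i, j}, {i, k}} \<in> k4_trees" using star by (simp add: insert_commute)
  have t6: "{{k, l}, {i, j}, {i, k}} \<in> k4_trees" using t2 by (simp add: insert_commute)
  have e: "unit_vec (ed {i, l}) - unit_vec (ed x) \<in> dirs ?Z" if "x \<in> {{i, k}, {j, k}, {j, l}, {k, l}}" for x
  proof -
    have "unit_vec (ed {i, l}) - unit_vec (ed {i, k}) \<in> dirs ?Z"
      by (rule dirs_exchange[OF t1 t2 _ _ mem[OF t1] mem[OF t2]]) (simp_all add: doubleton_eq_iff ne)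
    moreover have "unit_vec (ed {i, l}) - unit_vec (ed {j, k}) \<in> dirs ?Z"
      by (rule dirs_exchange[OF t1 t3 _ _ mem[OF t1] mem[OF t3]]) (simp_all add: doubleton_eq_iff ne)
    moreover have "unit_vec (ed {i, l}) - unit_vec (ed {j, l}) \<in> dirs ?Z"
      by (rule dirs_exchange[OF t1 t4 _ _ mem[OF t1] mem[OF t4]]) (simp_all add: doubleton_eq_iff ne)
    moreover have "unit_vec (ed {i, l}) - unit_vec (ed {k, l}) \<in> dirs ?Z"
      by (rule dirs_exchange[OF t5 t6 _ _ mem[OF t5] mem[OF t6]]) (simp_all add: doubleton_eq_iff ne)
    ultimately show ?thesis using that by (elim insertE emptyE) (simp_all only:)
  qed
  have four': "card (ed ` {{i, k}, {j, k}, {j, l}, {k, l}}) = 4"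
    using card_four_image(1)[of "[{i, k}, {j, k}, {j, l}, {k, l}]"] dd by (simp add: doubleton_eq_iff ne)
  have "ed {i, l} \<notin> ed ` {{i, k}, {j, k}, {j, l}, {k, l}}"
    using inj_on_image_mem_iff[OF inj dd(2), of "{{i, k}, {j, k}, {j, l}, {k, l}}"] dd by (simp add: doubleton_eq_iff ne)
  then have "card (ed ` {{i, k}, {j, k}, {j, l}, {k, l}}) \<le> polytope_dim ?Z"
    using e by (intro independent_edge_differences fin_dim_sub) (auto simp: one_face_def)
  then have dim: "4 \<le> polytope_dim ?Z" using four' by simp
  have s: "{{l, i}, {l, j}, {l, k}} \<in> k4_trees" using four.star[OF p(9)] .
  have "char_vec (C \<union> ed ` {{l, i}, {l, j}, {l, k}}) \<in> F" using poly_of_inc[OF tree_in[OF s]] .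
  moreover have "char_vec (C \<union> ed ` {{l, i}, {l, j}, {l, k}}) \<notin> ?Z"
    using in_one[OF s assms] d by (simp add: doubleton_eq_iff ne)
  ultimately have "?Z \<noteq> F" by metis
  moreover have "?Z \<noteq> {}" using mem[OF t1] nd by (metis empty_iff insertI1 insert_iff singletonD)
  ultimately show "?Z \<in> xfacets F"
    using facet_if_dim[OF exposed_one_face[OF bounds(2)] _ _ dim] by auto
qed

lemma separate:
  assumes d: "d \<in> doubletons" "d' \<in> doubletons" "d \<noteq> d'"
  shows "\<exists>R\<in>k4_trees. d \<in> R \<and> d' \<notin> R" "\<exists>R\<in>k4_trees. d \<notin> R \<and> d' \<notin> R"
proof -
  obtain i j k l where f: "four i j k l" and dd: "d = {i, j}" "d' = {k, l} \<or> d' = {i, k}"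
    by (rule four_of_two_doubletons[OF d])
  interpret four i j k l by fact
  note p = four_perms[OF f]
  show "\<exists>R\<in>k4_trees. d \<in> R \<and> d' \<notin> R"
    using dd(2)
  proof
    assume "d' = {k, l}"
    then show ?thesis by (intro bexI[OF _ star]) (simp add: dd(1) doubleton_eq_iff ne)
  next
    assume "d' = {i, k}"
    then show ?thesis by (intro bexI[OF _ four.star[OF p(1)]]) (simp add: dd(1) doubleton_eq_iff ne)
  qed
  show "\<exists>R\<in>k4_trees. d \<notin> R \<and> d' \<notin> R"
    using dd(2)
  proof
    assume "d' = {k, l}"
    then show ?thesis by (intro bexI[OF _ four.path[OF p(2)]]) (simp add: dd(1) doubleton_eq_iff ne)
  next
    assume "d' = {i, k}"
    then show ?thesis by (intro bexI[OF _ four.star[OF p(9)]]) (simp add: dd(1) doubleton_eq_iff ne)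
  qed
qed

text \<open>The faces x = 0 and x = 1 at the six elements are twelve distinct facets of a face of
  dimension 5, so the rank is even at least 12 - 6 = 6.\<close>

lemma rank_ge_4: "4 \<le> polytope_rank (poly_of N)"
proof -
  let ?z = "\<lambda>d. zero_face (ed d) F" and ?o = "\<lambda>d. one_face (ed d) F"
  let ?X = "?z ` doubletons \<union> ?o ` doubletons"
  have injz: "inj_on ?z doubletons"
  proof (rule inj_onI, rule ccontr)
    fix d d' assume h: "d \<in> doubletons" "d' \<in> doubletons" "?z d = ?z d'" "d \<noteq> d'"
    obtain R where "R \<in> k4_trees" "d \<in> R" "d' \<notin> R" using separate(1)[OF h(1,2,4)] by blast
    then show False using in_zero[of R d] in_zero[of R d'] h by simp
  qed
  have injo: "inj_on ?o doubletons"
  proof (rule inj_onI, rule ccontr)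
    fix d d' assume h: "d \<in> doubletons" "d' \<in> doubletons" "?o d = ?o d'" "d \<noteq> d'"
    obtain R where "R \<in> k4_trees" "d \<in> R" "d' \<notin> R" using separate(1)[OF h(1,2,4)] by blast
    then show False using in_one[of R d] in_one[of R d'] h by simp
  qed
  have disj: "?z d \<noteq> ?o d'" if h: "d \<in> doubletons" "d' \<in> doubletons" for d d'
  proof (cases "d = d'")
    case True
    have "?z d \<inter> ?o d = {}" by (auto simp: zero_face_def one_face_def)
    moreover have "?z d \<noteq> {}" using zero_facet(1)[OF h(1)] by (simp add: xfacets_def)
    ultimately show ?thesis using True by blast
  next
    case False
    obtain R where "R \<in> k4_trees" "d \<notin> R" "d' \<notin> R" using separate(2)[OF h False] by blast
    then show ?thesis using in_zero[of R d] in_one[of R d'] h by metis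
  qed
  have "card ?X = card (?z ` doubletons) + card (?o ` doubletons)"
    using disj finite_doubletons by (intro card_Un_disjoint) auto
  then have c: "card ?X = 12" using card_image[OF injz] card_image[OF injo] card_doubletons by simp
  have sub: "?X \<subseteq> xfacets F" using zero_facet(1) one_facet by blast
  have d01: "{0, 1} \<in> doubletons" by (auto simp: doubletons_def)
  have "zero_face (ed {0, 1}) F \<noteq> {}" using zero_facet(1)[OF d01] by (simp add: xfacets_def)
  then have ne: "F \<noteq> {}" by (auto simp: zero_face_def)
  have "int (card ?X) - (int (polytope_dim F) + 1) \<le> polytope_rank (poly_of N)"
    by (rule rank_face_lower_bound[OF _ poly_of_def exposed_F ne sub]) (use finite_system[OF fin NE] in simp)
  then show ?thesis using c zero_facet(2)[OF d01] by simp
qed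

end

subsection \<open>Irreducible graphs\<close>

lemma all_less_4: "(\<forall>i<4. P i) \<longleftrightarrow> P 0 \<and> P 1 \<and> P 2 \<and> P (3::nat)"
  by (auto simp: numeral_eq_Suc All_less_Suc)

text \<open>A set Z either splits a part and is crossed by an edge of the tree inside it, or is a
  union of parts and is crossed by a lifted edge of the tree on the four parts.\<close>

lemma lift_k4_tree:
  assumes part: "V = (\<Union>i<4. Pt i)" "\<And>i j. i < 4 \<Longrightarrow> j < 4 \<Longrightarrow> i \<noteq> j \<Longrightarrow> Pt i \<inter> Pt j = {}"
    and V: "V \<noteq> {}"
    and T: "\<And>i. i < 4 \<Longrightarrow> cut_conn (Pt i) en (T i)" "\<And>i e. i < 4 \<Longrightarrow> e \<in> T i \<Longrightarrow> en e \<subseteq> Pt i"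
    and ed: "\<And>d i. d \<in> R \<Longrightarrow> i \<in> d \<Longrightarrow> i < 4 \<and> en (ed d) \<inter> Pt i \<noteq> {}"
    and R: "cut_conn {..<4::nat} id R"
  shows "cut_conn V en ((\<Union>i<4. T i) \<union> ed ` R)"
proof (rule cut_connI[OF V])
  fix Z assume Z: "Z \<subseteq> V" "Z \<noteq> {}" "Z \<noteq> V"
  show "\<exists>e\<in>(\<Union>i<4. T i) \<union> ed ` R. crosses en Z e"
  proof (cases "\<exists>i<4. Z \<inter> Pt i \<noteq> {} \<and> Z \<inter> Pt i \<noteq> Pt i")
    case True
    then obtain i where i: "i < 4" "Z \<inter> Pt i \<noteq> {}" "Z \<inter> Pt i \<noteq> Pt i" by blast
    then obtain e where e: "e \<in> T i" "crosses en (Z \<inter> Pt i) e" using cut_connD[OF T(1)[OF i(1)], of "Z \<inter> Pt i"] by auto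
    then have "crosses en Z e" using T(2)[OF i(1) e(1)] by (auto simp: crosses_def)
    then show ?thesis using e(1) i(1) by blast
  next
    case False
    then have dich: "Z \<inter> Pt i = {} \<or> Pt i \<subseteq> Z" if "i < 4" for i using that by blast
    let ?J = "{i. i < 4 \<and> Pt i \<subseteq> Z}"
    obtain z where "z \<in> Z" using Z(2) by blast
    then obtain i where "i < 4" "z \<in> Pt i" using Z(1) part(1) by blast
    then have "i \<in> ?J" using dich[of i] \<open>z \<in> Z\<close> by blast
    then have "?J \<noteq> {}" by blast
    moreover have "?J \<noteq> {..<4}"
    proof
      assume J: "?J = {..<4}"
      have "V \<subseteq> Z"
      proof
        fix v assume "v \<in> V"
        then obtain i where i: "i < 4" "v \<in> Pt i" using part(1) by blast
        then have "i \<in> ?J" unfolding J by simp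
        then show "v \<in> Z" using i(2) by blast
      qed
      then show False using Z by blast
    qed
    moreover have "?J \<subseteq> {..<4}" by auto
    ultimately obtain d where d: "d \<in> R" "crosses id ?J d" using cut_connD[OF R, of ?J] by blast
    then obtain i j where ij: "i \<in> d" "i \<in> ?J" "j \<in> d" "j \<notin> ?J" by (auto simp: crosses_def)
    have ei: "en (ed d) \<inter> Pt i \<noteq> {}" "en (ed d) \<inter> Pt j \<noteq> {}" "j < 4"
      using ed[OF d(1) ij(1)] ed[OF d(1) ij(3)] by auto
    have "Z \<inter> Pt j = {}" using dich[OF ei(3)] ij(4) ei(3) by blast
    then have "crosses en Z (ed d)" unfolding crosses_def using ei ij(2) by blast
    then show ?thesis using d(1) by blast
  qed
qed

text \<open>Spanning trees of the four parts form the set C, and one edge between any two parts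
  stands for an edge of K_4. As a forest with four components C has four edges fewer than there are
  vertices, so three lifted edges complete it to a tree.\<close>

lemma irreducible_rank_ge_4:
  assumes wf: "wf_graph V en E" and tc: "two_conn V en E" and loopless: "\<And>e. e \<in> E \<Longrightarrow> card (en e) = 2"
    and simple: "\<And>e f. e \<in> E \<Longrightarrow> f \<in> E \<Longrightarrow> en e = en f \<Longrightarrow> e = f"
    and deg: "\<And>v. v \<in> V \<Longrightarrow> 3 \<le> card {e \<in> E. v \<in> en e}"
  shows "4 \<le> polytope_rank (poly_of (trees V en E))"
proof -
  have finV: "finite V" and finE: "finite E" and inV: "\<And>e. e \<in> E \<Longrightarrow> en e \<subseteq> V" using wf by (auto simp: wf_graph_def)
  define nb where "nb = (\<lambda>x y. \<exists>e\<in>E. en e = {x, y})"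
  have crs: "\<exists>x y. x \<in> Z \<and> y \<notin> Z \<and> en e = {x, y}" if e: "e \<in> E" "crosses en Z e" for e Z
  proof -
    obtain x y where xy: "x \<in> en e" "x \<in> Z" "y \<in> en e" "y \<notin> Z" using e(2) by (auto simp: crosses_def)
    obtain a b where "en e = {a, b}" using loopless[OF e(1)] by (auto simp: card_2_iff)
    then have "en e = {x, y}" using xy by auto
    then show ?thesis using xy by blast
  qed
  interpret min_degree_3 V nb
  proof
    show "finite V" by fact
    show "V \<noteq> {}" using tc by (simp add: two_conn_def cut_conn_def)
    show "nb y x" if "nb x y" for x y using that by (auto simp: nb_def insert_commute)
    show "\<not> nb x x" for x using loopless by (fastforce simp: nb_def)
    show "x \<in> V \<and> y \<in> V" if "nb x y" for x y using that inV by (auto simp: nb_def)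
    show "\<exists>x\<in>Z. \<exists>y\<in>V - {v} - Z. nb x y" if vZ: "v \<in> V" "Z \<subseteq> V - {v}" "Z \<noteq> {}" "Z \<noteq> V - {v}" for v Z
    proof -
      have "cut_conn (V - {v}) en {e \<in> E. v \<notin> en e}" using tc vZ(1) by (simp add: two_conn_def)
      then obtain e where e: "e \<in> E" "v \<notin> en e" "crosses en Z e" using cut_connD[of "V - {v}" en _ Z] vZ by blast
      then obtain x y where "x \<in> Z" "y \<notin> Z" "en e = {x, y}" using crs by blast
      moreover have "y \<in> V - {v}" using \<open>en e = {x, y}\<close> e inV[OF e(1)] by auto
      ultimately show ?thesis using e(1) unfolding nb_def by blast
    qed
    show "3 \<le> card {u. nb v u}" if v: "v \<in> V" for v
    proof -
      \<comment> \<open>Absence of parallel edges turns the number of incident edges into a number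
        of neighbours.\<close>
      define g where "g = (\<lambda>u. SOME e. e \<in> E \<and> en e = {v, u})"
      have "{e \<in> E. v \<in> en e} \<subseteq> g ` {u. nb v u}"
      proof
        fix e assume e: "e \<in> {e \<in> E. v \<in> en e}"
        then obtain a b where "en e = {a, b}" using loopless[of e] by (auto simp: card_2_iff)
        then obtain u where u: "en e = {v, u}" using e by auto
        have "g u \<in> E \<and> en (g u) = {v, u}" unfolding g_def by (rule someI[of _ e]) (use e u in simp)
        then have "g u = e" using simple[of "g u" e] e u by auto
        moreover have "nb v u" unfolding nb_def using e u by blast
        ultimately show "e \<in> g ` {u. nb v u}" by blast
      qed
      moreover have "finite {u. nb v u}" by (rule finite_subset[OF _ finV]) (use inV in \<open>auto simp: nb_def\<close>)
      ultimately have "card {e \<in> E. v \<in> en e} \<le> card {u. nb v u}"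
        by (meson card_image_le card_mono finite_imageI le_trans)
      then show ?thesis using deg[OF v] by linarith
    qed
  qed
  obtain A y S1 S2 where p: "cset A" "cset S1" "cset S2" "y \<in> V"
    "V = A \<union> {y} \<union> S1 \<union> S2" "A \<inter> S1 = {}" "A \<inter> S2 = {}" "S1 \<inter> S2 = {}" "y \<notin> A" "y \<notin> S1" "y \<notin> S2"
    and a: "\<exists>x\<in>{y}. \<exists>z\<in>A. nb x z" "\<exists>x\<in>{y}. \<exists>z\<in>S1. nb x z" "\<exists>x\<in>{y}. \<exists>z\<in>S2. nb x z"
    "\<exists>x\<in>S1. \<exists>z\<in>A. nb x z" "\<exists>x\<in>S2. \<exists>z\<in>A. nb x z" "\<exists>x\<in>S1. \<exists>z\<in>S2. nb x z"
    by (rule k4_partition) blast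
  define Pt where "Pt = (!) [A, {y}, S1, S2]"
  have Pt: "Pt 0 = A" "Pt 1 = {y}" "Pt 2 = S1" "Pt 3 = S2" by (simp_all add: Pt_def)
  have part: "V = (\<Union>i<4. Pt i)"
  proof -
    have "{..<4::nat} = {0, 1, 2, 3}" by auto
    then show ?thesis unfolding p(5) by (simp only: UN_insert UN_empty Pt) blast
  qed
  have "\<forall>i<4. \<forall>j<4. i \<noteq> j \<longrightarrow> Pt i \<inter> Pt j = {}" unfolding all_less_4 Pt using p by auto
  then have disj: "\<And>i j. i < 4 \<Longrightarrow> j < 4 \<Longrightarrow> i \<noteq> j \<Longrightarrow> Pt i \<inter> Pt j = {}" by blast
  have "\<forall>i<4. \<forall>j<4. i \<noteq> j \<longrightarrow> (\<exists>x\<in>Pt i. \<exists>z\<in>Pt j. nb x z)"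
    unfolding all_less_4 Pt using a nb_sym by (simp, blast)
  then have adj: "\<And>i j. i < 4 \<Longrightarrow> j < 4 \<Longrightarrow> i \<noteq> j \<Longrightarrow> \<exists>x\<in>Pt i. \<exists>z\<in>Pt j. nb x z" by blast
  have "\<forall>i<4. cset (Pt i)" unfolding all_less_4 Pt using p cset_singleton by simp
  then have cs: "\<And>i. i < 4 \<Longrightarrow> cset (Pt i)" by blast
  have PV: "Pt i \<subseteq> V" if "i < 4" for i using part that by blast
  have "\<exists>T. T \<subseteq> {e \<in> E. en e \<subseteq> Pt i} \<and> card T + 1 = card (Pt i) \<and> cut_conn (Pt i) en T" if i: "i < 4" for i
  proof -
    have "wf_graph (Pt i) en {e \<in> E. en e \<subseteq> Pt i}"
      using wf finite_subset[OF PV[OF i] finV] by (simp add: wf_graph_def)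
    moreover have "cut_conn (Pt i) en {e \<in> E. en e \<subseteq> Pt i}"
    proof (rule cut_connI)
      show "Pt i \<noteq> {}" using cs[OF i] by (simp add: cset_def)
      fix Z assume Z: "Z \<subseteq> Pt i" "Z \<noteq> {}" "Z \<noteq> Pt i"
      then obtain x z where xz: "x \<in> Z" "z \<in> Pt i - Z" "nb x z" using csetD[OF cs[OF i], of Z] by blast
      then obtain e where "e \<in> E" "en e = {x, z}" by (auto simp: nb_def)
      then show "\<exists>e\<in>{e \<in> E. en e \<subseteq> Pt i}. crosses en Z e"
        using xz Z by (intro bexI[of _ e]) (auto simp: crosses_def)
    qed
    ultimately obtain T where "T \<subseteq> {e \<in> E. en e \<subseteq> Pt i}" "card T + 1 = card (Pt i)" "cut_conn (Pt i) en T"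
      by (rule spanning_tree)
    then show ?thesis by blast
  qed
  then obtain T where T: "\<And>i. i < 4 \<Longrightarrow> T i \<subseteq> {e \<in> E. en e \<subseteq> Pt i}"
    "\<And>i. i < 4 \<Longrightarrow> card (T i) + 1 = card (Pt i)" "\<And>i. i < 4 \<Longrightarrow> cut_conn (Pt i) en (T i)"
    by metis
  define C where "C = (\<Union>i<4. T i)"
  have TE: "T i \<subseteq> E" "\<And>e. e \<in> T i \<Longrightarrow> en e \<subseteq> Pt i" if "i < 4" for i using T(1)[OF that] by auto
  have ne: "en e \<noteq> {}" if "e \<in> E" for e using loopless[OF that] by auto
  have cardC: "card C + 4 = card V"
  proof -
    have "card C = (\<Sum>i<4. card (T i))" unfolding C_def
    proof (rule card_UN_disjoint)
      show "\<forall>i\<in>{..<4}. finite (T i)" using TE(1) finE finite_subset by blast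
      show "\<forall>i\<in>{..<4}. \<forall>j\<in>{..<4}. i \<noteq> j \<longrightarrow> T i \<inter> T j = {}"
      proof (intro ballI impI, rule ccontr)
        fix i j :: nat assume ij: "i \<in> {..<4}" "j \<in> {..<4}" "i \<noteq> j" "T i \<inter> T j \<noteq> {}"
        then obtain e where e: "e \<in> T i" "e \<in> T j" by blast
        have "en e \<subseteq> Pt i \<inter> Pt j" using TE(2)[of i e] TE(2)[of j e] ij e by simp
        then show False using disj[of i j] ij ne[of e] TE(1)[of i] e by auto
      qed
    qed simp
    moreover have "card V = (\<Sum>i<4. card (Pt i))" unfolding part
    proof (rule card_UN_disjoint)
      show "\<forall>i\<in>{..<4}. finite (Pt i)" using PV finV finite_subset by blast
      show "\<forall>i\<in>{..<4}. \<forall>j\<in>{..<4}. i \<noteq> j \<longrightarrow> Pt i \<inter> Pt j = {}" using disj by simp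
    qed simp
    moreover have "(\<Sum>i<4. card (Pt i)) = (\<Sum>i<4. card (T i) + 1)" using T(2) by (intro sum.cong) auto
    moreover have "(\<Sum>i<4. card (T i) + 1) = (\<Sum>i<4. card (T i)) + 4"
      by (simp only: sum.distrib) simp
    ultimately show ?thesis by linarith
  qed
  have "\<exists>e. e \<in> E \<and> (\<forall>i<4. en e \<inter> Pt i \<noteq> {} \<longleftrightarrow> i \<in> d)" if d: "d \<in> doubletons" for d
  proof -
    obtain i j where ij: "d = {i, j}" "i \<noteq> j" "i < 4" "j < 4" using d by (auto simp: doubletons_def card_2_iff)
    then obtain x z where xz: "x \<in> Pt i" "z \<in> Pt j" "nb x z" using adj by blast
    then obtain e where e: "e \<in> E" "en e = {x, z}" by (auto simp: nb_def)
    have "x \<in> Pt m \<longleftrightarrow> m = i" "z \<in> Pt m \<longleftrightarrow> m = j" if "m < 4" for m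
      using disj[OF that ij(3)] disj[OF that ij(4)] xz by auto
    then have "\<forall>m<4. en e \<inter> Pt m \<noteq> {} \<longleftrightarrow> m \<in> d" using e(2) ij(1) by auto
    then show ?thesis using e(1) by blast
  qed
  then obtain ed where ed: "\<And>d. d \<in> doubletons \<Longrightarrow> ed d \<in> E"
    "\<And>d i. d \<in> doubletons \<Longrightarrow> i < 4 \<Longrightarrow> en (ed d) \<inter> Pt i \<noteq> {} \<longleftrightarrow> i \<in> d" by metis
  have edC: "ed d \<notin> C" if d: "d \<in> doubletons" for d
  proof
    assume "ed d \<in> C"
    then obtain i where i: "i < 4" "ed d \<in> T i" by (auto simp: C_def)
    have dlt: "d \<subseteq> {..<4}" "card d = 2" using d by (auto simp: doubletons_def)
    have "d \<subseteq> {i}"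
    proof
      fix m assume m: "m \<in> d"
      then have "en (ed d) \<inter> Pt m \<noteq> {}" using ed(2)[OF d, of m] dlt by auto
      then have "Pt i \<inter> Pt m \<noteq> {}" using TE(2)[OF i] by blast
      then show "m \<in> {i}" using disj[of i m] i(1) m dlt by auto
    qed
    then have "card d \<le> 1" using card_mono[of "{i}" d] by simp
    then show False using dlt by simp
  qed
  have "k4_face E (trees V en E) C ed"
  proof
    show "finite E" by fact
    show "trees V en E \<subseteq> Pow E" by (rule trees_subset)
    show CE: "C \<subseteq> E" using TE(1) by (auto simp: C_def)
    show "ed d \<in> E - C" if "d \<in> doubletons" for d using ed(1)[OF that] edC[OF that] by blast
    show inj: "inj_on ed doubletons"
    proof (rule inj_onI)
      fix d d' assume h: "d \<in> doubletons" "d' \<in> doubletons" "ed d = ed d'"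
      have "i \<in> d \<longleftrightarrow> i \<in> d'" if "i < 4" for i using ed(2)[OF h(1) that] ed(2)[OF h(2) that] h(3) by simp
      then show "d = d'" using h(1,2) unfolding doubletons_def by blast
    qed
    show "card X = card C + 3" if "X \<in> trees V en E" for X
      using that cardC by (simp add: trees_def)
    show "C \<union> ed ` R \<in> trees V en E" if R: "R \<in> k4_trees" for R
    proof -
      have R': "R \<subseteq> doubletons" "card R = 3" "cut_conn {..<4} id R" using R by (auto simp: k4_trees_def)
      have "cut_conn V en (C \<union> ed ` R)"
        unfolding C_def
      proof (rule lift_k4_tree[OF part disj V_ne T(3) TE(2) _ R'(3)])
        fix d i assume d: "d \<in> R" "i \<in> d"
        then have "d \<in> doubletons" using R' by blast
        moreover from this have "i < 4" using d(2) by (auto simp: doubletons_def)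
        ultimately show "i < 4 \<and> en (ed d) \<inter> Pt i \<noteq> {}" using ed(2) d(2) by blast
      qed
      moreover have "card (C \<union> ed ` R) = card C + 3"
      proof -
        have "finite C" using CE finE finite_subset by blast
        moreover have "finite R" using R'(2) card.infinite by fastforce
        moreover have "C \<inter> ed ` R = {}" using edC R'(1) by blast
        ultimately have "card (C \<union> ed ` R) = card C + card (ed ` R)" by (intro card_Un_disjoint) auto
        then show ?thesis using card_image[OF inj_on_subset[OF inj R'(1)]] R'(2) by simp
      qed
      ultimately show ?thesis using CE ed(1) R'(1) cardC by (auto simp: trees_def)
    qed
  qed
  then show ?thesis by (rule k4_face.rank_ge_4)
qed

subsection \<open>Classification by reduction\<close>

lemma toggle_comp: "toggle A (toggle B X) = toggle (toggle A B) X"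
  by (auto simp: toggle_def)

lemma toggle_image_comp: "toggle A ` toggle B ` N = toggle (toggle A B) ` N"
  by (simp add: image_image toggle_comp)

text \<open>Reflections away from e and f commute with the extension; it is a reflection at e that
  turns a parallel step into a series step and back.\<close>

lemma par_ext_toggle:
  assumes "e \<notin> D" "f \<notin> D"
  shows "par_ext e f (toggle D ` N) = toggle D ` par_ext e f N"
proof -
  have m: "e \<in> toggle D X \<longleftrightarrow> e \<in> X" for X using assms by (simp add: mem_toggle)
  have t: "insert f (toggle D X - {e}) = toggle D (insert f (X - {e}))" for X
    using assms by (auto simp: toggle_def)
  have "{insert f (X - {e}) | X. X \<in> toggle D ` N \<and> e \<in> X} = toggle D ` {insert f (X - {e}) | X. X \<in> N \<and> e \<in> X}"
    (is "?A = ?B")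
  proof
    show "?A \<subseteq> ?B"
    proof
      fix Y assume "Y \<in> ?A"
      then obtain X where "X \<in> N" "e \<in> X" "Y = insert f (toggle D X - {e})" using m by blast
      then show "Y \<in> ?B" unfolding t by blast
    qed
    show "?B \<subseteq> ?A"
    proof
      fix Y assume "Y \<in> ?B"
      then obtain X where X: "X \<in> N" "e \<in> X" "Y = toggle D (insert f (X - {e}))" by blast
      then have "Y = insert f (toggle D X - {e})" "e \<in> toggle D X" using t[of X] m[of X] by simp_all
      then show "Y \<in> ?A" using X(1) by blast
    qed
  qed
  then show ?thesis unfolding par_ext_def image_Un by simp
qed

text \<open>Two parallel edges stand apart because their segment is not normal. The alternative of
  large rank absorbs the graphs with a K_4 minor and persists under later extensions, which never
  lower the rank.\<close>

definition classified :: "'e set \<Rightarrow> 'e set set \<Rightarrow> bool" where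
  "classified E N \<longleftrightarrow> (\<exists>a b. a \<noteq> b \<and> E = {a, b} \<and> N = {{a}, {b}}) \<or> 4 \<le> polytope_rank (poly_of N) \<or>
    (\<exists>k N' D. sp_system k E N' \<and> D \<subseteq> E \<and> N = toggle D ` N')"

lemma sp_system_triangle:
  assumes "e \<noteq> g" "f \<noteq> e" "f \<noteq> g"
  shows "sp_system 0 {f, e, g} {{e}, {g}, {f}}"
proof -
  have "{f, e, g} = {e, g, f}" by auto
  then show ?thesis using sp_system.triangle[of e g f] assms by simp
qed

text \<open>If the reflection set D contains e, splitting off that reflection leaves an extension of
  the system reflected at e, that is, a series step of \<open>sp_system\<close>.\<close>

lemma classified_parallel:
  assumes c: "classified E N" and E: "finite E" "N \<subseteq> Pow E" and ef: "e \<in> E" "f \<notin> E"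
  shows "classified (insert f E) (par_ext e f N)"
  using c unfolding classified_def[of E N]
proof (elim disjE exE conjE)
  fix a b assume ab: "a \<noteq> b" "E = {a, b}" "N = {{a}, {b}}"
  obtain g where g: "e \<noteq> g" "E = {e, g}" "N = {{e}, {g}}"
  proof (cases "e = a")
    case True
    then show thesis using ab by (intro that[of b]) auto
  next
    case False
    then have "e = b" using ab ef(1) by simp
    then show thesis using ab by (intro that[of a]) auto
  qed
  have fg: "f \<noteq> e" "f \<noteq> g" using ef(2) g(2) by auto
  have "par_ext e f N = {{e}, {g}} \<union> {insert f ({e} - {e})}" unfolding g(3) par_ext_def using g(1) by blast
  then have "par_ext e f N = {{e}, {g}, {f}}" by (simp add: insert_commute)
  then have "par_ext e f N = toggle {} ` {{e}, {g}, {f}}" by (simp add: toggle_def)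
  then show ?thesis using sp_system_triangle[OF g(1) fg] unfolding classified_def g(2) by blast
next
  assume "4 \<le> polytope_rank (poly_of N)"
  then have "4 \<le> polytope_rank (poly_of (par_ext e f N))" using rank_par_ext_ge[OF E ef] by linarith
  then show ?thesis by (simp add: classified_def)
next
  fix k N' D assume h: "sp_system k E N'" "D \<subseteq> E" "N = toggle D ` N'"
  have fD: "f \<notin> D" using h(2) ef(2) by blast
  show ?thesis
  proof (cases "e \<in> D")
    case False
    have "par_ext e f N = toggle D ` par_ext e f N'" unfolding h(3) by (rule par_ext_toggle[OF False fD])
    moreover have "D \<subseteq> insert f E" using h(2) by blast
    ultimately show ?thesis using sp_system.parallel[OF h(1) ef] unfolding classified_def by blast
  next
    case True
    let ?D = "D - {e}"
    have "toggle ?D {e} = D" using True by (auto simp: toggle_def)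
    then have "N = toggle ?D ` toggle {e} ` N'" unfolding h(3) toggle_image_comp by simp
    then have "par_ext e f N = toggle ?D ` par_ext e f (toggle {e} ` N')"
      using fD by (simp add: par_ext_toggle)
    moreover have "?D \<subseteq> insert f E" using h(2) by blast
    ultimately show ?thesis using sp_system.series[OF h(1) ef] unfolding classified_def by blast
  qed
qed

text \<open>Dual to the parallel case: if e lies in D, the reflection at e that comes with the
  series extension cancels, and a parallel step remains.\<close>

lemma classified_series:
  assumes c: "classified E N" and E: "finite E" "N \<subseteq> Pow E" and ef: "e \<in> E" "f \<notin> E"
  shows "classified (insert f E) (toggle {e, f} ` par_ext e f (toggle {e} ` N))"
  using c unfolding classified_def[of E N]
proof (elim disjE exE conjE)
  fix a b assume ab: "a \<noteq> b" "E = {a, b}" "N = {{a}, {b}}"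
  obtain g where g: "e \<noteq> g" "E = {e, g}" "N = {{e}, {g}}"
  proof (cases "e = a")
    case True
    then show thesis using ab by (intro that[of b]) auto
  next
    case False
    then have "e = b" using ab ef(1) by simp
    then show thesis using ab by (intro that[of a]) auto
  qed
  have fg: "f \<noteq> e" "f \<noteq> g" using ef(2) g(2) by auto
  have "toggle {e} {e} = {}" "toggle {e} {g} = {e, g}" using g(1) by (auto simp: toggle_def)
  then have N: "toggle {e} ` N = {{}, {e, g}}" unfolding g(3) by simp
  have eg: "{e, g} - {e} = {g}" using g(1) by auto
  have "par_ext e f (toggle {e} ` N) = {{}, {e, g}} \<union> {insert f ({e, g} - {e})}"
    unfolding N par_ext_def by blast
  then have "par_ext e f (toggle {e} ` N) = {{}, {e, g}, {f, g}}" unfolding eg by (simp add: insert_commute)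
  also have "\<dots> = toggle {g} ` {{g}, {e}, {f}}"
  proof -
    have "toggle {g} {g} = {}" "toggle {g} {e} = {e, g}" "toggle {g} {f} = {f, g}"
      using g(1) fg by (auto simp: toggle_def)
    then show ?thesis by simp
  qed
  also have "{{g}, {e}, {f}} = {{e}, {g}, {f}}" by (rule insert_commute)
  finally have "toggle {e, f} ` par_ext e f (toggle {e} ` N) = toggle (toggle {e, f} {g}) ` {{e}, {g}, {f}}"
    by (simp only: toggle_image_comp)
  moreover have "toggle {e, f} {g} \<subseteq> {f, e, g}" by (auto simp: toggle_def)
  ultimately show ?thesis using sp_system_triangle[OF g(1) fg] unfolding classified_def g(2) by blast
next
  assume r: "4 \<le> polytope_rank (poly_of N)"
  have e: "{e} \<subseteq> E" using ef by simp
  note s = toggle_system[OF e E(2)]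
  have "4 \<le> polytope_rank (poly_of (par_ext e f (toggle {e} ` N)))"
    using rank_par_ext_ge[OF E(1) s ef] rank_toggle[OF E e] r by linarith
  moreover have "{e, f} \<subseteq> insert f E" using ef by blast
  moreover have "finite (insert f E)" using E(1) by simp
  ultimately have "4 \<le> polytope_rank (poly_of (toggle {e, f} ` par_ext e f (toggle {e} ` N)))"
    using rank_toggle[OF _ par_ext_system[OF s, where e = e and f = f], where D = "{e, f}"] by simp
  then show ?thesis by (simp add: classified_def)
next
  fix k N' D assume h: "sp_system k E N'" "D \<subseteq> E" "N = toggle D ` N'"
  have fD: "f \<notin> D" using h(2) ef(2) by blast
  show ?thesis
  proof (cases "e \<in> D")
    case False
    have "toggle {e} D = toggle D {e}" by (auto simp: toggle_def)
    then have tN: "toggle {e} ` N = toggle D ` toggle {e} ` N'" unfolding h(3) toggle_image_comp by simp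
    have 1: "par_ext e f (toggle {e} ` N) = toggle D ` par_ext e f (toggle {e} ` N')"
      unfolding tN by (rule par_ext_toggle[OF False fD])
    have "toggle {e, f} ` par_ext e f (toggle {e} ` N)
        = toggle (toggle {e, f} D) ` par_ext e f (toggle {e} ` N')"
      unfolding 1 by (rule toggle_image_comp)
    moreover have "toggle {e, f} D \<subseteq> insert f E" using h(2) ef by (auto simp: toggle_def)
    ultimately show ?thesis using sp_system.series[OF h(1) ef] unfolding classified_def by blast
  next
    case True
    let ?D = "D - {e}"
    have "toggle {e} D = ?D" using True by (auto simp: toggle_def)
    then have "toggle {e} ` N = toggle ?D ` N'" unfolding h(3) toggle_image_comp by simp
    moreover have "par_ext e f (toggle ?D ` N') = toggle ?D ` par_ext e f N'"
      using fD by (intro par_ext_toggle) auto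
    ultimately have "toggle {e, f} ` par_ext e f (toggle {e} ` N) = toggle (toggle {e, f} ?D) ` par_ext e f N'"
      by (simp only: toggle_image_comp)
    moreover have "toggle {e, f} ?D \<subseteq> insert f E" using h(2) ef by (auto simp: toggle_def)
    ultimately show ?thesis using sp_system.parallel[OF h(1) ef] unfolding classified_def by blast
  qed
qed

text \<open>Induction on the number of edges: one of two parallel edges is deleted or a vertex of
  degree two is suppressed; if neither is possible, all degrees are at least three and the rank is
  large.\<close>

lemma classified_trees:
  assumes "wf_graph V en E" "two_conn V en E" "\<And>e. e \<in> E \<Longrightarrow> card (en e) = 2" "2 \<le> card E"
  shows "classified E (trees V en E)"
  using assms
proof (induction "card E" arbitrary: V en E rule: less_induct)
  case less
  have finV: "finite V" and finE: "finite E" and inV: "\<And>e. e \<in> E \<Longrightarrow> en e \<subseteq> V"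
    using less.prems(1) by (auto simp: wf_graph_def)
  have C: "cut_conn V en E" using less.prems(2) by (simp add: two_conn_def)
  have Cv: "cut_conn (V - {v}) en {e \<in> E. v \<notin> en e}" if "v \<in> V" for v
    using less.prems(2) that by (simp add: two_conn_def)
  show ?case
  proof (cases "\<exists>e\<in>E. \<exists>f\<in>E. e \<noteq> f \<and> en e = en f")
    case True
    then obtain e f where ef: "e \<in> E" "f \<in> E" "e \<noteq> f" "en e = en f" by blast
    show ?thesis
    proof (cases "card E = 2")
      case True
      then have E: "E = {e, f}" using ef finE by (metis card_2_iff insert_iff singletonD doubleton_eq_iff)
      have V: "V = en e"
      proof (rule ccontr)
        assume "V \<noteq> en e"
        then obtain g where "g \<in> E" "crosses en (en e) g"
          using cut_connD[OF C inV[OF ef(1)]] less.prems(3)[OF ef(1)] by force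
        then show False using E ef(4) by (auto simp: crosses_def)
      qed
      have cr: "cut_conn V en {g}" if g: "g \<in> E" for g
      proof (rule cut_connI)
        show "V \<noteq> {}" using C by (simp add: cut_conn_def)
        fix Z assume "Z \<subseteq> V" "Z \<noteq> {}" "Z \<noteq> V"
        moreover have "en g = V" using g E V ef(4) by auto
        ultimately show "\<exists>e\<in>{g}. crosses en Z e" by (auto simp: crosses_def)
      qed
      have cV: "card V = 2" using V less.prems(3)[OF ef(1)] by simp
      have "trees V en E = {{e}, {f}}"
      proof
        show "{{e}, {f}} \<subseteq> trees V en E" using cr ef cV by (auto simp: trees_def)
        show "trees V en E \<subseteq> {{e}, {f}}"
        proof
          fix T assume "T \<in> trees V en E"
          then have "T \<subseteq> {e, f}" "card T = 1" using cV E by (auto simp: trees_def)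
          then show "T \<in> {{e}, {f}}" by (auto simp: card_1_singleton_iff)
        qed
      qed
      then show ?thesis using E ef(3) unfolding classified_def by blast
    next
      case False
      let ?E = "E - {f}"
      have card: "card ?E + 1 = card E" using ef(2) finE by (metis Suc_eq_plus1 card_Suc_Diff1)
      have "classified ?E (trees V en ?E)"
      proof (rule less.hyps)
        show "card ?E < card E" "2 \<le> card ?E" using card False less.prems(4) by linarith+
        show "wf_graph V en ?E" by (rule wf_graph_subset[OF less.prems(1)]) auto
        show "two_conn V en ?E" by (rule two_conn_parallel[OF less.prems(2) ef(1,3,4)])
      qed (use less.prems(3) in auto)
      then have "classified (insert f ?E) (par_ext e f (trees V en ?E))"
        by (rule classified_parallel[OF _ _ trees_subset]) (use ef finE in auto)
      moreover have "insert f ?E = E" using ef(2) by blast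
      ultimately show ?thesis using trees_parallel[OF less.prems(1) ef] by simp
    qed
  next
    case False
    then have simple: "\<And>e f. e \<in> E \<Longrightarrow> f \<in> E \<Longrightarrow> en e = en f \<Longrightarrow> e = f" by blast
    have V3: "3 \<le> card V"
    proof (rule ccontr)
      assume n: "\<not> 3 \<le> card V"
      have "en e = V" if "e \<in> E" for e
        using n less.prems(3)[OF that] inV[OF that] card_subset_eq[OF finV inV[OF that]] card_mono[OF finV inV[OF that]] by linarith
      then have "\<And>e f. e \<in> E \<Longrightarrow> f \<in> E \<Longrightarrow> e = f" using simple by metis
      then have "card E \<le> Suc 0" using card_le_Suc0_iff_eq[OF finE] by blast
      then show False using less.prems(4) by simp
    qed
    \<comment> \<open>Connectivity gives w a neighbour b, and connectivity after deleting b gives it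
      a different one.\<close>
    have two: "\<exists>e f b c. e \<in> E \<and> f \<in> E \<and> en e = {w, b} \<and> en f = {w, c} \<and> b \<noteq> w \<and> c \<noteq> w \<and> b \<noteq> c" if w: "w \<in> V" for w
    proof -
      have ends: "\<exists>b. en g = {w, b} \<and> b \<noteq> w" if g: "g \<in> E" "crosses en {w} g" for g
      proof -
        have "w \<in> en g" using g(2) by (auto simp: crosses_def)
        moreover obtain a b where "en g = {a, b}" "a \<noteq> b" using less.prems(3)[OF g(1)] by (auto simp: card_2_iff)
        ultimately show ?thesis by auto
      qed
      have "{w} \<noteq> V" using V3 by auto
      then obtain e where "e \<in> E" "crosses en {w} e" using cut_connD[OF C, of "{w}"] w by auto
      then obtain b where b: "e \<in> E" "en e = {w, b}" "b \<noteq> w" using ends by blast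
      have bV: "b \<in> V" using inV[OF b(1)] b(2) by auto
      have "{w} \<noteq> V - {b}"
      proof
        assume "{w} = V - {b}"
        then have "V \<subseteq> {w, b}" by blast
        then have "card V \<le> 2" using card_mono[of "{w, b}" V] b(3) by simp
        then show False using V3 by simp
      qed
      then obtain f where f: "f \<in> E" "b \<notin> en f" "crosses en {w} f"
        using cut_connD[OF Cv[OF bV], of "{w}"] w b(3) by auto
      then obtain c where c: "en f = {w, c}" "c \<noteq> w" using ends by blast
      then have "b \<noteq> c" using f(2) by auto
      then show ?thesis using b(1,2,3) c f(1) by (intro exI[of _ e] exI[of _ f] exI[of _ b] exI[of _ c] conjI)
    qed
    show ?thesis
    proof (cases "\<exists>w\<in>V. card {e \<in> E. w \<in> en e} \<le> 2")
      case True
      then obtain w where w: "w \<in> V" "card {e \<in> E. w \<in> en e} \<le> 2" by blast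
      obtain e f b c where h: "e \<in> E" "f \<in> E" "en e = {w, b}" "en f = {w, c}" "b \<noteq> w" "c \<noteq> w" "b \<noteq> c"
        using two[OF w(1)] by blast
      have ef: "e \<noteq> f" using h by auto
      have "{e, f} = {e \<in> E. w \<in> en e}"
        using h ef w(2) finE by (intro card_seteq) auto
      then have only: "\<And>g. g \<in> E \<Longrightarrow> w \<in> en g \<Longrightarrow> g = e \<or> g = f" by blast
      interpret series_pair V en E e f w b c
        by unfold_locales (use less.prems(1) h ef only in auto)
      let ?E = "E - {f}"
      have card: "card ?E + 1 = card E" using h(2) finE by (metis Suc_eq_plus1 card_Suc_Diff1)
      \<comment> \<open>An edge g avoiding w is a third edge, so at least two edges are left after
        the reduction.\<close>
      have "c \<in> V - {w}" "c \<notin> {b}" "{b} \<subseteq> V - {w}" using verts bc by auto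
      then have "{b} \<noteq> V - {w}" "{b} \<subseteq> V - {w}" by blast+
      then obtain g where g: "g \<in> E" "w \<notin> en g" using cut_connD[OF Cv[OF w(1)], of "{b}"] by auto
      have "g \<noteq> e" "g \<noteq> f" using g(2) h(3,4) by blast+
      then have "{e, f, g} \<subseteq> E" "card {e, f, g} = 3" using h(1,2) g(1) ef by simp_all
      then have "3 \<le> card E" using card_mono[OF finE, of "{e, f, g}"] by simp
      have "classified ?E (trees (V - {w}) en' ?E)"
      proof (rule less.hyps)
        show "card ?E < card E" "2 \<le> card ?E" using card \<open>3 \<le> card E\<close> by linarith+
        show "wf_graph (V - {w}) en' ?E" by (rule wf')
        show "two_conn (V - {w}) en' ?E" by (rule two_conn_series[OF less.prems(2)])
        show "card (en' g) = 2" if "g \<in> ?E" for g using less.prems(3)[of g] that bc by (auto simp: en'_def)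
      qed
      then have "classified (insert f ?E) (toggle {e, f} ` par_ext e f (toggle {e} ` trees (V - {w}) en' ?E))"
        by (rule classified_series[OF _ _ trees_subset]) (use h ef finE in auto)
      moreover have "insert f ?E = E" using h(2) by blast
      ultimately show ?thesis using trees_series by simp
    next
      case F: False
      have "3 \<le> card {e \<in> E. v \<in> en e}" if "v \<in> V" for v
      proof -
        have "\<not> card {e \<in> E. v \<in> en e} \<le> 2" using F that by blast
        then show ?thesis by linarith
      qed
      then have "4 \<le> polytope_rank (poly_of (trees V en E))"
        using irreducible_rank_ge_4[OF less.prems(1-3) simple] by blast
      then show ?thesis by (simp add: classified_def)
    qed
  qed
qed

section \<open>The graph families\<close>

lemma cycle_cut_conn:
  assumes cyc: "is_cycle G vs es"
  shows "cut_conn (set vs) (ends G) (set es)"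
proof (rule cut_connI)
  have len: "length vs = length es" "es \<noteq> []" using cyc by (auto simp: is_cycle_def)
  have c: "ends G (es ! k) = {vs ! k, vs ! ((k + 1) mod length es)}" if "k < length es" for k
    using cyc that by (auto simp: is_cycle_def)
  show "set vs \<noteq> {}" using len by auto
  fix Z assume Z: "Z \<subseteq> set vs" "Z \<noteq> {}" "Z \<noteq> set vs"
  show "\<exists>e\<in>set es. crosses (ends G) Z e"
  proof (rule ccontr)
    assume n: "\<not> ?thesis"
    have "(vs ! k \<in> Z) = (vs ! 0 \<in> Z)" if "k < length es" for k
      using that
    proof (induction k)
      case (Suc k)
      then have "es ! k \<in> set es" by simp
      then have "\<not> crosses (ends G) Z (es ! k)" using n by blast
      then have "(vs ! k \<in> Z) = (vs ! Suc k \<in> Z)" using c[of k] Suc.prems by (auto simp: crosses_def)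
      then show ?case using Suc by simp
    qed simp
    then have "\<forall>v\<in>set vs. (v \<in> Z) = (vs ! 0 \<in> Z)" using len by (metis in_set_conv_nth)
    then show False using Z by blast
  qed
qed

text \<open>A cycle has as many edges as vertices, so by count a tree omits exactly one edge; any
  one may be omitted.\<close>

lemma cycle_trees:
  assumes cyc: "is_cycle G vs es"
  shows "trees (set vs) (ends G) (set es) = (\<lambda>e. set es - {e}) ` set es"
proof
  have len: "card (set vs) = card (set es)" "es \<noteq> []" using cyc by (auto simp: is_cycle_def distinct_card)
  show "(\<lambda>e. set es - {e}) ` set es \<subseteq> trees (set vs) (ends G) (set es)"
  proof
    fix T assume "T \<in> (\<lambda>e. set es - {e}) ` set es"
    then obtain i where i: "i < length es" "T = set es - {es ! i}" by (auto simp: in_set_conv_nth)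
    have "cut_conn (set vs) (ends G) T" unfolding i(2)
      by (rule cycle_edge_removable[OF cycle_cut_conn[OF cyc] cyc subset_refl i(1)])
    moreover have "card T + 1 = card (set es)" unfolding i(2) using card_Suc_Diff1[of "set es" "es ! i"] i(1) by simp
    ultimately show "T \<in> trees (set vs) (ends G) (set es)" using i(2) len by (auto simp: trees_def)
  qed
  show "trees (set vs) (ends G) (set es) \<subseteq> (\<lambda>e. set es - {e}) ` set es"
  proof
    fix T assume "T \<in> trees (set vs) (ends G) (set es)"
    then have T: "T \<subseteq> set es" "card T + 1 = card (set es)" using len by (auto simp: trees_def)
    then have "card (set es - T) = 1" using finite_subset[OF T(1)] by (simp add: card_Diff_subset)
    then obtain e where "set es - T = {e}" by (auto simp: card_1_singleton_iff)
    then have "e \<in> set es" "T = set es - {e}" using T(1) by auto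
    then show "T \<in> (\<lambda>e. set es - {e}) ` set es" by blast
  qed
qed

text \<open>The representative e lies outside D because the parallel extension commutes with
  reflections away from e.\<close>

lemma trees_grow_parallel:
  assumes "finite A" "wf_graph V en (E0 \<union> A)" "E0 \<inter> A = {}"
    and "trees V en E0 = toggle D ` class_system E0 c T" "D \<subseteq> E0"
    and "\<And>a. a \<in> A \<Longrightarrow> \<exists>e\<in>E0 - D. en a = en e \<and> c a = c e"
  shows "trees V en (E0 \<union> A) = toggle D ` class_system (E0 \<union> A) c T"
  using assms
proof (induction A rule: finite_induct)
  case (insert a A)
  obtain e where e: "e \<in> E0" "e \<notin> D" "en a = en e" "c a = c e" using insert.prems(5)[of a] by auto
  have a: "a \<notin> E0" "a \<notin> A" "a \<notin> D" using insert by auto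
  have IH: "trees V en (E0 \<union> A) = toggle D ` class_system (E0 \<union> A) c T"
    using insert.prems by (intro insert.IH wf_graph_subset[OF insert.prems(1)]) auto
  have "E0 \<union> insert a A - {a} = E0 \<union> A" using a by auto
  then have "trees V en (E0 \<union> insert a A) = par_ext e a (trees V en (E0 \<union> A))"
    using trees_parallel[OF insert.prems(1), of e a] e a by auto
  also have "\<dots> = toggle D ` par_ext e a (class_system (E0 \<union> A) c T)"
    unfolding IH by (rule par_ext_toggle[OF e(2) a(3)])
  also have "par_ext e a (class_system (E0 \<union> A) c T) = class_system (insert a (E0 \<union> A)) c T"
    by (rule par_ext_class_system) (use e a in auto)
  finally show ?case by simp
qed simp

lemma trees_cong:
  assumes "\<And>e. e \<in> E \<Longrightarrow> en e = en' e" shows "trees V en E = trees V en' E"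
proof -
  have "cut_conn V en T = cut_conn V en' T" if "T \<subseteq> E" for T
  proof -
    have "crosses en Z e = crosses en' Z e" if "e \<in> T" for Z e
      using assms[of e] that \<open>T \<subseteq> E\<close> by (auto simp: crosses_def)
    then show ?thesis unfolding cut_conn_def by (simp cong: bex_cong)
  qed
  then show ?thesis unfolding trees_def by auto
qed

text \<open>The inner vertices of the path have degree two and are suppressed from the far end until
  the single edge \<open>g 0\<close> joins the two ends. After reflection all edges of the path form
  part of one class; \<open>D0\<close> carries reflections made elsewhere.\<close>

lemma trees_path:
  fixes g :: "nat \<Rightarrow> 'e" and x :: "nat \<Rightarrow> 'v"
  assumes "wf_graph V en E" "inj_on g {..p}" "g ` {..p} \<subseteq> E"
    and "\<And>i. i \<le> p \<Longrightarrow> en (g i) = {x i, x (Suc i)}" "inj_on x {..Suc p}"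
    and "\<And>i e. 1 \<le> i \<Longrightarrow> i \<le> p \<Longrightarrow> e \<in> E \<Longrightarrow> x i \<in> en e \<Longrightarrow> e \<in> g ` {..p}"
    and "\<And>i. i \<le> p \<Longrightarrow> c (g i) = c (g 0)" "D0 \<inter> g ` {..p} = {}"
    and "trees (V - x ` {1..p}) (en(g 0 := {x 0, x (Suc p)})) (E - g ` {1..p})
      = toggle (insert (g 0) D0) ` class_system (E - g ` {1..p}) c T"
  shows "trees V en E = toggle (g ` {..p} \<union> D0) ` class_system E c T"
  using assms
proof (induction p arbitrary: V en E x)
  case 0
  have "en(g 0 := {x 0, x (Suc 0)}) = en" using "0.prems"(4)[of 0] by (auto simp: fun_eq_iff)
  then show ?case using "0.prems"(9) by simp
next
  case (Suc p)
  let ?w = "x (Suc p)" and ?e = "g p" and ?f = "g (Suc p)" and ?b = "x p" and ?c = "x (Suc (Suc p))"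
  have gne: "g i \<noteq> g j" if "i \<le> Suc p" "j \<le> Suc p" "i \<noteq> j" for i j
    using inj_onD[OF Suc.prems(2), of i j] that by auto
  have xne: "x i \<noteq> x j" if "i \<le> Suc (Suc p)" "j \<le> Suc (Suc p)" "i \<noteq> j" for i j
    using inj_onD[OF Suc.prems(5), of i j] that by auto
  have gE: "g i \<in> E" if "i \<le> Suc p" for i using Suc.prems(3) that by auto
  have only: "h = ?e \<or> h = ?f" if h: "h \<in> E" "?w \<in> en h" for h
  proof -
    obtain i where i: "i \<le> Suc p" "h = g i" using Suc.prems(6)[of "Suc p" h] h by auto
    have "?w \<in> {x i, x (Suc i)}" using Suc.prems(4)[OF i(1)] h(2) i(2) by simp
    then have "i = Suc p \<or> Suc i = Suc p" using xne[of "Suc p" i] xne[of "Suc p" "Suc i"] i(1) by auto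
    then show ?thesis using i(2) by auto
  qed
  interpret series_pair V en E ?e ?f ?w ?b ?c
  proof
    show "en ?e = {?w, ?b}" using Suc.prems(4)[of p] by auto
    show "en ?f = {?w, ?c}" using Suc.prems(4)[of "Suc p"] by auto
  qed (use Suc.prems(1) gE gne xne only in auto)
  \<comment> \<open>With \<open>x (Suc p)\<close> suppressed, the edge \<open>g p\<close> leads to
    the far end, which becomes the last vertex of the shortened path.\<close>
  let ?x = "x(Suc p := x (Suc (Suc p)))" and ?E = "E - {?f}"
  have IH: "trees (V - {?w}) en' ?E = toggle (g ` {..p} \<union> D0) ` class_system ?E c T"
  proof (rule Suc.IH[where x = ?x])
    show "wf_graph (V - {?w}) en' ?E" by (rule wf')
    show "inj_on g {..p}" using Suc.prems(2) by (rule inj_on_subset) auto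
    show "g ` {..p} \<subseteq> ?E" using gE gne by auto
    show "en' (g i) = {?x i, ?x (Suc i)}" if "i \<le> p" for i
      using that Suc.prems(4)[of i] gne[of i p] by (cases "i = p") (auto simp: en'_def)
    show "inj_on ?x {..Suc p}"
    proof (rule inj_onI)
      fix i j assume ij: "i \<in> {..Suc p}" "j \<in> {..Suc p}" "?x i = ?x j"
      then show "i = j" using xne[of i j] xne[of "Suc (Suc p)" i] xne[of "Suc (Suc p)" j]
        by (cases "i = Suc p"; cases "j = Suc p") auto
    qed
    show "h \<in> g ` {..p}" if hi: "1 \<le> i" "i \<le> p" "h \<in> ?E" "?x i \<in> en' h" for i h
    proof (cases "h = ?e")
      case False
      then have "x i \<in> en h" using hi by (simp add: en'_def)
      then obtain j where "j \<le> Suc p" "h = g j" using Suc.prems(6)[of i h] hi by auto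
      moreover have "j \<noteq> Suc p" using hi(3) \<open>h = g j\<close> by auto
      ultimately show ?thesis by auto
    qed simp
    show "c (g i) = c (g 0)" if "i \<le> p" for i using Suc.prems(7)[of i] that by simp
    show "D0 \<inter> g ` {..p} = {}" using Suc.prems(8) by auto
    have s1: "V - {?w} - ?x ` {1..p} = V - x ` {1..Suc p}" by (auto simp: atLeastAtMostSuc_conv)
    have s2: "?E - g ` {1..p} = E - g ` {1..Suc p}" by (auto simp: atLeastAtMostSuc_conv)
    have eq: "trees (V - x ` {1..Suc p}) (en'(g 0 := {x 0, ?c})) (E - g ` {1..Suc p})
        = trees (V - x ` {1..Suc p}) (en(g 0 := {x 0, ?c})) (E - g ` {1..Suc p})"
    proof (rule trees_cong)
      fix h assume h: "h \<in> E - g ` {1..Suc p}"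
      show "(en'(g 0 := {x 0, ?c})) h = (en(g 0 := {x 0, ?c})) h"
      proof (cases "h = g 0")
        case False
        then have "h \<noteq> ?e" using h by (cases p) auto
        then show ?thesis by (simp add: en'_def)
      qed simp
    qed
    have xx: "?x 0 = x 0" "?x (Suc p) = ?c" by simp_all
    show "trees (V - {?w} - ?x ` {1..p}) (en'(g 0 := {?x 0, ?x (Suc p)})) (?E - g ` {1..p})
        = toggle (insert (g 0) D0) ` class_system (?E - g ` {1..p}) c T"
      unfolding s1 s2 xx by (rule trans[OF eq Suc.prems(9)])
  qed
  let ?D = "g ` {..p} \<union> D0" and ?D' = "g ` {..<p} \<union> D0"
  have gD: "g j \<notin> g ` A \<union> D0" if "j \<le> Suc p" "A \<subseteq> {..Suc p}" "j \<notin> A" for j A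
  proof -
    have "g j \<notin> D0" using Suc.prems(8) that(1) by blast
    moreover have "g j \<notin> g ` A" using inj_on_image_mem_iff[OF Suc.prems(2) _ that(2), of j] that by simp
    ultimately show ?thesis by blast
  qed
  have fD: "?f \<notin> ?D" by (rule gD) auto
  have eD: "?e \<notin> ?D'" by (rule gD) auto
  have "toggle {?e} ?D = ?D'" using eD by (auto simp: toggle_def atMost_Suc lessThan_Suc_atMost[symmetric] lessThan_Suc)
  then have "toggle {?e} ` trees (V - {?w}) en' ?E = toggle ?D' ` class_system ?E c T"
    unfolding IH toggle_image_comp by simp
  moreover have "par_ext ?e ?f (toggle ?D' ` class_system ?E c T) = toggle ?D' ` par_ext ?e ?f (class_system ?E c T)"
    using eD fD by (intro par_ext_toggle) auto
  moreover have "par_ext ?e ?f (class_system ?E c T) = class_system (insert ?f ?E) c T"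
    using gE gne Suc.prems(7)[of "Suc p"] Suc.prems(7)[of p] by (intro par_ext_class_system) auto
  moreover have "insert ?f ?E = E" using gE by auto
  ultimately have "trees V en E = toggle {?e, ?f} ` toggle ?D' ` class_system E c T"
    using trees_series by simp
  also have "\<dots> = toggle (toggle {?e, ?f} ?D') ` class_system E c T" by (rule toggle_image_comp)
  also have "toggle {?e, ?f} ?D' = g ` {..Suc p} \<union> D0"
    using eD fD by (auto simp: toggle_def atMost_Suc lessThan_Suc_atMost[symmetric] lessThan_Suc)
  finally show ?case .
qed

text \<open>Reflecting the only element of class j adds or removes the label j, so this reflection
  can be read off the label sets.\<close>

lemma toggle_singleton_class:
  assumes e: "cls E c j = {e}"
  shows "class_system E c T = toggle {e} ` class_system E c (toggle {j} ` T)"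
proof -
  have cj: "c e = j" "e \<in> E" and other: "\<And>x. x \<in> E \<Longrightarrow> x \<noteq> e \<Longrightarrow> c x \<noteq> j" using e by auto
  have 1: "toggle {e} X \<in> class_system E c (toggle {j} ` T)" if X: "X \<in> class_system E c T" for X T
  proof -
    have h: "X \<subseteq> E" "inj_on c X" "c ` X \<in> T" using X by (auto simp: class_system_def)
    have nj: "j \<notin> c ` (X - {e})" using other h(1) by fastforce
    have "inj_on c (toggle {e} X) \<and> c ` toggle {e} X = toggle {j} (c ` X)"
    proof (cases "e \<in> X")
      case True
      then have t: "toggle {e} X = X - {e}" by (auto simp: toggle_def)
      have "c ` X = insert j (c ` (X - {e}))" using True cj by auto
      then have "toggle {j} (c ` X) = c ` (X - {e})" using nj by (auto simp: toggle_def)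
      then show ?thesis unfolding t using inj_on_subset[OF h(2), of "X - {e}"] by auto
    next
      case False
      then have t: "toggle {e} X = insert e X" "X - {e} = X" by (auto simp: toggle_def)
      then show ?thesis using nj h(2) cj by (auto simp: toggle_def)
    qed
    then show ?thesis using toggle_subset[of "{e}" E X] h cj(2) by (auto simp: class_system_def)
  qed
  show ?thesis
  proof
    show "class_system E c T \<subseteq> toggle {e} ` class_system E c (toggle {j} ` T)"
      using 1 by (metis image_eqI subsetI toggle_toggle)
    show "toggle {e} ` class_system E c (toggle {j} ` T) \<subseteq> class_system E c T"
      using 1[of _ "toggle {j} ` T"] by auto
  qed
qed

text \<open>One representative per class gives a plain cycle, whose trees omit one edge; the
  remaining edges are parallel to the representatives.\<close>

lemma trees_cycle_classes:
  assumes wf: "wf_graph V en E" and n: "1 \<le> n" and v: "V = v ` {..<n}" "inj_on v {..<n}" and c: "c ` E = {..<n}"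
    and en: "\<And>e. e \<in> E \<Longrightarrow> en e = {v (c e), v (Suc (c e) mod n)}"
  shows "trees V en E = class_system E c ((\<lambda>i. {..<n} - {i}) ` {..<n})"
proof -
  have "\<exists>e\<in>E. c e = i" if "i < n" for i using c that by (metis image_iff lessThan_iff)
  then obtain r where r: "\<And>i. i < n \<Longrightarrow> r i \<in> E \<and> c (r i) = i" by metis
  let ?G = "\<lparr>verts = V, edges = E, ends = en\<rparr>"
  let ?es = "map r [0..<n]" and ?vs = "map v [0..<n]"
  let ?E = "r ` {..<n}"
  have rinj: "inj_on r {..<n}" using r by (metis inj_onI lessThan_iff)
  have "is_cycle ?G ?vs ?es"
    unfolding is_cycle_def using n v(2) rinj r en by (auto simp: distinct_map atLeast0LessThan)
  from cycle_trees[OF this] have "trees V en ?E = (\<lambda>e. ?E - {e}) ` ?E"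
    using v(1) by (simp add: atLeast0LessThan)
  also have "\<dots> = class_system ?E c ((\<lambda>i. {..<n} - {i}) ` {..<n})"
  proof -
    have ci: "inj_on c ?E" using r by (auto simp: inj_on_def)
    have cE: "c ` (?E - {r i}) = {..<n} - {i}" if "i < n" for i
    proof -
      have "c ` (?E - {r i}) = c ` ?E - c ` {r i}" using that by (intro inj_on_image_set_diff[OF ci]) auto
      moreover have "c ` ?E = {..<n}" using r by (force simp: image_image)
      ultimately show ?thesis using r[OF that] by simp
    qed
    show ?thesis
    proof
      show "(\<lambda>e. ?E - {e}) ` ?E \<subseteq> class_system ?E c ((\<lambda>i. {..<n} - {i}) ` {..<n})"
        using cE inj_on_subset[OF ci] by (auto simp: class_system_def)
      show "class_system ?E c ((\<lambda>i. {..<n} - {i}) ` {..<n}) \<subseteq> (\<lambda>e. ?E - {e}) ` ?E"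
      proof
        fix X assume "X \<in> class_system ?E c ((\<lambda>i. {..<n} - {i}) ` {..<n})"
        then obtain i where i: "X \<subseteq> ?E" "i < n" "c ` X = {..<n} - {i}" by (auto simp: class_system_def)
        then have "c ` X = c ` (?E - {r i})" using cE by simp
        then have "X = ?E - {r i}" using inj_on_image_eq_iff[OF ci i(1), of "?E - {r i}"] by auto
        then show "X \<in> (\<lambda>e. ?E - {e}) ` ?E" using i(2) by auto
      qed
    qed
  qed
  finally have base: "trees V en ?E = toggle {} ` class_system ?E c ((\<lambda>i. {..<n} - {i}) ` {..<n})"
    by (simp add: toggle_def)
  have sub: "?E \<subseteq> E" using r by auto
  then have E: "?E \<union> (E - ?E) = E" by blast
  have "trees V en (?E \<union> (E - ?E)) = toggle {} ` class_system (?E \<union> (E - ?E)) c ((\<lambda>i. {..<n} - {i}) ` {..<n})"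
  proof (rule trees_grow_parallel[OF _ _ _ base])
    show "finite (E - ?E)" using wf by (simp add: wf_graph_def)
    show "wf_graph V en (?E \<union> (E - ?E))" unfolding E by (rule wf)
    show "\<exists>e\<in>?E - {}. en a = en e \<and> c a = c e" if a: "a \<in> E - ?E" for a
    proof -
      have "c a < n" using a c by auto
      then show ?thesis using r[of "c a"] en[of a] en[of "r (c a)"] a by (intro bexI[of _ "r (c a)"]) auto
    qed
  qed auto
  then show ?thesis unfolding E by (simp add: toggle_def)
qed

text \<open>By \<open>class_polytope_equivalent\<close> the label sets T and the sizes n determine
  the polytope up to unimodular equivalence, so graphs are compared through these data
  alone.\<close>

definition class_polytope :: "('e \<Rightarrow>\<^sub>0 real) set \<Rightarrow> nat set set \<Rightarrow> (nat \<Rightarrow> nat) \<Rightarrow> bool" where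
  "class_polytope P T n \<longleftrightarrow> (\<exists>E c D. finite E \<and> c ` E \<subseteq> {..<4} \<and> D \<subseteq> E \<and>
     P = poly_of (toggle D ` class_system E c T) \<and> (\<forall>i<4. card (cls E c i) = n i))"

lemma class_polytope_equivalent:
  assumes "class_polytope P T n" "class_polytope Q T n"
  shows "unimodularly_equivalent P Q"
proof -
  obtain E1 c1 D1 where 1: "finite E1" "c1 ` E1 \<subseteq> {..<4}" "D1 \<subseteq> E1"
    "P = poly_of (toggle D1 ` class_system E1 c1 T)" "\<forall>i<4. card (cls E1 c1 i) = n i"
    using assms(1) unfolding class_polytope_def by blast
  obtain E2 c2 D2 where 2: "finite E2" "c2 ` E2 \<subseteq> {..<4}" "D2 \<subseteq> E2"
    "Q = poly_of (toggle D2 ` class_system E2 c2 T)" "\<forall>i<4. card (cls E2 c2 i) = n i"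
    using assms(2) unfolding class_polytope_def by blast
  have "card (cls E1 c1 i) = card (cls E2 c2 i)" for i
  proof (cases "i < 4")
    case False
    then have "cls E1 c1 i = {}" "cls E2 c2 i = {}" using 1(2) 2(2) by auto
    then show ?thesis by (simp only: card.empty)
  qed (use 1(5) 2(5) in simp)
  then show ?thesis unfolding 1(4) 2(4) by (intro class_systems_equivalent) (use 1 2 in auto)
qed

lemma shaped_cong:
  assumes "\<And>i. i < 4 \<Longrightarrow> n i = m i" shows "shaped k T n = shaped k T m"
  unfolding shaped_def using assms by simp

lemma class_polytope_rank:
  assumes "class_polytope P T n" "shaped k T n" shows "polytope_rank P = int k"
proof -
  obtain E c D where *: "finite E" "c ` E \<subseteq> {..<4}" "D \<subseteq> E"
    "P = poly_of (toggle D ` class_system E c T)" "\<forall>i<4. card (cls E c i) = n i"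
    using assms(1) unfolding class_polytope_def by blast
  have "shaped k T (\<lambda>i. card (cls E c i))" using assms(2) shaped_cong[of n "\<lambda>i. card (cls E c i)"] *(5) by simp
  then show ?thesis unfolding *(4) using * by (intro shaped_rank)
qed

lemma base_polytope_trees:
  assumes "wf_graph (verts G) (ends G) (edges G)" "trees (verts G) (ends G) (edges G) \<noteq> {}"
  shows "base_polytope G = poly_of (trees (verts G) (ends G) (edges G))"
proof -
  have "cut_conn (verts G) (ends G) (edges G)"
    using assms(2) cut_conn_mono unfolding trees_def by blast
  then show ?thesis using graphic_bases_trees[OF assms(1)] by (simp add: base_polytope_def poly_of_def)
qed

lemma wf_graph_of_list:
  assumes "finite X" "\<And>A. A \<in> set es \<Longrightarrow> A \<subseteq> X \<and> card A \<in> {1, 2}"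
  shows "wf_graph X ((!) es) {..<length es}"
  unfolding wf_graph_def using assms by simp

lemma graph_of_ends_polytope:
  assumes X: "finite X" "\<And>A. A \<in> set es \<Longrightarrow> A \<subseteq> X \<and> card A \<in> {1, 2}"
    and ls: "length ls = length es" "set ls \<subseteq> {..<4}" and D: "D \<subseteq> {..<length es}"
    and tr: "trees X ((!) es) {..<length es} = toggle D ` class_system {..<length es} ((!) ls) T"
    and ne: "class_system {..<length es} ((!) ls) T \<noteq> {}"
    and n: "\<And>i. i < 4 \<Longrightarrow> length (filter (\<lambda>y. y = i) ls) = n i"
  shows "class_polytope (base_polytope (graph_of_ends X es)) T n"
proof -
  have "wf_graph X ((!) es) {..<length es}" by (rule wf_graph_of_list[OF X])
  then have P: "base_polytope (graph_of_ends X es) = poly_of (toggle D ` class_system {..<length es} ((!) ls) T)"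
    using base_polytope_trees[of "graph_of_ends X es"] tr ne by (simp add: graph_of_ends_def)
  have "card (cls {..<length es} ((!) ls) i) = n i" if "i < 4" for i
    using n[OF that] ls(1) by (simp add: length_filter_conv_card)
  then show ?thesis unfolding class_polytope_def
    by (intro exI[of _ "{..<length es}"] exI[of _ "(!) ls"] exI[of _ D]) (use P D ls in \<open>auto simp: subset_iff\<close>)
qed

lemma shaped_graph_of_ends_polytope:
  assumes X: "finite X" "\<And>A. A \<in> set es \<Longrightarrow> A \<subseteq> X \<and> card A \<in> {1, 2}"
    and ls: "length ls = length es" "set ls \<subseteq> {..<4}" and D: "D \<subseteq> {..<length es}"
    and tr: "trees X ((!) es) {..<length es} = toggle D ` class_system {..<length es} ((!) ls) T"
    and n: "\<And>i. i < 4 \<Longrightarrow> length (filter (\<lambda>y. y = i) ls) = n i" and sh: "shaped k T n"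
  shows "class_polytope (base_polytope (graph_of_ends X es)) T n"
proof (rule graph_of_ends_polytope[OF X ls D tr _ n])
  have "shaped k T (\<lambda>i. card (cls {..<length es} ((!) ls) i))"
    using sh shaped_cong[of n "\<lambda>i. card (cls {..<length es} ((!) ls) i)"] n ls(1) by (simp add: length_filter_conv_card)
  moreover have "(!) ls ` {..<length es} \<subseteq> {..<4}" using ls by (auto simp: subset_iff)
  ultimately show "class_system {..<length es} ((!) ls) T \<noteq> {}"
    using sp_system_normal[OF shaped_sp_system[of "{..<length es}"]] by (simp add: normal_def)
qed

text \<open>Shrinking the path to one edge leaves a cycle of n + 1 classes, the last being the
  singleton \<open>g 0\<close>. Reflecting this singleton toggles the label n and gives the form
  that \<open>trees_path\<close> asks for.\<close>

lemma trees_cycle_path: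
  assumes wf: "wf_graph V en E"
    and g: "inj_on g {..p}" "g ` {..p} \<subseteq> E"
    and x: "\<And>i. i \<le> p \<Longrightarrow> en (g i) = {x i, x (Suc i)}" "inj_on x {..Suc p}" "x 0 = v 0" "x (Suc p) = v n"
    and V: "V = v ` {..n} \<union> x ` {1..p}" "v ` {..n} \<inter> x ` {1..p} = {}" "inj_on v {..n}"
    and c: "\<And>i. i \<le> p \<Longrightarrow> c (g i) = n" "c ` (E - g ` {..p}) = {..<n}"
    and en: "\<And>e. e \<in> E - g ` {..p} \<Longrightarrow> en e = {v (c e), v (Suc (c e))}"
  shows "trees V en E = toggle (g ` {..p}) ` class_system E c (toggle {n} ` (\<lambda>i. {..n} - {i}) ` {..n})"
proof -
  have "trees V en E = toggle (g ` {..p} \<union> {}) ` class_system E c (toggle {n} ` (\<lambda>i. {..n} - {i}) ` {..n})"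
  proof (rule trees_path[where x = x, OF wf g x(1,2)])
    have cn: "c e < n" if "e \<in> E - g ` {..p}" for e using that c(2) by auto
    show "e \<in> g ` {..p}" if "1 \<le> i" "i \<le> p" "e \<in> E" "x i \<in> en e" for i e
    proof (rule ccontr)
      assume "e \<notin> g ` {..p}"
      then have "x i \<in> v ` {..n}" using en[of e] cn[of e] that by auto
      moreover have "x i \<in> x ` {1..p}" using that(1,2) by auto
      ultimately show False using V(2) by blast
    qed
    show "c (g i) = c (g 0)" if "i \<le> p" for i using c(1) that by simp
    let ?V = "V - x ` {1..p}" and ?en = "en(g 0 := {x 0, x (Suc p)})" and ?E = "E - g ` {1..p}"
    have V': "?V = v ` {..<Suc n}" using V(1,2) by (auto simp: lessThan_Suc_atMost)
    have E': "?E = insert (g 0) (E - g ` {..p})" (is "_ = insert _ ?F")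
    proof -
      have "{..p} = insert 0 {1..p}" by auto
      then have "g ` {..p} = insert (g 0) (g ` {1..p})" by (simp only: image_insert)
      moreover have "g 0 \<notin> g ` {1..p}" using inj_on_image_mem_iff[OF g(1), of 0 "{1..p}"] by auto
      ultimately show ?thesis using g(2) by auto
    qed
    have g0: "c (g 0) = n" "g 0 \<notin> ?F" using c(1) by auto
    have "trees ?V ?en ?E = class_system ?E c ((\<lambda>i. {..<Suc n} - {i}) ` {..<Suc n})"
    proof (rule trees_cycle_classes[OF _ _ V'])
      have enE: "?en e = {v (c e), v (Suc (c e) mod Suc n)}" if "e \<in> ?E" for e
      proof (cases "e = g 0")
        case True
        then show ?thesis using g0 x(3,4) by auto
      next
        case False
        then have "e \<in> ?F" using that E' by auto
        then show ?thesis using en[of e] cn[of e] False by simp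
      qed
      then show "\<And>e. e \<in> ?E \<Longrightarrow> ?en e = {v (c e), v (Suc (c e) mod Suc n)}" .
      have cE: "c e < Suc n" if "e \<in> ?E" for e using that cn[of e] g0 E' by auto
      show "wf_graph ?V ?en ?E" unfolding wf_graph_def
      proof (intro conjI ballI)
        show "finite ?V" "finite ?E" using wf by (auto simp: wf_graph_def)
        fix e assume e: "e \<in> ?E"
        show "?en e \<subseteq> ?V" unfolding V' enE[OF e] using cE[OF e] by auto
        show "card (?en e) \<in> {1, 2}" unfolding enE[OF e] by (simp add: card_insert_if)
      qed
      have "c ` ?E = c ` insert (g 0) ?F" using E' by (rule arg_cong)
      also have "\<dots> = insert n {..<n}" using c(2) g0(1) by (simp only: image_insert)
      finally show "c ` ?E = {..<Suc n}" by (simp only: lessThan_Suc)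
      show "inj_on v {..<Suc n}" using V(3) by (simp add: lessThan_Suc_atMost)
    qed simp
    also have "\<dots> = toggle {g 0} ` class_system ?E c (toggle {n} ` (\<lambda>i. {..<Suc n} - {i}) ` {..<Suc n})"
    proof (rule toggle_singleton_class)
      have "c e \<noteq> n" if "e \<in> ?F" for e using cn[OF that] by simp
      then show "cls ?E c n = {g 0}" unfolding E' using g0 by blast
    qed
    finally show "trees ?V ?en ?E = toggle {g 0} ` class_system ?E c (toggle {n} ` (\<lambda>i. {..n} - {i}) ` {..n})"
      by (simp add: lessThan_Suc_atMost)
  qed simp_all
  then show ?thesis by simp
qed

section \<open>Explicit edge lists of the families and their class sizes\<close>

lemma length_path_ends: "length (path_ends xs) = length xs - 1"
  by (simp add: path_ends_def)

lemma path_ends_nth: "Suc i < length xs \<Longrightarrow> path_ends xs ! i = {xs ! i, xs ! Suc i}"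
  by (simp add: path_ends_def nth_tl)

lemma path_vertices:
  fixes U :: "nat \<Rightarrow> 'v" and a b :: 'v and p :: nat
  defines "xs \<equiv> [a] @ map U [1..<p + 1] @ [b]"
  shows "length xs = p + 2" "xs ! 0 = a" "xs ! Suc p = b" "(!) xs ` {1..p} = U ` {1..p}" "set xs = {a, b} \<union> U ` {1..p}"
    and "inj U \<Longrightarrow> a \<notin> range U \<Longrightarrow> b \<notin> range U \<Longrightarrow> a \<noteq> b \<Longrightarrow> inj_on ((!) xs) {..Suc p}"
proof -
  show l: "length xs = p + 2" and "xs ! 0 = a" "xs ! Suc p = b" by (auto simp: xs_def nth_append)
  have "xs ! i = U i" if "i \<in> {1..p}" for i using that by (cases i) (simp_all add: xs_def nth_append del: upt_Suc)
  then show "(!) xs ` {1..p} = U ` {1..p}" by (rule image_cong[OF refl])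
  show "set xs = {a, b} \<union> U ` {1..p}" by (auto simp: xs_def)
  assume "inj U" "a \<notin> range U" "b \<notin> range U" "a \<noteq> b"
  then have "distinct xs" by (auto simp: xs_def distinct_map inj_on_def)
  then show "inj_on ((!) xs) {..Suc p}" using l by (auto intro!: inj_onI simp: nth_eq_iff_index_eq)
qed

lemma card_doubleton_12: "card {a, b} \<in> {1, 2}"
  by (simp add: card_insert_if)

lemma path_ends_subset:
  assumes "A \<in> set (path_ends xs)" shows "A \<subseteq> set xs \<and> card A \<in> {1, 2}"
proof -
  obtain i where i: "i < length (path_ends xs)" "A = path_ends xs ! i"
    using assms by (metis in_set_conv_nth)
  then have "Suc i < length xs" by (simp add: length_path_ends)
  then show ?thesis using card_doubleton_12 i(2) by (simp add: path_ends_nth)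
qed

text \<open>Labels start at 0: the edges between v_(i+1) and v_(i+2) carry label i and the path
  carries label n, so T consists of the label sets of a cycle toggled at n.\<close>

lemma graph_B_polytope:
  fixes ss :: "nat list" and p :: nat
  defines "n \<equiv> length ss"
  defines "ls \<equiv> concat (map (\<lambda>i. replicate (ss ! i + 1) i) [0..<n]) @ replicate (p + 1) n"
  assumes n: "1 \<le> n" "n \<le> 3"
    and T: "T = toggle {n} ` (\<lambda>i. {..n} - {i}) ` {..n}"
    and m: "\<And>i. i < 4 \<Longrightarrow> length (filter (\<lambda>y. y = i) ls) = m i" and sh: "shaped k T m"
  shows "class_polytope (base_polytope (graph_B ss p)) T m"
proof -
  define Ls where "Ls = concat (map (\<lambda>i. replicate (ss ! i + 1) i) [0..<n])"
  define L where "L = map (\<lambda>i. {Vv (i + 1), Vv (i + 2)}) Ls"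
  define xs where "xs = [Vv 1] @ map Vu [1..<p + 1] @ [Vv (n + 1)]"
  define V where "V = Vv ` {1..n + 1} \<union> Vu ` {1..p}"
  define v where "v = (\<lambda>i. Vv (i + 1))"
  define g where "g = (\<lambda>i. length L + i)"
  let ?es = "L @ path_ends xs"
  note xs = path_vertices[where a = "Vv 1" and U = Vu and p = p and b = "Vv (n + 1)", folded xs_def]
  have up: "[1..<n + 1] = map Suc [0..<n]" by (simp add: map_Suc_upt del: upt_Suc)
  have "concat (map (\<lambda>i. replicate (ss ! (i - 1) + 1) {Vv i, Vv (i + 1)}) [1..<n + 1]) = L"
    unfolding up L_def Ls_def by (simp add: map_concat comp_def)
  then have G: "graph_B ss p = graph_of_ends V ?es" by (simp add: graph_B_def V_def xs_def n_def)
  have ls: "ls = Ls @ replicate (p + 1) n" by (simp add: ls_def Ls_def)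
  have setLs: "set Ls = {..<n}" unfolding Ls_def by (auto simp: in_set_replicate)
  have len: "length ls = length ?es" "length L = length Ls" "length ?es = length L + (p + 1)"
    using xs(1) by (simp_all add: ls L_def length_path_ends)
  have Lnth: "?es ! e = {v (ls ! e), v (Suc (ls ! e))}" if "e < length L" for e
    using that len(2) by (simp add: nth_append L_def ls v_def)
  have gnth: "?es ! g i = {xs ! i, xs ! Suc i}" "ls ! g i = n" if "i \<le> p" for i
    using that len(2) xs(1) by (simp_all add: g_def nth_append ls path_ends_nth del: replicate.simps)
  have gim: "g ` {..p} = {length L..<length ?es}"
  proof (rule set_eqI)
    fix e
    have "e \<in> g ` {..p} \<longleftrightarrow> (\<exists>i\<le>p. e = length L + i)" unfolding g_def image_iff Bex_def atMost_iff by (rule refl)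
    also have "\<dots> \<longleftrightarrow> length L \<le> e \<and> e < length L + (p + 1)" by presburger
    finally show "e \<in> g ` {..p} \<longleftrightarrow> e \<in> {length L..<length ?es}" unfolding len(3) by simp
  qed
  have E0: "{..<length ?es} - g ` {..p} = {..<length L}" unfolding gim len(3) by auto
  have Vim: "v ` {..n} = Vv ` {1..n + 1}" unfolding v_def
    using image_Suc_atMost[of n] by (metis (no_types, lifting) One_nat_def Suc_eq_plus1 image_cong image_image)
  have X: "A \<subseteq> V \<and> card A \<in> {1, 2}" if A: "A \<in> set ?es" for A
  proof (cases "A \<in> set L")
    case True
    then obtain i where "i < n" "A = {Vv (i + 1), Vv (i + 2)}" using setLs by (auto simp: L_def)
    then show ?thesis using card_doubleton_12[of "Vv (i + 1)" "Vv (i + 2)"] by (auto simp: V_def)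
  next
    case False
    then have "A \<subseteq> set xs \<and> card A \<in> {1, 2}" using A path_ends_subset[of A xs] by simp
    moreover have "set xs \<subseteq> V" unfolding xs(5) V_def by auto
    ultimately show ?thesis by blast
  qed
  have finV: "finite V" by (simp add: V_def)
  have tr: "trees V ((!) ?es) {..<length ?es} = toggle (g ` {..p}) ` class_system {..<length ?es} ((!) ls) T"
    unfolding T
  proof (rule trees_cycle_path[where x = "(!) xs" and v = v])
    show "wf_graph V ((!) ?es) {..<length ?es}" by (rule wf_graph_of_list[OF finV X])
    show "inj_on g {..p}" by (simp add: g_def)
    show "g ` {..p} \<subseteq> {..<length ?es}" unfolding gim by auto
    show "inj_on ((!) xs) {..Suc p}" by (rule xs(6)) (use n in \<open>auto simp: inj_on_def\<close>)
    show "xs ! 0 = v 0" "xs ! Suc p = v n" using xs(2,3) by (simp_all add: v_def)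
    show "V = v ` {..n} \<union> (!) xs ` {1..p}" unfolding V_def Vim xs(4) by simp
    show "v ` {..n} \<inter> (!) xs ` {1..p} = {}" unfolding Vim xs(4) by auto
    show "inj_on v {..n}" by (simp add: v_def inj_on_def)
    show "(!) ls ` ({..<length ?es} - g ` {..p}) = {..<n}"
    proof -
      have "(!) ls ` {..<length L} = (!) Ls ` {..<length Ls}"
        unfolding len(2) by (rule image_cong) (simp_all add: ls nth_append)
      also have "\<dots> = set Ls" by (auto simp: set_conv_nth)
      finally show ?thesis unfolding E0 setLs .
    qed
    show "?es ! e = {v (ls ! e), v (Suc (ls ! e))}" if "e \<in> {..<length ?es} - g ` {..p}" for e
      using that Lnth unfolding E0 by simp
  qed (use gnth in auto)
  show ?thesis unfolding G
  proof (rule shaped_graph_of_ends_polytope[where ls = ls and n = m and D = "g ` {..p}" and k = k])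
    show "finite V" by (rule finV)
    show "A \<subseteq> V \<and> card A \<in> {1, 2}" if "A \<in> set ?es" for A using that by (rule X)
    show "length ls = length ?es" by (rule len(1))
    show "trees V ((!) ?es) {..<length ?es} = toggle (g ` {..p}) ` class_system {..<length ?es} ((!) ls) T" by (rule tr)
    show "shaped k T m" by (rule sh)
    have "set ls = insert n {..<n}" unfolding ls set_append setLs set_replicate_conv_if by simp
    also have "\<dots> \<subseteq> {..<4}" using n(2) by (simp add: subset_iff)
    finally show "set ls \<subseteq> {..<4}" .
    show "g ` {..p} \<subseteq> {..<length ?es}" unfolding gim by auto
    show "length (filter (\<lambda>y. y = i) ls) = m i" if "i < 4" for i using m that by simp
  qed
qed

lemma graph_B_types:
  "toggle {1} ` (\<lambda>i. {..1} - {i}) ` {..1} = {{}, {0, 1 :: nat}}"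
  "toggle {2} ` (\<lambda>i. {..2} - {i}) ` {..2} = {{0}, {1}, {0, 1, 2 :: nat}}"
  "toggle {3} ` (\<lambda>i. {..3} - {i}) ` {..3} = {{0, 1}, {0, 2}, {1, 2}, {0, 1, 2, 3 :: nat}}"
proof -
  have u: "{..1 :: nat} = {0, 1}" "{..2 :: nat} = {0, 1, 2}" "{..3 :: nat} = {0, 1, 2, 3}" by auto
  show "toggle {1} ` (\<lambda>i. {..1} - {i}) ` {..1} = {{}, {0, 1 :: nat}}"
    unfolding u by (simp add: toggle_def insert_Diff_if insert_commute)
  show "toggle {2} ` (\<lambda>i. {..2} - {i}) ` {..2} = {{0}, {1}, {0, 1, 2 :: nat}}"
    unfolding u by (simp add: toggle_def insert_Diff_if insert_commute)
  show "toggle {3} ` (\<lambda>i. {..3} - {i}) ` {..3} = {{0, 1}, {0, 2}, {1, 2}, {0, 1, 2, 3 :: nat}}"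
    unfolding u by (simp add: toggle_def insert_Diff_if insert_commute)
qed

lemma graph_B_1:
  assumes "shaped k {{}, {0, 1}} n" "n 0 = s + 1" "n 1 = p + 1" "n 2 = 0" "n 3 = 0"
  shows "class_polytope (base_polytope (graph_B [s] p)) {{}, {0, 1}} n"
proof (rule graph_B_polytope[OF _ _ _ _ assms(1)])
  fix i :: nat assume "i < 4"
  then have "i = 0 \<or> i = 1 \<or> i = 2 \<or> i = 3" by linarith
  then show "length (filter (\<lambda>y. y = i) (concat (map (\<lambda>i. replicate ([s] ! i + 1) i) [0..<length [s]])
    @ replicate (p + 1) (length [s]))) = n i" using assms by (auto simp: filter_replicate)
next
  have l: "length [s] = 1" by simp
  show "{{}, {0, 1}} = toggle {length [s]} ` (\<lambda>i. {..length [s]} - {i}) ` {..length [s]}"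
    unfolding l by (rule graph_B_types(1)[symmetric])
qed simp_all

lemma graph_B_2:
  assumes "shaped k {{0}, {1}, {0, 1, 2}} n" "n 0 = s1 + 1" "n 1 = s2 + 1" "n 2 = p + 1" "n 3 = 0"
  shows "class_polytope (base_polytope (graph_B [s1, s2] p)) {{0}, {1}, {0, 1, 2}} n"
proof (rule graph_B_polytope[OF _ _ _ _ assms(1)])
  fix i :: nat assume "i < 4"
  then have "i = 0 \<or> i = 1 \<or> i = 2 \<or> i = 3" by linarith
  then show "length (filter (\<lambda>y. y = i) (concat (map (\<lambda>i. replicate ([s1, s2] ! i + 1) i) [0..<length [s1, s2]])
    @ replicate (p + 1) (length [s1, s2]))) = n i" using assms by (auto simp: filter_replicate)
next
  have l: "length [s1, s2] = 2" by simp
  show "{{0}, {1}, {0, 1, 2}} = toggle {length [s1, s2]} ` (\<lambda>i. {..length [s1, s2]} - {i}) ` {..length [s1, s2]}"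
    unfolding l by (rule graph_B_types(2)[symmetric])
qed simp_all

lemma graph_B_3:
  assumes "shaped k {{0, 1}, {0, 2}, {1, 2}, {0, 1, 2, 3}} n" "n 0 = s1 + 1" "n 1 = s2 + 1" "n 2 = s3 + 1" "n 3 = p + 1"
  shows "class_polytope (base_polytope (graph_B [s1, s2, s3] p)) {{0, 1}, {0, 2}, {1, 2}, {0, 1, 2, 3}} n"
proof (rule graph_B_polytope[OF _ _ _ _ assms(1)])
  fix i :: nat assume "i < 4"
  then have "i = 0 \<or> i = 1 \<or> i = 2 \<or> i = 3" by linarith
  then show "length (filter (\<lambda>y. y = i) (concat (map (\<lambda>i. replicate ([s1, s2, s3] ! i + 1) i) [0..<length [s1, s2, s3]])
    @ replicate (p + 1) (length [s1, s2, s3]))) = n i" using assms by (auto simp: filter_replicate numeral_eq_Suc)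
next
  have l: "length [s1, s2, s3] = 3" by simp
  show "{{0, 1}, {0, 2}, {1, 2}, {0, 1, 2, 3}} = toggle {length [s1, s2, s3]} ` (\<lambda>i. {..length [s1, s2, s3]} - {i}) ` {..length [s1, s2, s3]}"
    unfolding l by (rule graph_B_types(3)[symmetric])
qed simp_all

lemma inj_on_image_singleton:
  assumes "inj_on f X" "f ` X = {a}" shows "\<exists>x. X = {x}"
  using card_image[OF assms(1)] assms(2) card_1_singletonE[of X] by fastforce

lemma inj_on_image_singletons:
  assumes "inj_on f X \<and> f ` X \<in> {{a}, {b}}" shows "\<exists>x. X = {x}"
proof -
  have "f ` X = {a} \<or> f ` X = {b}" "inj_on f X" using assms by simp_all
  then show ?thesis by (elim disjE) (rule inj_on_image_singleton; assumption)+
qed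

lemma graph_A_polytope:
  assumes "n 0 = s" "n 1 = 0" "n 2 = 0" "n 3 = 0" "s \<ge> 2"
  shows "class_polytope (base_polytope (graph_A s)) {{0}} n"
proof -
  let ?es = "replicate s {Vv 1, Vv 2}" and ?V = "{Vv 1, Vv 2}" and ?ls = "replicate s (0 :: nat)"
  \<comment> \<open>Edge 0 against all others makes a cycle of two classes; its label sets {0} and
    {1} together say that a member is any single edge.\<close>
  let ?c = "\<lambda>e. if e = 0 then 0 else 1 :: nat"
  have "trees ?V ((!) ?es) {..<length ?es} = class_system {..<length ?es} ?c ((\<lambda>i. {..<2} - {i}) ` {..<2})"
  proof (rule trees_cycle_classes[where v = "\<lambda>i. Vv (i + 1)"])
    show "wf_graph ?V ((!) ?es) {..<length ?es}" by (auto simp: wf_graph_def)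
    show "?V = (\<lambda>i. Vv (i + 1)) ` {..<2}" by (auto simp: lessThan_Suc numeral_2_eq_2)
    show "?c ` {..<length ?es} = {..<2}"
    proof
      show "{..<2} \<subseteq> ?c ` {..<length ?es}"
        using assms(5) image_eqI[of 1 ?c 1 "{..<length ?es}"] image_eqI[of 0 ?c 0 "{..<length ?es}"]
        by (auto simp: less_2_cases_iff)
    qed auto
    show "\<And>e. e \<in> {..<length ?es} \<Longrightarrow> ?es ! e = {Vv (?c e + 1), Vv (Suc (?c e) mod 2 + 1)}"
      by (simp add: insert_commute numeral_2_eq_2)
  qed (auto simp: inj_on_def)
  also have "(\<lambda>i. {..<2} - {i}) ` {..<2} = {{0}, {1 :: nat}}"
  proof -
    have "{..<2 :: nat} = {0, 1}" by auto
    then show ?thesis by (simp add: insert_Diff_if insert_commute)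
  qed
  also have "class_system {..<length ?es} ?c {{0}, {1}} = class_system {..<length ?es} ((!) ?ls) {{0}}"
  proof -
    have eq: "inj_on ?c X \<and> ?c ` X \<in> {{0}, {1}} \<longleftrightarrow> inj_on ((!) ?ls) X \<and> (!) ?ls ` X \<in> {{0}}" if "X \<subseteq> {..<length ?es}" for X
    proof -
      have 0: "?ls ! e = 0" if "e \<in> X" for e using that \<open>X \<subseteq> _\<close> by (auto simp: subset_iff)
      have "inj_on ((!) ?ls) X \<and> (!) ?ls ` X \<in> {{0}} \<longleftrightarrow> (\<exists>e. X = {e})"
      proof
        assume h: "inj_on ((!) ?ls) X \<and> (!) ?ls ` X \<in> {{0}}"
        show "\<exists>e. X = {e}" by (rule inj_on_image_singleton[OF conjunct1[OF h] singletonD[OF conjunct2[OF h]]])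
      qed (use 0 in auto)
      moreover have "inj_on ?c X \<and> ?c ` X \<in> {{0}, {1}} \<longleftrightarrow> (\<exists>e. X = {e})"
      proof
        assume "inj_on ?c X \<and> ?c ` X \<in> {{0}, {1}}"
        then show "\<exists>e. X = {e}" by (rule inj_on_image_singletons)
      qed auto
      ultimately show ?thesis by simp
    qed
    show ?thesis unfolding class_system_def by (rule Collect_cong, rule conj_cong[OF refl], rule eq)
  qed
  finally have tr: "trees ?V ((!) ?es) {..<length ?es} = toggle {} ` class_system {..<length ?es} ((!) ?ls) {{0}}"
    by (simp add: toggle_def)
  show ?thesis unfolding graph_A_def
  proof (rule graph_of_ends_polytope[OF _ _ _ _ _ tr])
    have "{0} \<in> class_system {..<length ?es} ((!) ?ls) {{0}}" using assms(5) by (simp add: class_system_def)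
    then show "class_system {..<length ?es} ((!) ?ls) {{0}} \<noteq> {}" by blast
    fix i :: nat assume "i < 4"
    then have "i = 0 \<or> i = 1 \<or> i = 2 \<or> i = 3" by linarith
    then show "length (filter (\<lambda>y. y = i) ?ls) = n i" using assms by (auto simp: filter_replicate)
  qed auto
qed

text \<open>The coarse labelling \<open>f \<circ> c\<close> is replaced by the finer c with label
  sets pulled back; injectivity of f on A keeps at most one label per coarse class.\<close>

lemma class_system_merge:
  assumes "c ` E \<subseteq> C"
  shows "class_system E (f \<circ> c) T = class_system E c {A. A \<subseteq> C \<and> inj_on f A \<and> f ` A \<in> T}"
proof -
  have "inj_on (f \<circ> c) X \<longleftrightarrow> inj_on c X \<and> inj_on f (c ` X)" for X
    using comp_inj_on[of c X f] inj_on_imageI[of f c X] inj_on_imageI2[of f c X] by blast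
  moreover have "c ` X \<subseteq> C" if "X \<subseteq> E" for X using assms that by blast
  ultimately show ?thesis unfolding class_system_def by (auto simp: image_comp)
qed

lemma triangle_types: "(\<lambda>i. {..<3} - {i}) ` {..<3} = {{1, 2}, {0, 2}, {0, 1 :: nat}}"
proof -
  have "{..<3 :: nat} = {0, 1, 2}" by auto
  then show ?thesis by (simp add: insert_Diff_if insert_commute)
qed

lemma triangle_vertices: "Vv ` {1..3} = {Vv 1, Vv 2, Vv 3}"
proof -
  have "{1..3 :: nat} = {1, 2, 3}" by auto
  then show ?thesis by simp
qed

lemma less_4_cases: "i < 4 \<Longrightarrow> i = 0 \<or> i = 1 \<or> i = 2 \<or> i = (3 :: nat)"
  by linarith

lemma triangle_arith:
  "0 + 1 = (1 :: nat)" "Suc 0 mod 3 + 1 = 2" "1 + 1 = (2 :: nat)" "Suc 1 mod 3 + 1 = 3" "2 + 1 = (3 :: nat)" "Suc 2 mod 3 + 1 = 1"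
  by simp_all

lemma graph_D_polytope:
  assumes sh: "shaped k {{0, 1}, {0, 2}, {1, 2}, {0, 1, 2, 3}} n" "n 0 = s1" "n 1 = s2" "n 2 = s3" "n 3 = 0"
    and pos: "s1 > 0" "s2 > 0" "s3 > 0"
  shows "class_polytope (base_polytope (graph_D s1 s2 s3)) {{0, 1}, {0, 2}, {1, 2}, {0, 1, 2, 3}} n"
proof -
  define es where "es = replicate s1 {Vv 1, Vv 2} @ replicate s2 {Vv 2, Vv 3} @ replicate s3 {Vv 3, Vv 1}"
  define ls where "ls = replicate s1 (0 :: nat) @ replicate s2 1 @ replicate s3 2"
  let ?V = "Vv ` {1..3}" and ?E = "{..<length es}"
  have X: "A \<subseteq> ?V \<and> card A \<in> {1, 2}" if "A \<in> set es" for A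
    using that unfolding es_def by (auto simp: triangle_vertices split: if_splits)
  have setls: "set ls = {0, 1, 2}" using pos unfolding ls_def by auto
  have len: "length ls = length es" by (simp add: ls_def es_def)
  have im: "(!) ls ` ?E = {..<3}"
  proof -
    have "(!) ls ` ?E = set ls" unfolding len[symmetric] by (auto simp: set_conv_nth)
    then show ?thesis unfolding setls by auto
  qed
  have edge: "(ls ! e = 0 \<and> es ! e = {Vv 1, Vv 2}) \<or> (ls ! e = 1 \<and> es ! e = {Vv 2, Vv 3}) \<or>
      (ls ! e = 2 \<and> es ! e = {Vv 3, Vv 1})" if "e \<in> ?E" for e
    using that unfolding es_def ls_def by (auto simp: nth_append)
  have three: "{..<3 :: nat} = {0, 1, 2}" by auto
  have "trees ?V ((!) es) ?E = class_system ?E ((!) ls) ((\<lambda>i. {..<3} - {i}) ` {..<3})"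
  proof (rule trees_cycle_classes[where v = "\<lambda>i. Vv (i + 1)"])
    show "wf_graph ?V ((!) es) ?E" by (rule wf_graph_of_list[OF _ X]) simp_all
    show "?V = (\<lambda>i. Vv (i + 1)) ` {..<3}" unfolding triangle_vertices three by (simp add: numeral_eq_Suc)
    show "es ! e = {Vv (ls ! e + 1), Vv (Suc (ls ! e) mod 3 + 1)}" if "e \<in> ?E" for e
    proof -
      have "A = {Vv (l + 1), Vv (Suc l mod 3 + 1)}"
        if "(l = 0 \<and> A = {Vv 1, Vv 2}) \<or> (l = 1 \<and> A = {Vv 2, Vv 3}) \<or> (l = 2 \<and> A = {Vv 3, Vv 1})" for l A
        using that by (elim disjE conjE) (simp_all only: triangle_arith)
      from this[OF edge[OF that]] show ?thesis .
    qed
    show "(!) ls ` ?E = {..<3}" by (rule im)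
  qed (auto simp: inj_on_def)
  also have "\<dots> = toggle {} ` class_system ?E ((!) ls) {{0, 1}, {0, 2}, {1, 2}, {0, 1, 2, 3}}"
  proof -
    \<comment> \<open>No edge has label 3, so the label set {0, 1, 2, 3} is never attained and the
      system has the form shared with the graphs B.\<close>
    have "(!) ls ` X \<noteq> {0, 1, 2, 3}" if "X \<subseteq> ?E" for X
    proof
      assume "(!) ls ` X = {0, 1, 2, 3}"
      moreover have "(!) ls ` X \<subseteq> {..<3}" using image_mono[OF that, of "(!) ls"] im by simp
      ultimately show False by auto
    qed
    then show ?thesis unfolding triangle_types class_system_def by (auto simp: toggle_def)
  qed
  finally have tr: "trees ?V ((!) es) ?E = toggle {} ` class_system ?E ((!) ls) {{0, 1}, {0, 2}, {1, 2}, {0, 1, 2, 3}}" .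
  show ?thesis unfolding graph_D_def es_def[symmetric]
  proof (rule shaped_graph_of_ends_polytope[OF _ X len _ _ tr _ sh(1)])
    show "set ls \<subseteq> {..<4}" unfolding setls by simp
    fix i :: nat assume "i < 4"
    from less_4_cases[OF this] show "length (filter (\<lambda>y. y = i) ls) = n i"
      using sh by (auto simp: ls_def filter_replicate)
  qed auto
qed

text \<open>f sends the four labels to the three sides of a triangle. Labels 2 and 3 share a side:
  once the second path has shrunk to an edge, it is parallel to the edges between v_2 and v_3.
  Toggling 1 and 3 reflects the two path classes.\<close>

lemma graph_C_types:
  assumes f: "f 0 = 0" "f 1 = 2" "f 2 = 1" "f 3 = 1"
  shows "toggle {1} ` toggle {3} ` {A. A \<subseteq> {0, 1, 2, 3} \<and> inj_on f A \<and> f ` A \<in> {{1, 2}, {0, 2}, {0, 1 :: nat}}}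
   = {{}, {0, 1}, {2, 3}, {0, 1, 2, 3}, {0, 3 :: nat}}" (is "_ ` _ ` ?A = _")
proof -
  have "?A = {{0, 1}, {0, 2}, {0, 3}, {1, 2}, {1, 3}}"
  proof
    show "?A \<subseteq> {{0, 1}, {0, 2}, {0, 3}, {1, 2}, {1, 3}}"
    proof
      fix A assume "A \<in> ?A"
      note h = CollectD[OF this]
      note A = conjunct1[OF h] conjunct1[OF conjunct2[OF h]]
      have "f ` A \<in> {{1, 2}, {0, 2}, {0, 1}}" by (rule conjunct2[OF conjunct2[OF h]])
      then have "f ` A = {1, 2} \<or> f ` A = {0, 2} \<or> f ` A = {0, 1}" by (simp only: insert_iff empty_iff simp_thms)
      then have "card (f ` A) = 2" by (elim disjE) (simp_all only:, simp_all)
      then have c: "card A = 2" using card_image[OF A(2)] by simp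
      have n23: "\<not> (2 \<in> A \<and> 3 \<in> A)" using inj_onD[OF A(2), of 2 3] f(3,4) by auto
      obtain a b where ab: "A = {a, b}" "a \<noteq> b" using c by (auto simp: card_2_iff)
      have a: "a = 0 \<or> a = 1 \<or> a = 2 \<or> a = 3" and b: "b = 0 \<or> b = 1 \<or> b = 2 \<or> b = 3" using A(1) ab(1) by auto
      show "A \<in> {{0, 1}, {0, 2}, {0, 3}, {1, 2}, {1, 3}}"
        using a b n23 ab(2) unfolding ab(1) by (elim disjE) (simp_all add: insert_commute)
    qed
    show "{{0, 1}, {0, 2}, {0, 3}, {1, 2}, {1, 3}} \<subseteq> ?A"
      using f by (simp add: insert_commute)
  qed
  then show ?thesis by (simp add: toggle_def insert_Diff_if insert_commute)
qed

text \<open>Both paths shrink to single edges, leaving a triangle with parallel edges; two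
  applications of \<open>trees_path\<close> restore the u-path and then the w-path.\<close>

lemma graph_C_polytope:
  assumes sh: "shaped k {{}, {0, 1}, {2, 3}, {0, 1, 2, 3}, {0, 3}} n"
    "n 0 = s + 1" "n 1 = p + 1" "n 2 = t + 1" "n 3 = q + 1"
  shows "class_polytope (base_polytope (graph_C s t p q)) {{}, {0, 1}, {2, 3}, {0, 1, 2, 3}, {0, 3}} n"
    (is "class_polytope _ ?T _")
proof -
  define xs where "xs = [Vv 1] @ map Vu [1..<p + 1] @ [Vv 3]"
  define ys where "ys = [Vv 2] @ map Vw [1..<q + 1] @ [Vv 3]"
  note xs = path_vertices[where a = "Vv 1" and U = Vu and p = p and b = "Vv 3", folded xs_def]
  note ys = path_vertices[where a = "Vv 2" and U = Vw and p = q and b = "Vv 3", folded ys_def]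
  define es where "es = replicate (s + 1) {Vv 1, Vv 2} @ replicate (t + 1) {Vv 2, Vv 3} @ path_ends xs @ path_ends ys"
  define ls where "ls = replicate (s + 1) (0 :: nat) @ replicate (t + 1) 2 @ replicate (p + 1) 1 @ replicate (q + 1) 3"
  define m where "m = s + t + 2"
  define g where "g = (\<lambda>i. m + i)"
  define h where "h = (\<lambda>i. m + p + 1 + i)"
  define V where "V = Vv ` {1..3} \<union> Vu ` {1..p} \<union> Vw ` {1..q}"
  let ?E = "{..<length es}" and ?en = "(!) es" and ?c = "(!) ls"
  have G: "graph_C s t p q = graph_of_ends V es" by (simp add: graph_C_def V_def es_def xs_def ys_def)
  have len: "length es = m + p + q + 2" "length ls = length es"
    using xs(1) ys(1) by (simp_all add: es_def ls_def m_def length_path_ends)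
  have lP: "length (path_ends xs) = p + 1" "length (path_ends ys) = q + 1" using xs(1) ys(1) by (simp_all add: length_path_ends)
  have base: "(e \<le> s \<and> ?en e = {Vv 1, Vv 2} \<and> ?c e = 0) \<or> (s < e \<and> ?en e = {Vv 2, Vv 3} \<and> ?c e = 2)" if "e < m" for e
    using that by (auto simp: es_def ls_def nth_append m_def simp del: replicate.simps)
  have gn: "?en (g i) = {xs ! i, xs ! Suc i}" "?c (g i) = 1" if "i \<le> p" for i
    using that xs(1) lP by (simp_all add: es_def ls_def nth_append m_def g_def path_ends_nth del: replicate.simps)
  have hn: "?en (h i) = {ys ! i, ys ! Suc i}" "?c (h i) = 3" if "i \<le> q" for i
    using that ys(1) lP by (simp_all add: es_def ls_def nth_append m_def h_def path_ends_nth del: replicate.simps)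
  have split: "e < m \<or> (\<exists>i\<le>p. e = g i) \<or> (\<exists>i\<le>q. e = h i)" if "e < length es" for e
  proof -
    have "e < m \<or> (e - m \<le> p \<and> e = g (e - m)) \<or> (e - (m + p + 1) \<le> q \<and> e = h (e - (m + p + 1)))"
      using that len(1) by (auto simp: g_def h_def)
    then show ?thesis by blast
  qed
  have xV: "xs ! i = Vv 1 \<or> xs ! i = Vv 3 \<or> xs ! i \<in> Vu ` {1..p}" if "i \<le> Suc p" for i
    using that nth_mem[of i xs] unfolding xs(1) xs(5) by auto
  have yV: "ys ! i = Vv 2 \<or> ys ! i = Vv 3 \<or> ys ! i \<in> Vw ` {1..q}" if "i \<le> Suc q" for i
    using that nth_mem[of i ys] unfolding ys(1) ys(5) by auto
  have xi: "xs ! i \<in> Vu ` {1..p}" if "1 \<le> i" "i \<le> p" for i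
    using imageI[of i "{1..p}" "(!) xs"] that unfolding xs(4) by simp
  have yi: "ys ! i \<in> Vw ` {1..q}" if "1 \<le> i" "i \<le> q" for i
    using imageI[of i "{1..q}" "(!) ys"] that unfolding ys(4) by simp
  have baseV: "?en e \<subseteq> {Vv 1, Vv 2, Vv 3} \<union> W" if "e < m" for e W
    using base[OF that] by (elim disjE conjE) simp_all
  have gV: "?en (g i) \<subseteq> {Vv 1, Vv 2, Vv 3} \<union> Vu ` {1..p}" if "i \<le> p" for i
  proof -
    have "xs ! j \<in> {Vv 1, Vv 2, Vv 3} \<union> Vu ` {1..p}" if "j \<le> Suc p" for j using xV[OF that] by blast
    then show ?thesis unfolding gn(1)[OF that] using that by (simp only: insert_subset empty_subsetI le_SucI Suc_le_mono simp_thms)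
  qed
  have hV: "?en (h i) \<subseteq> {Vv 1, Vv 2, Vv 3} \<union> Vw ` {1..q}" if "i \<le> q" for i
  proof -
    have "ys ! j \<in> {Vv 1, Vv 2, Vv 3} \<union> Vw ` {1..q}" if "j \<le> Suc q" for j using yV[OF that] by blast
    then show ?thesis unfolding hn(1)[OF that] using that by (simp only: insert_subset empty_subsetI le_SucI Suc_le_mono simp_thms)
  qed
  have notU: False if "z \<in> Vu ` {1..p}" "z \<in> A" "A \<subseteq> {Vv 1, Vv 2, Vv 3} \<union> Vw ` {1..q}" for z A
    using that(1) subsetD[OF that(3,2)] by auto
  have notW: False if "z \<in> Vw ` {1..q}" "z \<in> A" "A \<subseteq> {Vv 1, Vv 2, Vv 3} \<union> Vu ` {1..p}" for z A
    using that(1) subsetD[OF that(3,2)] by auto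
  have finV: "finite V" by (simp add: V_def)
  have X: "A \<subseteq> V \<and> card A \<in> {1, 2}" if A: "A \<in> set es" for A
  proof -
    have "A = {Vv 1, Vv 2} \<or> A = {Vv 2, Vv 3} \<or> A \<in> set (path_ends xs) \<or> A \<in> set (path_ends ys)"
      using A by (auto simp: es_def in_set_replicate)
    moreover have "set xs \<subseteq> V" "set ys \<subseteq> V" unfolding xs(5) ys(5) V_def by auto
    moreover have "{Vv 1, Vv 2} \<subseteq> V" "{Vv 2, Vv 3} \<subseteq> V" unfolding V_def by auto
    ultimately show ?thesis using path_ends_subset[of A xs] path_ends_subset[of A ys]
        card_doubleton_12[of "Vv 1" "Vv 2"] card_doubleton_12[of "Vv 2" "Vv 3"] by blast
  qed
  have wf: "wf_graph V ?en ?E" by (rule wf_graph_of_list[OF finV X])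
  \<comment> \<open>In the graph on V1 the w-path has shrunk to the edge \<open>h 0\<close>; in the
    graph on V2 the u-path has also shrunk, to \<open>g 0\<close>.\<close>
  define V1 where "V1 = V - (!) ys ` {1..q}"
  define en1 where "en1 = ?en(h 0 := {ys ! 0, ys ! Suc q})"
  define E1 where "E1 = ?E - h ` {1..q}"
  define V2 where "V2 = V1 - (!) xs ` {1..p}"
  define en2 where "en2 = en1(g 0 := {xs ! 0, xs ! Suc p})"
  define E2 where "E2 = E1 - g ` {1..p}"
  have V1: "V1 = Vv ` {1..3} \<union> Vu ` {1..p}" unfolding V1_def V_def ys(4) by auto
  have V2: "V2 = {Vv 1, Vv 2, Vv 3}" unfolding V2_def V1 xs(4) triangle_vertices by auto
  have E2: "E2 = {..<m} \<union> {g 0, h 0}"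
  proof
    show "E2 \<subseteq> {..<m} \<union> {g 0, h 0}"
    proof
      fix e assume e: "e \<in> E2"
      have ne: "e \<noteq> g i" if "1 \<le> i" "i \<le> p" for i using e that unfolding E2_def by auto
      have nh: "e \<noteq> h i" if "1 \<le> i" "i \<le> q" for i using e that unfolding E2_def E1_def by auto
      from e have "e < length es" unfolding E2_def E1_def by auto
      from split[OF this] ne nh show "e \<in> {..<m} \<union> {g 0, h 0}" by (metis UnCI insert_iff lessThan_iff less_one not_less)
    qed
    show "{..<m} \<union> {g 0, h 0} \<subseteq> E2" unfolding E2_def E1_def len(1) by (auto simp: g_def h_def)
  qed
  have enlab: "en2 (g 0) = {Vv 1, Vv 3}" "en2 (h 0) = {Vv 2, Vv 3}" "?c (g 0) = 1" "?c (h 0) = 3" "g 0 \<noteq> h 0"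
    using xs(2,3) ys(2,3) gn[of 0] hn[of 0] by (auto simp: en2_def en1_def g_def h_def)
  have en2b: "en2 e = ?en e" if "e < m" for e using that by (simp add: en2_def en1_def g_def h_def)
  let ?f = "(\<lambda>_ :: nat. 1 :: nat)(0 := 0, 1 := 2)"
  have f: "?f 0 = 0" "?f 1 = 2" "?f 2 = 1" "?f 3 = 1" by simp_all
  have E2cases: "(en2 e = {Vv 1, Vv 2} \<and> ?c e = 0) \<or> (en2 e = {Vv 2, Vv 3} \<and> ?c e = 2) \<or>
      (e = g 0 \<and> en2 e = {Vv 1, Vv 3} \<and> ?c e = 1) \<or> (e = h 0 \<and> en2 e = {Vv 2, Vv 3} \<and> ?c e = 3)" if "e \<in> E2" for e
  proof -
    have "e < m \<or> e = g 0 \<or> e = h 0" using that unfolding E2 by blast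
    then show ?thesis
    proof (elim disjE)
      assume "e < m"
      from base[OF this] show ?thesis unfolding en2b[OF \<open>e < m\<close>] by blast
    qed (simp_all only: enlab simp_thms)
  qed
  have "trees V2 en2 E2 = class_system E2 (?f \<circ> ?c) ((\<lambda>i. {..<3} - {i}) ` {..<3})"
  proof (rule trees_cycle_classes[where v = "\<lambda>i. Vv (i + 1)"])
    show "wf_graph V2 en2 E2" unfolding wf_graph_def
    proof (intro conjI ballI)
      show "finite V2" "finite E2" unfolding V2 E2 by simp_all
      fix e assume "e \<in> E2"
      from E2cases[OF this] show "en2 e \<subseteq> V2" unfolding V2 by auto
      from E2cases[OF \<open>e \<in> E2\<close>] show "card (en2 e) \<in> {1, 2}" using card_doubleton_12 by metis
    qed
    have three: "{..<3 :: nat} = {0, 1, 2}" by auto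
    show "V2 = (\<lambda>i. Vv (i + 1)) ` {..<3}" unfolding V2 three by (simp add: numeral_eq_Suc)
    show "(?f \<circ> ?c) ` E2 = {..<3}"
    proof
      show "(?f \<circ> ?c) ` E2 \<subseteq> {..<3}" using E2cases by fastforce
      have "?c 0 = 0" using base[of 0] by (auto simp: m_def)
      then have "(?f \<circ> ?c) 0 = 0" "(?f \<circ> ?c) (h 0) = 1" "(?f \<circ> ?c) (g 0) = 2" using enlab by simp_all
      moreover have "0 \<in> E2" "h 0 \<in> E2" "g 0 \<in> E2" unfolding E2 by (simp_all add: m_def)
      ultimately show "{..<3} \<subseteq> (?f \<circ> ?c) ` E2" unfolding three by (metis empty_subsetI imageI insert_subset)
    qed
    show "en2 e = {Vv ((?f \<circ> ?c) e + 1), Vv (Suc ((?f \<circ> ?c) e) mod 3 + 1)}" if "e \<in> E2" for e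
      using E2cases[OF that] unfolding comp_apply
      by (elim disjE conjE) (simp_all only: f triangle_arith insert_commute)
  qed (auto simp: inj_on_def)
  also have "\<dots> = class_system E2 ?c {A. A \<subseteq> {0, 1, 2, 3} \<and> inj_on ?f A \<and> ?f ` A \<in> {{1, 2}, {0, 2}, {0, 1}}}"
    unfolding triangle_types
  proof (rule class_system_merge)
    show "?c ` E2 \<subseteq> {0, 1, 2, 3}" using E2cases by fastforce
  qed
  also have "\<dots> = toggle {h 0} ` toggle {g 0} ` class_system E2 ?c ?T"
  proof -
    let ?A = "{A. A \<subseteq> {0, 1, 2, 3} \<and> inj_on ?f A \<and> ?f ` A \<in> {{1, 2}, {0, 2}, {0, 1}}}"
    have 1: "cls E2 ?c 1 = {g 0}" using E2cases enlab unfolding E2 by fastforce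
    have 3: "cls E2 ?c 3 = {h 0}" using E2cases enlab unfolding E2 by fastforce
    show ?thesis
      unfolding toggle_singleton_class[OF 3, where T = ?A] toggle_singleton_class[OF 1, where T = "toggle {3} ` ?A"]
        graph_C_types[OF f] by (rule refl)
  qed
  also have "\<dots> = toggle (insert (g 0) {h 0}) ` class_system E2 ?c ?T"
    unfolding toggle_image_comp using enlab(5) by (simp add: toggle_def insert_Diff_if insert_commute)
  finally have base_trees: "trees V2 en2 E2 = toggle (insert (g 0) {h 0}) ` class_system E2 ?c ?T" .
  have gh: "g i \<noteq> h j" if "i \<le> p" for i j using that by (simp add: g_def h_def)
  have mid: "trees V1 en1 E1 = toggle (g ` {..p} \<union> {h 0}) ` class_system E1 ?c ?T"
  proof (rule trees_path[where x = "(!) xs"])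
    show "wf_graph V1 en1 E1" unfolding wf_graph_def
    proof (intro conjI ballI)
      show "finite V1" "finite E1" unfolding V1 E1_def by simp_all
      fix e assume e: "e \<in> E1"
      have "e < m \<or> (\<exists>i\<le>p. e = g i) \<or> e = h 0"
      proof -
        have "e \<noteq> h i" if "1 \<le> i" "i \<le> q" for i using e that unfolding E1_def by auto
        moreover have "e < length es" using e unfolding E1_def by auto
        ultimately show ?thesis using split[of e] by (metis less_one not_less)
      qed
      then have "en1 e \<subseteq> V1 \<and> card (en1 e) \<in> {1, 2}"
      proof (elim disjE exE conjE)
        assume "e < m"
        then have "en1 e = ?en e" by (simp add: en1_def h_def)
        then show ?thesis using base[OF \<open>e < m\<close>] card_doubleton_12[of "Vv 1" "Vv 2"] card_doubleton_12[of "Vv 2" "Vv 3"]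
          unfolding V1 triangle_vertices by (elim disjE) auto
      next
        fix i assume i: "i \<le> p" "e = g i"
        then have "en1 e = {xs ! i, xs ! Suc i}" using gh[of i 0] gn[of i] by (simp add: en1_def)
        then show ?thesis using xV[of i] xV[of "Suc i"] i(1) card_doubleton_12[of "xs ! i" "xs ! Suc i"]
          unfolding V1 triangle_vertices by auto
      next
        assume "e = h 0"
        then show ?thesis using ys(2,3) card_doubleton_12[of "Vv 2" "Vv 3"] unfolding V1 triangle_vertices by (simp add: en1_def)
      qed
      then show "en1 e \<subseteq> V1" "card (en1 e) \<in> {1, 2}" by blast+
    qed
    show "inj_on g {..p}" by (simp add: g_def)
    show "g ` {..p} \<subseteq> E1" unfolding E1_def using gh by (auto simp: len(1) g_def)
    show "en1 (g i) = {xs ! i, xs ! Suc i}" if "i \<le> p" for i using that gh[of i 0] gn[of i] by (simp add: en1_def)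
    show "inj_on ((!) xs) {..Suc p}" by (rule xs(6)) (auto simp: inj_on_def)
    show "e \<in> g ` {..p}" if e: "1 \<le> i" "i \<le> p" "e \<in> E1" "xs ! i \<in> en1 e" for i e
    proof (rule ccontr)
      assume n: "e \<notin> g ` {..p}"
      have u: "xs ! i \<in> Vu ` {1..p}" using e xi by simp
      show False
      proof (cases "e = h 0")
        case True
        then show False using e(4) u ys(2,3) by (auto simp: en1_def)
      next
        case False
        then have e4: "xs ! i \<in> ?en e" using e(4) by (simp add: en1_def)
        have "e < length es" using e(3) unfolding E1_def by simp
        then consider "e < m" | j where "j \<le> q" "e = h j" using split[of e] n by blast
        then show False
        proof cases
          case 1
          show False by (rule notU[OF u e4 baseV[OF 1]])
        next
          case 2
          show False by (rule notU[OF u e4[unfolded 2(2)] hV[OF 2(1)]])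
        qed
      qed
    qed
    show "?c (g i) = ?c (g 0)" if "i \<le> p" for i using gn(2)[of i] gn(2)[of 0] that by simp
    show "{h 0} \<inter> g ` {..p} = {}" using gh[symmetric] by auto
    show "trees (V1 - (!) xs ` {1..p}) (en1(g 0 := {xs ! 0, xs ! Suc p})) (E1 - g ` {1..p})
        = toggle (insert (g 0) {h 0}) ` class_system (E1 - g ` {1..p}) ?c ?T"
      using base_trees unfolding V2_def en2_def E2_def .
  qed
  have tr: "trees V ?en ?E = toggle (h ` {..q} \<union> g ` {..p}) ` class_system ?E ?c ?T"
  proof (rule trees_path[where x = "(!) ys", OF wf])
    show "inj_on h {..q}" by (simp add: h_def inj_on_def)
    show "h ` {..q} \<subseteq> ?E" by (auto simp: len(1) h_def)
    show "?en (h i) = {ys ! i, ys ! Suc i}" if "i \<le> q" for i using that hn by simp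
    show "inj_on ((!) ys) {..Suc q}" by (rule ys(6)) (auto simp: inj_on_def)
    show "e \<in> h ` {..q}" if e: "1 \<le> i" "i \<le> q" "e \<in> ?E" "ys ! i \<in> ?en e" for i e
    proof (rule ccontr)
      assume n: "e \<notin> h ` {..q}"
      have u: "ys ! i \<in> Vw ` {1..q}" using e yi by simp
      have "e < length es" using e(3) by simp
      then consider "e < m" | j where "j \<le> p" "e = g j" using split[of e] n by blast
      then show False
      proof cases
        case 1
        show False by (rule notW[OF u e(4) baseV[OF 1]])
      next
        case 2
        show False by (rule notW[OF u e(4)[unfolded 2(2)] gV[OF 2(1)]])
      qed
    qed
    show "?c (h i) = ?c (h 0)" if "i \<le> q" for i using hn(2)[of i] hn(2)[of 0] that by simp
    show "g ` {..p} \<inter> h ` {..q} = {}" using gh by fastforce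
    show "trees (V - (!) ys ` {1..q}) (?en(h 0 := {ys ! 0, ys ! Suc q})) (?E - h ` {1..q})
        = toggle (insert (h 0) (g ` {..p})) ` class_system (?E - h ` {1..q}) ?c ?T"
      using mid unfolding V1_def en1_def E1_def by simp
  qed
  show ?thesis unfolding G
  proof (rule shaped_graph_of_ends_polytope[OF finV X len(2) _ _ tr _ sh(1)])
    show "set ls \<subseteq> {..<4}" by (auto simp: ls_def)
    show "h ` {..q} \<union> g ` {..p} \<subseteq> {..<length es}" by (auto simp: len(1) g_def h_def)
    fix i :: nat assume "i < 4"
    from less_4_cases[OF this] show "length (filter (\<lambda>y. y = i) ls) = n i" using sh by (auto simp: ls_def filter_replicate)
  qed
qed

section \<open>The classification\<close>

lemma two_connected_two_conn:
  assumes wf: "wf_graph (verts G) (ends G) (edges G)" and tc: "two_connected G"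
  shows "two_conn (verts G) (ends G) (edges G)"
proof -
  have G: "G = \<lparr>verts = verts G, edges = edges G, ends = ends G\<rparr>" by simp
  have "graph_connected G" using tc by (simp add: two_connected_def)
  then have "graph_connected \<lparr>verts = verts G, edges = edges G, ends = ends G\<rparr>"
    by (rule subst[OF G, where P = graph_connected])
  then have "cut_conn (verts G) (ends G) (edges G)" using graph_connected_cut[OF wf] by simp
  moreover have "cut_conn (verts G - {v}) (ends G) {e \<in> edges G. v \<notin> ends G e}" if v: "v \<in> verts G" for v
  proof -
    have wfv: "wf_graph (verts G - {v}) (ends G) {e \<in> edges G. v \<notin> ends G e}"
      using wf unfolding wf_graph_def by auto
    have "graph_connected (delete_vertex G v)" using tc v by (simp add: two_connected_def)
    then show ?thesis using graph_connected_cut[OF wfv] by (simp add: delete_vertex_def)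
  qed
  ultimately show ?thesis by (simp add: two_conn_def)
qed

lemma crosses_card_2:
  assumes "finite (en e)" "card (en e) \<in> {1, 2}" "crosses en Z e" shows "card (en e) = 2"
proof -
  have "card (en e) \<noteq> 1"
  proof
    assume "card (en e) = 1"
    then obtain x where "en e = {x}" by (rule card_1_singletonE)
    then show False using assms(3) by (auto simp: crosses_def)
  qed
  then show ?thesis using assms(2) by simp
qed

lemma cut_conn_loopless:
  assumes "wf_graph V en E" "cut_conn V en F" "F \<subseteq> E"
  shows "cut_conn V en {e \<in> F. card (en e) = 2}"
proof (rule cut_conn_replace[OF assms(2)])
  fix e Z assume e: "e \<in> F" "crosses en Z e"
  then have "en e \<subseteq> V" "card (en e) \<in> {1, 2}" "finite V" using assms(1,3) by (auto simp: wf_graph_def)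
  then have "card (en e) = 2" using e(2) crosses_card_2[of en e Z] finite_subset by blast
  then show "\<exists>e'\<in>{e \<in> F. card (en e) = 2}. crosses en Z e'" using e by blast
qed

text \<open>A loop crosses no cut, so cut connectivity survives its removal and, by the count of
  edges, no tree contains it.\<close>

lemma two_conn_loopless:
  assumes wf: "wf_graph V en E" and tc: "two_conn V en E"
  shows "two_conn V en {e \<in> E. card (en e) = 2}" "trees V en E = trees V en {e \<in> E. card (en e) = 2}"
proof -
  have "cut_conn (V - {v}) en {e \<in> {e \<in> E. card (en e) = 2}. v \<notin> en e}" if "v \<in> V" for v
  proof -
    have c: "cut_conn (V - {v}) en {e \<in> E. v \<notin> en e}" using tc that by (simp add: two_conn_def)
    have w: "wf_graph (V - {v}) en {e \<in> E. v \<notin> en e}" using wf unfolding wf_graph_def by auto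
    have "{e \<in> {e \<in> E. v \<notin> en e}. card (en e) = 2} = {e \<in> {e \<in> E. card (en e) = 2}. v \<notin> en e}" by blast
    then show ?thesis using cut_conn_loopless[OF w c subset_refl] by simp
  qed
  moreover have "cut_conn V en {e \<in> E. card (en e) = 2}"
    using cut_conn_loopless[OF wf _ subset_refl] tc by (simp add: two_conn_def)
  ultimately show "two_conn V en {e \<in> E. card (en e) = 2}" unfolding two_conn_def by blast
  have "T \<subseteq> {e \<in> E. card (en e) = 2}" if T: "T \<subseteq> E" "cut_conn V en T" "card T + 1 = card V" for T
  proof -
    let ?L = "{e \<in> T. card (en e) = 2}"
    have fT: "finite T" using T(1) wf finite_subset by (auto simp: wf_graph_def)
    have "cut_conn V en ?L" by (rule cut_conn_loopless[OF wf T(2,1)])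
    moreover have "wf_graph V en ?L" using T(1) by (intro wf_graph_subset[OF wf]) blast
    ultimately have "card V \<le> card ?L + 1" by (intro cut_conn_card)
    then have "card T \<le> card ?L" using T(3) by simp
    then have "?L = T" by (intro card_seteq[OF fT]) auto
    then show ?thesis using T(1) by blast
  qed
  then show "trees V en E = trees V en {e \<in> E. card (en e) = 2}" unfolding trees_def by blast
qed

lemma one_edge_trees:
  assumes "wf_graph V en {e}" "cut_conn V en {e}" "card (en e) = 2"
  shows "trees V en {e} = {{e}}"
proof -
  have V: "en e \<subseteq> V" "finite V" using assms(1) by (auto simp: wf_graph_def)
  have "card V = 2"
    using card_mono[OF V(2,1)] cut_conn_card[OF assms(1,2)] assms(3) by simp
  then have "T \<in> trees V en {e} \<longleftrightarrow> T = {e}" for T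
    using assms(2) by (auto simp: trees_def subset_singleton_iff)
  then show ?thesis by blast
qed

lemma trees_no_edges:
  assumes "wf_graph V en {}" "cut_conn V en {}" shows "trees V en {} = {{}}"
proof -
  have "card V \<le> 1" using cut_conn_card[OF assms] by simp
  moreover have "V \<noteq> {}" "finite V" using assms by (auto simp: cut_conn_def wf_graph_def)
  ultimately have "card V = 1" by (simp add: le_Suc_eq)
  then show ?thesis using assms(2) by (auto simp: trees_def)
qed

text \<open>A point has no facet and dimension 0, which gives 0 - 1; this value separates it from
  all families.\<close>

lemma rank_poly_of_point: "polytope_rank (poly_of {B}) = - 1"
proof -
  have P: "poly_of {B} = {char_vec B}" by (simp add: poly_of_def)
  have "{F. is_facet F (poly_of {B})} = {}" unfolding P by (simp add: is_facet_def polytope_dim_singleton)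
  then show ?thesis unfolding polytope_rank_def by (simp add: P polytope_dim_singleton)
qed

lemma class_polytope_segment:
  assumes "a \<noteq> b" "n 0 = 2" "n 1 = 0" "n 2 = 0" "n 3 = 0"
  shows "class_polytope (poly_of {{a}, {b}}) {{0}} n"
proof -
  let ?c = "\<lambda>_. 0 :: nat"
  have "class_system {a, b} ?c {{0}} = {{a}, {b}}"
  proof
    show "class_system {a, b} ?c {{0}} \<subseteq> {{a}, {b}}"
    proof
      fix X assume "X \<in> class_system {a, b} ?c {{0}}"
      then have X: "X \<subseteq> {a, b}" "inj_on ?c X" "?c ` X = {0}" by (auto simp: class_system_def)
      from inj_on_image_singleton[OF X(2,3)] obtain x where "X = {x}" ..
      then show "X \<in> {{a}, {b}}" using X(1) by auto
    qed
  qed (auto simp: class_system_def)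
  then have "poly_of {{a}, {b}} = poly_of (toggle {} ` class_system {a, b} ?c {{0}})" by (simp add: toggle_def)
  moreover have "card (cls {a, b} ?c i) = n i" if "i < 4" for i
  proof -
    have "{a, b} = cls {a, b} ?c 0" by auto
    then have "card (cls {a, b} ?c 0) = 2" using assms(1) card_2_iff by metis
    moreover have "cls {a, b} ?c i = {}" if "i \<noteq> 0" using that by simp
    ultimately show ?thesis using less_4_cases[OF that] assms(2-) by (cases "i = 0") auto
  qed
  ultimately show ?thesis unfolding class_polytope_def
    by (intro exI[of _ "{a, b}"] exI[of _ ?c] exI[of _ "{}"]) auto
qed

text \<open>Two elements are not \<open>shaped\<close>, which asks for three, so their segment is
  treated apart.\<close>

lemma class_polytope_0_rank:
  assumes P: "class_polytope P {{0}} n" and n: "n 0 = s" "n 1 = 0" "n 2 = 0" "n 3 = 0" "2 \<le> s"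
  shows "polytope_rank P = 0"
proof (cases "s = 2")
  case True
  have "class_polytope (poly_of {{0 :: nat}, {1}}) {{0}} n" using class_polytope_segment[of "0 :: nat" 1 n] n True by simp
  from unimodularly_equivalent_rank[OF class_polytope_equivalent[OF P this]] show ?thesis
    using poly_of_segment(1)[of "0 :: nat" 1] by simp
next
  case False
  then have "shaped 0 {{0}} n" using n by (simp add: shaped_def)
  from class_polytope_rank[OF P this] show ?thesis by simp
qed

lemma sp_system_class_polytope:
  assumes sp: "sp_system k E N" and D: "D \<subseteq> E"
  shows "polytope_rank (poly_of (toggle D ` N)) = int k"
    and "k \<le> 3 \<Longrightarrow> \<exists>T n. shaped k T n \<and> class_polytope (poly_of (toggle D ` N)) T n"
proof -
  have n: "normal (int k) E N" by (rule sp_system_normal[OF sp])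
  then have fin: "finite E" and rk: "polytope_rank (poly_of N) = int k" "N \<subseteq> Pow E" by (simp_all add: normal_def)
  show "polytope_rank (poly_of (toggle D ` N)) = int k" using rank_toggle[OF fin rk(2) D] rk(1) by simp
  assume "k \<le> 3"
  from sp_system_shape[OF sp this] obtain c T where
    "c ` E \<subseteq> {..<4}" "shaped k T (\<lambda>i. card (cls E c i))" "N = class_system E c T" by blast
  then show "\<exists>T n. shaped k T n \<and> class_polytope (poly_of (toggle D ` N)) T n"
    unfolding class_polytope_def using fin D by blast
qed

lemma classifiedE:
  assumes "classified E N"
  obtains a b where "a \<noteq> b" "N = {{a}, {b}}"
    | "4 \<le> polytope_rank (poly_of N)"
    | k N' D where "sp_system k E N'" "D \<subseteq> E" "N = toggle D ` N'"
  using assms unfolding classified_def by (elim disjE exE conjE)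

text \<open>The alternatives are distinguished by the rank, so a given rank from 0 to 3 selects its
  shape. Fewer than two edges other than loops give a point.\<close>

lemma base_polytope_classification:
  assumes fin: "finite_multigraph G" and tc: "two_connected G"
  shows "polytope_rank (base_polytope G) = - 1 \<or> polytope_rank (base_polytope G) \<ge> 4 \<or>
    (polytope_rank (base_polytope G) = 0 \<and> (\<exists>s n. class_polytope (base_polytope G) {{0}} n \<and>
        n 0 = s \<and> n 1 = 0 \<and> n 2 = 0 \<and> n 3 = 0 \<and> 2 \<le> s)) \<or>
    (\<exists>k T n. 1 \<le> k \<and> k \<le> 3 \<and> polytope_rank (base_polytope G) = int k \<and> shaped k T n \<and>
        class_polytope (base_polytope G) T n)"
proof -
  let ?P = "base_polytope G" and ?V = "verts G" and ?en = "ends G"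
  let ?E = "{e \<in> edges G. card (?en e) = 2}"
  have wf: "wf_graph ?V ?en (edges G)" using fin by (simp add: finite_multigraph_def wf_graph_def)
  note tc' = two_connected_two_conn[OF wf tc]
  note L = two_conn_loopless[OF wf tc']
  have wfE: "wf_graph ?V ?en ?E" by (rule wf_graph_subset[OF wf]) blast
  have C: "cut_conn ?V ?en ?E" using L(1) by (simp add: two_conn_def)
  have P: "?P = poly_of (trees ?V ?en ?E)"
    using graphic_bases_trees[OF wf] tc' L(2) by (simp add: two_conn_def base_polytope_def poly_of_def)
  consider "card ?E = 0" | "card ?E = 1" | "2 \<le> card ?E" by linarith
  then show ?thesis
  proof cases
    case 1
    then have E: "?E = {}" using wfE by (simp add: wf_graph_def)
    have "?P = poly_of {{}}" unfolding P E trees_no_edges[OF wfE[unfolded E] C[unfolded E]] by (rule refl)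
    then show ?thesis by (simp only: rank_poly_of_point simp_thms)
  next
    case 2
    then obtain e where e: "?E = {e}" by (rule card_1_singletonE)
    then have ce: "card (?en e) = 2" by blast
    have "?P = poly_of {{e}}" unfolding P e one_edge_trees[OF wfE[unfolded e] C[unfolded e] ce] by (rule refl)
    then show ?thesis by (simp only: rank_poly_of_point simp_thms)
  next
    case 3
    have cl: "classified ?E (trees ?V ?en ?E)" by (rule classified_trees[OF wfE L(1) _ 3]) simp
    show ?thesis
      using cl
    proof (cases rule: classifiedE)
      case (1 a b)
      let ?n = "\<lambda>i. if i = 0 then 2 else 0 :: nat"
      have "class_polytope ?P {{0}} ?n" unfolding P 1(2) by (rule class_polytope_segment[OF 1(1)]) simp_all
      moreover have "polytope_rank ?P = 0" unfolding P 1(2) by (rule poly_of_segment(1)[OF 1(1)])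
      ultimately show ?thesis by (intro disjI2 disjI1 conjI exI[of _ 2] exI[of _ ?n]) simp_all
    next
      case 2
      then show ?thesis unfolding P by simp
    next
      case (3 k N' D)
      note s = sp_system_class_polytope[OF 3(1,2), folded 3(3), folded P]
      show ?thesis
      proof (cases "k \<le> 3")
        case True
        then obtain T n where Tn: "shaped k T n" "class_polytope ?P T n" using s(2) by blast
        show ?thesis
        proof (cases "k = 0")
          case True
          then have "T = {{0}}" "n 0 \<ge> 3" "n 1 = 0" "n 2 = 0" "n 3 = 0" using Tn(1) by (simp_all add: shaped_def)
          then show ?thesis using s(1) Tn(2) True by (intro disjI2 disjI1 conjI exI[of _ "n 0"] exI[of _ n]) simp_all
        next
          case False
          then show ?thesis using Tn s(1) True by (intro disjI2 exI[of _ k] exI[of _ T] exI[of _ n]) simp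
        qed
      qed (use s(1) in simp)
    qed
  qed
qed

section \<open>Ranks of the graph families\<close>

lemma graph_A_rank:
  assumes "s > 0" shows "polytope_rank (base_polytope (graph_A (s + 1))) = 0"
proof -
  let ?n = "\<lambda>i. if i = 0 then s + 1 else 0 :: nat"
  have "class_polytope (base_polytope (graph_A (s + 1))) {{0}} ?n" using assms by (intro graph_A_polytope) simp_all
  from class_polytope_0_rank[OF this] show ?thesis using assms by simp
qed

lemma graph_B_1_rank:
  assumes "s > 0" "p > 0" shows "polytope_rank (base_polytope (graph_B [s] p)) = 1"
proof -
  define n where "n = (\<lambda>i :: nat. 0 :: nat)(0 := s + 1, 1 := p + 1)"
  have sh: "shaped 1 {{}, {0, 1}} n" unfolding shaped_def n_def using assms by simp
  have "class_polytope (base_polytope (graph_B [s] p)) {{}, {0, 1}} n" by (rule graph_B_1[OF sh]) (simp_all add: n_def)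
  from class_polytope_rank[OF this sh] show ?thesis by simp
qed

lemma graph_B_2_rank:
  assumes "s1 > 0" "s2 > 0" shows "polytope_rank (base_polytope (graph_B [s1, s2] p)) = 2"
proof -
  define n where "n = (\<lambda>i :: nat. 0 :: nat)(0 := s1 + 1, 1 := s2 + 1, 2 := p + 1)"
  have sh: "shaped 2 {{0}, {1}, {0, 1, 2}} n" unfolding shaped_def n_def using assms by simp
  have "class_polytope (base_polytope (graph_B [s1, s2] p)) {{0}, {1}, {0, 1, 2}} n"
    by (rule graph_B_2[OF sh]) (simp_all add: n_def)
  from class_polytope_rank[OF this sh] show ?thesis by simp
qed

lemma graph_B_3_rank:
  assumes "s1 > 0" "s2 > 0" "s3 > 0" shows "polytope_rank (base_polytope (graph_B [s1, s2, s3] p)) = 3"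
proof -
  define n where "n = (\<lambda>i :: nat. 0 :: nat)(0 := s1 + 1, 1 := s2 + 1, 2 := s3 + 1, 3 := p + 1)"
  have sh: "shaped 3 {{0, 1}, {0, 2}, {1, 2}, {0, 1, 2, 3}} n" unfolding shaped_def n_def using assms by simp
  have "class_polytope (base_polytope (graph_B [s1, s2, s3] p)) {{0, 1}, {0, 2}, {1, 2}, {0, 1, 2, 3}} n"
    by (rule graph_B_3[OF sh]) (simp_all add: n_def)
  from class_polytope_rank[OF this sh] show ?thesis by simp
qed

lemma graph_C_rank:
  assumes "s > 0" "q > 0" shows "polytope_rank (base_polytope (graph_C s t p q)) = 3"
proof -
  define n where "n = (\<lambda>i :: nat. 0 :: nat)(0 := s + 1, 1 := p + 1, 2 := t + 1, 3 := q + 1)"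
  have sh: "shaped 3 {{}, {0, 1}, {2, 3}, {0, 1, 2, 3}, {0, 3}} n" unfolding shaped_def n_def using assms by simp
  have "class_polytope (base_polytope (graph_C s t p q)) {{}, {0, 1}, {2, 3}, {0, 1, 2, 3}, {0, 3}} n"
    by (rule graph_C_polytope[OF sh]) (simp_all add: n_def)
  from class_polytope_rank[OF this sh] show ?thesis by simp
qed

lemma graph_D_rank:
  assumes "s1 > 0" "s2 > 0" "s3 > 0"
  shows "polytope_rank (base_polytope (graph_D (s1 + 1) (s2 + 1) (s3 + 1))) = 3"
proof -
  define n where "n = (\<lambda>i :: nat. 0 :: nat)(0 := s1 + 1, 1 := s2 + 1, 2 := s3 + 1)"
  have sh: "shaped 3 {{0, 1}, {0, 2}, {1, 2}, {0, 1, 2, 3}} n" unfolding shaped_def n_def using assms by simp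
  have "class_polytope (base_polytope (graph_D (s1 + 1) (s2 + 1) (s3 + 1))) {{0, 1}, {0, 2}, {1, 2}, {0, 1, 2, 3}} n"
    by (rule graph_D_polytope[OF sh]) (simp_all add: n_def)
  from class_polytope_rank[OF this sh] show ?thesis by simp
qed

section \<open>From shapes to members of the families\<close>

lemma shaped_1:
  assumes "shaped 1 T n" "class_polytope P T n"
  shows "\<exists>s p. s > 0 \<and> p > 0 \<and> unimodularly_equivalent P (base_polytope (graph_B [s] p))"
proof -
  have n: "T = {{}, {0, 1}}" "n 0 \<ge> 2" "n 1 \<ge> 2" "n 2 = 0" "n 3 = 0" using assms(1) by (simp_all add: shaped_def)
  have "class_polytope (base_polytope (graph_B [n 0 - 1] (n 1 - 1))) {{}, {0, 1}} n"
    by (rule graph_B_1[OF assms(1)[unfolded n(1)]]) (use n in auto)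
  with assms(2)[unfolded n(1)] have "unimodularly_equivalent P (base_polytope (graph_B [n 0 - 1] (n 1 - 1)))"
    by (rule class_polytope_equivalent)
  then show ?thesis using n(2,3) by (intro exI[of _ "n 0 - 1"] exI[of _ "n 1 - 1"]) simp
qed

lemma shaped_2:
  assumes "shaped 2 T n" "class_polytope P T n"
  shows "\<exists>s1 s2 p. s1 > 0 \<and> s2 > 0 \<and> unimodularly_equivalent P (base_polytope (graph_B [s1, s2] p))"
proof -
  have n: "T = {{0}, {1}, {0, 1, 2}}" "n 0 \<ge> 2" "n 1 \<ge> 2" "n 2 \<ge> 1" "n 3 = 0" using assms(1) by (simp_all add: shaped_def)
  have "class_polytope (base_polytope (graph_B [n 0 - 1, n 1 - 1] (n 2 - 1))) {{0}, {1}, {0, 1, 2}} n"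
    by (rule graph_B_2[OF assms(1)[unfolded n(1)]]) (use n in auto)
  with assms(2)[unfolded n(1)] have "unimodularly_equivalent P (base_polytope (graph_B [n 0 - 1, n 1 - 1] (n 2 - 1)))"
    by (rule class_polytope_equivalent)
  then show ?thesis using n(2,3) by (intro exI[of _ "n 0 - 1"] exI[of _ "n 1 - 1"] exI[of _ "n 2 - 1"]) simp
qed

text \<open>Class 3 of the first shape is the path of a graph B, which has at least one edge; when
  this class is empty, a graph D realises the shape.\<close>

lemma shaped_3:
  assumes "shaped 3 T n" "class_polytope P T n"
  shows "(\<exists>s1 s2 s3 p. s1 > 0 \<and> s2 > 0 \<and> s3 > 0 \<and>
      unimodularly_equivalent P (base_polytope (graph_B [s1, s2, s3] p))) \<or>
    (\<exists>s t p q. s > 0 \<and> q > 0 \<and> unimodularly_equivalent P (base_polytope (graph_C s t p q))) \<or>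
    (\<exists>s1 s2 s3. s1 > 0 \<and> s2 > 0 \<and> s3 > 0 \<and>
      unimodularly_equivalent P (base_polytope (graph_D (s1 + 1) (s2 + 1) (s3 + 1))))"
    (is "?B \<or> ?C \<or> ?D")
proof -
  consider "T = {{0, 1}, {0, 2}, {1, 2}, {0, 1, 2, 3}}" "n 0 \<ge> 2" "n 1 \<ge> 2" "n 2 \<ge> 2"
    | "T = {{}, {0, 1}, {2, 3}, {0, 1, 2, 3}, {0, 3}}" "n 0 \<ge> 2" "n 1 \<ge> 1" "n 2 \<ge> 1" "n 3 \<ge> 2"
    using assms(1) unfolding shaped_def by (elim disjE conjE) simp_all
  then show ?thesis
  proof cases
    case 1
    note sh = assms(1)[unfolded 1(1)] and cp = assms(2)[unfolded 1(1)]
    show ?thesis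
    proof (cases "n 3 = 0")
      case True
      have "class_polytope (base_polytope (graph_D (n 0 - 1 + 1) (n 1 - 1 + 1) (n 2 - 1 + 1))) {{0, 1}, {0, 2}, {1, 2}, {0, 1, 2, 3}} n"
        by (rule graph_D_polytope[OF sh]) (use 1 True in auto)
      from class_polytope_equivalent[OF cp this] have ?D using 1(2-4)
        by (intro exI[of _ "n 0 - 1"] exI[of _ "n 1 - 1"] exI[of _ "n 2 - 1"] conjI) auto
      then show ?thesis by blast
    next
      case False
      have "class_polytope (base_polytope (graph_B [n 0 - 1, n 1 - 1, n 2 - 1] (n 3 - 1))) {{0, 1}, {0, 2}, {1, 2}, {0, 1, 2, 3}} n"
        by (rule graph_B_3[OF sh]) (use 1 False in auto)
      from class_polytope_equivalent[OF cp this] have ?B using 1(2-4)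
        by (intro exI[of _ "n 0 - 1"] exI[of _ "n 1 - 1"] exI[of _ "n 2 - 1"] exI[of _ "n 3 - 1"]) simp
      then show ?thesis by blast
    qed
  next
    case 2
    note sh = assms(1)[unfolded 2(1)] and cp = assms(2)[unfolded 2(1)]
    have "class_polytope (base_polytope (graph_C (n 0 - 1) (n 2 - 1) (n 1 - 1) (n 3 - 1))) {{}, {0, 1}, {2, 3}, {0, 1, 2, 3}, {0, 3}} n"
      by (rule graph_C_polytope[OF sh]) (use 2 in auto)
    from class_polytope_equivalent[OF cp this] have ?C using 2(2,5)
      by (intro exI[of _ "n 0 - 1"] exI[of _ "n 2 - 1"] exI[of _ "n 1 - 1"] exI[of _ "n 3 - 1"]) simp
    then show ?thesis by blast
  qed
qed

text \<open>The rank is invariant under unimodular equivalence and known for each family, which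
  gives one direction. For the other, the classification turns the rank into a shape and the shape
  into a member of a family.\<close>

theorem theorem3p7:
  fixes G :: "('v, 'e) multigraph"
  assumes "finite_multigraph G" and "two_connected G"
  shows
    "(polytope_rank (base_polytope G) = 0 \<longleftrightarrow>
        (\<exists>s. s > 0 \<and> unimodularly_equivalent (base_polytope G) (base_polytope (graph_A (s + 1)))))
     \<and>
     (polytope_rank (base_polytope G) = 1 \<longleftrightarrow>
        (\<exists>s p. s > 0 \<and> p > 0 \<and>
           unimodularly_equivalent (base_polytope G) (base_polytope (graph_B [s] p))))
     \<and>
     (polytope_rank (base_polytope G) = 2 \<longleftrightarrow>
        (\<exists>s1 s2 p. s1 > 0 \<and> s2 > 0 \<and>
           unimodularly_equivalent (base_polytope G) (base_polytope (graph_B [s1, s2] p))))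
     \<and>
     (polytope_rank (base_polytope G) = 3 \<longleftrightarrow>
        (\<exists>s1 s2 s3 p. s1 > 0 \<and> s2 > 0 \<and> s3 > 0 \<and>
           unimodularly_equivalent (base_polytope G) (base_polytope (graph_B [s1, s2, s3] p))) \<or>
        (\<exists>s t p q. s > 0 \<and> q > 0 \<and>
           unimodularly_equivalent (base_polytope G) (base_polytope (graph_C s t p q))) \<or>
        (\<exists>s1 s2 s3. s1 > 0 \<and> s2 > 0 \<and> s3 > 0 \<and>
           unimodularly_equivalent (base_polytope G)
             (base_polytope (graph_D (s1 + 1) (s2 + 1) (s3 + 1)))))"
proof -
  let ?P = "base_polytope G"
  have eqA: "polytope_rank ?P = 0" if "s > 0" "unimodularly_equivalent ?P (base_polytope (graph_A (s + 1)))" for s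
    using unimodularly_equivalent_rank[OF that(2)] graph_A_rank[OF that(1)] by simp
  have eqB1: "polytope_rank ?P = 1" if "s > 0" "p > 0" "unimodularly_equivalent ?P (base_polytope (graph_B [s] p))" for s p
    using unimodularly_equivalent_rank[OF that(3)] graph_B_1_rank[OF that(1,2)] by simp
  have eqB2: "polytope_rank ?P = 2"
    if "s1 > 0" "s2 > 0" "unimodularly_equivalent ?P (base_polytope (graph_B [s1, s2] p))" for s1 s2 p
    using unimodularly_equivalent_rank[OF that(3)] graph_B_2_rank[OF that(1,2)] by simp
  have eqB3: "polytope_rank ?P = 3"
    if "s1 > 0" "s2 > 0" "s3 > 0" "unimodularly_equivalent ?P (base_polytope (graph_B [s1, s2, s3] p))" for s1 s2 s3 p
    using unimodularly_equivalent_rank[OF that(4)] graph_B_3_rank[OF that(1-3)] by simp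
  have eqC: "polytope_rank ?P = 3" if "s > 0" "q > 0" "unimodularly_equivalent ?P (base_polytope (graph_C s t p q))" for s t p q
    using unimodularly_equivalent_rank[OF that(3)] graph_C_rank[OF that(1,2)] by simp
  have eqD: "polytope_rank ?P = 3"
    if "s1 > 0" "s2 > 0" "s3 > 0" "unimodularly_equivalent ?P (base_polytope (graph_D (s1 + 1) (s2 + 1) (s3 + 1)))" for s1 s2 s3
    using unimodularly_equivalent_rank[OF that(4)] graph_D_rank[OF that(1-3)] by simp
  note cl = base_polytope_classification[OF assms]
  have A: "\<exists>s. s > 0 \<and> unimodularly_equivalent ?P (base_polytope (graph_A (s + 1)))" if r: "polytope_rank ?P = 0"
  proof -
    obtain n where n: "class_polytope ?P {{0}} n" "n 1 = 0" "n 2 = 0" "n 3 = 0" "2 \<le> n 0"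
      using cl unfolding r by auto
    have "class_polytope (base_polytope (graph_A (n 0 - 1 + 1))) {{0}} n"
      by (rule graph_A_polytope) (use n in auto)
    from class_polytope_equivalent[OF n(1) this] show ?thesis
      using n(5) by (intro exI[of _ "n 0 - 1"] conjI) auto
  qed
  have shape: "\<exists>T n. shaped k T n \<and> class_polytope ?P T n" if "polytope_rank ?P = int k" "1 \<le> k" "k \<le> 3" for k
    using cl unfolding that(1) using that(2,3) by auto
  have B1: "\<exists>s p. s > 0 \<and> p > 0 \<and> unimodularly_equivalent ?P (base_polytope (graph_B [s] p))"
    if "polytope_rank ?P = 1"
    using shape[of 1] shaped_1 that by fastforce
  have B2: "\<exists>s1 s2 p. s1 > 0 \<and> s2 > 0 \<and> unimodularly_equivalent ?P (base_polytope (graph_B [s1, s2] p))"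
    if "polytope_rank ?P = 2"
    using shape[of 2] shaped_2 that by fastforce
  show ?thesis
  proof (intro conjI)
    show "polytope_rank ?P = 0 \<longleftrightarrow>
        (\<exists>s. s > 0 \<and> unimodularly_equivalent ?P (base_polytope (graph_A (s + 1))))"
      using A eqA by blast
    show "polytope_rank ?P = 1 \<longleftrightarrow>
        (\<exists>s p. s > 0 \<and> p > 0 \<and> unimodularly_equivalent ?P (base_polytope (graph_B [s] p)))"
      using B1 eqB1 by blast
    show "polytope_rank ?P = 2 \<longleftrightarrow>
        (\<exists>s1 s2 p. s1 > 0 \<and> s2 > 0 \<and> unimodularly_equivalent ?P (base_polytope (graph_B [s1, s2] p)))"
      using B2 eqB2 by blast
  next
    show "polytope_rank ?P = 3 \<longleftrightarrow>
        (\<exists>s1 s2 s3 p. s1 > 0 \<and> s2 > 0 \<and> s3 > 0 \<and>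
           unimodularly_equivalent ?P (base_polytope (graph_B [s1, s2, s3] p))) \<or>
        (\<exists>s t p q. s > 0 \<and> q > 0 \<and>
           unimodularly_equivalent ?P (base_polytope (graph_C s t p q))) \<or>
        (\<exists>s1 s2 s3. s1 > 0 \<and> s2 > 0 \<and> s3 > 0 \<and>
           unimodularly_equivalent ?P (base_polytope (graph_D (s1 + 1) (s2 + 1) (s3 + 1))))"
      (is "_ \<longleftrightarrow> ?fam")
    proof
      assume "polytope_rank ?P = 3"
      then obtain T n where "shaped 3 T n" "class_polytope ?P T n" using shape[of 3] by auto
      then show ?fam by (rule shaped_3)
    next
      assume ?fam
      then show "polytope_rank ?P = 3"
        by (elim disjE exE conjE) (erule (3) eqB3, erule (2) eqC, erule (3) eqD)
    qed
  qed
qed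

end
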